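(* Let $k$ be a field, $r\ge1$, and let $\mathcal X\subset\mathbb Z^r$ be a Cubist subset. The following hold, for all $x,y\in\mathcal X$ where entries are indicated. Combinatorial formulae for decomposition matrices: $$D_{U_{\mathcal X}}(q)_{xy}=\sum_{z\in\lambda x}\delta_{zy}q^{d(z,x)},\qquad D_{V_{\mathcal X}}(q)_{xy}=\sum_{z\in\mu x}\delta_{zy}q^{d(z,x)}.$$ Combinatorial formulae for Cartan matrices: $$C_{U_{\mathcal X}}(q)_{xy}=\sum_{z\in I_{\mathcal X}(x)\cap I_{\mathcal X}(y)}q^{r-1}[r-d(z,x)-d(z,y)]_q,\qquad C_{V_{\mathcal X}}(q)_{xy}=(1-q^2)^{1-r}q^{d(x,y)}.$$ Brauer formulae: $C_{U_{\mathcal X}}(q)=D_{U_{\mathcal X}}(q)^TD_{U_{\mathcal X}}(q)$ and $C_{V_{\mathcal X}}(q)=D_{V_{\mathcal X}}(q)^TD_{V_{\mathcal X}}(q)$. Transpose formulae: $C_{U_{\mathcal X}}(q)=C_{U_{\mathcal X}}(q)^T$ and $C_{V_{\mathcal X}}(q)=C_{V_{\mathcal X}}(q)^T$. Inverse formulae: $D_{U_{\mathcal X}}(q)^T\,D_{V_{\mathcal X}}(-q)=1$ and $C_{U_{\mathcal X}}(q)\,C_{V_{\mathcal X}}(-q)=1$. Symmetry formula: $C_{U_{\mathcal X}}(q^{-1})=q^{2-2r}C_{U_{\mathcal X}}(q)$.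
   Context: Combinatorics. $\epsilon_1,\dots,\epsilon_r$ is the standard basis of $\mathbb Z^r$; $x\le y$ means $y-x$ has nonnegative coordinates; $x[n]=x+n(\epsilon_1+\cdots+\epsilon_r)$; $d(x,y)=\sum_i|x_i-y_i|$. A subset $\mathcal X\subset\mathbb Z^r$ is Cubist if $\mathcal X=\mathcal X^-\setminus\mathcal X^-[-1]$ for some nonempty proper ideal (down-closed subset) $\mathcal X^-$ of $(\mathbb Z^r,\le)$. For $1\le i\le r$ put $F_i=\{\sum_{j<i}a_j\epsilon_j-\sum_{j>i}a_j\epsilon_j : a_j\in\{0,1\}\}$ and $C_i=\mathbb Z_{\le0}^{i-1}\times\mathbb Z\times\mathbb Z_{\ge0}^{r-i}$. For each $x\in\mathcal X$ there is a unique $i$ with $x+F_i\subseteq\mathcal X$; put $\lambda x=x+F_i$, $\mu x=x+C_i$. The partial order $\succeq$ on $\mathcal X$ is generated by $x\succeq y$ for $y\in\lambda x$. $I_{\mathcal X}(x)=\{z\in\mathcal X: x\le z\le x[1]\}$. $[n]_q=(q^n-q^{-n})/(q-q^{-1})$. $\delta$ is the Kronecker delta and $1$ the identity matrix. Algebras. Paths in quivers are composed from left to right; arrows have degree 1. $U_r$ is the $k$-algebra given by the quiver with vertices (idempotents) $e_x$, $x\in\mathbb Z^r$, arrows $a_{x,i}$ from $x$ to $x+\epsilon_i$ and $b_{x,i}$ from $x$ to $x-\epsilon_i$ ($1\le i\le r$), with relations, for all $x$: $a_{x,i}a_{x+\epsilon_i,i}=0$ and $b_{x,i}b_{x-\epsilon_i,i}=0$;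 for $i\neq j$: $a_{x,i}a_{x+\epsilon_i,j}+a_{x,j}a_{x+\epsilon_j,i}=0$, $b_{x,i}b_{x-\epsilon_i,j}+b_{x,j}b_{x-\epsilon_j,i}=0$, $a_{x,i}b_{x+\epsilon_i,j}+b_{x,j}a_{x-\epsilon_j,i}=0$; and for $1\le i<r$: $b_{x,i}a_{x-\epsilon_i,i}+a_{x,i}b_{x+\epsilon_i,i}=b_{x,i+1}a_{x-\epsilon_{i+1},i+1}+a_{x,i+1}b_{x+\epsilon_{i+1},i+1}$. Put $U_{\mathcal X}=U_r/\sum_{x\in\mathbb Z^r\setminus\mathcal X}U_re_xU_r$. $V_r$ is the $k$-algebra given by the quiver with vertices (idempotents) $f_x$, $x\in\mathbb Z^r$, arrows $\alpha_{x,i}$ from $x$ to $x+\epsilon_i$ and $\beta_{x,i}$ from $x$ to $x-\epsilon_i$, with relations, for all $x$: $\alpha_{x,i}\alpha_{x+\epsilon_i,j}=\alpha_{x,j}\alpha_{x+\epsilon_j,i}$ and $\beta_{x,i}\beta_{x-\epsilon_i,j}=\beta_{x,j}\beta_{x-\epsilon_j,i}$ for $i\ne j$; $\alpha_{x,i}\beta_{x+\epsilon_i,j}=\beta_{x,j}\alpha_{x-\epsilon_j,i}$ for all $1\le i,j\le r$; and $\sum_{i=1}^r\beta_{x,i}\alpha_{x-\epsilon_i,i}=0$. Put $V_{\mathcal X}=\sum_{x,y\in\mathcal X}f_xV_rf_y$. Matrices. For $A=U_{\mathcal X}$ or $V_{\mathcal X}$, with idempotents $e_x$ (resp. $f_x$)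 denoted here $e_x$, $x\in\mathcal X$: $C_A(q)$ is the $\mathcal X\times\mathcal X$ matrix with $C_A(q)_{xy}=\sum_i(\dim e_xA_ie_y)q^i$, and $D_A(q)$ is the matrix with $D_A(q)_{xy}=\sum_i(\dim e_y\Delta_A(x)_i)q^i$, where $\Delta_A(x)=Ae_x/\sum_{t}Ae_tAe_x$, the sum being over $t\succ x$ if $A=U_{\mathcal X}$, and over $t\prec x$ (i.e. $t$ strictly larger than $x$ for the opposite order $\succeq^{op}$) if $A=V_{\mathcal X}$. Entries are (Laurent) power series in $q$; products of infinite matrices are computed entrywise in formal power series. *)

theory Defs
  imports
    "HOL-Analysis.Infinite_Sum"
    "HOL-Computational_Algebra.Formal_Laurent_Series"
    "HOL-Library.Poly_Mapping"
    "HOL-Algebra.QuotRing"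
    "Graph_Theory.Arc_Walk"
    "Jordan_Normal_Form.VS_Connect"
begin

section \<open>Cubist combinatorics\<close>

text \<open>
  A point of \<open>\<int>\<^sup>r\<close> is a function \<open>nat \<Rightarrow> int\<close> that vanishes outside the coordinate range
  \<open>{1..r}\<close>. On such functions the pointwise order of the library is the product order of
  \<open>\<int>\<^sup>r\<close>.
\<close>

type_synonym point = "nat \<Rightarrow> int"

definition lattice_pts :: "nat \<Rightarrow> point set" where
  "lattice_pts r = {x. \<forall>j. j \<notin> {1..r} \<longrightarrow> x j = 0}"

definition diag_shift :: "nat \<Rightarrow> int \<Rightarrow> point \<Rightarrow> point" where
  "diag_shift r n x = (\<lambda>j. if j \<in> {1..r} then x j + n else x j)"

definition translate :: "point \<Rightarrow> point set \<Rightarrow> point set" where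
  "translate x S = (\<lambda>v j. x j + v j) ` S"

definition l1_dist :: "nat \<Rightarrow> point \<Rightarrow> point \<Rightarrow> int" where
  "l1_dist r x y = (\<Sum>j=1..r. \<bar>x j - y j\<bar>)"

definition proper_ideal :: "nat \<Rightarrow> point set \<Rightarrow> bool" where
  "proper_ideal r I \<longleftrightarrow> I \<subseteq> lattice_pts r \<and> I \<noteq> {} \<and> I \<noteq> lattice_pts r \<and>
     (\<forall>x\<in>I. \<forall>y\<in>lattice_pts r. y \<le> x \<longrightarrow> y \<in> I)"

definition cubist :: "nat \<Rightarrow> point set \<Rightarrow> bool" where
  "cubist r X \<longleftrightarrow> (\<exists>I. proper_ideal r I \<and> X = I - diag_shift r (- 1) ` I)"

definition cube_face :: "nat \<Rightarrow> nat \<Rightarrow> point set" where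
  "cube_face r i = {v \<in> lattice_pts r.
     (\<forall>j\<in>{1..<i}. v j \<in> {0, 1}) \<and> v i = 0 \<and> (\<forall>j\<in>{i<..r}. v j \<in> {0, - 1})}"

definition cube_cone :: "nat \<Rightarrow> nat \<Rightarrow> point set" where
  "cube_cone r i = {v \<in> lattice_pts r.
     (\<forall>j\<in>{1..<i}. v j \<le> 0) \<and> (\<forall>j\<in>{i<..r}. v j \<ge> 0)}"

definition face_index :: "nat \<Rightarrow> point set \<Rightarrow> point \<Rightarrow> nat" where
  "face_index r X x = (THE i. i \<in> {1..r} \<and> translate x (cube_face r i) \<subseteq> X)"

definition cubist_lam :: "nat \<Rightarrow> point set \<Rightarrow> point \<Rightarrow> point set" where
  "cubist_lam r X x = translate x (cube_face r (face_index r X x))"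

definition cubist_mu :: "nat \<Rightarrow> point set \<Rightarrow> point \<Rightarrow> point set" where
  "cubist_mu r X x = translate x (cube_cone r (face_index r X x))"

text \<open>\<open>(x, y) \<in> cubist_order r X\<close> stands for \<open>x \<succeq> y\<close>.\<close>

definition cubist_order :: "nat \<Rightarrow> point set \<Rightarrow> point rel" where
  "cubist_order r X = {(x, y). x \<in> X \<and> y \<in> cubist_lam r X x}\<^sup>*"

definition unit_interval :: "nat \<Rightarrow> point set \<Rightarrow> point \<Rightarrow> point set" where
  "unit_interval r X x = {z \<in> X. x \<le> z \<and> z \<le> diag_shift r 1 x}"


section \<open>Graded algebras with idempotents\<close>

text \<open>
  The algebras below have in general no identity element but a family of idempotents. They are
  records over \<open>HOL-Algebra\<close>'s modules, extended by the homogeneous components and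
  the idempotents; the field \<open>one\<close> is never used. Scalars come from a type of class
  \<open>field\<close>, which \<open>class_ring\<close> turns into a \<open>HOL-Algebra\<close> ring.
\<close>

record ('k, 'a, 'v) idem_algebra = "('k, 'a) module" +
  component :: "nat \<Rightarrow> 'a set"
  idem :: "'v \<Rightarrow> 'a"

abbreviation lin_span :: "('k::field, 'a, 'm) module_scheme \<Rightarrow> 'a set \<Rightarrow> 'a set" where
  "lin_span \<equiv> LinearCombinations.module.span class_ring"

abbreviation sub_dim :: "('k::field, 'a, 'm) module_scheme \<Rightarrow> 'a set \<Rightarrow> nat" where
  "sub_dim M W \<equiv> vectorspace.dim class_ring (M\<lparr>carrier := W\<rparr>)"

text \<open>
  \<open>A S A\<close>. For an algebra in which every element \<open>a\<close> satisfies \<open>a = e a = a e\<close> for a finite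
  sum \<open>e\<close> of idempotents, as is the case here, this is the two-sided ideal generated by \<open>S\<close>.
\<close>

definition ideal_gen :: "('k::field, 'a, 'm) module_scheme \<Rightarrow> 'a set \<Rightarrow> 'a set" where
  "ideal_gen A S = lin_span A
     {a \<otimes>\<^bsub>A\<^esub> s \<otimes>\<^bsub>A\<^esub> b | a s b. a \<in> carrier A \<and> s \<in> S \<and> b \<in> carrier A}"

definition quot_module ::
  "('k::field, 'a, 'm) module_scheme \<Rightarrow> 'a set \<Rightarrow> ('k, 'a set) module" where
  "quot_module M N = ring.extend (M Quot N)
     (module.fields (\<lambda>c S. \<Union>s\<in>S. N +>\<^bsub>M\<^esub> (c \<odot>\<^bsub>M\<^esub> s)))"

definition quot_algebra ::
  "('k::field, 'a, 'v) idem_algebra \<Rightarrow> 'a set \<Rightarrow> ('k, 'a set, 'v) idem_algebra" where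
  "quot_algebra A J = module.extend (quot_module A J)
     (idem_algebra.fields
        (\<lambda>n. (\<lambda>a. J +>\<^bsub>A\<^esub> a) ` component A n)
        (\<lambda>x. J +>\<^bsub>A\<^esub> idem A x))"

subsection \<open>Cartan matrices\<close>

definition graded_dim :: "(nat \<Rightarrow> nat) \<Rightarrow> rat fls" where
  "graded_dim d = fps_to_fls (Abs_fps (\<lambda>n. of_nat (d n)))"

definition cartan :: "('k::field, 'a, 'v) idem_algebra \<Rightarrow> 'v \<Rightarrow> 'v \<Rightarrow> rat fls" where
  "cartan A x y = graded_dim (\<lambda>n. sub_dim A
     {idem A x \<otimes>\<^bsub>A\<^esub> a \<otimes>\<^bsub>A\<^esub> idem A y | a. a \<in> component A n})"

subsection \<open>Standard modules and decomposition matrices\<close>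

text \<open>
  The left module \<open>\<Delta>(x) = A e\<^sub>x / \<Sum>\<^bsub>t\<in>T\<^esub> A e\<^sub>t A e\<^sub>x\<close> is the quotient of
  the vector space \<open>A e\<^sub>x\<close> by \<open>std_kernel A T x\<close>, with the left action of \<open>A\<close> on cosets
  given by \<open>std_action\<close>.
\<close>

definition std_kernel :: "('k::field, 'a, 'v) idem_algebra \<Rightarrow> 'v set \<Rightarrow> 'v \<Rightarrow> 'a set" where
  "std_kernel A T x = lin_span A
     {a \<otimes>\<^bsub>A\<^esub> idem A t \<otimes>\<^bsub>A\<^esub> b \<otimes>\<^bsub>A\<^esub> idem A x | a t b.
        a \<in> carrier A \<and> t \<in> T \<and> b \<in> carrier A}"

definition std_module ::
  "('k::field, 'a, 'v) idem_algebra \<Rightarrow> 'v set \<Rightarrow> 'v \<Rightarrow> ('k, 'a set) module" where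
  "std_module A T x = quot_module
     (A\<lparr>carrier := (\<lambda>a. a \<otimes>\<^bsub>A\<^esub> idem A x) ` carrier A\<rparr>) (std_kernel A T x)"

definition std_component ::
  "('k::field, 'a, 'v) idem_algebra \<Rightarrow> 'v set \<Rightarrow> 'v \<Rightarrow> nat \<Rightarrow> 'a set set" where
  "std_component A T x n =
     (\<lambda>a. std_kernel A T x +>\<^bsub>A\<^esub> (a \<otimes>\<^bsub>A\<^esub> idem A x)) ` component A n"

definition std_action ::
  "('k::field, 'a, 'v) idem_algebra \<Rightarrow> 'v set \<Rightarrow> 'v \<Rightarrow> 'a \<Rightarrow> 'a set \<Rightarrow> 'a set" where
  "std_action A T x a S = (\<Union>s\<in>S. std_kernel A T x +>\<^bsub>A\<^esub> (a \<otimes>\<^bsub>A\<^esub> s))"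

text \<open>In \<open>decomp A larger x y\<close> the set \<open>larger x\<close> consists of the vertices strictly larger than \<open>x\<close>.\<close>

definition decomp ::
  "('k::field, 'a, 'v) idem_algebra \<Rightarrow> ('v \<Rightarrow> 'v set) \<Rightarrow> 'v \<Rightarrow> 'v \<Rightarrow> rat fls" where
  "decomp A larger x y = graded_dim (\<lambda>n. sub_dim (std_module A (larger x) x)
     (std_action A (larger x) x (idem A y) ` std_component A (larger x) x n))"

subsection \<open>Path algebras\<close>

text \<open>
  A path is a pair of its initial vertex and the list of its arrows, read from left to right.
  The sum in the product ranges over pairs of composable paths.
\<close>

type_synonym ('v, 'e, 'k) path_elem = "('v \<times> 'e list) \<Rightarrow>\<^sub>0 'k"

definition path_mult ::
  "('v, 'e) pre_digraph \<Rightarrow> ('v, 'e, 'k::field) path_elem \<Rightarrow> ('v, 'e, 'k) path_elem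
     \<Rightarrow> ('v, 'e, 'k) path_elem" where
  "path_mult Q f g = (\<Sum>(u, p)\<in>Poly_Mapping.keys f. \<Sum>(v, p')\<in>Poly_Mapping.keys g.
     if pre_digraph.awalk Q u p v
     then Poly_Mapping.single (u, p @ p')
            (Poly_Mapping.lookup f (u, p) * Poly_Mapping.lookup g (v, p'))
     else 0)"

definition path_carrier :: "('v, 'e) pre_digraph \<Rightarrow> ('v, 'e, 'k::field) path_elem set" where
  "path_carrier Q = {f. \<forall>(u, p)\<in>Poly_Mapping.keys f. \<exists>v. pre_digraph.awalk Q u p v}"

definition path_algebra ::
  "('v, 'e) pre_digraph \<Rightarrow> ('k::field, ('v, 'e, 'k) path_elem, 'v) idem_algebra" where
  "path_algebra Q =
     \<lparr>carrier = path_carrier Q,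
      mult = path_mult Q,
      one = 0,
      zero = 0,
      add = (+),
      smult = (\<lambda>c. Poly_Mapping.map ((*) c)),
      component = (\<lambda>n. {f \<in> path_carrier Q. \<forall>(u, p)\<in>Poly_Mapping.keys f. length p = n}),
      idem = (\<lambda>x. Poly_Mapping.single (x, []) 1)\<rparr>"


section \<open>The algebras attached to a Cubist set\<close>

text \<open>
  \<open>Up x i\<close> is the arrow from \<open>x\<close> to \<open>x + \<epsilon>\<^sub>i\<close> (written \<open>a\<close> or \<open>\<alpha>\<close> with index \<open>x, i\<close>),
  \<open>Down x i\<close> the arrow from \<open>x\<close> to \<open>x - \<epsilon>\<^sub>i\<close> (written \<open>b\<close> or \<open>\<beta>\<close>).
\<close>

datatype arrow = Up point nat | Down point nat

definition up :: "point \<Rightarrow> nat \<Rightarrow> point" where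
  "up x i = x(i := x i + 1)"

definition down :: "point \<Rightarrow> nat \<Rightarrow> point" where
  "down x i = x(i := x i - 1)"

definition lattice_quiver :: "nat \<Rightarrow> (point, arrow) pre_digraph" where
  "lattice_quiver r =
     \<lparr>verts = lattice_pts r,
      arcs = {Up x i | x i. x \<in> lattice_pts r \<and> i \<in> {1..r}}
           \<union> {Down x i | x i. x \<in> lattice_pts r \<and> i \<in> {1..r}},
      tail = (\<lambda>e. case e of Up x i \<Rightarrow> x | Down x i \<Rightarrow> x),
      head = (\<lambda>e. case e of Up x i \<Rightarrow> up x i | Down x i \<Rightarrow> down x i)\<rparr>"

type_synonym 'k lattice_path_elem = "(point, arrow, 'k) path_elem"

definition path_aa :: "point \<Rightarrow> nat \<Rightarrow> nat \<Rightarrow> 'k::field lattice_path_elem" where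
  "path_aa x i j = Poly_Mapping.single (x, [Up x i, Up (up x i) j]) 1"

definition path_ab :: "point \<Rightarrow> nat \<Rightarrow> nat \<Rightarrow> 'k::field lattice_path_elem" where
  "path_ab x i j = Poly_Mapping.single (x, [Up x i, Down (up x i) j]) 1"

definition path_ba :: "point \<Rightarrow> nat \<Rightarrow> nat \<Rightarrow> 'k::field lattice_path_elem" where
  "path_ba x i j = Poly_Mapping.single (x, [Down x i, Up (down x i) j]) 1"

definition path_bb :: "point \<Rightarrow> nat \<Rightarrow> nat \<Rightarrow> 'k::field lattice_path_elem" where
  "path_bb x i j = Poly_Mapping.single (x, [Down x i, Down (down x i) j]) 1"

definition U_relations :: "nat \<Rightarrow> 'k::field lattice_path_elem set" where
  "U_relations r =
     {path_aa x i i | x i. x \<in> lattice_pts r \<and> i \<in> {1..r}} \<union>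
     {path_bb x i i | x i. x \<in> lattice_pts r \<and> i \<in> {1..r}} \<union>
     {path_aa x i j + path_aa x j i | x i j. x \<in> lattice_pts r \<and> i \<in> {1..r} \<and> j \<in> {1..r} \<and> i \<noteq> j} \<union>
     {path_bb x i j + path_bb x j i | x i j. x \<in> lattice_pts r \<and> i \<in> {1..r} \<and> j \<in> {1..r} \<and> i \<noteq> j} \<union>
     {path_ab x i j + path_ba x j i | x i j. x \<in> lattice_pts r \<and> i \<in> {1..r} \<and> j \<in> {1..r} \<and> i \<noteq> j} \<union>
     {path_ba x i i + path_ab x i i - (path_ba x (i + 1) (i + 1) + path_ab x (i + 1) (i + 1)) | x i.
        x \<in> lattice_pts r \<and> i \<in> {1..<r}}"

definition V_relations :: "nat \<Rightarrow> 'k::field lattice_path_elem set" where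
  "V_relations r =
     {path_aa x i j - path_aa x j i | x i j. x \<in> lattice_pts r \<and> i \<in> {1..r} \<and> j \<in> {1..r} \<and> i \<noteq> j} \<union>
     {path_bb x i j - path_bb x j i | x i j. x \<in> lattice_pts r \<and> i \<in> {1..r} \<and> j \<in> {1..r} \<and> i \<noteq> j} \<union>
     {path_ab x i j - path_ba x j i | x i j. x \<in> lattice_pts r \<and> i \<in> {1..r} \<and> j \<in> {1..r}} \<union>
     {(\<Sum>i=1..r. path_ba x i i) | x. x \<in> lattice_pts r}"

definition U_algebra ::
  "'k::field itself \<Rightarrow> nat \<Rightarrow> ('k, 'k lattice_path_elem set, point) idem_algebra" where
  "U_algebra k r = quot_algebra (path_algebra (lattice_quiver r))
     (ideal_gen (path_algebra (lattice_quiver r)) (U_relations r))"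

definition V_algebra ::
  "'k::field itself \<Rightarrow> nat \<Rightarrow> ('k, 'k lattice_path_elem set, point) idem_algebra" where
  "V_algebra k r = quot_algebra (path_algebra (lattice_quiver r))
     (ideal_gen (path_algebra (lattice_quiver r)) (V_relations r))"

definition U_cubist :: "'k::field itself \<Rightarrow> nat \<Rightarrow> point set
    \<Rightarrow> ('k, 'k lattice_path_elem set set, point) idem_algebra" where
  "U_cubist k r X = quot_algebra (U_algebra k r)
     (ideal_gen (U_algebra k r) (idem (U_algebra k r) ` (lattice_pts r - X)))"

definition V_cubist :: "'k::field itself \<Rightarrow> nat \<Rightarrow> point set
    \<Rightarrow> ('k, 'k lattice_path_elem set, point) idem_algebra" where
  "V_cubist k r X = (let V = V_algebra k r;
       W = lin_span V {idem V x \<otimes>\<^bsub>V\<^esub> v \<otimes>\<^bsub>V\<^esub> idem V y | x v y.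
                         x \<in> X \<and> v \<in> carrier V \<and> y \<in> X}
     in V\<lparr>carrier := W, component := (\<lambda>n. component V n \<inter> W)\<rparr>)"

text \<open>
  All spaces whose dimensions enter the following matrices are spanned by the classes of the
  finitely many paths of a fixed length between two fixed vertices, hence finite-dimensional.
\<close>

definition C_U :: "'k::field itself \<Rightarrow> nat \<Rightarrow> point set \<Rightarrow> point \<Rightarrow> point \<Rightarrow> rat fls" where
  "C_U k r X = cartan (U_cubist k r X)"

definition C_V :: "'k::field itself \<Rightarrow> nat \<Rightarrow> point set \<Rightarrow> point \<Rightarrow> point \<Rightarrow> rat fls" where
  "C_V k r X = cartan (V_cubist k r X)"

definition D_U :: "'k::field itself \<Rightarrow> nat \<Rightarrow> point set \<Rightarrow> point \<Rightarrow> point \<Rightarrow> rat fls" where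
  "D_U k r X = decomp (U_cubist k r X) (\<lambda>x. {t \<in> X. (t, x) \<in> cubist_order r X \<and> t \<noteq> x})"

definition D_V :: "'k::field itself \<Rightarrow> nat \<Rightarrow> point set \<Rightarrow> point \<Rightarrow> point \<Rightarrow> rat fls" where
  "D_V k r X = decomp (V_cubist k r X) (\<lambda>x. {t \<in> X. (x, t) \<in> cubist_order r X \<and> t \<noteq> x})"


section \<open>Series and matrices\<close>

text \<open>The variable \<open>q\<close> is \<^const>\<open>fls_X\<close>.\<close>

definition q_int :: "int \<Rightarrow> rat fls" where
  "q_int n = (fls_X powi n - fls_X powi (- n)) / (fls_X - fls_X powi (- 1))"

definition at_minus_q :: "rat fls \<Rightarrow> rat fls" where
  "at_minus_q f = fls_compose_fps f (- fps_X)"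

text \<open>The substitution \<open>q \<mapsto> q\<^sup>-\<^sup>1\<close> only makes sense for Laurent polynomials.\<close>

definition laurent_poly :: "rat fls \<Rightarrow> bool" where
  "laurent_poly f \<longleftrightarrow> finite {n. fls_nth f n \<noteq> 0}"

definition at_inverse_q :: "rat fls \<Rightarrow> rat fls" where
  "at_inverse_q f = Abs_fls (\<lambda>n. fls_nth f (- n))"

text \<open>
  \<open>A B = C\<close> for matrices indexed by \<open>X\<close>. Convergence is in the \<open>q\<close>-adic topology that the
  library puts on Laurent series. Since coefficients are discrete, a summable family has, in
  each degree, only finitely many members with a nonzero coefficient, and its sum is
  computed coefficient by coefficient.
\<close>

definition mat_prod_eq ::
  "'v set \<Rightarrow> ('v \<Rightarrow> 'v \<Rightarrow> rat fls) \<Rightarrow> ('v \<Rightarrow> 'v \<Rightarrow> rat fls) \<Rightarrow> ('v \<Rightarrow> 'v \<Rightarrow> rat fls) \<Rightarrow> bool"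
  where
  "mat_prod_eq X A B C \<longleftrightarrow>
     (\<forall>x\<in>X. \<forall>y\<in>X. ((\<lambda>z. A x z * B z y) has_sum C x y) X)"

definition mat_transpose :: "('v \<Rightarrow> 'v \<Rightarrow> rat fls) \<Rightarrow> 'v \<Rightarrow> 'v \<Rightarrow> rat fls" where
  "mat_transpose A = (\<lambda>x y. A y x)"

definition mat_one :: "'v \<Rightarrow> 'v \<Rightarrow> rat fls" where
  "mat_one = (\<lambda>x y. of_bool (x = y))"

end

theory Submission
  imports Defs
begin

text \<open>
  A path is encoded by its initial vertex and a word in the \<open>2 r\<close> unit steps. A graded piece of an
  algebra or of a standard module is a space of words of fixed length between two fixed points modulo
  relations, so its dual consists of the functions on such words that respect the relations. Its
  dimension is bounded above by rewriting words to normal forms and bounded below by explicit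
  functions: for \<open>U\<close> alternating traces of sign representations over the part of a unit cube that
  lies in the ideal, for \<open>V\<close> the coefficients of monomials in a polynomial ring.

  The matrix identities rest on two sums over the face \<open>\<lambda>x\<close>, which factor over the coordinates:
  \<open>D\<^sub>U(q) C\<^sub>V(-q) = D\<^sub>V(-q)\<close> and \<open>D\<^sub>U(q) D\<^sub>V(-q)\<^sup>T = 1\<close>. Since \<open>D\<^sub>U\<close> has identity constant term, an equation
  \<open>D\<^sub>U M = 0\<close> forces \<open>M = 0\<close>, and this turns the one-sided identities into the remaining ones. The
  \<open>q\<close>-integers in \<open>C\<^sub>U\<close> arise from a telescoping sum over the coordinates, whose two directions of
  summation give the symmetry.
\<close>

text \<open>The delicate point is independence in \<open>U\<close>: a test function must vanish on
  every word that leaves the Cubist set, and a word can leave it in two ways. A word from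
  \<open>x\<close> to \<open>y\<close> is closed up by a return through the corner opposite to
  \<open>v\<close> in a cube \<open>lam v\<close>, so the loop has length \<open>2 r - 2\<close>. If
  it meets a point outside the ideal, no corner of the truncated sum survives. If it meets a point
  whose diagonal shift still lies in the ideal, all contributing corners lie in the ideal, the
  truncation is invisible, and the full alternating sum is zero because a loop shorter than
  \<open>2 r\<close> misses a direction. The resulting functions are not dual to the normal words,
  but their values form a triangular matrix for a lexicographic order in which each coordinate has
  three states. Spanning rests on another fact: an edge of the Cubist set lies in the cube of
  exactly one of its ends, so a step out of a vertex stays in its cube, or goes up in the order, or
  leaves the Cubist set. Both bounds count the cubes that contain \<open>x\<close> and
  \<open>y\<close>, which is the Brauer formula for \<open>U\<close> before any series is written
  down.\<close>

type_synonym step = "bool \<times> nat"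

definition sg :: "step \<Rightarrow> int" where
  "sg s = (if fst s then 1 else - 1)"

definition mv :: "point \<Rightarrow> step \<Rightarrow> point" where
  "mv x s = x(snd s := x (snd s) + sg s)"

definition opp :: "step \<Rightarrow> step" where
  "opp s = (\<not> fst s, snd s)"

text \<open>These points lead from \<open>x\<close> to its diagonal shift, one coordinate at a time.
  For \<open>x\<close> in the Cubist set the chain starts inside the ideal and ends outside, and the
  unique \<open>i\<close> of the face turns out to be the place where it leaves.\<close>

definition pshift :: "nat \<Rightarrow> point \<Rightarrow> point" where
  "pshift k x = (\<lambda>j. if j \<in> {1..k} then x j + 1 else x j)"

lemma sg_opp [simp]: "sg (opp s) = - sg s"
  by (simp add: sg_def opp_def)

lemma snd_opp [simp]: "snd (opp s) = snd s"
  by (simp add: opp_def)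

lemma opp_opp [simp]: "opp (opp s) = s"
  by (simp add: opp_def)

lemma mv_apply: "mv x s j = (if j = snd s then x j + sg s else x j)"
  by (simp add: mv_def)

lemma mv_opp [simp]: "mv (mv x s) (opp s) = x" "mv (mv x (opp s)) s = x"
  by (auto simp: mv_def)

lemma mv_lattice: "x \<in> lattice_pts r \<Longrightarrow> snd s \<in> {1..r} \<Longrightarrow> mv x s \<in> lattice_pts r"
  by (auto simp: mv_def lattice_pts_def)

lemma pshift_lattice: "x \<in> lattice_pts r \<Longrightarrow> k \<le> r \<Longrightarrow> pshift k x \<in> lattice_pts r"
  by (auto simp: pshift_def lattice_pts_def)

lemma pshift_0 [simp]: "pshift 0 x = x"
  by (auto simp: pshift_def)

lemma pshift_mono: "x \<le> y \<Longrightarrow> k \<le> l \<Longrightarrow> pshift k x \<le> pshift l y"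
  by (auto simp: pshift_def le_fun_def intro: order.trans)

lemma diag_shift_1: "diag_shift r 1 x = pshift r x"
  by (simp add: diag_shift_def pshift_def)

section \<open>Translates of faces and cones in coordinates\<close>

lemma translate_iff:
  assumes "x \<in> lattice_pts r" "S \<subseteq> lattice_pts r"
  shows "y \<in> translate x S \<longleftrightarrow> y \<in> lattice_pts r \<and> (\<lambda>j. y j - x j) \<in> S"
proof
  assume "y \<in> translate x S"
  then obtain v where v: "v \<in> S" "y = (\<lambda>j. x j + v j)" unfolding translate_def by auto
  then have "(\<lambda>j. y j - x j) = v" by auto
  moreover have "y \<in> lattice_pts r" using v assms by (auto simp: lattice_pts_def)
  ultimately show "y \<in> lattice_pts r \<and> (\<lambda>j. y j - x j) \<in> S" using v by simp
next
  assume "y \<in> lattice_pts r \<and> (\<lambda>j. y j - x j) \<in> S"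
  then show "y \<in> translate x S"
    unfolding translate_def by (intro image_eqI[of _ _ "\<lambda>j. y j - x j"]) auto
qed

lemma translate_face_iff:
  assumes "x \<in> lattice_pts r"
  shows "y \<in> translate x (cube_face r i) \<longleftrightarrow> y \<in> lattice_pts r \<and> y i = x i \<and>
    (\<forall>j\<in>{1..<i}. y j = x j \<or> y j = x j + 1) \<and> (\<forall>j\<in>{i<..r}. y j = x j \<or> y j = x j - 1)"
proof -
  have sub: "cube_face r i \<subseteq> lattice_pts r" by (auto simp: cube_face_def)
  have 1: "y \<in> lattice_pts r \<Longrightarrow> (\<lambda>j. y j - x j) \<in> lattice_pts r"
    using assms by (auto simp: lattice_pts_def)
  have 2: "y j - x j \<in> {0, 1} \<longleftrightarrow> y j = x j \<or> y j = x j + 1"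
    "y j - x j \<in> {0, - 1} \<longleftrightarrow> y j = x j \<or> y j = x j - 1" "y j - x j = 0 \<longleftrightarrow> y j = x j" for j by auto
  have "y \<in> translate x (cube_face r i) \<longleftrightarrow> y \<in> lattice_pts r \<and> (\<lambda>j. y j - x j) \<in> cube_face r i"
    by (rule translate_iff[OF assms sub])
  then show ?thesis unfolding cube_face_def mem_Collect_eq 2 using 1 by blast
qed

lemma translate_cone_iff:
  assumes "x \<in> lattice_pts r"
  shows "y \<in> translate x (cube_cone r i) \<longleftrightarrow> y \<in> lattice_pts r \<and>
    (\<forall>j\<in>{1..<i}. y j \<le> x j) \<and> (\<forall>j\<in>{i<..r}. x j \<le> y j)"
proof -
  have sub: "cube_cone r i \<subseteq> lattice_pts r" by (auto simp: cube_cone_def)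
  have 1: "y \<in> lattice_pts r \<Longrightarrow> (\<lambda>j. y j - x j) \<in> lattice_pts r"
    using assms by (auto simp: lattice_pts_def)
  have "y \<in> translate x (cube_cone r i) \<longleftrightarrow> y \<in> lattice_pts r \<and> (\<lambda>j. y j - x j) \<in> cube_cone r i"
    by (rule translate_iff[OF assms sub])
  then show ?thesis unfolding cube_cone_def using 1 by auto
qed

lemma translate_face_coord:
  assumes "x \<in> lattice_pts r" "y \<in> translate x (cube_face r i)"
  shows "1 \<le> j \<Longrightarrow> j < i \<Longrightarrow> y j = x j \<or> y j = x j + 1"
    and "i < j \<Longrightarrow> j \<le> r \<Longrightarrow> y j = x j \<or> y j = x j - 1"
    and "j = 0 \<or> r < j \<or> j = i \<Longrightarrow> y j = x j"
proof -
  have a: "\<forall>j\<in>{1..<i}. y j = x j \<or> y j = x j + 1" and b: "\<forall>j\<in>{i<..r}. y j = x j \<or> y j = x j - 1"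
    and c: "y i = x i" and d: "y \<in> lattice_pts r"
    using assms(2) unfolding translate_face_iff[OF assms(1)] by blast+
  show "1 \<le> j \<Longrightarrow> j < i \<Longrightarrow> y j = x j \<or> y j = x j + 1" using bspec[OF a, of j] by simp
  show "i < j \<Longrightarrow> j \<le> r \<Longrightarrow> y j = x j \<or> y j = x j - 1" using bspec[OF b, of j] by simp
  show "j = 0 \<or> r < j \<or> j = i \<Longrightarrow> y j = x j" using c d assms(1) by (auto simp: lattice_pts_def)
qed

lemma translate_cone_coord:
  assumes "x \<in> lattice_pts r" "y \<in> translate x (cube_cone r i)"
  shows "1 \<le> j \<Longrightarrow> j < i \<Longrightarrow> y j \<le> x j"
    and "i < j \<Longrightarrow> j \<le> r \<Longrightarrow> x j \<le> y j"
    and "j = 0 \<or> r < j \<Longrightarrow> y j = x j"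
proof -
  have a: "\<forall>j\<in>{1..<i}. y j \<le> x j" and b: "\<forall>j\<in>{i<..r}. x j \<le> y j" and d: "y \<in> lattice_pts r"
    using assms(2) unfolding translate_cone_iff[OF assms(1)] by blast+
  show "1 \<le> j \<Longrightarrow> j < i \<Longrightarrow> y j \<le> x j" using bspec[OF a, of j] by simp
  show "i < j \<Longrightarrow> j \<le> r \<Longrightarrow> x j \<le> y j" using bspec[OF b, of j] by simp
  show "j = 0 \<or> r < j \<Longrightarrow> y j = x j" using d assms(1) by (auto simp: lattice_pts_def)
qed

section \<open>Cubist sets: the index of a vertex, its cube and cone, and the order\<close>

locale cubist_ideal =
  fixes r :: nat and I :: "point set"
  assumes r_pos: "1 \<le> r" and ideal: "proper_ideal r I"
begin

definition X :: "point set" where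
  "X = I - diag_shift r (- 1) ` I"

abbreviation L :: "point set" where "L \<equiv> lattice_pts r"

definition idx :: "point \<Rightarrow> nat" where "idx = face_index r X"

abbreviation lam :: "point \<Rightarrow> point set" where "lam \<equiv> cubist_lam r X"

abbreviation mu :: "point \<Rightarrow> point set" where "mu \<equiv> cubist_mu r X"

definition covers :: "point rel" where "covers = {(x, y). x \<in> X \<and> y \<in> lam x}"

definition gt :: "point \<Rightarrow> point \<Rightarrow> bool" where
  "gt t x \<longleftrightarrow> t \<in> X \<and> x \<in> X \<and> (t, x) \<in> cubist_order r X \<and> t \<noteq> x"

lemma order_eq: "cubist_order r X = covers\<^sup>*"
  by (simp add: cubist_order_def covers_def)

lemma I_L: "x \<in> I \<Longrightarrow> x \<in> L"
  using ideal by (auto simp: proper_ideal_def)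

lemma I_down: "x \<in> I \<Longrightarrow> y \<in> L \<Longrightarrow> y \<le> x \<Longrightarrow> y \<in> I"
  using ideal by (auto simp: proper_ideal_def)

lemma X_iff: "x \<in> X \<longleftrightarrow> x \<in> I \<and> pshift r x \<notin> I"
proof -
  have *: "diag_shift r (- 1) y = x \<longleftrightarrow> y = pshift r x" for y x
    by (auto simp: diag_shift_def pshift_def fun_eq_iff)
  have "x \<in> diag_shift r (- 1) ` I \<longleftrightarrow> pshift r x \<in> I"
    unfolding image_iff using * by metis
  then show ?thesis unfolding X_def by simp
qed

lemma X_I: "x \<in> X \<Longrightarrow> x \<in> I" and X_L: "x \<in> X \<Longrightarrow> x \<in> L"
  using X_iff I_L by auto

text \<open>The face has a largest corner \<open>pshift (i - 1) x\<close> and a smallest one, whose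
  diagonal shift is \<open>pshift i x\<close>. Since the ideal is down-closed, membership of the
  whole face is decided at these two corners.\<close>

lemma face_subset_iff:
  assumes x: "x \<in> X" and i: "i \<in> {1..r}"
  shows "translate x (cube_face r i) \<subseteq> X \<longleftrightarrow> pshift (i - 1) x \<in> I \<and> pshift i x \<notin> I"
proof
  assume sub: "translate x (cube_face r i) \<subseteq> X"
  have "pshift (i - 1) x \<in> translate x (cube_face r i)"
    unfolding translate_face_iff[OF X_L[OF x]] using i pshift_lattice[OF X_L[OF x], of "i - 1"]
    by (auto simp: pshift_def)
  then have 1: "pshift (i - 1) x \<in> I" using sub X_I by blast
  define b where "b = (\<lambda>j. if j \<in> {i<..r} then x j - 1 else x j)"
  have "b \<in> translate x (cube_face r i)"
    unfolding translate_face_iff[OF X_L[OF x]] using X_L[OF x] by (auto simp: b_def lattice_pts_def)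
  then have "b \<in> X" using sub by auto
  moreover have "pshift r b = pshift i x" using i by (auto simp: b_def pshift_def fun_eq_iff)
  ultimately show "pshift (i - 1) x \<in> I \<and> pshift i x \<notin> I" using 1 X_iff by metis
next
  assume a: "pshift (i - 1) x \<in> I \<and> pshift i x \<notin> I"
  show "translate x (cube_face r i) \<subseteq> X"
  proof
    fix y assume y: "y \<in> translate x (cube_face r i)"
    note yc = translate_face_coord[OF X_L[OF x] y]
    have yL: "y \<in> L" using y unfolding translate_face_iff[OF X_L[OF x]] by blast
    have "y j \<le> pshift (i - 1) x j" for j
      using yc[of j] i by (cases "j = i"; cases "j < i"; cases "j = 0"; cases "j \<le> r"; auto simp: pshift_def)
    then have "y \<le> pshift (i - 1) x" by (rule le_funI)
    then have "y \<in> I" using I_down[of "pshift (i - 1) x" y] a yL by simp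
    have "pshift i x j \<le> pshift r y j" for j
      using yc[of j] i by (cases "j = i"; cases "j < i"; cases "j = 0"; cases "j \<le> r"; auto simp: pshift_def)
    then have "pshift i x \<le> pshift r y" by (rule le_funI)
    then have "pshift r y \<notin> I"
      using I_down[of "pshift r y" "pshift i x"] a pshift_lattice[OF X_L[OF x], of i] i by auto
    with \<open>y \<in> I\<close> show "y \<in> X" by (simp add: X_iff)
  qed
qed

lemma idx_unique:
  assumes "x \<in> X" "i \<in> {1..r}" "pshift (i - 1) x \<in> I" "pshift i x \<notin> I"
    and "j \<in> {1..r}" "pshift (j - 1) x \<in> I" "pshift j x \<notin> I"
  shows "i = j"
proof -
  have *: "\<not> i < j" if "i \<in> {1..r}" "pshift i x \<notin> I" "j \<in> {1..r}" "pshift (j - 1) x \<in> I" for i j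
  proof
    assume "i < j"
    then have "pshift i x \<le> pshift (j - 1) x" by (intro pshift_mono) auto
    then show False using that I_down pshift_lattice[OF X_L[OF assms(1)], of i] by auto
  qed
  show ?thesis using *[of i j] *[of j i] assms by auto
qed

lemma idx_ex: assumes "x \<in> X" shows "\<exists>i\<in>{1..r}. pshift (i - 1) x \<in> I \<and> pshift i x \<notin> I"
proof -
  define k where "k = (LEAST k. pshift k x \<notin> I)"
  have ex: "pshift r x \<notin> I" using assms X_iff by auto
  then have 1: "pshift k x \<notin> I" "k \<le> r" unfolding k_def by (rule LeastI, rule Least_le)
  have "k \<noteq> 0" using 1 assms X_iff by (metis pshift_0)
  moreover have "pshift (k - 1) x \<in> I" using not_less_Least[of "k - 1" "\<lambda>k. pshift k x \<notin> I"] \<open>k \<noteq> 0\<close>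
    unfolding k_def by fastforce
  ultimately show ?thesis using 1 by (intro bexI[of _ k]) auto
qed

lemma idx_props:
  assumes "x \<in> X"
  shows "idx x \<in> {1..r}" "pshift (idx x - 1) x \<in> I" "pshift (idx x) x \<notin> I"
proof -
  obtain i where i: "i \<in> {1..r}" "pshift (i - 1) x \<in> I" "pshift i x \<notin> I" using idx_ex assms by blast
  have "idx x = i" unfolding idx_def face_index_def
    using i idx_unique[OF assms] face_subset_iff[OF assms] by (intro the_equality) blast+
  with i show "idx x \<in> {1..r}" "pshift (idx x - 1) x \<in> I" "pshift (idx x) x \<notin> I" by auto
qed

lemma idx_eqI: "x \<in> X \<Longrightarrow> i \<in> {1..r} \<Longrightarrow> pshift (i - 1) x \<in> I \<Longrightarrow> pshift i x \<notin> I \<Longrightarrow> idx x = i"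
  using idx_unique[of x i "idx x"] idx_props[of x] by blast

lemma pshift_I_iff:
  assumes "x \<in> X" "k \<le> r" shows "pshift k x \<in> I \<longleftrightarrow> k < idx x"
proof
  assume "k < idx x"
  then have "pshift k x \<le> pshift (idx x - 1) x" by (intro pshift_mono) auto
  then show "pshift k x \<in> I" using I_down idx_props(2) pshift_lattice X_L assms by blast
next
  assume "pshift k x \<in> I"
  then show "k < idx x"
  proof (rule contrapos_pp)
    assume "\<not> k < idx x"
    then have "pshift (idx x) x \<le> pshift k x" by (intro pshift_mono) auto
    then show "pshift k x \<notin> I"
      using I_down[of "pshift k x" "pshift (idx x) x"] idx_props[OF assms(1)] pshift_lattice X_L[OF assms(1)] by auto
  qed
qed

lemma lam_iff:
  assumes "x \<in> X"
  shows "y \<in> lam x \<longleftrightarrow> y \<in> L \<and> y (idx x) = x (idx x) \<and>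
    (\<forall>j\<in>{1..<idx x}. y j = x j \<or> y j = x j + 1) \<and> (\<forall>j\<in>{idx x<..r}. y j = x j \<or> y j = x j - 1)"
  using translate_face_iff[OF X_L[OF assms]] by (simp add: cubist_lam_def idx_def)

lemma mu_iff:
  assumes "x \<in> X"
  shows "y \<in> mu x \<longleftrightarrow> y \<in> L \<and> (\<forall>j\<in>{1..<idx x}. y j \<le> x j) \<and> (\<forall>j\<in>{idx x<..r}. x j \<le> y j)"
  using translate_cone_iff[OF X_L[OF assms]] by (simp add: cubist_mu_def idx_def)

lemma lamI:
  assumes "x \<in> X" "y \<in> L" "y (idx x) = x (idx x)"
    and "\<And>j. 1 \<le> j \<Longrightarrow> j < idx x \<Longrightarrow> y j = x j \<or> y j = x j + 1"
    and "\<And>j. idx x < j \<Longrightarrow> j \<le> r \<Longrightarrow> y j = x j \<or> y j = x j - 1"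
  shows "y \<in> lam x"
  using assms by (simp add: lam_iff)

lemma muI:
  assumes "x \<in> X" "y \<in> L"
    and "\<And>j. 1 \<le> j \<Longrightarrow> j < idx x \<Longrightarrow> y j \<le> x j"
    and "\<And>j. idx x < j \<Longrightarrow> j \<le> r \<Longrightarrow> x j \<le> y j"
  shows "y \<in> mu x"
  using assms by (simp add: mu_iff)

lemma mv_lamI:
  assumes x: "x \<in> X" and i: "i \<in> {1..r}" and b: "if b then i < idx x else idx x < i"
  shows "mv x (b, i) \<in> lam x"
proof (rule lamI[OF x])
  show "mv x (b, i) \<in> L" using mv_lattice[OF X_L[OF x], of "(b, i)"] i by simp
  show "mv x (b, i) (idx x) = x (idx x)" using b by (cases b) (simp_all add: mv_apply)
  show "mv x (b, i) j = x j \<or> mv x (b, i) j = x j + 1" if "1 \<le> j" "j < idx x" for j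
    using b that by (cases b) (simp_all add: mv_apply sg_def)
  show "mv x (b, i) j = x j \<or> mv x (b, i) j = x j - 1" if "idx x < j" "j \<le> r" for j
    using b that by (cases b) (simp_all add: mv_apply sg_def)
qed

lemma lam_coord:
  assumes "x \<in> X" "y \<in> lam x"
  shows "1 \<le> j \<Longrightarrow> j < idx x \<Longrightarrow> y j = x j \<or> y j = x j + 1"
    and "idx x < j \<Longrightarrow> j \<le> r \<Longrightarrow> y j = x j \<or> y j = x j - 1"
    and "j = 0 \<or> r < j \<or> j = idx x \<Longrightarrow> y j = x j"
  using translate_face_coord[OF X_L[OF assms(1)], of y "idx x" j] assms(2) by (simp_all add: cubist_lam_def idx_def)

lemma mu_coord:
  assumes "x \<in> X" "y \<in> mu x"
  shows "1 \<le> j \<Longrightarrow> j < idx x \<Longrightarrow> y j \<le> x j"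
    and "idx x < j \<Longrightarrow> j \<le> r \<Longrightarrow> x j \<le> y j"
    and "j = 0 \<or> r < j \<Longrightarrow> y j = x j"
  using translate_cone_coord[OF X_L[OF assms(1)], of y "idx x" j] assms(2) by (simp_all add: cubist_mu_def idx_def)

lemma lam_X: "x \<in> X \<Longrightarrow> lam x \<subseteq> X"
  using face_subset_iff idx_props by (simp add: cubist_lam_def idx_def)

lemma lam_self: "x \<in> X \<Longrightarrow> x \<in> lam x"
  by (simp add: lam_iff X_L)

text \<open>For a larger point the chain of shifts leaves the ideal no later.\<close>

lemma idx_antimono:
  assumes "x \<in> X" "y \<in> X" "x \<le> y" shows "idx y \<le> idx x"
proof -
  have "pshift (idx x) x \<le> pshift (idx x) y" using assms by (intro pshift_mono) auto
  then have "pshift (idx x) y \<notin> I"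
    using I_down[of "pshift (idx x) y" "pshift (idx x) x"] idx_props[OF assms(1)]
      pshift_lattice[OF X_L[OF assms(1)], of "idx x"] by auto
  then show ?thesis using pshift_I_iff[OF assms(2), of "idx x"] idx_props(1)[OF assms(1)] by auto
qed

lemma covers_X: "(x, y) \<in> covers \<Longrightarrow> x \<in> X \<and> y \<in> X"
  using lam_X by (auto simp: covers_def)

text \<open>Along a cycle of the order the first coordinates are constant and the index stays above
  any bound below \<open>r\<close>: coordinate \<open>k\<close> can only grow while the index is at least \<open>k\<close>, and an index
  larger than \<open>k\<close> can then not drop to \<open>k\<close>.\<close>

lemma order_antisym:
  assumes xy: "(x, y) \<in> covers\<^sup>*" "(y, x) \<in> covers\<^sup>*"
  shows "x = y"
proof (cases "(x, y) \<in> covers\<^sup>+ \<and> x \<in> X")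
  case False
  then show ?thesis using rtranclD[OF xy(1)] covers_X by (auto dest!: tranclD)
next
  case True
  define S where "S = {z. (x, z) \<in> covers\<^sup>* \<and> (z, x) \<in> covers\<^sup>*}"
  have xS: "x \<in> S" by (simp add: S_def)
  have yS: "y \<in> S" using xy by (simp add: S_def)
  have "z \<in> X" if "(x, z) \<in> covers\<^sup>*" for z
    using that
  proof induction
    case base
    then show ?case using True by simp
  next
    case (step y z)
    then show ?case using covers_X by blast
  qed
  then have SX: "z \<in> X" if "z \<in> S" for z using that by (simp add: S_def)
  have path: "(z, w) \<in> (covers \<inter> S \<times> S)\<^sup>*" if "z \<in> S" "w \<in> S" for z w
  proof -
    have zw: "(z, w) \<in> covers\<^sup>*" using that rtrancl_trans[of z x covers w] unfolding S_def by simp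
    then show ?thesis using that(1)
    proof (induction rule: converse_rtrancl_induct)
      case base then show ?case by simp
    next
      case (step z z')
      have "(x, z') \<in> covers\<^sup>*" using step(1,4) rtrancl.rtrancl_into_rtrancl[of x z covers z'] unfolding S_def by simp
      moreover have "(z', x) \<in> covers\<^sup>*" using rtrancl_trans[of z' w covers x] step(2) that(2) unfolding S_def by simp
      ultimately have "z' \<in> S" unfolding S_def by simp
      then show ?case using step by (intro converse_rtrancl_into_rtrancl[of z z']) auto
    qed
  qed
  \<comment> \<open>A quantity that never drops along the order is constant on a cycle. This is
    applied to a coordinate and to the truth value of \<open>Suc k < idx z\<close>.\<close>
  have const: "f z = f w" if mono: "\<And>z w. (z, w) \<in> covers \<Longrightarrow> z \<in> S \<Longrightarrow> w \<in> S \<Longrightarrow> f z \<le> f w" and "z \<in> S" "w \<in> S"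
    for f :: "point \<Rightarrow> 'b :: order" and z w
  proof -
    have "f z \<le> f w" if "(z, w) \<in> (covers \<inter> S \<times> S)\<^sup>*" for z w
      using that
    proof induction
      case (step w w')
      then have "f w \<le> f w'" using mono by auto
      with step.IH show ?case by (rule order.trans)
    qed simp
    then show ?thesis using path that by (intro order.antisym) auto
  qed
  have main: "x = y \<or> (\<forall>z\<in>S. k < idx z \<and> (\<forall>j\<in>{1..k}. z j = x j))" if "k \<le> r" for k
    using that
  proof (induction k)
    case 0
    have "0 < idx z" if "z \<in> S" for z using idx_props(1)[OF SX[OF that]] by simp
    then show ?case by simp
  next
    case (Suc k)
    show ?case
    proof (cases "x = y")
      case False
      then have IH: "k < idx z" "\<forall>j\<in>{1..k}. z j = x j" if "z \<in> S" for z using that Suc by auto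
      have "z (Suc k) \<le> w (Suc k)" if "(z, w) \<in> covers" "z \<in> S" "w \<in> S" for z w
      proof -
        have "w \<in> lam z" "z \<in> X" using that by (auto simp: covers_def)
        then show ?thesis using IH(1)[OF \<open>z \<in> S\<close>] lam_coord[of z w "Suc k"]
          by (cases "idx z = Suc k") auto
      qed
      then have ck: "z (Suc k) = x (Suc k)" if "z \<in> S" for z
        using const[of "\<lambda>z. z (Suc k)" z x] that xS by blast
      then have ckk: "\<forall>j\<in>{1..Suc k}. z j = x j" if "z \<in> S" for z
        using IH(2)[OF that] that by (auto simp: le_Suc_eq)
      have keep: "Suc k < idx z \<Longrightarrow> Suc k < idx w" if zw: "(z, w) \<in> covers" "z \<in> S" "w \<in> S" for z w
      proof -
        assume a: "Suc k < idx z"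
        have w: "w \<in> lam z" "z \<in> X" "w \<in> X" using zw SX by (auto simp: covers_def)
        have "pshift (Suc k) w j \<le> pshift (idx z - 1) z j" for j
        proof (cases "j \<in> {1..Suc k}")
          case True
          then have "w j = z j" using ckk[OF zw(2)] ckk[OF zw(3)] by simp
          then show ?thesis using a True by (auto simp: pshift_def)
        next
          case False
          then show ?thesis using lam_coord[OF w(2,1), of j]
            by (cases "j = 0"; cases "j = idx z"; cases "j < idx z"; cases "j \<le> r"; auto simp: pshift_def Suc_le_eq)
        qed
        then have "pshift (Suc k) w \<in> I" using I_down[OF idx_props(2)[OF w(2)], of "pshift (Suc k) w"]
            pshift_lattice[OF X_L[OF w(3)] Suc.prems] by (auto simp: le_fun_def)
        then show "Suc k < idx w" using pshift_I_iff[OF w(3) Suc.prems] by simp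
      qed
      have all: "(Suc k < idx z) = (Suc k < idx x)" if "z \<in> S" for z
        using const[of "\<lambda>z. Suc k < idx z" z x] keep that xS by (simp add: le_bool_def)
      show ?thesis
      proof (cases "Suc k < idx x")
        case True
        then show ?thesis using ckk all by auto
      next
        case False
        \<comment> \<open>Now all indices on the cycle equal \<open>Suc k\<close>. Every cover then
          fixes the first \<open>Suc k\<close> coordinates and can only lower the others, so the
          cycle is a single point.\<close>
        then have id: "idx z = Suc k" if "z \<in> S" for z using IH(1)[OF that] all[OF that] by simp
        have "w \<le> z" if zw: "(z, w) \<in> covers" "z \<in> S" "w \<in> S" for z w
        proof (rule le_funI)
          fix j
          have w: "w \<in> lam z" "z \<in> X" "w \<in> X" using zw SX by (auto simp: covers_def)
          show "w j \<le> z j"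
          proof (cases "j \<in> {1..Suc k}")
            case True
            then show ?thesis using ckk[OF zw(2)] ckk[OF zw(3)] by simp
          next
            case False
            then show ?thesis using lam_coord[OF w(2,1), of j] id[OF zw(2)]
              by (cases "j = 0"; cases "j \<le> r"; auto simp: Suc_le_eq)
          qed
        qed
        note m = this
        have "w \<le> z" if "(z, w) \<in> (covers \<inter> S \<times> S)\<^sup>*" for z w
          using that
        proof induction
          case (step w w')
          then have "w' \<le> w" using m by auto
          then show ?case using step.IH by (rule order.trans)
        qed simp
        then have "x = y" using path[OF yS xS] path[OF xS yS] by (intro order.antisym) auto
        then show ?thesis ..
      qed
    qed simp
  qed
  from main[of r] have "x = y \<or> r < idx x" using xS by blast
  then show ?thesis using idx_props(1)[OF SX[OF xS]] by simp
qed

lemma gt_trans: "gt a b \<Longrightarrow> gt b c \<Longrightarrow> gt a c"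
  using order_antisym[of a b] rtrancl_trans[of a b covers c] unfolding gt_def order_eq by auto

lemma gt_irrefl: "\<not> gt a a"
  by (simp add: gt_def)

lemma lam_gt: "x \<in> X \<Longrightarrow> y \<in> lam x \<Longrightarrow> x \<noteq> y \<Longrightarrow> gt x y"
  unfolding gt_def order_eq using lam_X[of x] by (auto intro!: r_into_rtrancl simp: covers_def)

lemma lam_not_gt: "x \<in> X \<Longrightarrow> y \<in> lam x \<Longrightarrow> \<not> gt y x"
  using lam_gt[of x y] gt_trans[of y x y] gt_irrefl by blast

text \<open>An edge of the Cubist set belongs to the cube of exactly one of its ends. As the index
  is antitone, the inequality between direction and index that is missing at \<open>x\<close> holds
  at the other end; if the direction equals the index of \<open>x\<close>, a shift of the new point
  coincides with a shift of \<open>x\<close>, which decides the case.\<close>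

lemma step_cases:
  assumes x: "x \<in> X" and s: "snd s \<in> {1..r}" and m: "mv x s \<in> X"
  shows "(mv x s \<in> lam x \<and> (if fst s then snd s < idx x else idx x < snd s)) \<or>
    (gt (mv x s) x \<and> \<not> (if fst s then snd s < idx x else idx x < snd s))"
proof -
  let ?m = "mv x s"
  define b i where "b = fst s" and "i = snd s"
  have i: "i \<in> {1..r}" using s by (simp add: i_def)
  have mj: "?m j = (if j = i then if b then x j + 1 else x j - 1 else x j)" for j
    by (simp add: mv_apply sg_def b_def i_def)
  show ?thesis unfolding b_def[symmetric] i_def[symmetric]
  proof (cases "if b then i < idx x else idx x < i")
    case True
    then have "?m \<in> lam x" using mv_lamI[OF x i, of b] by (simp add: b_def i_def)
    then show "(?m \<in> lam x \<and> (if b then i < idx x else idx x < i)) \<or>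
      (gt ?m x \<and> \<not> (if b then i < idx x else idx x < i))" using True by simp
  next
    case nd: False
    have "x \<in> lam ?m"
    proof -
      have "if b then idx ?m < i else i < idx ?m"
      proof (cases b)
        case True
        then have le: "x \<le> ?m" by (simp add: mj le_fun_def)
        have *: "idx ?m \<le> idx x" using idx_antimono[OF x m le] .
        show ?thesis
        proof (cases "i = idx x")
          case True
          have "pshift (i - 1) ?m = pshift i x" using \<open>b\<close> i
            by (auto simp: pshift_def mj fun_eq_iff)
          then have "pshift (i - 1) ?m \<notin> I" using idx_props(3)[OF x] True by simp
          moreover have "i - 1 \<le> r" using i by auto
          ultimately have "\<not> i - 1 < idx ?m" using pshift_I_iff[OF m, of "i - 1"] by simp
          then show ?thesis using i \<open>b\<close> by auto
        next
          case False
          then show ?thesis using * nd \<open>b\<close> by simp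
        qed
      next
        case False
        then have le: "?m \<le> x" by (simp add: mj le_fun_def)
        have *: "idx x \<le> idx ?m" using idx_antimono[OF m x le] .
        show ?thesis
        proof (cases "i = idx x")
          case True
          have "pshift i ?m = pshift (i - 1) x" using False i
            by (auto simp: pshift_def mj fun_eq_iff)
          then have "pshift i ?m \<in> I" using idx_props(2)[OF x] True by simp
          then have "i < idx ?m" using pshift_I_iff[OF m, of i] i by simp
          then show ?thesis using False by simp
        next
          case nv: False
          then show ?thesis using * nd False by simp
        qed
      qed
      then show ?thesis
        using mv_lamI[OF m i, of "\<not> b"] mv_opp(1)[of x s]
        by (simp add: opp_def b_def i_def split: if_splits)
    qed
    moreover have "?m i \<noteq> x i" by (simp add: mj)
    then have "?m \<noteq> x" by metis
    ultimately have "gt ?m x" using lam_gt[OF m] by blast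
    then show "(?m \<in> lam x \<and> (if b then i < idx x else idx x < i)) \<or>
      (gt ?m x \<and> \<not> (if b then i < idx x else idx x < i))" using nd by blast
  qed
qed

text \<open>A vertex \<open>y\<close> of the cone descends to \<open>x\<close> by single steps
  inside the cubes it meets, each of which shortens the distance and stays in the cone. When no such
  step is left, the two chains of shifts contradict each other unless \<open>y = x\<close>.\<close>

lemma mu_order:
  assumes x: "x \<in> X" and "y \<in> X" "y \<in> mu x"
  shows "(y, x) \<in> covers\<^sup>*"
  using assms(2,3)
proof (induction "\<Sum>j=1..r. nat \<bar>y j - x j\<bar>" arbitrary: y rule: less_induct)
  case less
  note y = less.prems(1)
  define v where "v = idx x"
  define i where "i = idx y"
  have vi: "v \<in> {1..r}" "i \<in> {1..r}" using idx_props(1) x y by (auto simp: v_def i_def)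
  show ?case
  proof (cases "\<exists>s. snd s \<in> {1..r} \<and> mv y s \<in> lam y \<and> (if fst s then y (snd s) < x (snd s) else x (snd s) < y (snd s))")
    case True
    then obtain s where s: "snd s \<in> {1..r}" "mv y s \<in> lam y" "if fst s then y (snd s) < x (snd s) else x (snd s) < y (snd s)"
      by blast
    have mX: "mv y s \<in> X" using s lam_X[OF y] by auto
    have "(\<Sum>j=1..r. nat \<bar>mv y s j - x j\<bar>) < (\<Sum>j=1..r. nat \<bar>y j - x j\<bar>)"
    proof (rule sum_strict_mono_ex1)
      have "nat \<bar>mv y s j - x j\<bar> \<le> nat \<bar>y j - x j\<bar>" for j
        using s(3) by (cases "j = snd s"; cases "fst s"; simp add: mv_apply sg_def)
      then show "\<forall>j\<in>{1..r}. nat \<bar>mv y s j - x j\<bar> \<le> nat \<bar>y j - x j\<bar>" by blast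
      have "nat \<bar>mv y s (snd s) - x (snd s)\<bar> < nat \<bar>y (snd s) - x (snd s)\<bar>"
        using s(3) by (cases "fst s"; simp add: mv_apply sg_def)
      then show "\<exists>j\<in>{1..r}. nat \<bar>mv y s j - x j\<bar> < nat \<bar>y j - x j\<bar>" using s(1) by blast
    qed simp
    moreover have "mv y s \<in> mu x"
    proof (rule muI[OF x X_L[OF mX]])
      show "mv y s j \<le> x j" if "1 \<le> j" "j < idx x" for j
        using mu_coord(1)[OF x less.prems(2) that] s(3) by (auto simp: mv_apply sg_def split: if_splits)
      show "x j \<le> mv y s j" if "idx x < j" "j \<le> r" for j
        using mu_coord(2)[OF x less.prems(2) that] s(3) by (auto simp: mv_apply sg_def split: if_splits)
    qed
    ultimately have "(mv y s, x) \<in> covers\<^sup>*" using less.hyps[OF _ mX] by simp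
    moreover have "(y, mv y s) \<in> covers" using s y by (simp add: covers_def)
    ultimately show ?thesis by (rule converse_rtrancl_into_rtrancl[rotated])
  next
    case False
    \<comment> \<open>Being stuck gives the inequalities \<open>n1\<close> and \<open>n2\<close>,
      opposite to \<open>m1\<close> and \<open>m2\<close> from the cone. If the indices agree, only
      coordinate \<open>v\<close> is left open; if they differ, a shift of one point outside the
      ideal lies below a shift of the other inside it.\<close>
    have no: "\<not> y j < x j" if "j \<in> {1..<i}" for j
    proof
      assume "y j < x j"
      moreover have "mv y (True, j) \<in> lam y" using that vi mv_lamI[OF y, of j True] by (simp add: i_def)
      ultimately have "snd (True, j) \<in> {1..r} \<and> mv y (True, j) \<in> lam y \<and>
        (if fst (True, j) then y (snd (True, j)) < x (snd (True, j)) else x (snd (True, j)) < y (snd (True, j)))"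
        using that vi by simp
      then show False using False by blast
    qed
    have no2: "\<not> x j < y j" if "j \<in> {i<..r}" for j
    proof
      assume "x j < y j"
      moreover have "mv y (False, j) \<in> lam y" using that vi mv_lamI[OF y, of j False] by (simp add: i_def)
      ultimately have "snd (False, j) \<in> {1..r} \<and> mv y (False, j) \<in> lam y \<and>
        (if fst (False, j) then y (snd (False, j)) < x (snd (False, j)) else x (snd (False, j)) < y (snd (False, j)))"
        using that vi by simp
      then show False using False by blast
    qed
    have out: "y j = x j" if "j \<notin> {1..r}" for j using that X_L[OF x] X_L[OF y] by (simp add: lattice_pts_def)
    have m1: "1 \<le> j \<Longrightarrow> j < v \<Longrightarrow> y j \<le> x j" and m2: "v < j \<Longrightarrow> j \<le> r \<Longrightarrow> x j \<le> y j" for j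
      using mu_coord[OF x less.prems(2), of j] by (simp_all add: v_def)
    have n1: "1 \<le> j \<Longrightarrow> j < i \<Longrightarrow> x j \<le> y j" and n2: "i < j \<Longrightarrow> j \<le> r \<Longrightarrow> y j \<le> x j" for j
      using no[of j] no2[of j] by simp_all
    have o0: "y 0 = x 0" and o1: "r < j \<Longrightarrow> y j = x j" for j using out[of 0] out[of j] by simp_all
    have px: "pshift (v - 1) x \<in> I" "pshift v x \<notin> I" "pshift v x \<in> L" and py: "pshift (i - 1) y \<in> I" "pshift i y \<notin> I" "pshift i y \<in> L"
      using idx_props[OF x] idx_props[OF y] pshift_lattice[OF X_L[OF x], of v] pshift_lattice[OF X_L[OF y], of i] vi
      by (simp_all add: v_def i_def)
    consider "i = v" | "v < i" | "i < v" using linorder_less_linear[of i v] by blast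
    then show ?thesis
    proof cases
      case 1
      have eq: "y j = x j" if "j \<noteq> v" for j
      proof (cases "j = 0 \<or> r < j")
        case True
        then show ?thesis using o0 o1 by auto
      next
        case False
        then have "j < v \<or> v < j" "1 \<le> j" "j \<le> r" using that by auto
        then show ?thesis using m1[of j] m2[of j] n1[of j] n2[of j] 1 by (elim disjE) simp_all
      qed
      have "\<not> y v < x v"
      proof
        assume "y v < x v"
        then have "pshift v y j \<le> pshift (v - 1) x j" for j
          using eq[of j] vi by (cases "j = v") (auto simp: pshift_def)
        then have "pshift v y \<le> pshift (v - 1) x" by (rule le_funI)
        then show False using I_down[OF px(1), of "pshift v y"] py 1 by simp
      qed
      moreover have "\<not> x v < y v"
      proof
        assume "x v < y v"
        then have "pshift v x j \<le> pshift (v - 1) y j" for j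
          using eq[of j] vi by (cases "j = v") (auto simp: pshift_def)
        then have "pshift v x \<le> pshift (v - 1) y" by (rule le_funI)
        then show False using I_down[OF py(1), of "pshift v x"] px 1 by simp
      qed
      ultimately have "y v = x v" by simp
      then have "y = x" using eq by (intro ext) metis
      then show ?thesis by simp
    next
      case 2
      have "pshift v x j \<le> pshift (i - 1) y j" for j
      proof -
        consider "j = 0" | "r < j" | "1 \<le> j" "j < i" | "i \<le> j" "j \<le> r" by linarith
        then show ?thesis
        proof cases
          case 3
          then have "j \<le> i - 1" by simp
          then show ?thesis using 3 n1[of j] by (simp add: pshift_def)
        next
          case 4
          then show ?thesis using 2 m2[of j] by (simp add: pshift_def)
        qed (use o0 o1[of j] vi in \<open>simp_all add: pshift_def\<close>)
      qed
      then have "pshift v x \<le> pshift (i - 1) y" by (rule le_funI)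
      then show ?thesis using I_down[OF py(1), of "pshift v x"] px by simp
    next
      case 3
      have "pshift i y j \<le> pshift (v - 1) x j" for j
      proof -
        consider "j = 0" | "r < j" | "1 \<le> j" "j < v" | "v \<le> j" "j \<le> r" by linarith
        then show ?thesis
        proof cases
          case c: 3
          then have "j \<le> v - 1" by simp
          then show ?thesis using c m1[of j] by (simp add: pshift_def)
        next
          case 4
          then show ?thesis using 3 n2[of j] by (simp add: pshift_def)
        qed (use o0 o1[of j] vi in \<open>simp_all add: pshift_def\<close>)
      qed
      then have "pshift i y \<le> pshift (v - 1) x" by (rule le_funI)
      then show ?thesis using I_down[OF px(1), of "pshift i y"] py by simp
    qed
  qed
qed

text \<open>Used to see that geodesics inside a cone avoid the vertices below its apex, which are
  the ones factored out of the standard module of \<open>V\<close>.\<close>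

lemma gt_not_mu: assumes "gt x t" shows "t \<notin> mu x"
proof
  assume "t \<in> mu x"
  then have "(t, x) \<in> covers\<^sup>*" using assms mu_order[of x t] unfolding gt_def by simp
  then show False using assms order_antisym[of t x] unfolding gt_def order_eq by simp
qed

end

subsection \<open>Words\<close>

definition valid :: "nat \<Rightarrow> step list \<Rightarrow> bool" where
  "valid r w \<longleftrightarrow> snd ` set w \<subseteq> {1..r}"

definition endp :: "point \<Rightarrow> step list \<Rightarrow> point" where
  "endp u w = foldl mv u w"

definition rv :: "step list \<Rightarrow> step list" where
  "rv w = map opp (rev w)"

definition d1 :: "nat \<Rightarrow> point \<Rightarrow> point \<Rightarrow> nat" where
  "d1 r x y = (\<Sum>j=1..r. nat \<bar>x j - y j\<bar>)"

text \<open>One fixed geodesic, coordinate by coordinate. All geodesics between two points use the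
  same letters, so in \<open>V\<close> the choice is immaterial, and inside a unit cube it matters
  for \<open>U\<close> only up to sign.\<close>

definition geo :: "nat \<Rightarrow> point \<Rightarrow> point \<Rightarrow> step list" where
  "geo r u t = concat (map (\<lambda>i. replicate (nat \<bar>t i - u i\<bar>) (u i < t i, i)) [1..<Suc r])"

lemma valid_simps [simp]:
  "valid r []" "valid r (s # w) \<longleftrightarrow> snd s \<in> {1..r} \<and> valid r w" "valid r (v @ w) \<longleftrightarrow> valid r v \<and> valid r w"
  by (auto simp: valid_def)

lemma endp_simps [simp]: "endp u [] = u" "endp u (s # w) = endp (mv u s) w" "endp u (v @ w) = endp (endp u v) w"
  by (auto simp: endp_def)

lemma rv_simps [simp]: "rv [] = []" "rv (v @ w) = rv w @ rv v" "rv (s # w) = rv w @ [opp s]" "rv (rv w) = w"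
  "length (rv w) = length w" "valid r (rv w) = valid r w"
  by (auto simp: rv_def rev_map valid_def image_image comp_def)

lemma endp_rv [simp]: "endp (endp u w) (rv w) = u"
  by (induction w arbitrary: u) auto

lemma endp_rv': "endp u w = t \<Longrightarrow> endp t (rv w) = u"
  by auto

lemma endp_lattice: "u \<in> lattice_pts r \<Longrightarrow> valid r w \<Longrightarrow> endp u w \<in> lattice_pts r"
  by (induction w arbitrary: u) (simp_all add: mv_lattice)

lemma mv_commute: "mv (mv u s) t = mv (mv u t) s"
  by (auto simp: mv_def fun_eq_iff)

lemma d1_sym: "d1 r x y = d1 r y x"
  by (simp add: d1_def abs_minus_commute)

lemma d1_self [simp]: "d1 r x x = 0"
  by (simp add: d1_def)

text \<open>Steps commute on points, so an end point depends on the letters alone; every reordering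
  of words below relies on this.\<close>

lemma endp_count:
  "endp u w j = u j + int (count (mset w) (True, j)) - int (count (mset w) (False, j))"
proof (induction w arbitrary: u)
  case (Cons s w)
  obtain b i where s: "s = (b, i)" by force
  have "mv u s j = (if i = j then u j + sg s else u j)" by (simp add: mv_apply s)
  then show ?case using Cons[of "mv u s"] by (cases b) (simp_all add: s sg_def)
qed simp

lemma length_count:
  assumes "valid r w"
  shows "length w = (\<Sum>j=1..r. count (mset w) (True, j) + count (mset w) (False, j))"
  using assms
proof (induction w)
  case (Cons s w)
  obtain b i where s: "s = (b, i)" by force
  have "(\<Sum>j=1..r. count (mset (s # w)) (True, j) + count (mset (s # w)) (False, j)) =
    (\<Sum>j=1..r. (count (mset w) (True, j) + count (mset w) (False, j)) + (if j = i then 1 else 0))"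
    by (intro sum.cong) (auto simp: s)
  also have "\<dots> = length w + 1" using Cons by (simp add: s sum.distrib)
  finally show ?case by simp
qed simp

lemma valid_count: "valid r w \<Longrightarrow> j \<notin> {1..r} \<Longrightarrow> count (mset w) (b, j) = 0"
  by (force simp: valid_def count_eq_zero_iff)

lemma length_ge_d1:
  assumes "valid r w" shows "d1 r u (endp u w) \<le> length w"
  unfolding length_count[OF assms] d1_def by (intro sum_mono) (auto simp: endp_count)

text \<open>Equality in \<open>length_ge_d1\<close> forces equality in each coordinate: no direction
  is travelled both ways.\<close>

lemma geodesic_count:
  assumes w: "valid r w" and len: "length w = d1 r u (endp u w)"
  shows "count (mset w) (b, j) = (if b = (u j < endp u w j) then nat \<bar>endp u w j - u j\<bar> else 0)"
proof (cases "j \<in> {1..r}")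
  case False
  then show ?thesis using valid_count[OF w False] endp_count[of u w j]
    by (simp del: count_mset_0_iff count_eq_zero_iff)
next
  case True
  let ?c = "\<lambda>b j. count (mset w) (b, j)"
  have le: "nat \<bar>u j - endp u w j\<bar> \<le> ?c True j + ?c False j" for j
    unfolding endp_count[of u w j] by linarith
  have "(\<Sum>j=1..r. nat \<bar>u j - endp u w j\<bar>) = (\<Sum>j=1..r. ?c True j + ?c False j)"
    using len length_count[OF w] by (simp add: d1_def)
  then have "nat \<bar>u j - endp u w j\<bar> = ?c True j + ?c False j"
    using sum_mono_inv[of "\<lambda>j. nat \<bar>u j - endp u w j\<bar>" "{1..r}" "\<lambda>j. ?c True j + ?c False j" j, OF _ le True]
    by blast
  then have "int (?c True j) + int (?c False j) = \<bar>u j - endp u w j\<bar>" by linarith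
  moreover have "endp u w j = u j + int (?c True j) - int (?c False j)" by (rule endp_count)
  ultimately show ?thesis by (cases b) (auto simp del: count_mset_0_iff count_eq_zero_iff)
qed

lemma geodesic_mset:
  assumes "valid r v" "valid r w" "length v = d1 r u t" "length w = d1 r u t" "endp u v = t" "endp u w = t"
  shows "mset v = mset w"
proof (rule multiset_eqI)
  fix s :: step
  obtain b j where s: "s = (b, j)" by force
  show "count (mset v) s = count (mset w) s"
    using geodesic_count[of r v u b j] geodesic_count[of r w u b j] assms unfolding s by simp
qed

text \<open>The letters of a prefix are among those of the whole geodesic, which moves every
  coordinate monotonically.\<close>

lemma geodesic_between:
  assumes w: "valid r (a @ b)" and len: "length (a @ b) = d1 r u (endp u (a @ b))"
  shows "(u j \<le> endp u a j \<and> endp u a j \<le> endp u (a @ b) j) \<or> (endp u (a @ b) j \<le> endp u a j \<and> endp u a j \<le> u j)"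
proof -
  define e where "e = endp u (a @ b) j"
  have "count (mset a) (True, j) + count (mset b) (True, j) = (if u j < e then nat \<bar>e - u j\<bar> else 0)"
    "count (mset a) (False, j) + count (mset b) (False, j) = (if u j < e then 0 else nat \<bar>e - u j\<bar>)"
    using geodesic_count[OF w len, of True j] geodesic_count[OF w len, of False j]
    by (simp_all add: e_def del: endp_simps)
  then show ?thesis using endp_count[of u a j] unfolding e_def[symmetric]
    by (cases "u j < e") (linarith | simp del: count_mset_0_iff count_eq_zero_iff)+
qed

lemma geo_aux:
  "valid r (geo r u t)" "length (geo r u t) = d1 r u t"
  "endp u (geo r u t) = (\<lambda>j. if j \<in> {1..r} then t j else u j)"
proof (induction r)
  case 0
  {
    case 1 then show ?case by (simp add: geo_def)
  next
    case 2 then show ?case by (simp add: geo_def d1_def)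
  next
    case 3 then show ?case by (simp add: geo_def)
  }
next
  case (Suc r)
  let ?l = "replicate (nat \<bar>t (Suc r) - u (Suc r)\<bar>) (u (Suc r) < t (Suc r), Suc r)"
  have g: "geo (Suc r) u t = geo r u t @ ?l" by (simp add: geo_def)
  have rep: "endp v (replicate n (b, i)) = v(i := if b then v i + int n else v i - int n)" for v n b i
    by (induction n arbitrary: v) (auto simp: mv_def sg_def fun_eq_iff)
  {
    case 1 then show ?case using Suc(1) by (auto simp: g valid_def)
  next
    case 2 then show ?case using Suc(2) by (simp add: g d1_def abs_minus_commute)
  next
    case 3 then show ?case using Suc(3) by (auto simp: g rep fun_eq_iff le_Suc_eq)
  }
qed

lemma geo_valid [simp]: "valid r (geo r u t)" and geo_length [simp]: "length (geo r u t) = d1 r u t"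
  by (rule geo_aux)+

lemma geo_endp [simp]: "u \<in> lattice_pts r \<Longrightarrow> t \<in> lattice_pts r \<Longrightarrow> endp u (geo r u t) = t"
  by (auto simp: geo_aux(3) lattice_pts_def fun_eq_iff)

lemma distinct_snd_count:
  "distinct (map snd (w :: step list)) \<longleftrightarrow> (\<forall>j. count (mset w) (True, j) + count (mset w) (False, j) \<le> 1)"
proof -
  have c: "count (mset (map snd w)) j = count (mset w) (True, j) + count (mset w) (False, j)" for j
    by (induction w) auto
  have "distinct (xs :: nat list) \<longleftrightarrow> (\<forall>j. count (mset xs) j \<le> 1)" for xs
  proof (induction xs)
    case (Cons a xs)
    have "(\<forall>j. count (mset (a # xs)) j \<le> 1) \<longleftrightarrow> count (mset xs) a = 0 \<and> (\<forall>j. count (mset xs) j \<le> 1)"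
      by (simp del: count_mset_0_iff) (metis le_0_eq nat_le_linear not_less_eq_eq One_nat_def)
    then show ?case using Cons by simp
  qed simp
  from this[of "map snd w"] show ?thesis unfolding c .
qed

lemma geodesic_distinct:
  assumes "valid r w" "length w = d1 r u t" "endp u w = t" "\<And>j. j \<in> {1..r} \<Longrightarrow> \<bar>u j - t j\<bar> \<le> 1"
  shows "distinct (map snd w)"
proof -
  have "count (mset w) (True, j) + count (mset w) (False, j) \<le> 1" for j
  proof (cases "j \<in> {1..r}")
    case True
    then show ?thesis using assms(4)[OF True] geodesic_count[of r w u _ j] assms(1-3) by auto
  next
    case False
    then show ?thesis using valid_count[OF assms(1) False] by (simp del: count_mset_0_iff count_eq_zero_iff)
  qed
  then show ?thesis by (simp add: distinct_snd_count)
qed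

lemma geodesic_step:
  assumes "valid r w" "length w = d1 r u t" "endp u w = t"
  shows "s \<in> set w \<longleftrightarrow> u (snd s) \<noteq> t (snd s) \<and> fst s = (u (snd s) < t (snd s)) "
proof -
  obtain b j where s: "s = (b, j)" by force
  have "s \<in> set w \<longleftrightarrow> count (mset w) (b, j) \<noteq> 0" by (simp add: s count_eq_zero_iff del: count_mset_0_iff)
  then show ?thesis using geodesic_count[of r w u b j] assms s by auto
qed


subsection \<open>Functions on words compatible with the relations\<close>

text \<open>Such a function is a linear functional on the paths from a fixed point, written on
  words, that kills the ideal of relations. Loop sums of any two directions are compared at once,
  whereas the relations of the quiver compare neighbouring directions.\<close>

definition U_rel :: "nat \<Rightarrow> (step list \<Rightarrow> 'k::field) \<Rightarrow> bool" where
  "U_rel r F \<longleftrightarrow> (\<forall>a b. valid r a \<longrightarrow> valid r b \<longrightarrow>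
     (\<forall>s. snd s \<in> {1..r} \<longrightarrow> F (a @ [s, s] @ b) = 0) \<and>
     (\<forall>s t. snd s \<in> {1..r} \<longrightarrow> snd t \<in> {1..r} \<longrightarrow> snd s \<noteq> snd t \<longrightarrow> F (a @ [s, t] @ b) + F (a @ [t, s] @ b) = 0) \<and>
     (\<forall>i j. i \<in> {1..r} \<longrightarrow> j \<in> {1..r} \<longrightarrow>
        F (a @ [(False, i), (True, i)] @ b) + F (a @ [(True, i), (False, i)] @ b) =
        F (a @ [(False, j), (True, j)] @ b) + F (a @ [(True, j), (False, j)] @ b)))"

definition V_rel :: "nat \<Rightarrow> (step list \<Rightarrow> 'k::field) \<Rightarrow> bool" where
  "V_rel r F \<longleftrightarrow> (\<forall>a b. valid r a \<longrightarrow> valid r b \<longrightarrow>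
     (\<forall>s t. snd s \<in> {1..r} \<longrightarrow> snd t \<in> {1..r} \<longrightarrow> F (a @ [s, t] @ b) = F (a @ [t, s] @ b)) \<and>
     (\<Sum>i=1..r. F (a @ [(False, i), (True, i)] @ b)) = 0)"

text \<open>Words carry no vertices, hence the starting point \<open>u\<close>. With
  \<open>K\<close> the complement of the Cubist set this expresses passage to the quotient algebra,
  with \<open>K\<close> the strictly larger vertices passage to a standard module.\<close>

definition kills :: "nat \<Rightarrow> point \<Rightarrow> point set \<Rightarrow> (step list \<Rightarrow> 'k::field) \<Rightarrow> bool" where
  "kills r u K F \<longleftrightarrow> (\<forall>a b. valid r a \<longrightarrow> valid r b \<longrightarrow> endp u a \<in> K \<longrightarrow> F (a @ b) = 0)"

lemma U_relD:
  assumes "U_rel r F" "valid r a" "valid r b"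
  shows "snd s \<in> {1..r} \<Longrightarrow> F (a @ s # s # b) = 0"
    and "snd s \<in> {1..r} \<Longrightarrow> snd t \<in> {1..r} \<Longrightarrow> snd s \<noteq> snd t \<Longrightarrow> F (a @ s # t # b) = - F (a @ t # s # b)"
    and "i \<in> {1..r} \<Longrightarrow> j \<in> {1..r} \<Longrightarrow>
        F (a @ (False, i) # (True, i) # b) + F (a @ (True, i) # (False, i) # b) =
        F (a @ (False, j) # (True, j) # b) + F (a @ (True, j) # (False, j) # b)"
proof -
  have D: "(\<forall>s. snd s \<in> {1..r} \<longrightarrow> F (a @ [s, s] @ b) = 0) \<and>
     (\<forall>s t. snd s \<in> {1..r} \<longrightarrow> snd t \<in> {1..r} \<longrightarrow> snd s \<noteq> snd t \<longrightarrow> F (a @ [s, t] @ b) + F (a @ [t, s] @ b) = 0) \<and>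
     (\<forall>i j. i \<in> {1..r} \<longrightarrow> j \<in> {1..r} \<longrightarrow>
        F (a @ [(False, i), (True, i)] @ b) + F (a @ [(True, i), (False, i)] @ b) =
        F (a @ [(False, j), (True, j)] @ b) + F (a @ [(True, j), (False, j)] @ b))"
    using assms(1)[unfolded U_rel_def, rule_format, OF assms(2,3)] by blast
  show "snd s \<in> {1..r} \<Longrightarrow> F (a @ s # s # b) = 0" using D[THEN conjunct1, rule_format, of s] by simp
  show "snd s \<in> {1..r} \<Longrightarrow> snd t \<in> {1..r} \<Longrightarrow> snd s \<noteq> snd t \<Longrightarrow> F (a @ s # t # b) = - F (a @ t # s # b)"
    using D[THEN conjunct2, THEN conjunct1, rule_format, of s t] by (simp add: eq_neg_iff_add_eq_0)
  show "i \<in> {1..r} \<Longrightarrow> j \<in> {1..r} \<Longrightarrow>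
        F (a @ (False, i) # (True, i) # b) + F (a @ (True, i) # (False, i) # b) =
        F (a @ (False, j) # (True, j) # b) + F (a @ (True, j) # (False, j) # b)"
    using D[THEN conjunct2, THEN conjunct2, rule_format, of i j] by simp
qed

lemma U_relI:
  assumes "\<And>a b s. valid r a \<Longrightarrow> valid r b \<Longrightarrow> snd s \<in> {1..r} \<Longrightarrow> F (a @ s # s # b) = 0"
    and "\<And>a b s t. valid r a \<Longrightarrow> valid r b \<Longrightarrow> snd s \<in> {1..r} \<Longrightarrow> snd t \<in> {1..r} \<Longrightarrow> snd s \<noteq> snd t \<Longrightarrow>
      F (a @ s # t # b) + F (a @ t # s # b) = 0"
    and "\<And>a b i j. valid r a \<Longrightarrow> valid r b \<Longrightarrow> i \<in> {1..r} \<Longrightarrow> j \<in> {1..r} \<Longrightarrow>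
        F (a @ (False, i) # (True, i) # b) + F (a @ (True, i) # (False, i) # b) =
        F (a @ (False, j) # (True, j) # b) + F (a @ (True, j) # (False, j) # b)"
  shows "U_rel r F"
  unfolding U_rel_def
proof (intro allI impI conjI)
  fix a b assume ab: "valid r a" "valid r b"
  show "F (a @ [s, s] @ b) = 0" if "snd s \<in> {1..r}" for s using assms(1)[OF ab that] by simp
  show "F (a @ [s, t] @ b) + F (a @ [t, s] @ b) = 0"
    if "snd s \<in> {1..r}" "snd t \<in> {1..r}" "snd s \<noteq> snd t" for s t using assms(2)[OF ab that] by simp
  show "F (a @ [(False, i), (True, i)] @ b) + F (a @ [(True, i), (False, i)] @ b) =
        F (a @ [(False, j), (True, j)] @ b) + F (a @ [(True, j), (False, j)] @ b)"
    if "i \<in> {1..r}" "j \<in> {1..r}" for i j using assms(3)[OF ab that] by simp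
qed

lemma killsD: "kills r u K F \<Longrightarrow> valid r a \<Longrightarrow> valid r b \<Longrightarrow> endp u a \<in> K \<Longrightarrow> F (a @ b) = 0"
  by (simp add: kills_def)

lemma U_rel_prefix:
  assumes "U_rel r F" "valid r p" shows "U_rel r (\<lambda>w. F (p @ w))"
proof (rule U_relI)
  fix a b assume ab: "valid r a" "valid r b"
  note D = U_relD[OF assms(1), of "p @ a" b, simplified, OF conjI[OF assms(2) ab(1)] ab(2)]
  show "F (p @ a @ s # s # b) = 0" if "snd s \<in> {1..r}" for s using D(1) that by simp
  show "F (p @ a @ s # t # b) + F (p @ a @ t # s # b) = 0"
    if "snd s \<in> {1..r}" "snd t \<in> {1..r}" "snd s \<noteq> snd t" for s t using D(2)[of s t] that by simp
  show "F (p @ a @ (False, i) # (True, i) # b) + F (p @ a @ (True, i) # (False, i) # b) =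
        F (p @ a @ (False, j) # (True, j) # b) + F (p @ a @ (True, j) # (False, j) # b)"
    if "i \<in> {1..r}" "j \<in> {1..r}" for i j using D(3)[of i j] that by simp
qed

lemma U_rel_suffix:
  assumes "U_rel r F" "valid r p" shows "U_rel r (\<lambda>w. F (w @ p))"
proof (rule U_relI)
  fix a b assume ab: "valid r a" "valid r b"
  note D = U_relD[OF assms(1), of a "b @ p", simplified, OF ab(1) conjI[OF ab(2) assms(2)]]
  show "F ((a @ s # s # b) @ p) = 0" if "snd s \<in> {1..r}" for s using D(1) that by simp
  show "F ((a @ s # t # b) @ p) + F ((a @ t # s # b) @ p) = 0"
    if "snd s \<in> {1..r}" "snd t \<in> {1..r}" "snd s \<noteq> snd t" for s t using D(2)[of s t] that by simp
  show "F ((a @ (False, i) # (True, i) # b) @ p) + F ((a @ (True, i) # (False, i) # b) @ p) =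
        F ((a @ (False, j) # (True, j) # b) @ p) + F ((a @ (True, j) # (False, j) # b) @ p)"
    if "i \<in> {1..r}" "j \<in> {1..r}" for i j using D(3)[of i j] that by simp
qed

text \<open>Reversing paths is an anti-automorphism of the relations; it exchanges statements about
  the start of a word with statements about its end.\<close>

lemma U_rel_rv:
  assumes "U_rel r F" shows "U_rel r (\<lambda>w. F (rv w))"
proof (rule U_relI)
  fix a b assume ab: "valid r a" "valid r b"
  note D = U_relD[OF assms, of "rv b" "rv a", simplified, OF ab(2,1)]
  show "F (rv (a @ s # s # b)) = 0" if "snd s \<in> {1..r}" for s using D(1)[of "opp s"] that by simp
  show "F (rv (a @ s # t # b)) + F (rv (a @ t # s # b)) = 0"
    if "snd s \<in> {1..r}" "snd t \<in> {1..r}" "snd s \<noteq> snd t" for s t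
    using D(2)[of "opp s" "opp t"] that by simp
  show "F (rv (a @ (False, i) # (True, i) # b)) + F (rv (a @ (True, i) # (False, i) # b)) =
        F (rv (a @ (False, j) # (True, j) # b)) + F (rv (a @ (True, j) # (False, j) # b))"
    if "i \<in> {1..r}" "j \<in> {1..r}" for i j
    using D(3)[of i j] that by (simp add: opp_def)
qed

lemma U_rel_sum:
  assumes "\<And>z. z \<in> A \<Longrightarrow> U_rel r (F z)" shows "U_rel r (\<lambda>w. \<Sum>z\<in>A. c z * F z w)"
proof (rule U_relI)
  fix a b assume ab: "valid r a" "valid r b"
  note D = U_relD[OF assms ab]
  show "(\<Sum>z\<in>A. c z * F z (a @ s # s # b)) = 0" if "snd s \<in> {1..r}" for s using D(1) that by simp
  show "(\<Sum>z\<in>A. c z * F z (a @ s # t # b)) + (\<Sum>z\<in>A. c z * F z (a @ t # s # b)) = 0"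
    if "snd s \<in> {1..r}" "snd t \<in> {1..r}" "snd s \<noteq> snd t" for s t
    using D(2)[of _ s t] that by (simp add: sum_negf)
  show "(\<Sum>z\<in>A. c z * F z (a @ (False, i) # (True, i) # b)) + (\<Sum>z\<in>A. c z * F z (a @ (True, i) # (False, i) # b)) =
        (\<Sum>z\<in>A. c z * F z (a @ (False, j) # (True, j) # b)) + (\<Sum>z\<in>A. c z * F z (a @ (True, j) # (False, j) # b))"
    if "i \<in> {1..r}" "j \<in> {1..r}" for i j
    unfolding sum.distrib[symmetric] distrib_left[symmetric] using D(3)[of _ i j] that by simp
qed

text \<open>All words occurring in one relation have the same length and the same end point.\<close>

lemma U_rel_restrict:
  assumes "U_rel r F" shows "U_rel r (\<lambda>w. if length w = n \<and> endp x w = y then F w else 0)"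
proof (rule U_relI)
  fix a b assume ab: "valid r a" "valid r b"
  let ?F = "\<lambda>w. if length w = n \<and> endp x w = y then F w else 0"
  note D = U_relD[OF assms ab]
  show "?F (a @ s # s # b) = 0" if "snd s \<in> {1..r}" for s using D(1) that by simp
  show "?F (a @ s # t # b) + ?F (a @ t # s # b) = 0"
    if "snd s \<in> {1..r}" "snd t \<in> {1..r}" "snd s \<noteq> snd t" for s t
    using D(2)[of s t] that mv_commute[of _ s t] by simp
  have mm: "mv (mv u (False, i)) (True, i) = u" "mv (mv u (True, i)) (False, i) = u" for u i
    using mv_opp[of u "(True, i)"] by (auto simp: opp_def)
  show "?F (a @ (False, i) # (True, i) # b) + ?F (a @ (True, i) # (False, i) # b) =
        ?F (a @ (False, j) # (True, j) # b) + ?F (a @ (True, j) # (False, j) # b)"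
    if "i \<in> {1..r}" "j \<in> {1..r}" for i j
    using D(3)[of i j] that by (simp add: mm)
qed

lemma kills_prefix: "kills r u K F \<Longrightarrow> valid r p \<Longrightarrow> kills r (endp u p) K (\<lambda>w. F (p @ w))"
  unfolding kills_def
proof (intro allI impI)
  fix a b assume "\<forall>a b. valid r a \<longrightarrow> valid r b \<longrightarrow> endp u a \<in> K \<longrightarrow> F (a @ b) = 0"
    and "valid r p" "valid r a" "valid r b" "endp (endp u p) a \<in> K"
  then have "F ((p @ a) @ b) = 0" by (simp del: append_assoc)
  then show "F (p @ a @ b) = 0" by simp
qed

lemma kills_suffix: "kills r u K F \<Longrightarrow> valid r p \<Longrightarrow> kills r u K (\<lambda>w. F (w @ p))"
  unfolding kills_def by simp

lemma U_rel_move: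
  assumes "U_rel r F" "valid r a" "valid r b" "snd s \<in> {1..r}" "snd s \<notin> snd ` set a"
  shows "F (a @ s # b) = (- 1) ^ length a * F (s # a @ b)"
  using assms
proof (induction a arbitrary: F)
  case (Cons t a)
  have "F (t # a @ s # b) = (- 1) ^ length a * F (t # s # a @ b)"
    using Cons.IH[of "\<lambda>w. F (t # w)"] Cons.prems U_rel_prefix[OF Cons.prems(1), of "[t]"] by simp
  also have "F (t # s # a @ b) = - F (s # t # a @ b)"
    using U_relD(2)[OF Cons.prems(1), of "[]" "a @ b" t s] Cons.prems by force
  finally show ?case by simp
qed simp

text \<open>Letters of distinct directions anticommute, so reordering costs a sign. The sign is left
  undetermined because only vanishing matters for dimensions.\<close>

lemma U_rel_perm:
  assumes "U_rel r F" "valid r v" "mset v = mset w" "distinct (map snd v)"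
  shows "F w = F v \<or> F w = - F v"
  using assms
proof (induction v arbitrary: w F)
  case (Cons s v)
  have "s \<in> set w" using Cons.prems(3) by (metis list.set_intros(1) set_mset_mset)
  then obtain a b where w: "w = a @ s # b" by (meson split_list)
  have ab: "mset v = mset (a @ b)" using Cons.prems(3) w by simp
  have sv: "set v = set a \<union> set b" using arg_cong[OF ab, of set_mset] by simp
  have va: "valid r a" "valid r b" "snd s \<in> {1..r}" "snd s \<notin> snd ` set a" "valid r v"
    using Cons.prems(2,4) sv by (auto simp: valid_def)
  have "F w = (- 1) ^ length a * F (s # a @ b)"
    unfolding w using U_rel_move[OF Cons.prems(1) va(1,2,3,4)] .
  moreover have "F (s # a @ b) = F (s # v) \<or> F (s # a @ b) = - F (s # v)"
    using Cons.IH[of "\<lambda>w. F (s # w)" "a @ b"] U_rel_prefix[OF Cons.prems(1), of "[s]"] va ab Cons.prems(4) by simp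
  moreover have "(- 1 :: 'a) ^ length a = 1 \<or> (- 1 :: 'a) ^ length a = - 1"
    by (cases "even (length a)") simp_all
  ultimately show ?case by auto
qed simp

lemma U_rel_move_zero:
  assumes "U_rel r F" "valid r a" "valid r b" "snd s \<in> {1..r}" "snd s \<notin> snd ` set a"
  shows "F (a @ s # b) = 0 \<longleftrightarrow> F (s # a @ b) = 0"
  using U_rel_move[OF assms] by simp

subsection \<open>The sign representations on cubes\<close>

text \<open>\<open>u\<close> is a corner of the unit cube whose largest corner is
  \<open>z\<close>.\<close>

definition incube :: "nat \<Rightarrow> point \<Rightarrow> point \<Rightarrow> bool" where
  "incube r z u \<longleftrightarrow> (\<forall>j\<in>{1..r}. z j = u j \<or> z j = u j + 1)"

text \<open>The exponent of a Jordan-Wigner sign: it counts the smaller directions in which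
  \<open>u\<close> differs from \<open>z\<close>, and it makes operators in different directions
  anticommute.\<close>

definition below :: "point \<Rightarrow> point \<Rightarrow> nat \<Rightarrow> nat" where
  "below z u k = card {j \<in> {1..<k}. z j \<noteq> u j}"

lemma below_cong:
  assumes "\<And>j. j < k \<Longrightarrow> (z j = u j) = (z' j = u' j)"
  shows "below z u k = below z' u' k"
  unfolding below_def using assms by (intro arg_cong[of _ _ card] Collect_cong) auto

lemma below_change:
  assumes "i \<in> {1..<k}" "\<And>j. j \<noteq> i \<Longrightarrow> (z j = u j) = (z' j = u' j)" "(z i = u i) \<noteq> (z' i = u' i)"
  shows "(- 1 :: 'k::field) ^ below z u k = - ((- 1) ^ below z' u' k)"
proof -
  have *: "below z u k = Suc (below z' u' k)"
    if "\<And>j. j \<noteq> i \<Longrightarrow> (z j = u j) = (z' j = u' j)" "z i \<noteq> u i" "z' i = u' i" for z u z' u' :: point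
  proof -
    have "j \<in> {j \<in> {1..<k}. z j \<noteq> u j} \<longleftrightarrow> j \<in> insert i {j \<in> {1..<k}. z' j \<noteq> u' j}" for j
      using that(1)[of j] that(2,3) assms(1) by (cases "j = i") auto
    then have "{j \<in> {1..<k}. z j \<noteq> u j} = insert i {j \<in> {1..<k}. z' j \<noteq> u' j}" by blast
    moreover have "i \<notin> {j \<in> {1..<k}. z' j \<noteq> u' j}" using that by simp
    ultimately show ?thesis unfolding below_def by simp
  qed
  show ?thesis
  proof (cases "z i = u i")
    case True
    then show ?thesis using *[of z' u' z u] assms by simp
  next
    case False
    then show ?thesis using *[of z u z' u'] assms by simp
  qed
qed

text \<open>For fixed \<open>z\<close> the points \<open>u\<close> with \<open>incube r z u\<close> index a basis of a right module over
  the first algebra, in which up and down arrows act as the raising and lowering operators of a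
  Fock space; \<open>chi r z u w\<close> is the coefficient with which the word \<open>w\<close> acts on the basis vector \<open>u\<close>.\<close>

fun chi :: "nat \<Rightarrow> point \<Rightarrow> point \<Rightarrow> step list \<Rightarrow> 'k::field" where
  "chi r z u [] = 1"
| "chi r z u (s # w) = (if incube r z u \<and> incube r z (mv u s)
     then (- 1) ^ below z u (snd s) * chi r z (mv u s) w else 0)"

lemma chi_append: "chi r z u (v @ w) = chi r z u v * chi r z (endp u v) w"
  by (induction v arbitrary: u) auto

text \<open>A value of \<open>chi\<close> is a single product of signs, so nothing can cancel, and
  it vanishes only when the path leaves the cube.\<close>

lemma chi_nonzero:
  assumes "incube r z u"
  shows "chi r z u w \<noteq> (0 :: 'k::field) \<longleftrightarrow> (\<forall>a b. w = a @ b \<longrightarrow> incube r z (endp u a))"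
  using assms
proof (induction w arbitrary: u)
  case (Cons s w)
  have "(\<forall>a b. s # w = a @ b \<longrightarrow> incube r z (endp u a)) \<longleftrightarrow> (\<forall>a b. w = a @ b \<longrightarrow> incube r z (endp (mv u s) a))"
    (is "?l = ?r")
  proof
    assume l: ?l
    show ?r
    proof (intro allI impI)
      fix a b assume "w = a @ b"
      then show "incube r z (endp (mv u s) a)" using l[rule_format, of "s # a" b] by simp
    qed
  next
    assume r: ?r
    show ?l
    proof (intro allI impI)
      fix a b assume ab: "s # w = a @ b"
      show "incube r z (endp u a)"
      proof (cases a)
        case Nil
        then show ?thesis using Cons.prems by simp
      next
        case (Cons s' a')
        then show ?thesis using r[rule_format, of a' b] ab by simp
      qed
    qed
  qed
  moreover have "?r \<Longrightarrow> incube r z (mv u s)" using append_Nil by fastforce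
  ultimately show ?case using Cons by auto
qed simp

lemma chi_zero:
  assumes "incube r z u" "\<not> incube r z (endp u a)"
  shows "chi r z u (a @ b) = (0 :: 'k::field)"
  using chi_nonzero[OF assms(1), of "a @ b", where 'k='k] assms(2) by blast



lemma incube_mv:
  assumes "snd s \<in> {1..r}" "incube r z u"
  shows "incube r z (mv u s) \<longleftrightarrow> (if fst s then z (snd s) = u (snd s) + 1 else z (snd s) = u (snd s))"
proof
  assume "incube r z (mv u s)"
  then have "z (snd s) = mv u s (snd s) \<or> z (snd s) = mv u s (snd s) + 1" using assms(1) by (auto simp: incube_def)
  moreover have "z (snd s) = u (snd s) \<or> z (snd s) = u (snd s) + 1" using assms by (auto simp: incube_def)
  ultimately show "if fst s then z (snd s) = u (snd s) + 1 else z (snd s) = u (snd s)"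
    by (cases "fst s") (auto simp: mv_apply sg_def)
next
  assume a: "if fst s then z (snd s) = u (snd s) + 1 else z (snd s) = u (snd s)"
  show "incube r z (mv u s)" unfolding incube_def
  proof
    fix j assume j: "j \<in> {1..r}"
    then have "z j = u j \<or> z j = u j + 1" using assms(2) by (simp add: incube_def)
    then show "z j = mv u s j \<or> z j = mv u s j + 1"
      using a by (cases "j = snd s"; cases "fst s") (simp_all add: mv_apply sg_def)
  qed
qed

text \<open>Raising and lowering in one direction act on a two-state system, and the signs combine
  the directions as in a Fock space. The last relation holds because the loop sum acts as the
  identity, whatever the direction.\<close>

lemma U_rel_chi: "U_rel r (chi r z u :: step list \<Rightarrow> 'k::field)"
proof (rule U_relI)
  fix a b :: "step list"
  let ?v = "endp u a"
  let ?c = "\<lambda>u i. (- 1 :: 'k) ^ below z u i"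
  show "chi r z u (a @ s # s # b) = (0 :: 'k)" if s: "snd s \<in> {1..r}" for s
  proof (cases "incube r z ?v \<and> incube r z (mv ?v s)")
    case True
    then have "\<not> incube r z (mv (mv ?v s) s)"
      using incube_mv[OF s, of z ?v] incube_mv[OF s, of z "mv ?v s"] s by (auto simp: mv_apply sg_def split: if_splits)
    then show ?thesis by (simp add: chi_append)
  qed (auto simp: chi_append)
  show "chi r z u (a @ s # t # b) + chi r z u (a @ t # s # b) = (0 :: 'k)"
    if st: "snd s \<in> {1..r}" "snd t \<in> {1..r}" "snd s \<noteq> snd t" for s t
  proof (cases "incube r z ?v")
    case v: True
    have 1: "incube r z (mv (mv ?v s) t) \<longleftrightarrow> incube r z (mv ?v t)" if "incube r z (mv ?v s)"
      using incube_mv[OF st(2) v] incube_mv[OF st(2) that] st(3) by (simp add: mv_apply)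
    have 2: "incube r z (mv (mv ?v t) s) \<longleftrightarrow> incube r z (mv ?v s)" if "incube r z (mv ?v t)"
      using incube_mv[OF st(1) v] incube_mv[OF st(1) that] st(3) by (simp add: mv_apply)
    show ?thesis
    proof (cases "incube r z (mv ?v s) \<and> incube r z (mv ?v t)")
      case True
      \<comment> \<open>A step in the smaller direction changes the count seen by the larger one,
        but not conversely; this produces exactly one sign.\<close>
      have sgn: "?c ?v (snd s) * ?c (mv ?v s) (snd t) = - (?c ?v (snd t) * ?c (mv ?v t) (snd s))"
        if "snd s < snd t" "snd s \<in> {1..r}" "incube r z (mv ?v s)" for s t
      proof -
        have "below z (mv ?v t) (snd s) = below z ?v (snd s)"
          using that by (intro below_cong) (simp add: mv_apply)
        moreover have "?c (mv ?v s) (snd t) = - ?c ?v (snd t)"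
        proof (rule below_change)
          show "snd s \<in> {1..<snd t}" using that by simp
          show "(z j = mv ?v s j) = (z j = ?v j)" if "j \<noteq> snd s" for j using that by (simp add: mv_apply)
          show "(z (snd s) = mv ?v s (snd s)) \<noteq> (z (snd s) = ?v (snd s))"
            using incube_mv[OF that(2) v] that(3) by (cases "fst s") (simp_all add: mv_apply sg_def)
        qed
        ultimately show ?thesis by simp
      qed
      have sgn': "?c ?v (snd s) * ?c (mv ?v s) (snd t) = - (?c ?v (snd t) * ?c (mv ?v t) (snd s))"
      proof (cases "snd s < snd t")
        case True
        then show ?thesis using sgn[of s t] st \<open>incube r z (mv ?v s) \<and> _\<close> by blast
      next
        case False
        then have "snd t < snd s" using st(3) by simp
        then show ?thesis using sgn[of t s] st True by (simp add: minus_equation_iff)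
      qed
      have "chi r z u (a @ s # t # b) = chi r z u a * (?c ?v (snd s) * ?c (mv ?v s) (snd t)) * chi r z (mv (mv ?v s) t) b"
        using v True 1 by (simp add: chi_append mult.assoc)
      moreover have "chi r z u (a @ t # s # b) = chi r z u a * (?c ?v (snd t) * ?c (mv ?v t) (snd s)) * chi r z (mv (mv ?v s) t) b"
        using v True 2 by (simp add: chi_append mult.assoc mv_commute[of _ s t])
      ultimately show ?thesis by (simp add: sgn')
    next
      case False
      then show ?thesis using 1 2 by (auto simp: chi_append)
    qed
  qed (simp add: chi_append)
  have mm: "mv (mv w (False, i)) (True, i) = w" "mv (mv w (True, i)) (False, i) = w" for w i
    using mv_opp[of w "(True, i)"] by (auto simp: opp_def)
  \<comment> \<open>At each corner of the cube exactly one of the two loops in direction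
    \<open>i\<close> stays inside, and its two equal signs multiply to one.\<close>
  have key: "chi r z u (a @ (False, i) # (True, i) # b) + chi r z u (a @ (True, i) # (False, i) # b) =
     (if incube r z ?v then chi r z u a * chi r z ?v b else (0 :: 'k))" if i: "i \<in> {1..r}" for i
  proof (cases "incube r z ?v")
    case v: True
    have e: "below z (mv ?v (c, i)) i = below z ?v i" for c
      by (intro below_cong) (simp add: mv_apply)
    have "z i = ?v i \<or> z i = ?v i + 1" using v i by (auto simp: incube_def)
    then show ?thesis using v incube_mv[OF _ v, of "(True, i)"] incube_mv[OF _ v, of "(False, i)"] i
      by (auto simp: chi_append mm e simp flip: power_add mult.assoc)
  qed (simp add: chi_append)
  show "chi r z u (a @ (False, i) # (True, i) # b) + chi r z u (a @ (True, i) # (False, i) # b) =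
        (chi r z u (a @ (False, j) # (True, j) # b) + chi r z u (a @ (True, j) # (False, j) # b) :: 'k)"
    if "i \<in> {1..r}" "j \<in> {1..r}" for i j using key[OF that(1)] key[OF that(2)] by simp
qed

text \<open>The changed coordinate of \<open>z\<close> is seen only by steps in larger directions,
  and each of them contributes one sign.\<close>

lemma chi_flip:
  assumes "valid r w" "i \<notin> snd ` set w" "z' i \<noteq> z i" "\<And>j. j \<noteq> i \<Longrightarrow> z' j = z j"
    "i \<in> {1..r}" "u i = c" "z i = c \<or> z i = c + 1" "z' i = c \<or> z' i = c + 1"
  shows "chi r z' u w = (- 1) ^ length (filter (\<lambda>s. i < snd s) w) * (chi r z u w :: 'k::field)"
  using assms(1,2,6)
proof (induction w arbitrary: u)
  case (Cons s w)
  have inc: "incube r z' v = incube r z v" if "v i = c" for v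
    using assms(3-5,7,8) that unfolding incube_def by metis
  have vi: "mv u s i = c" using Cons.prems by (simp add: mv_apply)
  have sgn: "(- 1 :: 'k) ^ below z' u (snd s) = (if i < snd s then - 1 else 1) * (- 1) ^ below z u (snd s)"
  proof (cases "i < snd s")
    case False
    then have "below z' u (snd s) = below z u (snd s)" using assms(4) by (intro below_cong) auto
    then show ?thesis using False by simp
  next
    case True
    have "(- 1 :: 'k) ^ below z' u (snd s) = - ((- 1) ^ below z u (snd s))"
      using True assms(3-5,7,8) Cons.prems(3) by (intro below_change[of i]) auto
    then show ?thesis using True by simp
  qed
  show ?case using Cons.IH[of "mv u s"] Cons.prems inc[of "mv u s"] inc[of u] vi by (simp add: sgn)
qed simp

text \<open>Up and down letters of a direction balance in a closed word; this removes the sign of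
  \<open>chi_flip\<close>.\<close>

lemma closed_even:
  assumes "valid r w" "endp x w = x"
  shows "even (length (filter (\<lambda>s. P (snd s)) w))"
proof -
  have c: "count (mset w) (True, j) = count (mset w) (False, j)" for j
    using endp_count[of x w j] assms(2) by simp
  let ?f = "filter (\<lambda>s. P (snd s)) w"
  have v: "valid r ?f" using assms(1) by (auto simp: valid_def)
  have "length ?f = (\<Sum>j=1..r. count (mset ?f) (True, j) + count (mset ?f) (False, j))"
    by (rule length_count[OF v])
  also have "\<dots> = (\<Sum>j=1..r. 2 * (if P j then count (mset w) (False, j) else 0))"
    using c by (intro sum.cong) simp_all
  also have "even \<dots>" by (simp add: dvd_sum)
  finally show ?thesis .
qed

text \<open>In a closed word each direction that is used costs at least two letters.\<close>

lemma closed_unused: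
  assumes "valid r w" "endp x w = x" "length w < 2 * r"
  obtains i where "i \<in> {1..r}" "i \<notin> snd ` set w"
proof (rule ccontr)
  assume "\<not> thesis"
  then have all: "\<forall>i\<in>{1..r}. i \<in> snd ` set w" using that by blast
  have "2 \<le> count (mset w) (True, j) + count (mset w) (False, j)" if "j \<in> {1..r}" for j
  proof -
    have c: "count (mset w) (True, j) = count (mset w) (False, j)"
      using endp_count[of x w j] assms(2) by simp
    have "j \<in> snd ` set w" using all that by blast
    then obtain s where "s \<in> set w" "j = snd s" by (rule imageE)
    then have "(fst s, j) \<in> set w" by simp
    then have "(True, j) \<in> set w \<or> (False, j) \<in> set w" by (cases "fst s") simp_all
    then have "count (mset w) (True, j) \<noteq> 0 \<or> count (mset w) (False, j) \<noteq> 0" by simp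
    then show ?thesis using c by linarith
  qed
  then have "(\<Sum>j=1..r. 2) \<le> length w" unfolding length_count[OF assms(1)] by (intro sum_mono) auto
  then show False using assms(3) by simp
qed

lemma finite_box: "finite {z \<in> lattice_pts r. \<forall>j\<in>{1..r}. a j \<le> z j \<and> z j \<le> b j}"
proof (rule finite_subset)
  show "{z \<in> lattice_pts r. \<forall>j\<in>{1..r}. a j \<le> z j \<and> z j \<le> b j} \<subseteq>
    (\<lambda>f j. if j \<in> {1..r} then f j else 0) ` (PiE {1..r} (\<lambda>j. {a j..b j}))"
  proof
    fix z assume z: "z \<in> {z \<in> lattice_pts r. \<forall>j\<in>{1..r}. a j \<le> z j \<and> z j \<le> b j}"
    then have "z = (\<lambda>j. if j \<in> {1..r} then restrict z {1..r} j else 0)"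
      by (auto simp: lattice_pts_def fun_eq_iff)
    moreover have "restrict z {1..r} \<in> PiE {1..r} (\<lambda>j. {a j..b j})" using z by auto
    ultimately show "z \<in> (\<lambda>f j. if j \<in> {1..r} then f j else 0) ` (PiE {1..r} (\<lambda>j. {a j..b j}))" by blast
  qed
qed (auto intro!: finite_imageI finite_PiE)

definition cube :: "nat \<Rightarrow> point \<Rightarrow> point set" where
  "cube r x = {z \<in> lattice_pts r. incube r z x}"

lemma finite_cube: "finite (cube r x)"
  by (rule finite_subset[OF _ finite_box[of r x "\<lambda>j. x j + 1"]]) (auto simp: cube_def incube_def)

text \<open>The truncation to the ideal carries the information: over the whole cube the alternating
  sum vanishes on short closed words, so a nonzero value means that the word feels the boundary of
  the ideal.\<close>

definition trace :: "nat \<Rightarrow> point set \<Rightarrow> point \<Rightarrow> step list \<Rightarrow> 'k::field" where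
  "trace r I x w = (\<Sum>z\<in>cube r x \<inter> I. (- 1) ^ d1 r z x * chi r z x w)"

text \<open>A closed word shorter than \<open>2 r\<close> leaves some direction unused; flipping \<open>z\<close> in that direction
  pairs up the summands.\<close>

lemma trace_full:
  assumes "valid r w" "endp x w = x" "length w < 2 * r" "x \<in> lattice_pts r"
  shows "(\<Sum>z\<in>cube r x. (- 1) ^ d1 r z x * chi r z x w) = (0 :: 'k::field)"
proof -
  obtain i where i: "i \<in> {1..r}" "i \<notin> snd ` set w" using closed_unused[OF assms(1-3)] .
  define A where "A = {z \<in> cube r x. z i = x i}"
  define B where "B = {z \<in> cube r x. z i = x i + 1}"
  let ?f = "\<lambda>z. (- 1) ^ d1 r z x * (chi r z x w :: 'k)"
  have "cube r x = A \<union> B" using i by (auto simp: A_def B_def cube_def incube_def)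
  moreover have "A \<inter> B = {}" by (auto simp: A_def B_def)
  moreover have fin: "finite A" "finite B" using finite_cube by (auto simp: A_def B_def)
  ultimately have "(\<Sum>z\<in>cube r x. ?f z) = (\<Sum>z\<in>A. ?f z) + (\<Sum>z\<in>B. ?f z)" by (simp add: sum.union_disjoint)
  also have "(\<Sum>z\<in>B. ?f z) = (\<Sum>z\<in>A. - ?f z)"
  proof (rule sum.reindex_bij_witness[where i = "\<lambda>z. z(i := x i + 1)" and j = "\<lambda>z. z(i := x i)"])
    show "z(i := x i, i := x i + 1) = z" if "z \<in> B" for z using that by (auto simp: B_def)
    show "z(i := x i) \<in> A" if "z \<in> B" for z
      using that i by (auto simp: A_def B_def cube_def incube_def lattice_pts_def)
    show "z(i := x i + 1, i := x i) = z" if "z \<in> A" for z using that by (auto simp: A_def)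
    show "z(i := x i + 1) \<in> B" if "z \<in> A" for z
      using that i by (auto simp: A_def B_def cube_def incube_def lattice_pts_def)
    show "- ?f (z(i := x i)) = ?f z" if z: "z \<in> B" for z
    proof -
      have zi: "z i = x i + 1" using z by (simp add: B_def)
      have "chi r (z(i := x i)) x w = (- 1) ^ length (filter (\<lambda>s. i < snd s) w) * (chi r z x w :: 'k)"
        using i zi by (intro chi_flip[OF assms(1), of i _ _ _ "x i"]) auto
      then have "chi r (z(i := x i)) x w = (chi r z x w :: 'k)"
        using closed_even[OF assms(1,2), of "\<lambda>j. i < j"] by simp
      moreover have "d1 r z x = Suc (d1 r (z(i := x i)) x)"
      proof -
        have "d1 r z x = nat \<bar>z i - x i\<bar> + (\<Sum>j\<in>{1..r} - {i}. nat \<bar>z j - x j\<bar>)"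
          using i unfolding d1_def by (intro sum.remove) auto
        moreover have "d1 r (z(i := x i)) x = (\<Sum>j\<in>{1..r} - {i}. nat \<bar>z j - x j\<bar>)"
          using i unfolding d1_def by (subst sum.remove[of _ i]) (auto intro!: sum.cong)
        ultimately show ?thesis using zi by simp
      qed
      ultimately show ?thesis by simp
    qed
  qed
  finally show ?thesis by (simp add: sum_negf)
qed

lemma endp_mset: "mset v = mset w \<Longrightarrow> endp u v = endp u w"
  by (intro ext) (simp add: endp_count)

lemma geo_self [simp]: "geo r x x = []"
  using geo_length[of r x x] by (simp del: geo_length)

lemma d1_mv: "snd s \<in> {1..r} \<Longrightarrow> u (snd s) = t (snd s) \<Longrightarrow> d1 r (mv u s) t = Suc (d1 r u t)"
proof -
  assume s: "snd s \<in> {1..r}" "u (snd s) = t (snd s)"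
  have "d1 r (mv u s) t = nat \<bar>mv u s (snd s) - t (snd s)\<bar> + (\<Sum>j\<in>{1..r} - {snd s}. nat \<bar>mv u s j - t j\<bar>)"
    using s unfolding d1_def by (intro sum.remove) auto
  moreover have "d1 r u t = nat \<bar>u (snd s) - t (snd s)\<bar> + (\<Sum>j\<in>{1..r} - {snd s}. nat \<bar>u j - t j\<bar>)"
    using s unfolding d1_def by (intro sum.remove) auto
  moreover have "(\<Sum>j\<in>{1..r} - {snd s}. nat \<bar>mv u s j - t j\<bar>) = (\<Sum>j\<in>{1..r} - {snd s}. nat \<bar>u j - t j\<bar>)"
    by (intro sum.cong) (auto simp: mv_apply)
  ultimately show ?thesis using s by (simp add: mv_apply sg_def)
qed

section \<open>Spanning words for the standard modules and Cartan entries of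
  \<open>U\<close>\<close>

context cubist_ideal
begin

lemma lam_L: "x \<in> X \<Longrightarrow> y \<in> lam x \<Longrightarrow> y \<in> L"
  using lam_X X_L by blast

lemma lam_d: "x \<in> X \<Longrightarrow> y \<in> lam x \<Longrightarrow> \<bar>y j - x j\<bar> \<le> 1"
proof -
  assume a: "x \<in> X" "y \<in> lam x"
  consider "1 \<le> j" "j < idx x" | "idx x < j" "j \<le> r" | "j = 0 \<or> r < j \<or> j = idx x" by linarith
  then show ?thesis
  proof cases
    case 1
    then show ?thesis using lam_coord(1)[OF a 1] by linarith
  next
    case 2
    then show ?thesis using lam_coord(2)[OF a 2] by linarith
  next
    case 3
    then show ?thesis using lam_coord(3)[OF a 3] by linarith
  qed
qed

lemma lam_between:
  assumes "x \<in> X" "u \<in> lam x" "t \<in> lam x" "m \<in> L"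
    "\<And>j. (u j \<le> m j \<and> m j \<le> t j) \<or> (t j \<le> m j \<and> m j \<le> u j)"
  shows "m \<in> lam x"
proof (rule lamI[OF assms(1,4)])
  show "m (idx x) = x (idx x)"
    using lam_coord(3)[OF assms(1,2), of "idx x"] lam_coord(3)[OF assms(1,3), of "idx x"] assms(5)[of "idx x"] by auto
  show "m j = x j \<or> m j = x j + 1" if "1 \<le> j" "j < idx x" for j
    using lam_coord(1)[OF assms(1,2) that] lam_coord(1)[OF assms(1,3) that] assms(5)[of j] by auto
  show "m j = x j \<or> m j = x j - 1" if "idx x < j" "j \<le> r" for j
    using lam_coord(2)[OF assms(1,2) that] lam_coord(2)[OF assms(1,3) that] assms(5)[of j] by auto
qed

lemma geodesic_lam:
  assumes "x \<in> X" "u \<in> lam x" "t \<in> lam x" "valid r (a @ b)" "endp u (a @ b) = t" "length (a @ b) = d1 r u t"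
  shows "endp u a \<in> lam x"
proof (rule lam_between[OF assms(1-3)])
  show "endp u a \<in> L" using assms(4) by (intro endp_lattice lam_L[OF assms(1,2)]) simp
  show "(u j \<le> endp u a j \<and> endp u a j \<le> t j) \<or> (t j \<le> endp u a j \<and> endp u a j \<le> u j)" for j
    using geodesic_between[of r a b u j] assms(4-6) by simp
qed

text \<open>A step that does not follow the cube of \<open>x\<close> hits a point that vanishes in
  the standard module at \<open>x\<close>.\<close>

lemma neighbour:
  assumes "x \<in> X" "snd s \<in> {1..r}" "\<not> (if fst s then snd s < idx x else idx x < snd s)"
  shows "mv x s \<in> (L - X) \<union> {t. gt t x}"
  using step_cases[OF assms(1,2)] assms mv_lattice[OF X_L[OF assms(1)] assms(2)] by blast

text \<open>Words ending at \<open>x\<close> reduce to geodesics inside \<open>lam x\<close>. A new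
  front letter either extends such a geodesic, or can be pushed to the end so that the word enters
  \<open>x\<close> from a forbidden neighbour, or meets the letter of its own direction.\<close>

lemma standard_words:
  fixes F :: "step list \<Rightarrow> 'k::field"
  assumes x: "x \<in> X" and "U_rel r F" "kills r y ((L - X) \<union> {t. gt t x}) F" "y \<in> L" "valid r w" "endp y w = x"
  shows "if y \<in> lam x \<and> length w = d1 r y x then F w = F (geo r y x) \<or> F w = - F (geo r y x) else F w = 0"
  using assms(2-)
proof (induction w arbitrary: y F)
  case Nil
  then show ?case using lam_self[OF x] by simp
next
  case (Cons s w)
  define i where "i = snd s"
  define y' where "y' = mv y s"
  define v where "v = idx x"
  note U = Cons.prems(1) and K = Cons.prems(2)
  have i: "i \<in> {1..r}" and vw: "valid r w" and sv: "snd s \<in> {1..r}" using Cons.prems(4) by (auto simp: i_def)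
  have y'L: "y' \<in> L" using mv_lattice[OF Cons.prems(3) sv] by (simp add: y'_def)
  have yy': "y = mv y' (opp s)" by (simp add: y'_def)
  have ew: "endp y' w = x" using Cons.prems(5) by (simp add: y'_def)
  have U': "U_rel r (\<lambda>w. F (s # w))" using U_rel_prefix[OF U, of "[s]"] sv by simp
  have K': "kills r y' ((L - X) \<union> {t. gt t x}) (\<lambda>w. F (s # w))"
    using kills_prefix[OF K, of "[s]"] sv by (simp add: y'_def)
  note IH = Cons.IH[OF U' K' y'L vw ew]
  let ?g = "geo r y' x"
  have gx: "endp y' ?g = x" using y'L X_L[OF x] by simp
  show ?case
  proof (cases "y' \<in> lam x \<and> length w = d1 r y' x")
    case False
    then have F0: "F (s # w) = 0" using IH by (simp only: if_False)
    have "\<not> (y \<in> lam x \<and> length (s # w) = d1 r y x)"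
    proof
      assume a: "y \<in> lam x \<and> length (s # w) = d1 r y x"
      have "y' \<in> lam x"
        using geodesic_lam[OF x, of y x "[s]" w] a lam_self[OF x] Cons.prems(4,5) by (simp add: y'_def)
      moreover have "d1 r y x \<le> Suc (d1 r y' x)"
        using length_ge_d1[of r "s # ?g" y] sv gx by (simp add: y'_def)
      moreover have "d1 r y' x \<le> length w" using length_ge_d1[OF vw, of y'] ew by simp
      ultimately show False using False a by simp
    qed
    then show ?thesis using F0 by (simp only: if_False)
  next
    case True
    then have Fw: "F (s # w) = F (s # ?g) \<or> F (s # w) = - F (s # ?g)" using IH by simp
    have y'lam: "y' \<in> lam x" using True by simp
    have gstep: "t \<in> set ?g \<longleftrightarrow> y' (snd t) \<noteq> x (snd t) \<and> fst t = (y' (snd t) < x (snd t))" for t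
      using geodesic_step[of r ?g y' x t] gx by simp
    have gdist: "distinct (map snd ?g)"
      using geodesic_distinct[of r ?g y' x] gx lam_d[OF x y'lam] by simp
    show ?thesis
    proof (cases "y \<in> lam x \<and> length (s # w) = d1 r y x")
      case A: True
      have e1: "endp y (s # ?g) = x" using gx by (simp add: y'_def)
      have e2: "valid r (s # ?g)" using sv by simp
      have e3: "length (s # ?g) = d1 r y x" using A True by simp
      have "mset (s # ?g) = mset (geo r y x)"
        using geodesic_mset[OF e2 geo_valid e3 geo_length e1 geo_endp[OF Cons.prems(3) X_L[OF x]]] .
      moreover have "distinct (map snd (s # ?g))"
        using geodesic_distinct[OF e2 e3 e1] lam_d[OF x, of y] A by simp
      ultimately have "F (geo r y x) = F (s # ?g) \<or> F (geo r y x) = - F (s # ?g)"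
        using U_rel_perm[OF U e2] by blast
      then show ?thesis using A Fw by auto
    next
      case B: False
      have zero: "F (p @ [t, opp t]) = 0"
        if "valid r p" "endp y p = x" "snd t \<in> {1..r}" "\<not> (if fst t then snd t < v else v < snd t)" for p t
      proof -
        have "mv x t \<in> (L - X) \<union> {t. gt t x}" using neighbour[OF x that(3)] that(4) unfolding v_def by blast
        then show ?thesis using killsD[OF K, of "p @ [t]" "[opp t]"] that(1-3) by simp
      qed
      have "F (s # ?g) = 0"
      proof (cases "y' i = x i")
        case False
        then have iv: "i \<noteq> v" using lam_coord(3)[OF x y'lam, of i] by (auto simp: v_def)
        \<comment> \<open>\<open>e\<close> is the letter of the geodesic in the direction of
          \<open>s\<close>. Brought next to \<open>s\<close>, it either repeats \<open>s\<close>,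
          which gives zero, or is its inverse; in that case the pair is moved to the end, where it
          is a loop at \<open>x\<close>.\<close>
        define e where "e = (y' i < x i, i)"
        have "e \<in> set ?g" using gstep False by (simp add: e_def)
        then obtain a b where g: "?g = a @ e # b" by (meson split_list)
        have vab: "valid r a" "valid r b" "snd e \<in> {1..r}" using geo_valid[of r y' x] unfolding g by simp_all
        have ne: "snd e \<notin> snd ` set a" "snd e \<notin> snd ` set b" using gdist unfolding g by auto
        have "F (s # ?g) = 0 \<longleftrightarrow> F (s # e # a @ b) = 0"
          unfolding g using U_rel_move_zero[OF U' vab ne(1)] .
        also have "F (s # e # a @ b) = 0"
        proof (cases "fst e = fst s")
          case True
          then have "e = s" by (simp add: e_def i_def prod_eq_iff)
          then show ?thesis using U_relD(1)[OF U, of "[]" "a @ b" s] vab sv by simp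
        next
          case False
          then have es: "e = opp s" by (auto simp: e_def i_def opp_def)
          define p where "p = a @ b"
          have vp: "valid r p" using vab by (simp add: p_def)
          have sp: "snd s \<notin> snd ` set p" "snd e \<notin> snd ` set p" using ne es by (auto simp: p_def)
          have "F (s # e # p) = 0 \<longleftrightarrow> F (s # p @ [e]) = 0"
            using U_rel_move_zero[OF U' vp _ vab(3) sp(2), of "[]"] by simp
          also have "\<dots> \<longleftrightarrow> F (p @ s # [e]) = 0"
            using U_rel_move_zero[OF U vp _ sv sp(1), of "[e]"] vab by simp
          also have "F (p @ s # [e]) = 0"
          proof -
            have "mset (e # p) = mset ?g" unfolding g p_def by simp
            then have "endp y' (e # p) = x" using endp_mset[of "e # p" ?g y'] gx by simp
            then have ep: "endp y p = x" using es yy' by simp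
            have "\<not> (if fst e then snd e < v else v < snd e)"
            proof (cases "i < v")
              case True
              then have "y' i = x i + 1" using lam_coord(1)[OF x y'lam, of i] \<open>y' i \<noteq> x i\<close> i by (simp add: v_def)
              then show ?thesis using True by (simp add: e_def)
            next
              case False
              then have "y' i = x i - 1"
                using lam_coord(2)[OF x y'lam, of i] \<open>y' i \<noteq> x i\<close> i iv by (simp add: v_def)
              then show ?thesis using False by (simp add: e_def)
            qed
            then have e0: "F (p @ [e, opp e]) = 0" by (rule zero[OF vp ep vab(3)])
            \<comment> \<open>Both loops at \<open>x\<close> in direction \<open>idx x\<close> pass
              through forbidden neighbours, so the loop relation makes the loop sum at
              \<open>x\<close> vanish in every direction. One loop in direction \<open>i\<close> is
              zero by \<open>e0\<close>, hence so is the other.\<close>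
            have v0: "F (p @ [(False, v), (True, v)]) = 0" "F (p @ [(True, v), (False, v)]) = 0"
              using zero[OF vp ep, of "(False, v)"] zero[OF vp ep, of "(True, v)"] idx_props(1)[OF x]
              by (simp_all add: v_def opp_def)
            have "F (p @ [s, e]) + F (p @ [e, s]) = 0"
              using U_relD(3)[OF U vp, of "[]" i v] v0 i idx_props(1)[OF x]
              by (cases s; cases "fst s") (simp_all add: es opp_def i_def v_def add.commute)
            then show ?thesis using e0 es by simp
          qed
          finally show ?thesis by (simp add: p_def)
        qed
        finally show ?thesis by simp
      next
        case y'x: True
        \<comment> \<open>The direction of \<open>s\<close> is fresh, so \<open>s\<close> can be
          moved to the end. The word then enters \<open>x\<close> along \<open>s\<close>; if it came
          from a point of \<open>lam x\<close>, the whole word would have been a geodesic of the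
          cube.\<close>
        have ng: "snd s \<notin> snd ` set ?g" using gstep y'x by (auto simp: i_def)
        have "F (s # ?g) = 0 \<longleftrightarrow> F (?g @ [s]) = 0"
          using U_rel_move_zero[OF U geo_valid _ sv ng, of "[]"] by simp
        also have "F (?g @ [s]) = 0"
        proof -
          have "mset (?g @ [s]) = mset (s # ?g)" by simp
          then have "endp y (?g @ [s]) = x" using endp_mset[of "?g @ [s]" "s # ?g" y] gx by (simp add: y'_def)
          then have m: "endp y ?g = mv x (opp s)" using mv_opp(1)[of "endp y ?g" s] by simp
          have "\<not> (if fst (opp s) then snd (opp s) < v else v < snd (opp s))"
          proof
            assume a: "if fst (opp s) then snd (opp s) < v else v < snd (opp s)"
            have yj: "y j = (if j = i then x i + sg (opp s) else y' j)" for j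
              unfolding yy' using y'x by (simp add: mv_apply i_def)
            have "y \<in> lam x"
            proof (rule lamI[OF x Cons.prems(3)])
              show "y (idx x) = x (idx x)" using yj a lam_coord(3)[OF x y'lam, of "idx x"]
                by (auto simp: v_def i_def split: if_splits)
              show "y j = x j \<or> y j = x j + 1" if "1 \<le> j" "j < idx x" for j
                using yj[of j] a lam_coord(1)[OF x y'lam that] that by (auto simp: v_def i_def sg_def split: if_splits)
              show "y j = x j \<or> y j = x j - 1" if "idx x < j" "j \<le> r" for j
                using yj[of j] a lam_coord(2)[OF x y'lam that] that by (auto simp: v_def i_def sg_def split: if_splits)
            qed
            moreover have "d1 r y x = Suc (d1 r y' x)"
              unfolding yy' using d1_mv[of "opp s" r y' x] sv y'x by (simp add: i_def)
            ultimately show False using B True by simp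
          qed
          then have "mv x (opp s) \<in> (L - X) \<union> {t. gt t x}"
            using neighbour[OF x, of "opp s"] sv unfolding v_def by simp
          then show ?thesis using killsD[OF K geo_valid, of "[s]" y' x] m sv by simp
        qed
        finally show ?thesis by simp
      qed
      then have "F (s # w) = 0" using Fw by auto
      then show ?thesis using B by (simp only: if_False)
    qed
  qed
qed

text \<open>Reversal turns words starting at \<open>t\<close> into words ending there. Support on
  words with end \<open>y\<close> is what lets a point reached from \<open>y\<close> in the reversed
  word be read as a point of the original one.\<close>

lemma standard_words_rv:
  fixes F :: "step list \<Rightarrow> 'k::field"
  assumes t: "t \<in> X" and U: "U_rel r F" and K: "kills r t ((L - X) \<union> {s. gt s t}) F"
    and E: "\<And>w. endp t w \<noteq> y \<Longrightarrow> F w = 0" and y: "y \<in> L" and w: "valid r w" "endp t w = y"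
  shows "if y \<in> lam t \<and> length w = d1 r y t then F w = F (rv (geo r y t)) \<or> F w = - F (rv (geo r y t)) else F w = 0"
proof -
  have "kills r y ((L - X) \<union> {s. gt s t}) (\<lambda>w. F (rv w))"
    unfolding kills_def
  proof (intro allI impI)
    fix a b assume ab: "valid r a" "valid r b" "endp y a \<in> (L - X) \<union> {s. gt s t}"
    show "F (rv (a @ b)) = 0"
    proof (cases "endp t (rv (a @ b)) = y")
      case True
      then have "endp y a = endp t (rv b)" using endp_rv[of "endp t (rv b)" "rv a"] by simp
      then show ?thesis using killsD[OF K, of "rv b" "rv a"] ab by simp
    qed (rule E)
  qed
  then show ?thesis
    using standard_words[OF t U_rel_rv[OF U] _ y, of "rv w", unfolded rv_simps] w endp_rv[of t w] by blast
qed

text \<open>Vertices are treated from the largest down. Once words through larger vertices vanish, a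
  word through \<open>t\<close> reduces like an element of a standard module in its first half and,
  reversed, in its second half; what remains are two geodesics of \<open>lam t\<close> joined at
  \<open>t\<close>.\<close>

lemma cartan_words_span:
  fixes F :: "step list \<Rightarrow> 'k::field"
  assumes x: "x \<in> X" and y: "y \<in> X" and U: "U_rel r F" and K: "kills r x (L - X) F"
    and P: "\<And>v. v \<in> X \<Longrightarrow> x \<in> lam v \<Longrightarrow> y \<in> lam v \<Longrightarrow> d1 r x v + d1 r y v = n \<Longrightarrow>
      F (geo r x v @ rv (geo r y v)) = 0"
    and w: "valid r w" "endp x w = y" "length w = n"
  shows "F w = 0"
proof -
  define G where "G = (\<lambda>w. if length w = n \<and> endp x w = y then F w else 0)"
  have UG: "U_rel r G" unfolding G_def by (rule U_rel_restrict[OF U])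
  have KG: "kills r x (L - X) G" using K by (simp add: kills_def G_def)
  \<comment> \<open>A word of length \<open>n\<close> meets only vertices within distance
    \<open>n\<close> of \<open>x\<close>, so the induction along the order takes place on a finite
    set.\<close>
  define B where "B = {t \<in> X. d1 r x t \<le> n}"
  have "B \<subseteq> {z \<in> L. \<forall>j\<in>{1..r}. x j - int n \<le> z j \<and> z j \<le> x j + int n}"
  proof
    fix t assume t: "t \<in> B"
    have "x j - int n \<le> t j \<and> t j \<le> x j + int n" if "j \<in> {1..r}" for j
    proof -
      have "nat \<bar>x j - t j\<bar> \<le> d1 r x t"
        unfolding d1_def using member_le_sum[of j "{1..r}" "\<lambda>j. nat \<bar>x j - t j\<bar>"] that by simp
      then show ?thesis using t by (auto simp: B_def)
    qed
    then show "t \<in> {z \<in> L. \<forall>j\<in>{1..r}. x j - int n \<le> z j \<and> z j \<le> x j + int n}"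
      using t X_L by (simp add: B_def)
  qed
  then have finB: "finite B" by (rule finite_subset[OF _ finite_box])
  define R where "R = {(s, t). s \<in> B \<and> t \<in> B \<and> gt s t}"
  have "R \<subseteq> B \<times> B" by (auto simp: R_def)
  then have "finite R" using finB finite_subset by blast
  moreover have "trans R" unfolding R_def using gt_trans by (intro transI) blast
  then have "acyclic R" using gt_irrefl by (auto simp: acyclic_def trancl_id R_def)
  ultimately have "wf R" by (rule finite_acyclic_wf)
  have main: "G (a @ b) = 0" if "t \<in> X" "valid r a" "valid r b" "endp x a = t" for t a b
    using \<open>wf R\<close> that
  proof (induction t arbitrary: a b rule: wf_induct_rule)
    case (less t)
    have far: "G (a @ b) = 0" if "valid r a" "endp x a \<in> X - B" for a b
    proof -
      have "d1 r x (endp x a) \<le> length a" by (rule length_ge_d1[OF that(1)])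
      then have "n < length (a @ b)" using that(2) by (auto simp: B_def)
      then show ?thesis by (simp add: G_def)
    qed
    show ?case
    proof (cases "t \<in> B")
      case False
      then show ?thesis using far less.prems by simp
    next
      case True
      \<comment> \<open>Words through larger vertices within reach vanish by induction, those
        through vertices out of reach by their length.\<close>
      have KK: "kills r x ((L - X) \<union> {s. gt s t}) G"
        unfolding kills_def
      proof (intro allI impI)
        fix a b assume ab: "valid r a" "valid r b" "endp x a \<in> (L - X) \<union> {s. gt s t}"
        show "G (a @ b) = 0"
        proof (cases "endp x a \<in> L - X")
          case True
          then show ?thesis using killsD[OF KG ab(1,2)] by simp
        next
          case False
          then have g: "gt (endp x a) t" using ab(3) by blast
          then have "endp x a \<in> X" by (simp add: gt_def)
          show ?thesis
          proof (cases "endp x a \<in> B")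
            case False
            then show ?thesis using far ab \<open>endp x a \<in> X\<close> by simp
          next
            case True
            then have "(endp x a, t) \<in> R" using g \<open>t \<in> B\<close> by (simp add: R_def)
            then show ?thesis using less.IH \<open>endp x a \<in> X\<close> ab by blast
          qed
        qed
      qed
      show ?thesis
      proof (cases "endp t b = y")
        case False
        then show ?thesis using less.prems by (simp add: G_def)
      next
        case tb: True
        have 1: "if x \<in> lam t \<and> length a = d1 r x t then G (a @ b) = G (geo r x t @ b) \<or> G (a @ b) = - G (geo r x t @ b)
          else G (a @ b) = 0"
          using standard_words[OF less.prems(1) U_rel_suffix[OF UG less.prems(3)]
              kills_suffix[OF KK less.prems(3)] X_L[OF x] less.prems(2,4)] .
        have ge: "endp x (geo r x t) = t" using X_L x less.prems(1) by simp
        have kp: "kills r t ((L - X) \<union> {s. gt s t}) (\<lambda>b. G (geo r x t @ b))"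
          using kills_prefix[OF KK geo_valid, of x t] ge by simp
        have 2: "if y \<in> lam t \<and> length b = d1 r y t
          then G (geo r x t @ b) = G (geo r x t @ rv (geo r y t)) \<or> G (geo r x t @ b) = - G (geo r x t @ rv (geo r y t))
          else G (geo r x t @ b) = 0"
          using ge by (intro standard_words_rv[OF less.prems(1) U_rel_prefix[OF UG geo_valid] kp _ X_L[OF y] less.prems(3) tb])
            (simp add: G_def)
        have 3: "G (geo r x t @ rv (geo r y t)) = 0" if "x \<in> lam t" "y \<in> lam t"
          using P[OF less.prems(1) that] by (simp add: G_def)
        show ?thesis using 1 2 3 by (auto split: if_splits)
      qed
    qed
  qed
  \<comment> \<open>A word passes through its own starting vertex, so \<open>t = x\<close> covers
    all words.\<close>
  have "G ([] @ w) = 0" using main[OF x, of "[]" w] w by simp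
  then show ?thesis using w by (simp add: G_def)
qed

end

text \<open>Lexicographic comparison as comparison of numbers in base 3, coordinate 1 being the most
  significant digit: a tail of digits at most 2 is smaller than one unit of the digit before
  it.\<close>

lemma digits_less:
  fixes D E :: "nat \<Rightarrow> nat"
  assumes "j \<in> {1..r}" "\<And>l. l < j \<Longrightarrow> 1 \<le> l \<Longrightarrow> D l = E l" "D j < E j" "\<And>l. D l \<le> 2"
  shows "(\<Sum>l=1..r. D l * 3 ^ (r - l)) < (\<Sum>l=1..r. E l * 3 ^ (r - l))"
proof -
  have tail: "(\<Sum>l\<in>{j<..r}. D l * 3 ^ (r - l)) < 3 ^ (r - j)"
  proof -
    have "(\<Sum>l\<in>{j<..r}. D l * 3 ^ (r - l)) \<le> (\<Sum>l\<in>{j<..r}. 2 * 3 ^ (r - l))"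
      using assms(4) by (intro sum_mono mult_right_mono) auto
    also have "\<dots> = (\<Sum>k<r - j. 2 * 3 ^ k)"
      by (rule sum.reindex_bij_witness[where i = "\<lambda>k. r - k" and j = "\<lambda>l. r - l"]) auto
    also have "\<dots> + 1 = 3 ^ n" if "n = r - j" for n
      unfolding that[symmetric] by (induction n) auto
    finally show ?thesis by simp
  qed
  have split: "{1..r} = {1..<j} \<union> ({j} \<union> {j<..r})" using assms(1) by auto
  have s: "(\<Sum>l=1..r. C l * 3 ^ (r - l)) = (\<Sum>l\<in>{1..<j}. C l * 3 ^ (r - l)) + (C j * 3 ^ (r - j) + (\<Sum>l\<in>{j<..r}. C l * 3 ^ (r - l)))"
    for C :: "nat \<Rightarrow> nat"
    unfolding split by (subst sum.union_disjoint, auto)+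
  have "(\<Sum>l\<in>{1..<j}. D l * 3 ^ (r - l)) = (\<Sum>l\<in>{1..<j}. E l * 3 ^ (r - l))"
    using assms(2) by (intro sum.cong) auto
  moreover have "D j * 3 ^ (r - j) + 3 ^ (r - j) \<le> E j * 3 ^ (r - j)"
    using assms(3) by (metis Suc_leI add.commute mult_Suc mult_le_mono1)
  ultimately show ?thesis unfolding s[of D] s[of E] using tail by linarith
qed

section \<open>Independence for \<open>U\<close>: truncated traces paired with normal words\<close>

context cubist_ideal
begin

text \<open>The corner of \<open>lam v\<close> opposite to \<open>v\<close>.\<close>

definition opv :: "point \<Rightarrow> point" where
  "opv v = (\<lambda>j. if 1 \<le> j \<and> j < idx v then v j + 1 else if idx v < j \<and> j \<le> r then v j - 1 else v j)"

text \<open>The largest corner of \<open>lam v\<close>. By the choice of the index it is the last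
  shift of \<open>v\<close> inside the ideal.\<close>

definition top :: "point \<Rightarrow> point" where
  "top v = pshift (idx v - 1) v"

definition pword :: "point \<Rightarrow> point \<Rightarrow> point \<Rightarrow> step list" where
  "pword x y v = geo r x v @ rv (geo r y v)"

text \<open>The return path from \<open>y\<close> to \<open>x\<close> through the corner opposite to
  \<open>v\<close>. With the path through \<open>v\<close> it makes a loop of length
  \<open>2 (r - 1)\<close>, just short of the \<open>2 r\<close> letters that would be needed to use
  every direction.\<close>

definition tword :: "point \<Rightarrow> point \<Rightarrow> point \<Rightarrow> step list" where
  "tword x y v = geo r y (opv v) @ geo r (opv v) x"

definition tfun :: "point \<Rightarrow> point \<Rightarrow> nat \<Rightarrow> point \<Rightarrow> step list \<Rightarrow> 'k::field" where
  "tfun x y n v w = (if length w = n \<and> endp x w = y then trace r I x (w @ tword x y v) else 0)"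

text \<open>The three states of a direction seen from \<open>x\<close>: spanned by the cube with
  \<open>x\<close> at the end of \<open>v\<close>, missing, spanned with \<open>x\<close> at the
  other end. Directions beyond the index carry no digit; there the equality of lengths takes
  over.\<close>

definition digit :: "point \<Rightarrow> point \<Rightarrow> nat \<Rightarrow> nat" where
  "digit x v j = (if j < idx v then if v j = x j then 0 else 2 else if j = idx v then 1 else 0)"

definition key :: "point \<Rightarrow> point \<Rightarrow> nat" where
  "key x v = (\<Sum>j=1..r. digit x v j * 3 ^ (r - j))"

lemma opv_lam: "v \<in> X \<Longrightarrow> opv v \<in> lam v"
  using X_L[of v] idx_props(1)[of v] by (intro lamI) (auto simp: opv_def lattice_pts_def)

lemma top_L: "v \<in> X \<Longrightarrow> top v \<in> L"
  unfolding top_def using idx_props(1)[of v] by (intro pshift_lattice X_L) auto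

lemma top_incube: "v \<in> X \<Longrightarrow> u \<in> lam v \<Longrightarrow> incube r (top v) u"
  unfolding incube_def
proof
  fix j assume v: "v \<in> X" "u \<in> lam v" and j: "j \<in> {1..r}"
  consider "1 \<le> j" "j < idx v" | "idx v < j" "j \<le> r" | "j = idx v" using j by force
  then show "top v j = u j \<or> top v j = u j + 1"
  proof cases
    case 1
    then show ?thesis using lam_coord(1)[OF v 1] by (auto simp: top_def pshift_def)
  next
    case 2
    then show ?thesis using lam_coord(2)[OF v 2] by (auto simp: top_def pshift_def)
  next
    case 3
    then show ?thesis using lam_coord(3)[OF v, of j] j by (auto simp: top_def pshift_def)
  qed
qed

text \<open>In each of the \<open>r - 1\<close> spanned directions \<open>x\<close> agrees with
  exactly one of the two opposite corners.\<close>

lemma lam_opposite_dist: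
  assumes "v \<in> X" "x \<in> lam v" shows "d1 r x v + d1 r x (opv v) = r - 1"
proof -
  have "nat \<bar>x j - v j\<bar> + nat \<bar>x j - opv v j\<bar> = (if j = idx v then 0 else 1)" if j: "j \<in> {1..r}" for j
  proof -
    consider "1 \<le> j" "j < idx v" | "idx v < j" "j \<le> r" | "j = idx v" using j by force
    then show ?thesis
    proof cases
      case 1
      then show ?thesis using lam_coord(1)[OF assms 1] by (auto simp: opv_def)
    next
      case 2
      then show ?thesis using lam_coord(2)[OF assms 2] by (auto simp: opv_def)
    next
      case 3
      then show ?thesis using lam_coord(3)[OF assms, of j] by (auto simp: opv_def)
    qed
  qed
  then have "d1 r x v + d1 r x (opv v) = (\<Sum>j=1..r. if j = idx v then 0 else 1)"
    unfolding d1_def sum.distrib[symmetric] by (intro sum.cong) auto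
  also have "\<dots> = card ({1..r} - {idx v})"
  proof -
    have "(\<Sum>j=1..r. if j = idx v then 0 else 1) = (\<Sum>j\<in>{1..r} - {idx v}. 1 :: nat)"
      by (intro sum.mono_neutral_cong_right) auto
    then show ?thesis by simp
  qed
  also have "\<dots> = r - 1" using idx_props(1)[OF assms(1)] by simp
  finally show ?thesis .
qed

lemma pword_props:
  assumes "v \<in> X" "x \<in> lam v" "y \<in> lam v"
  shows "valid r (pword x y v)" "endp x (pword x y v) = y" "length (pword x y v) = d1 r x v + d1 r y v"
  using lam_L[OF assms(1,2)] lam_L[OF assms(1,3)] X_L[OF assms(1)] endp_rv'[of y "geo r y v" v]
  by (simp_all add: pword_def)

lemma tword_props:
  assumes "v \<in> X" "x \<in> lam v" "y \<in> lam v"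
  shows "valid r (tword x y v)" "endp y (tword x y v) = x"
    "length (tword x y v) + (d1 r x v + d1 r y v) = 2 * (r - 1)"
  using lam_L[OF assms(1,2)] lam_L[OF assms(1,3)] lam_L[OF assms(1) opv_lam[OF assms(1)]]
    lam_opposite_dist[OF assms(1,2)] lam_opposite_dist[OF assms(1,3)]
  by (simp_all add: tword_def d1_sym[of r "opv v" x])

lemma incube_le: "z \<in> L \<Longrightarrow> t \<in> L \<Longrightarrow> incube r z t \<Longrightarrow> t \<le> z"
  unfolding le_fun_def incube_def lattice_pts_def mem_Collect_eq
  by (metis add.right_neutral add_left_mono dual_order.refl zero_le_one)

lemma incube_le': "z \<in> L \<Longrightarrow> t \<in> L \<Longrightarrow> incube r z t \<Longrightarrow> z \<le> pshift r t"
proof (rule le_funI)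
  fix j assume zt: "z \<in> L" "t \<in> L" "incube r z t"
  show "z j \<le> pshift r t j"
  proof (cases "j \<in> {1..r}")
    case True
    then have "z j = t j \<or> z j = t j + 1" using zt(3) unfolding incube_def by blast
    then show ?thesis using True by (auto simp: pshift_def)
  next
    case False
    then show ?thesis using zt by (auto simp: pshift_def lattice_pts_def)
  qed
qed

text \<open>If every contributing corner lies in the ideal, the truncation cuts nothing away and
  \<open>trace_full\<close> applies.\<close>

lemma trace_vanish:
  assumes "valid r w" "endp x w = x" "length w < 2 * r" "x \<in> L"
    and "\<And>z. z \<in> cube r x \<Longrightarrow> chi r z x w \<noteq> (0 :: 'k::field) \<Longrightarrow> z \<in> I"
  shows "trace r I x w = (0 :: 'k)"
proof -
  have "trace r I x w = (\<Sum>z\<in>cube r x. (- 1) ^ d1 r z x * chi r z x w :: 'k)"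
    unfolding trace_def using assms(5) by (intro sum.mono_neutral_left finite_cube) auto
  then show ?thesis using trace_full[OF assms(1-4)] by simp
qed

lemma tfun_U_rel:
  assumes "v \<in> X" "x \<in> lam v" "y \<in> lam v"
  shows "U_rel r (tfun x y n v :: step list \<Rightarrow> 'k::field)"
  unfolding tfun_def trace_def
  by (intro U_rel_restrict U_rel_sum U_rel_suffix U_rel_chi tword_props[OF assms])

text \<open>A point outside the Cubist set is either outside the ideal, and then so are all corners
  \<open>z\<close> whose cube contains it, or its diagonal shift is inside, and then so are all
  these corners. The truncated sum has no term or all terms, and vanishes either way.\<close>

lemma tfun_kills:
  assumes v: "v \<in> X" "x \<in> lam v" "y \<in> lam v" "d1 r x v + d1 r y v = n"
  shows "kills r x (L - X) (tfun x y n v :: step list \<Rightarrow> 'k::field)"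
  unfolding kills_def
proof (intro allI impI)
  fix a b assume ab: "valid r a" "valid r b" "endp x a \<in> L - X"
  define w where "w = (a @ b) @ tword x y v"
  have xL: "x \<in> L" using lam_L v by blast
  show "tfun x y n v (a @ b) = (0 :: 'k)"
  proof (cases "length (a @ b) = n \<and> endp x (a @ b) = y")
    case True
    have nz: "incube r z (endp x a)" if "z \<in> cube r x" "chi r z x w \<noteq> (0 :: 'k)" for z
      using chi_zero[of r z x a "b @ tword x y v", where 'k='k] that by (auto simp: w_def cube_def)
    have "trace r I x w = (0 :: 'k)"
    proof (cases "endp x a \<in> I")
      case False
      have "chi r z x w = (0 :: 'k)" if "z \<in> cube r x \<inter> I" for z
      proof (rule ccontr)
        assume "chi r z x w \<noteq> (0 :: 'k)"
        then have "endp x a \<le> z" using nz that ab(3) by (intro incube_le) (auto simp: cube_def)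
        then show False using False I_down[of z "endp x a"] that ab(3) by auto
      qed
      then show ?thesis by (simp add: trace_def)
    next
      case True2: True
      show ?thesis
      proof (rule trace_vanish)
        show "valid r w" using ab tword_props[OF v(1-3)] by (simp add: w_def)
        show "endp x w = x" using True tword_props[OF v(1-3)] by (simp add: w_def)
        have "length w = 2 * (r - 1)" using True tword_props(3)[OF v(1-3)] v(4) by (simp add: w_def)
        then show "length w < 2 * r" using r_pos by simp
        show "x \<in> L" by (rule xL)
        show "z \<in> I" if "z \<in> cube r x" "chi r z x w \<noteq> (0 :: 'k)" for z
        proof -
          have "z \<le> pshift r (endp x a)" using nz that ab(3) by (intro incube_le') (auto simp: cube_def)
          moreover have "pshift r (endp x a) \<in> I" using True2 ab(3) X_iff by auto
          ultimately show ?thesis using I_down that by (auto simp: cube_def)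
        qed
      qed
    qed
    then show ?thesis by (simp add: tfun_def w_def)
  qed (auto simp: tfun_def)
qed

text \<open>All points visited by the loop must lie in the cube of a surviving corner;
  \<open>v\<close> and \<open>opv v'\<close> are the visited points that pin the corner
  down.\<close>

lemma chi_visits:
  assumes "v \<in> X" "v' \<in> X" "x \<in> lam v" "y \<in> lam v" "y \<in> lam v'" "x \<in> lam v'" "incube r z x"
    "chi r z x (pword x y v @ tword x y v') \<noteq> (0 :: 'k::field)"
  shows "incube r z v" "incube r z (opv v')"
proof -
  have L: "x \<in> L" "y \<in> L" "v \<in> L" "opv v' \<in> L" using assms lam_L X_L opv_lam by blast+
  show "incube r z v"
    using chi_zero[OF assms(7), of "geo r x v" "rv (geo r y v) @ tword x y v'", where 'k='k] assms(8) L
    by (auto simp: pword_def)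
  have "endp x (pword x y v @ geo r y (opv v')) = opv v'"
    using pword_props[OF assms(1,3,4)] L by simp
  then show "incube r z (opv v')"
    using chi_zero[OF assms(7), of "pword x y v @ geo r y (opv v')" "geo r (opv v') x", where 'k='k] assms(8)
    by (auto simp: tword_def)
qed



lemma geodesic_chi:
  assumes v: "v \<in> X" and u: "u \<in> lam v" "t \<in> lam v" and w: "valid r w" "endp u w = t" "length w = d1 r u t"
  shows "chi r (top v) u w \<noteq> (0 :: 'k::field)"
  unfolding chi_nonzero[OF top_incube[OF v u(1)]]
proof (intro allI impI)
  fix a b assume "w = a @ b"
  then show "incube r (top v) (endp u a)"
    using geodesic_lam[OF v u, of a b] w by (intro top_incube[OF v]) simp
qed

text \<open>Having both \<open>v\<close> and its opposite corner in its cube fixes \<open>z\<close>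
  in all spanned directions, and in the missing direction the ideal forbids the upper choice. So a
  single summand survives, and it is a product of signs.\<close>

lemma tfun_diag:
  assumes v: "v \<in> X" "x \<in> lam v" "y \<in> lam v" "d1 r x v + d1 r y v = n"
  shows "tfun x y n v (pword x y v) \<noteq> (0 :: 'k::field)"
proof -
  define w where "w = pword x y v @ tword x y v"
  note P = pword_props[OF v(1-3)]
  have L: "x \<in> L" "y \<in> L" "v \<in> L" "opv v \<in> L" using v lam_L X_L opv_lam by blast+
  have ov: "opv v \<in> lam v" by (rule opv_lam[OF v(1)])
  have idx: "idx v \<in> {1..r}" by (rule idx_props(1)[OF v(1)])
  have z: "z = top v" if "z \<in> cube r x \<inter> I" "chi r z x w \<noteq> (0 :: 'k)" for z
  proof -
    have zL: "z \<in> L" using that I_L by blast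
    have zc: "incube r z v" "incube r z (opv v)"
      using chi_visits[OF v(1,1,2,3,3,2), of z, where 'k='k] that by (auto simp: w_def cube_def)
    have zz: "z j = v j \<or> z j = v j + 1" "z j = opv v j \<or> z j = opv v j + 1" if "j \<in> {1..r}" for j
      using zc that unfolding incube_def by blast+
    have "\<not> z (idx v) = v (idx v) + 1"
    proof
      assume a: "z (idx v) = v (idx v) + 1"
      have "pshift (idx v) v j \<le> z j" for j
      proof (cases "j \<in> {1..r}")
        case True
        then have "z j = v j \<or> z j = v j + 1" "z j = opv v j \<or> z j = opv v j + 1"
          using zc unfolding incube_def by blast+
        then show ?thesis using a True by (cases "j < idx v"; cases "j = idx v") (auto simp: pshift_def opv_def)
      next
        case False
        then show ?thesis using L(3) zL idx by (auto simp: pshift_def lattice_pts_def)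
      qed
      then have "pshift (idx v) v \<le> z" by (rule le_funI)
      then show False using I_down[of z "pshift (idx v) v"] that idx_props(3)[OF v(1)] pshift_lattice[OF L(3)] idx by auto
    qed
    show ?thesis
    proof
      fix j
      consider "j \<notin> {1..r}" | "1 \<le> j" "j < idx v" "j \<in> {1..r}" | "idx v < j" "j \<le> r" "j \<in> {1..r}" | "j = idx v"
        using idx by force
      then show "z j = top v j"
      proof cases
        case 1
        then show ?thesis using zL top_L[OF v(1)] by (simp add: lattice_pts_def)
      next
        case 2
        then have "opv v j = v j + 1" by (simp add: opv_def)
        then show ?thesis using 2 zz[OF 2(3)] by (auto simp: top_def pshift_def)
      next
        case 3
        then have "opv v j = v j - 1" by (simp add: opv_def)
        then show ?thesis using 3 zz[OF 3(3)] by (auto simp: top_def pshift_def)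
      next
        case 4
        then have "z j = v j" using zz(1)[of j] idx \<open>\<not> z (idx v) = v (idx v) + 1\<close> by simp
        moreover have "\<not> idx v \<le> idx v - 1" using idx by auto
        ultimately show ?thesis using 4 by (simp add: top_def pshift_def)
      qed
    qed
  qed
  have "chi r (top v) x w \<noteq> (0 :: 'k)"
    unfolding w_def pword_def tword_def chi_append
    using geodesic_chi[OF v(1,2) lam_self[OF v(1)], of "geo r x v", where 'k='k]
      geodesic_chi[OF v(1) lam_self[OF v(1)] v(3), of "rv (geo r y v)", where 'k='k]
      geodesic_chi[OF v(1,3) ov, of "geo r y (opv v)", where 'k='k]
      geodesic_chi[OF v(1) ov v(2), of "geo r (opv v) x", where 'k='k] L
      endp_rv'[of y "geo r y v" v] by (simp add: d1_sym[of r v y])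
  moreover have "top v \<in> cube r x \<inter> I"
    using top_L[OF v(1)] top_incube[OF v(1,2)] idx_props(2)[OF v(1)] by (simp add: cube_def top_def)
  moreover have "trace r I x w = (\<Sum>z\<in>{top v}. (- 1) ^ d1 r z x * chi r z x w :: 'k)"
    unfolding trace_def using z calculation(2) finite_cube by (intro sum.mono_neutral_right) auto
  ultimately have "trace r I x w \<noteq> (0 :: 'k)" by simp
  then show ?thesis using P v(4) by (simp add: tfun_def w_def)
qed

text \<open>At the first coordinate where the two cubes part, the surviving corners confine
  \<open>v\<close> and \<open>v'\<close>, and the ideal excludes the configurations in which the
  digit of \<open>v'\<close> is not the larger one.\<close>

lemma tfun_triangular:
  assumes v: "v \<in> X" "x \<in> lam v" "y \<in> lam v" "d1 r x v + d1 r y v = n"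
    and v': "v' \<in> X" "x \<in> lam v'" "y \<in> lam v'" "d1 r x v' + d1 r y v' = n"
    and ne: "v \<noteq> v'" and nz: "tfun x y n v' (pword x y v) \<noteq> (0 :: 'k::field)"
  shows "key x v < key x v'"
proof -
  define w where "w = pword x y v @ tword x y v'"
  note P = pword_props[OF v(1-3)] and T = tword_props[OF v'(1-3)]
  have L: "x \<in> L" "y \<in> L" "v \<in> L" "opv v' \<in> L" "v' \<in> L" using v v' lam_L X_L opv_lam by blast+
  have iv: "idx v \<in> {1..r}" "idx v' \<in> {1..r}" using idx_props(1) v v' by auto
  have tr: "trace r I x w \<noteq> (0 :: 'k)" using nz P v(4) by (auto simp: tfun_def w_def split: if_splits)
  have vis: "incube r z v" "incube r z (opv v')" if "z \<in> cube r x" "chi r z x w \<noteq> (0 :: 'k)" for z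
    using chi_visits[OF v(1) v'(1) v(2,3) v'(3,2), of z, where 'k='k] that by (auto simp: w_def cube_def)
  obtain z where z: "z \<in> cube r x" "z \<in> I" "chi r z x w \<noteq> (0 :: 'k)"
    using tr unfolding trace_def by (metis (no_types, lifting) IntE mult_zero_right sum.neutral)
  have zv: "z j = v j \<or> z j = v j + 1" "z j = opv v' j \<or> z j = opv v' j + 1" if "j \<in> {1..r}" for j
    using vis[OF z(1,3)] that by (auto simp: incube_def)
  have zL: "z \<in> L" using z I_L by blast
  \<comment> \<open>The first coordinate at which an index is reached or the two vertices differ;
    before it all digits agree.\<close>
  define j where "j = (LEAST j. \<not> (1 \<le> j \<longrightarrow> j < idx v \<and> j < idx v' \<and> v j = v' j))"
  have ex: "\<not> (1 \<le> idx v \<longrightarrow> idx v < idx v \<and> idx v < idx v' \<and> v (idx v) = v' (idx v))" using iv by simp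
  have jl: "1 \<le> l \<Longrightarrow> l < idx v \<and> l < idx v' \<and> v l = v' l" if "l < j" for l
    using not_less_Least[OF that[unfolded j_def]] by blast
  have j: "1 \<le> j" "\<not> (j < idx v \<and> j < idx v' \<and> v j = v' j)"
    using LeastI[of "\<lambda>j. \<not> (1 \<le> j \<longrightarrow> j < idx v \<and> j < idx v' \<and> v j = v' j)" "idx v"] ex
    unfolding j_def[symmetric] by auto
  have jle: "j \<le> idx v" unfolding j_def by (rule Least_le) (use iv in simp)
  have jle': "j \<le> idx v'" unfolding j_def by (rule Least_le) (use iv in simp)
  have jr: "j \<in> {1..r}" using j(1) jle iv by auto
  have xv: "x l = v l \<or> x l = v l + 1" if "1 \<le> l" "l < idx v" for l by (rule lam_coord(1)[OF v(1,2) that])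
  have xv': "x l = v' l \<or> x l = v' l + 1" if "1 \<le> l" "l < idx v'" for l by (rule lam_coord(1)[OF v'(1,2) that])
  have xi: "x (idx v) = v (idx v)" "x (idx v') = v' (idx v')"
    using lam_coord(3)[OF v(1,2)] lam_coord(3)[OF v'(1,2)] by blast+
  have zl: "z l = v l + 1" if "1 \<le> l" "l < j" for l
  proof -
    have "l \<in> {1..r}" "opv v' l = v l + 1" using jl[OF that(2,1)] that jr by (simp_all add: opv_def)
    then show ?thesis using zv[of l] by auto
  qed
  have "digit x v j < digit x v' j"
  proof (cases "j < idx v")
    case jv: True
    show ?thesis
    proof (cases "j < idx v'")
      case True
      then have "v j \<noteq> v' j" using j jv by blast
      moreover have "opv v' j = v' j + 1" using True j(1) by (simp add: opv_def)
      ultimately have "x j = v j" "v' j \<noteq> x j" using zv[OF jr] xv[OF j(1) jv] xv'[OF j(1) True] by auto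
      then show ?thesis using True jv by (simp add: digit_def)
    next
      case False
      then have ji: "j = idx v'" using jle' by simp
      have "v j = x j"
      proof (rule ccontr)
        assume "v j \<noteq> x j"
        then have vj: "x j = v j + 1" using xv[OF j(1) jv] by auto
        \<comment> \<open>Under this assumption every surviving corner lies below the largest corner
          of \<open>lam v'\<close>, hence in the ideal, so nothing is truncated.\<close>
        have "trace r I x w = (0 :: 'k)"
        proof (rule trace_vanish)
          show "valid r w" using P T by (simp add: w_def)
          show "endp x w = x" using P T by (simp add: w_def)
          have "length w = 2 * (r - 1)" using P T v(4) v'(4) by (simp add: w_def)
          then show "length w < 2 * r" using r_pos by simp
          show "x \<in> L" by (rule L)
          show "y \<in> I" if y: "y \<in> cube r x" "chi r y x w \<noteq> (0 :: 'k)" for y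
          proof -
            have yL: "y \<in> L" using y by (simp add: cube_def)
            have yv: "y l = v l \<or> y l = v l + 1" "y l = opv v' l \<or> y l = opv v' l + 1" if "l \<in> {1..r}" for l
              using vis[OF y] that by (auto simp: incube_def)
            have "y l \<le> pshift (idx v' - 1) v' l" for l
            proof -
              consider "l \<notin> {1..r}" | "1 \<le> l" "l < j" "l \<in> {1..r}" | "l = j" | "j < l" "l \<in> {1..r}" by force
              then show ?thesis
              proof cases
                case 1
                then show ?thesis using yL L(5) iv by (auto simp: lattice_pts_def pshift_def)
              next
                case 2
                then show ?thesis using yv(1)[of l] jl[of l] ji by (auto simp: pshift_def)
              next
                case 3
                then show ?thesis using yv(1)[OF jr] vj xi(2) ji jr by (auto simp: pshift_def)
              next
                case 4
                then show ?thesis using yv(2)[of l] ji by (auto simp: pshift_def opv_def)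
              qed
            qed
            then have "y \<le> pshift (idx v' - 1) v'" by (rule le_funI)
            then show ?thesis using I_down[OF idx_props(2)[OF v'(1)] yL] by simp
          qed
        qed
        then show False using tr by simp
      qed
      then show ?thesis using jv ji by (simp add: digit_def)
    qed
  next
    case False
    then have ji: "j = idx v" using jle by simp
    \<comment> \<open>A corner raised in the direction missing at \<open>v\<close> would pull the
      shift of \<open>v\<close> that has just left the ideal back into it.\<close>
    have big: "pshift (idx v) v \<in> I" if "z j = v j + 1"
    proof -
      have "pshift (idx v) v l \<le> z l" for l
      proof -
        consider "l \<notin> {1..r}" | "1 \<le> l" "l < j" "l \<in> {1..r}" | "l = j" | "j < l" "l \<in> {1..r}" by force
        then show ?thesis
        proof cases
          case 1
          then show ?thesis using zL L(3) iv by (auto simp: lattice_pts_def pshift_def)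
        next
          case 2
          then show ?thesis using zl[of l] by (auto simp: pshift_def)
        next
          case 3
          then show ?thesis using that by (auto simp: pshift_def)
        next
          case 4
          then show ?thesis using zv(1)[of l] ji by (auto simp: pshift_def)
        qed
      qed
      then have "pshift (idx v) v \<le> z" by (rule le_funI)
      then show ?thesis using I_down[OF z(2)] pshift_lattice[OF L(3)] iv by auto
    qed
    show ?thesis
    proof (cases "j < idx v'")
      case True
      have "v' j \<noteq> x j"
      proof
        assume "v' j = x j"
        then have "opv v' j = v j + 1" using True j(1) xi(1) ji by (simp add: opv_def)
        then have "z j = v j + 1" using zv[OF jr] by auto
        then show False using big idx_props(3)[OF v(1)] by simp
      qed
      then show ?thesis using True ji by (simp add: digit_def)
    next
      case nj': False
      then have ji': "j = idx v'" using jle' by simp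
      have le: "v l \<le> v' l" if "j < l" "l \<in> {1..r}" for l
      proof -
        have "opv v' l = v' l - 1" using that ji' by (simp add: opv_def)
        then show ?thesis using zv[OF that(2)] by auto
      qed
      have eqj: "v j = v' j" using xi ji ji' by simp
      have xl: "x l \<le> v l" "x l \<le> v' l" "y l \<le> v l" "y l \<le> v' l" if "j < l" "l \<in> {1..r}" for l
      proof -
        have l: "idx v < l" "idx v' < l" "l \<le> r" using that ji ji' by simp_all
        show "x l \<le> v l" using lam_coord(2)[OF v(1,2) l(1,3)] by linarith
        show "x l \<le> v' l" using lam_coord(2)[OF v'(1,2) l(2,3)] by linarith
        show "y l \<le> v l" using lam_coord(2)[OF v(1,3) l(1,3)] by linarith
        show "y l \<le> v' l" using lam_coord(2)[OF v'(1,3) l(2,3)] by linarith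
      qed
      \<comment> \<open>Both cubes miss direction \<open>j\<close>. Beyond it \<open>v\<close> lies
        below \<open>v'\<close> while both lie above \<open>x\<close> and \<open>y\<close>, so equal
        total distances force equality in each coordinate.\<close>
      let ?f = "\<lambda>v l. nat \<bar>x l - v l\<bar> + nat \<bar>y l - v l\<bar>"
      have mono: "?f v l \<le> ?f v' l" if "l \<in> {1..r}" for l
      proof -
        consider "l < j" | "l = j" | "j < l" by linarith
        then show ?thesis
        proof cases
          case 1
          then show ?thesis using jl[of l] that by simp
        next
          case 2
          then show ?thesis using eqj by simp
        next
          case 3
          then show ?thesis using le[OF 3 that] xl[OF 3 that] by linarith
        qed
      qed
      have "(\<Sum>l=1..r. ?f v l) = (\<Sum>l=1..r. ?f v' l)"
        using v(4) v'(4) by (simp add: d1_def sum.distrib)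
      then have eq: "?f v l = ?f v' l" if "l \<in> {1..r}" for l
        using sum_mono_inv[of "?f v" "{1..r}" "?f v'" l] mono that by blast
      have "v = v'"
      proof
        fix l
        consider "l \<notin> {1..r}" | "1 \<le> l" "l < j" | "l = j" | "j < l" "l \<in> {1..r}" by force
        then show "v l = v' l"
        proof cases
          case 1
          then show ?thesis using L by (simp add: lattice_pts_def)
        next
          case 2
          then show ?thesis using jl by blast
        next
          case 3
          then show ?thesis using eqj by simp
        next
          case 4
          then show ?thesis using eq[OF 4(2)] le[OF 4] xl[OF 4] by linarith
        qed
      qed
      then show ?thesis using ne by simp
    qed
  qed
  then show ?thesis unfolding key_def
    by (intro digits_less[OF jr]) (use jl in \<open>auto simp: digit_def\<close>)
qed

text \<open>One corner suffices here, since geodesics of \<open>lam x\<close> never leave the cube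
  of its largest corner. The length condition restricts the function to such geodesics, and these
  meet neither points outside the Cubist set nor vertices larger than \<open>x\<close>.\<close>

lemma standard_functional:
  assumes x: "x \<in> X" "y \<in> lam x"
  defines "H \<equiv> (\<lambda>w. if length w = d1 r y x \<and> endp y w = x then chi r (top x) y w else (0 :: 'k::field))"
  shows "U_rel r H" "kills r y ((L - X) \<union> {t. gt t x}) H" "H (geo r y x) \<noteq> 0"
proof -
  show "U_rel r H" unfolding H_def by (intro U_rel_restrict U_rel_chi)
  show "kills r y ((L - X) \<union> {t. gt t x}) H" unfolding kills_def
  proof (intro allI impI)
    fix a b assume ab: "valid r a" "valid r b" "endp y a \<in> (L - X) \<union> {t. gt t x}"
    show "H (a @ b) = 0"
    proof (rule ccontr)
      assume "H (a @ b) \<noteq> 0"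
      then have "length (a @ b) = d1 r y x" "endp y (a @ b) = x" by (auto simp: H_def split: if_splits)
      then have "endp y a \<in> lam x" using geodesic_lam[OF x lam_self[OF x(1)], of a b] ab by simp
      then show False using ab(3) lam_X[OF x(1)] lam_not_gt[OF x(1)] by blast
    qed
  qed
  show "H (geo r y x) \<noteq> 0"
    using geodesic_chi[OF x lam_self[OF x(1)], of "geo r y x", where 'k='k] lam_L[OF x] X_L[OF x(1)] by (simp add: H_def)
qed

end

section \<open>Functions on words compatible with the relations of \<open>V\<close>\<close>

lemma V_relD:
  assumes "V_rel r F" "valid r a" "valid r b"
  shows "snd s \<in> {1..r} \<Longrightarrow> snd t \<in> {1..r} \<Longrightarrow> F (a @ s # t # b) = F (a @ t # s # b)"
    and "(\<Sum>i=1..r. F (a @ (False, i) # (True, i) # b)) = 0"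
proof -
  have D: "(\<forall>s t. snd s \<in> {1..r} \<longrightarrow> snd t \<in> {1..r} \<longrightarrow> F (a @ [s, t] @ b) = F (a @ [t, s] @ b)) \<and>
     (\<Sum>i=1..r. F (a @ [(False, i), (True, i)] @ b)) = 0"
    using assms(1)[unfolded V_rel_def, rule_format, OF assms(2,3)] by blast
  show "snd s \<in> {1..r} \<Longrightarrow> snd t \<in> {1..r} \<Longrightarrow> F (a @ s # t # b) = F (a @ t # s # b)"
    using D[THEN conjunct1, rule_format, of s t] by simp
  show "(\<Sum>i=1..r. F (a @ (False, i) # (True, i) # b)) = 0"
    using D[THEN conjunct2] by simp
qed

text \<open>Any two adjacent letters commute in \<open>V\<close>; the prefix \<open>p\<close> is
  carried along for the induction.\<close>

lemma V_rel_perm: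
  assumes "V_rel r F" "valid r p" "valid r v" "mset v = mset w"
  shows "F (p @ w) = F (p @ v)"
  using assms
proof (induction v arbitrary: w p)
  case (Cons s v)
  have "s \<in> set w" using Cons.prems(4) by (metis list.set_intros(1) set_mset_mset)
  then obtain a b where w: "w = a @ s # b" by (meson split_list)
  have ab: "mset v = mset (a @ b)" using Cons.prems(4) w by simp
  have sv: "set v = set a \<union> set b" using arg_cong[OF ab, of set_mset] by simp
  have va: "valid r a" "valid r b" "snd s \<in> {1..r}" "valid r v"
    using Cons.prems(3) sv by (auto simp: valid_def)
  have "F (p @ a @ s # b) = F (p @ s # a @ b)"
    using va(1) Cons.prems(2)
  proof (induction a arbitrary: p)
    case (Cons t a)
    have "F (p @ t # a @ s # b) = F (p @ t # s # a @ b)"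
      using Cons.IH[of "p @ [t]"] Cons.prems by simp
    also have "\<dots> = F (p @ s # t # a @ b)"
      using V_relD(1)[OF assms(1) Cons.prems(2), of "a @ b" t s] Cons.prems va by simp
    finally show ?case by simp
  qed simp
  also have "\<dots> = F (p @ s # v)" using Cons.IH[OF assms(1), of "p @ [s]" "a @ b"] Cons.prems va ab by simp
  finally show ?case using w by simp
qed simp

lemma V_rel_mset: "V_rel r F \<Longrightarrow> valid r v \<Longrightarrow> mset v = mset w \<Longrightarrow> F w = F v"
  using V_rel_perm[of r F "[]" v w] by simp

subsection \<open>Words for the Cartan matrix of the second algebra\<close>

definition loops :: "nat \<Rightarrow> (nat \<Rightarrow> nat) \<Rightarrow> step list" where
  "loops r m = concat (map (\<lambda>i. replicate (m i) (False, i) @ replicate (m i) (True, i)) [1..<Suc r])"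

lemma loops_count: "count (mset (loops r m)) (b, j) = (if j \<in> {1..r} then m j else 0)"
proof (induction r)
  case 0
  then show ?case by (simp add: loops_def)
next
  case (Suc r)
  have "loops (Suc r) m = loops r m @ replicate (m (Suc r)) (False, Suc r) @ replicate (m (Suc r)) (True, Suc r)"
    by (simp add: loops_def)
  then show ?case using Suc by (cases b) (auto simp: le_Suc_eq)
qed

lemma loops_valid [simp]: "valid r (loops r m)"
  by (auto simp: valid_def loops_def)

lemma length_loops: "length (loops r m) = 2 * (\<Sum>j=1..r. m j)"
  unfolding length_count[OF loops_valid] sum_distrib_left loops_count by (intro sum.cong) auto

lemma endp_loops [simp]: "endp u (loops r m) = u"
  by (intro ext) (simp add: endp_count loops_count)

definition cword :: "nat \<Rightarrow> point \<Rightarrow> point \<Rightarrow> (nat \<Rightarrow> nat) \<Rightarrow> step list" where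
  "cword r x y m = geo r x y @ loops r m"

lemma cword_props:
  assumes "x \<in> lattice_pts r" "y \<in> lattice_pts r"
  shows "valid r (cword r x y m)" "endp x (cword r x y m) = y"
    "length (cword r x y m) = d1 r x y + 2 * (\<Sum>j=1..r. m j)"
  using assms by (simp_all add: cword_def length_loops)

text \<open>In each direction the smaller of the two letter counts splits off as loops; what is left
  is a geodesic.\<close>

lemma cword_cover:
  assumes "x \<in> lattice_pts r" "y \<in> lattice_pts r" "valid r w" "endp x w = y"
  obtains m where "mset w = mset (cword r x y m)" "length w = d1 r x y + 2 * (\<Sum>j=1..r. m j)"
proof -
  define m where "m = (\<lambda>j. min (count (mset w) (True, j)) (count (mset w) (False, j)))"
  have g: "count (mset (geo r x y)) (b, j) = (if b = (x j < y j) then nat \<bar>y j - x j\<bar> else 0)" for b j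
    using geodesic_count[of r "geo r x y" x b j] assms by simp
  have "mset w = mset (cword r x y m)"
  proof (rule multiset_eqI)
    fix s :: step
    obtain b j where s: "s = (b, j)" by force
    show "count (mset w) s = count (mset (cword r x y m)) s"
    proof (cases "j \<in> {1..r}")
      case False
      then show ?thesis using valid_count[OF assms(3) False] valid_count[OF cword_props(1)[OF assms(1,2)] False]
        unfolding s by metis
    next
      case True
      have "y j - x j = int (count (mset w) (True, j)) - int (count (mset w) (False, j))"
        using endp_count[of x w j] assms(4) by simp
      then have "count (mset w) (b, j) = (if b = (x j < y j) then nat \<bar>y j - x j\<bar> else 0) + m j"
        unfolding m_def by (cases b) (auto simp del: count_mset_0_iff count_eq_zero_iff)
      moreover have "count (mset (cword r x y m)) (b, j) = (if b = (x j < y j) then nat \<bar>y j - x j\<bar> else 0) + m j"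
        using True by (simp add: cword_def g loops_count)
      ultimately show ?thesis unfolding s by (rule trans_sym)
    qed
  qed
  moreover from this have "length w = length (cword r x y m)" by (rule mset_eq_length)
  ultimately show ?thesis using that cword_props(3)[OF assms(1,2)] by simp
qed

text \<open>The loop relation trades a loop in direction 1 for loops in the other directions, so
  loops in direction 1 can be eliminated one by one.\<close>

lemma V_span_aux:
  assumes xy: "x \<in> lattice_pts r" "y \<in> lattice_pts r" and F: "V_rel r F" and r: "1 \<le> r"
    and Z: "\<And>m. m 1 = 0 \<Longrightarrow> (\<Sum>j=1..r. m j) = k \<Longrightarrow> F (cword r x y m) = (0 :: 'k::field)"
  shows "(\<Sum>j=1..r. m j) = k \<Longrightarrow> F (cword r x y m) = 0"
proof (induction "m 1" arbitrary: m)
  case 0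
  then show ?case using Z by simp
next
  case (Suc a)
  define m' where "m' = m(1 := a)"
  have s: "(\<Sum>j=1..r. (m'(i := m' i + 1)) j) = (\<Sum>j=1..r. m' j) + 1" if "i \<in> {1..r}" for i
  proof -
    have "(\<Sum>j=1..r. (m'(i := m' i + 1)) j) = (\<Sum>j=1..r. m' j + (if j = i then 1 else 0))"
      by (intro sum.cong) auto
    then show ?thesis using that by (simp add: sum.distrib)
  qed
  have e: "F (cword r x y m' @ [(False, i), (True, i)]) = F (cword r x y (m'(i := m' i + 1)))" if "i \<in> {1..r}" for i
  proof (rule V_rel_mset[OF F cword_props(1)[OF xy]], rule multiset_eqI)
    fix s :: step
    obtain b j where s: "s = (b, j)" by force
    show "count (mset (cword r x y (m'(i := m' i + 1)))) s = count (mset (cword r x y m' @ [(False, i), (True, i)])) s"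
      unfolding s using that by (cases b) (simp_all add: cword_def loops_count)
  qed
  have mm: "m = m'(1 := m' 1 + 1)" using Suc(2) by (auto simp: m'_def)
  have k: "(\<Sum>j=1..r. m' j) + 1 = k" using s[of 1] r mm Suc(3) by simp
  have z: "F (cword r x y (m'(i := m' i + 1))) = 0" if "i \<in> {2..r}" for i
  proof (rule Suc(1))
    show "a = (m'(i := m' i + 1)) 1" using that by (simp add: m'_def)
    show "(\<Sum>j=1..r. (m'(i := m' i + 1)) j) = k" using s[of i] that k by simp
  qed
  \<comment> \<open>The loop relation at \<open>m'\<close>, which has one loop less in direction 1
    than \<open>m\<close>: every term except that of direction 1 is covered by the
    induction.\<close>
  have "(\<Sum>i=1..r. F (cword r x y m' @ [(False, i), (True, i)])) = 0"
    using V_relD(2)[OF F cword_props(1)[OF xy], of "[]"] by simp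
  also have "(\<Sum>i=1..r. F (cword r x y m' @ [(False, i), (True, i)])) = (\<Sum>i=1..r. F (cword r x y (m'(i := m' i + 1))))"
    using e by (intro sum.cong) auto
  also have "\<dots> = F (cword r x y m) + (\<Sum>i=2..r. F (cword r x y (m'(i := m' i + 1))))"
    using r mm by (simp add: sum.atLeast_Suc_atMost numeral_2_eq_2)
  also have "\<dots> = F (cword r x y m)" using z by simp
  finally show ?case .
qed

text \<open>List positions start at 0 and stand for the directions from 2 on; direction 1 gets
  exponent 0.\<close>

definition half_exp :: "nat list \<Rightarrow> nat \<Rightarrow> nat" where
  "half_exp l j = (if 2 \<le> j \<and> j - 2 < length l then (l ! (j - 2)) div 2 else 0)"

text \<open>The lists hold doubled exponents because a loop has two letters and because
  \<open>natpermute\<close> indexes the coefficients of powers of a series: these sets count the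
  coefficients of \<open>(1 - q^2)^(-k)\<close>.\<close>

definition even_lists :: "nat \<Rightarrow> nat \<Rightarrow> nat list set" where
  "even_lists n k = {l \<in> natpermute n k. \<forall>e\<in>set l. even e}"

lemma finite_even_lists [simp]: "finite (even_lists n k)"
  by (simp add: even_lists_def natpermute_finite)

lemma half_exp_sum:
  assumes "l \<in> even_lists n (r - 1)" "1 \<le> r"
  shows "2 * (\<Sum>j=1..r. half_exp l j) = n"
proof -
  have l: "length l = r - 1" "sum_list l = n" "\<forall>e\<in>set l. even e"
    using assms(1) by (auto simp: even_lists_def natpermute_def)
  have "2 * (\<Sum>j=1..r. half_exp l j) = (\<Sum>j=1..r. 2 * half_exp l j)" by (rule sum_distrib_left)
  also have "\<dots> = (\<Sum>j\<in>{2..r}. l ! (j - 2))"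
  proof (rule sum.mono_neutral_cong_right)
    show "\<forall>i\<in>{1..r} - {2..r}. 2 * half_exp l i = 0" by (auto simp: half_exp_def)
    show "2 * half_exp l j = l ! (j - 2)" if "j \<in> {2..r}" for j
    proof -
      have "j - 2 < length l" using that l(1) by auto
      then show ?thesis using l(3) that by (simp add: half_exp_def)
    qed
  qed auto
  also have "\<dots> = (\<Sum>i<length l. l ! i)"
    using l(1) by (intro sum.reindex_bij_witness[where i = "\<lambda>i. i + 2" and j = "\<lambda>j. j - 2"]) auto
  also have "\<dots> = n" using l(2) by (simp add: sum_list_sum_nth atLeast0LessThan)
  finally show ?thesis .
qed

lemma half_exp_surj:
  assumes "m 1 = 0" "1 \<le> r"
  obtains l where "l \<in> even_lists (2 * (\<Sum>j=1..r. m j)) (r - 1)" "\<And>j. j \<in> {1..r} \<Longrightarrow> half_exp l j = m j"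
proof -
  define l where "l = map (\<lambda>i. 2 * m (i + 2)) [0..<r - 1]"
  have half: "half_exp l j = m j" if "j \<in> {1..r}" for j
  proof (cases "j = 1")
    case True
    then show ?thesis using assms by (simp add: half_exp_def)
  next
    case False
    then have "2 \<le> j" "j - 2 < r - 1" using that by auto
    moreover from this have "Suc (Suc (j - 2)) = j" by simp
    ultimately show ?thesis by (simp add: half_exp_def l_def)
  qed
  have "l \<in> even_lists (sum_list l) (r - 1)" by (auto simp: even_lists_def natpermute_def l_def)
  moreover from half_exp_sum[OF this assms(2)] have "sum_list l = 2 * (\<Sum>j=1..r. m j)"
    using half by simp
  ultimately show ?thesis using that half by simp
qed

lemma V_cartan_words_span:
  assumes xy: "x \<in> lattice_pts r" "y \<in> lattice_pts r" and F: "V_rel r F" and r: "1 \<le> r"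
    and Z: "\<And>l. d1 r x y \<le> n \<Longrightarrow> l \<in> even_lists (n - d1 r x y) (r - 1) \<Longrightarrow> F (cword r x y (half_exp l)) = (0 :: 'k::field)"
    and w: "valid r w" "endp x w = y" "length w = n"
  shows "F w = 0"
proof -
  obtain m where m: "mset w = mset (cword r x y m)" "n = d1 r x y + 2 * (\<Sum>j=1..r. m j)"
    using cword_cover[OF xy w(1,2)] w(3) by metis
  have "F (cword r x y m) = 0"
  proof (rule V_span_aux[OF xy F r _ refl])
    fix m' assume m': "m' 1 = 0" "(\<Sum>j=1..r. m' j) = (\<Sum>j=1..r. m j)"
    obtain l where l: "l \<in> even_lists (2 * (\<Sum>j=1..r. m' j)) (r - 1)" "\<And>j. j \<in> {1..r} \<Longrightarrow> half_exp l j = m' j"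
      using half_exp_surj[of m' r] m'(1) r by metis
    have "loops r (half_exp l) = loops r m'"
      unfolding loops_def using l(2) by (intro arg_cong[of _ _ concat] map_cong) auto
    then show "F (cword r x y m') = 0" using Z[of l] l(1) m m' by (simp add: cword_def)
  qed
  moreover have "F w = F (cword r x y m)" by (rule V_rel_mset[OF F cword_props(1)[OF xy] m(1)[symmetric]])
  ultimately show ?thesis by (simp only:)
qed

text \<open>Independence is witnessed by a polynomial ring in the variables \<open>T\<^sub>2, \<dots>, T\<^sub>r\<close>: a step in the
  direction of the geodesics from \<open>x\<close> to \<open>y\<close> acts as \<open>1\<close>, a step against it as \<open>T\<^sub>i\<close>, where
  \<open>T\<^sub>1 = - T\<^sub>2 - \<dots> - T\<^sub>r\<close>.\<close>

type_synonym 'k mpoly = "(nat \<Rightarrow>\<^sub>0 nat) \<Rightarrow>\<^sub>0 'k"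

definition T_var :: "nat \<Rightarrow> nat \<Rightarrow> 'k::field mpoly" where
  "T_var r i = (if i = 1 then - (\<Sum>j=2..r. Poly_Mapping.single (Poly_Mapping.single j 1) 1)
     else Poly_Mapping.single (Poly_Mapping.single i 1) 1)"

definition step_poly :: "nat \<Rightarrow> point \<Rightarrow> point \<Rightarrow> step \<Rightarrow> 'k::field mpoly" where
  "step_poly r x y s = (if fst s = (x (snd s) < y (snd s)) then 1 else T_var r (snd s))"

definition word_poly :: "nat \<Rightarrow> point \<Rightarrow> point \<Rightarrow> step list \<Rightarrow> 'k::field mpoly" where
  "word_poly r x y w = prod_list (map (step_poly r x y) w)"

lemma T_var_sum: "1 \<le> r \<Longrightarrow> (\<Sum>i=1..r. T_var r i) = (0 :: 'k::field mpoly)"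
proof -
  assume r: "1 \<le> r"
  have "(\<Sum>i=1..r. T_var r i) = T_var r 1 + (\<Sum>i=2..r. T_var r i :: 'k mpoly)"
    using r by (simp add: sum.atLeast_Suc_atMost numeral_2_eq_2)
  also have "(\<Sum>i=2..r. T_var r i :: 'k mpoly) = (\<Sum>i=2..r. Poly_Mapping.single (Poly_Mapping.single i 1) 1)"
    by (intro sum.cong) (auto simp: T_var_def)
  finally show ?thesis by (simp add: T_var_def)
qed

text \<open>Of two opposite letters in direction \<open>i\<close> one acts as 1 and the other as the
  variable, so every loop contributes \<open>T_var r i\<close> and the loop relation becomes
  \<open>T_var_sum\<close>.\<close>

lemma V_rel_word_poly:
  assumes "1 \<le> r"
  shows "V_rel r (\<lambda>w. Poly_Mapping.lookup (word_poly r x y w :: 'k::field mpoly) e)"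
proof -
  have p: "step_poly r x y (False, i) * step_poly r x y (True, i) = (T_var r i :: 'k mpoly)" for i
    by (simp add: step_poly_def)
  have "(\<Sum>i=1..r. Poly_Mapping.lookup (word_poly r x y (a @ [(False, i), (True, i)] @ b) :: 'k mpoly) e) = 0" for a b
  proof -
    have "(\<Sum>i=1..r. Poly_Mapping.lookup (word_poly r x y (a @ [(False, i), (True, i)] @ b) :: 'k mpoly) e) =
      Poly_Mapping.lookup (\<Sum>i=1..r. word_poly r x y a * T_var r i * word_poly r x y b) e"
      by (simp add: lookup_sum word_poly_def mult.assoc flip: p)
    also have "(\<Sum>i=1..r. word_poly r x y a * T_var r i * word_poly r x y b) =
      word_poly r x y a * (\<Sum>i=1..r. T_var r i) * (word_poly r x y b :: 'k mpoly)"
      by (simp add: sum_distrib_left sum_distrib_right)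
    finally show ?thesis using T_var_sum[OF assms, where 'k='k] by simp
  qed
  then show ?thesis by (auto simp: V_rel_def word_poly_def mult_ac)
qed

definition expo :: "nat \<Rightarrow> (nat \<Rightarrow> nat) \<Rightarrow> nat \<Rightarrow>\<^sub>0 nat" where
  "expo r m = (\<Sum>j=1..r. Poly_Mapping.single j (m j))"

lemma lookup_expo: "j \<in> {1..r} \<Longrightarrow> Poly_Mapping.lookup (expo r m) j = m j"
proof -
  assume j: "j \<in> {1..r}"
  have "Poly_Mapping.lookup (expo r m) j = (\<Sum>i=1..r. if i = j then m i else 0)"
    unfolding expo_def lookup_sum by (intro sum.cong) (auto simp: lookup_single when_def)
  then show ?thesis using j by simp
qed

text \<open>With \<open>m 1 = 0\<close> the composite variable of direction 1 does not occur, so a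
  normal word becomes a plain monomial.\<close>

lemma word_poly_cword:
  assumes "x \<in> lattice_pts r" "y \<in> lattice_pts r" "m 1 = 0"
  shows "word_poly r x y (cword r x y m) = (Poly_Mapping.single (expo r m) 1 :: 'k::field mpoly)"
proof -
  have one: "step_poly r x y s = (1 :: 'k mpoly)" if "s \<in> set (geo r x y)" for s
    using geodesic_step[of r "geo r x y" x y s] assms that by (simp add: step_poly_def)
  then have g: "word_poly r x y (geo r x y) = (1 :: 'k mpoly)"
  proof -
    have "prod_list (map (step_poly r x y) w) = (1 :: 'k mpoly)" if "\<And>s. s \<in> set w \<Longrightarrow> step_poly r x y s = (1 :: 'k mpoly)" for w
      using that by (induction w) auto
    from this[OF one] show ?thesis by (simp add: word_poly_def)
  qed
  have pw: "Poly_Mapping.single a (1 :: 'k) ^ n = Poly_Mapping.single (\<Sum>i<n. a) 1" for a :: "nat \<Rightarrow>\<^sub>0 nat" and n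
    by (induction n) (simp_all add: mult_single add.commute del: sum_constant)
  have sn: "(\<Sum>i<n. Poly_Mapping.single j (Suc 0)) = Poly_Mapping.single j n" for j n :: nat
    by (induction n) (simp_all del: sum_constant flip: single_add)
  have l: "word_poly r x y (loops k m) = (Poly_Mapping.single (expo k m) 1 :: 'k mpoly)" for k
  proof (induction k)
    case 0
    then show ?case by (simp add: loops_def word_poly_def expo_def)
  next
    case (Suc k)
    have "word_poly r x y (loops (Suc k) m) = word_poly r x y (loops k m) * (T_var r (Suc k) ^ m (Suc k) :: 'k mpoly)"
      by (simp add: loops_def word_poly_def step_poly_def)
    also have "T_var r (Suc k) ^ m (Suc k) = (Poly_Mapping.single (Poly_Mapping.single (Suc k) (m (Suc k))) 1 :: 'k mpoly)"
    proof (cases "k = 0")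
      case True
      then show ?thesis using assms(3) by simp
    next
      case False
      then show ?thesis unfolding T_var_def using pw[of "Poly_Mapping.single (Suc k) 1" "m (Suc k)"] by (simp add: sn del: sum_constant)
    qed
    finally show ?case unfolding Suc by (simp add: mult_single expo_def)
  qed
  show ?thesis unfolding cword_def using g l[of r] by (simp add: word_poly_def)
qed

text \<open>Distinct normal words give distinct monomials, so here the coefficient functions are a
  dual basis and not merely triangular.\<close>

lemma V_cartan_diag:
  assumes "x \<in> lattice_pts r" "y \<in> lattice_pts r" "1 \<le> r"
    and "l \<in> even_lists n (r - 1)" "l' \<in> even_lists n (r - 1)"
  shows "Poly_Mapping.lookup (word_poly r x y (cword r x y (half_exp l)) :: 'k::field mpoly) (expo r (half_exp l')) =
    (if l = l' then 1 else 0)"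
proof -
  have "l = l'" if e: "expo r (half_exp l) = expo r (half_exp l')"
  proof (rule nth_equalityI)
    have len: "length l = r - 1" "length l' = r - 1" and ev: "\<forall>e\<in>set l. even e" "\<forall>e\<in>set l'. even e"
      using assms(4,5) by (auto simp: even_lists_def natpermute_def)
    show "length l = length l'" using len by simp
    show "l ! i = l' ! i" if i: "i < length l" for i
    proof -
      have "half_exp l (i + 2) = half_exp l' (i + 2)"
        using lookup_expo[of "i + 2" r "half_exp l"] lookup_expo[of "i + 2" r "half_exp l'"] e i len by simp
      then have "l ! i div 2 = l' ! i div 2" using i len by (simp add: half_exp_def)
      moreover have "even (l ! i)" "even (l' ! i)" using ev i len by auto
      ultimately show ?thesis by (metis dvd_mult_div_cancel)
    qed
  qed
  moreover have "word_poly r x y (cword r x y (half_exp l)) = (Poly_Mapping.single (expo r (half_exp l)) 1 :: 'k mpoly)"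
    using assms(1,2) by (intro word_poly_cword) (simp_all add: half_exp_def)
  ultimately show ?thesis by (auto simp: lookup_single when_def)
qed

section \<open>Standard modules of \<open>V\<close>\<close>

context cubist_ideal
begin

text \<open>Letters can be reordered freely, so a word with a letter that enters \<open>x\<close>
  from its own cube can be made to pass through a smaller vertex. Words without such letters come
  monotonically from the cone.\<close>

lemma V_standard_words:
  fixes F :: "step list \<Rightarrow> 'k::field"
  assumes x: "x \<in> X" and F: "V_rel r F" and K: "kills r y {t. gt x t} F" and y: "y \<in> L"
    and w: "valid r w" "endp y w = x"
  shows "if y \<in> mu x \<and> length w = d1 r y x then F w = F (geo r y x) else F w = 0"
proof (cases "y \<in> mu x \<and> length w = d1 r y x")
  case True
  have "mset (geo r y x) = mset w"
    using geodesic_mset[OF geo_valid w(1) geo_length conjunct2[OF True] geo_endp[OF y X_L[OF x]] w(2)] .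
  then have "F w = F (geo r y x)" by (rule V_rel_mset[OF F geo_valid])
  then show ?thesis using True by (simp only: if_True simp_thms)
next
  case False
  define v where "v = idx x"
  have v: "v \<in> {1..r}" using idx_props(1)[OF x] by (simp add: v_def)
  have bad: "F w = 0" if w: "valid r w" "endp y w = x" and s: "s \<in> set w" "if fst s then v < snd s else snd s < v" for w s
  proof -
    obtain a b where ab: "w = a @ s # b" using s(1) by (meson split_list)
    have va: "valid r a" "valid r b" "snd s \<in> {1..r}" using w(1) ab by simp_all
    have ms: "mset ((a @ b) @ [s]) = mset w" using ab by simp
    then have "endp y ((a @ b) @ [s]) = x" using endp_mset[of "(a @ b) @ [s]" w y] w(2) by simp
    then have e: "endp y (a @ b) = mv x (opp s)" using mv_opp(1)[of "endp y (a @ b)" s] by simp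
    have "mv x (opp s) \<in> lam x" using mv_lamI[OF x va(3), of "\<not> fst s"] s(2)
      by (simp add: opp_def v_def split: if_splits)
    moreover have "mv x (opp s) (snd s) \<noteq> x (snd s)" by (simp add: mv_apply sg_def)
    then have "x \<noteq> mv x (opp s)" by metis
    ultimately have "gt x (mv x (opp s))" using lam_gt[OF x] by blast
    then have "F ((a @ b) @ [s]) = 0" using killsD[OF K, of "a @ b" "[s]"] e va by simp
    moreover have "F ((a @ b) @ [s]) = F w" by (rule V_rel_mset[OF F w(1) ms[symmetric]])
    ultimately show ?thesis by (simp only:)
  qed
  have "F w = 0"
  proof (rule ccontr)
    assume nz: "F w \<noteq> 0"
    let ?c = "\<lambda>b j. count (mset w) (b, j)"
    have c1: "?c False j = 0" if "j < v" for j using bad[OF w, of "(False, j)"] nz that by auto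
    have c2: "?c True j = 0" if "v < j" for j using bad[OF w, of "(True, j)"] nz that by auto
    \<comment> \<open>A loop in direction \<open>idx x\<close> is minus the sum of the loops in the
      other directions, and each of those contains a letter excluded by \<open>bad\<close>.\<close>
    have c3: "?c True v = 0 \<or> ?c False v = 0"
    proof (rule ccontr)
      assume "\<not> ?thesis"
      then have "{#(False, v), (True, v)#} \<subseteq># mset w"
        by (simp add: insert_subset_eq_iff in_diff_count)
      then obtain M where M: "mset w = {#(False, v), (True, v)#} + M" by (metis mset_subset_eq_exists_conv)
      obtain p where p: "mset p = M" using ex_mset by blast
      have "set p \<subseteq> set w" using M p by (metis set_mset_mset set_mset_union sup_ge2)
      then have vp: "valid r p" using w(1) by (auto simp: valid_def)
      have ms: "mset (p @ [(False, v), (True, v)]) = mset w" using M p by simp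
      have e1: "endp y (p @ [(False, v), (True, v)]) = x" using endp_mset[OF ms] w(2) by simp
      have mm: "mv (mv u (False, i)) (True, i) = u" for u i using mv_opp(2)[of u "(True, i)"] by (simp add: opp_def)
      have ep: "endp y p = x" using e1 by (simp add: mm)
      have "F (p @ [(False, i), (True, i)]) = 0" if i: "i \<in> {1..r} - {v}" for i
      proof -
        have w': "valid r (p @ [(False, i), (True, i)])" "endp y (p @ [(False, i), (True, i)]) = x"
          using vp ep i by (simp_all add: mm)
        show ?thesis
        proof (cases "i < v")
          case True
          then show ?thesis using bad[OF w', of "(False, i)"] by simp
        next
          case False
          then show ?thesis using bad[OF w', of "(True, i)"] i by simp
        qed
      qed
      moreover have "(\<Sum>i=1..r. F (p @ [(False, i), (True, i)])) = 0"
        using V_relD(2)[OF F vp, of "[]"] by simp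
      moreover have "(\<Sum>i=1..r. F (p @ [(False, i), (True, i)])) =
        F (p @ [(False, v), (True, v)]) + (\<Sum>i\<in>{1..r} - {v}. F (p @ [(False, i), (True, i)]))"
        using v by (intro sum.remove) auto
      ultimately have "F (p @ [(False, v), (True, v)]) = 0" by simp
      moreover have "F (p @ [(False, v), (True, v)]) = F w" by (rule V_rel_mset[OF F w(1) ms[symmetric]])
      ultimately show False using nz by (simp only:)
    qed
    have e: "x j = y j + int (?c True j) - int (?c False j)" for j using endp_count[of y w j] w(2) by simp
    have "y \<in> mu x"
    proof (rule muI[OF x y])
      show "y j \<le> x j" if "1 \<le> j" "j < idx x" for j using e[of j] c1[of j] that by (simp add: v_def)
      show "x j \<le> y j" if "idx x < j" "j \<le> r" for j using e[of j] c2[of j] that by (simp add: v_def)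
    qed
    moreover have "length w = d1 r y x"
      unfolding length_count[OF w(1)] d1_def
    proof (rule sum.cong[OF refl])
      fix j
      have "?c True j = 0 \<or> ?c False j = 0" using c1[of j] c2[of j] c3 by (cases "j < v"; cases "j = v"; simp)
      then show "?c True j + ?c False j = nat \<bar>y j - x j\<bar>" unfolding e by linarith
    qed
    ultimately show False using False by simp
  qed
  then show ?thesis using False by (simp only: if_False)
qed

text \<open>A geodesic contains no opposite letters, so the loop relation holds with all terms zero;
  and a geodesic from the cone to its apex stays in the cone, away from the smaller
  vertices.\<close>

lemma V_standard_functional:
  assumes x: "x \<in> X" and y: "y \<in> mu x"
  defines "H \<equiv> (\<lambda>w. if mset w = mset (geo r y x) then 1 else (0 :: 'k::field))"
  shows "V_rel r H" "kills r y {t. gt x t} H" "H (geo r y x) \<noteq> 0"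
proof -
  have yL: "y \<in> L" using y mu_iff[OF x] by blast
  have ge: "endp y (geo r y x) = x" using yL X_L[OF x] by simp
  have "mset (a @ [(False, i), (True, i)] @ b) \<noteq> mset (geo r y x)" for a b i
  proof
    assume m: "mset (a @ [(False, i), (True, i)] @ b) = mset (geo r y x)"
    have "count (mset (geo r y x)) (True, i) = 0 \<or> count (mset (geo r y x)) (False, i) = 0"
      using geodesic_count[OF geo_valid, of r y x y _ i] ge by (simp del: count_mset_0_iff count_eq_zero_iff)
    then show False unfolding m[symmetric] by simp
  qed
  moreover have "mset (a @ [s, t] @ b) = mset (a @ [t, s] @ b)" for a b and s t :: step by simp
  ultimately show "V_rel r H" unfolding V_rel_def H_def by (simp del: mset_append mset.simps)
  show "kills r y {t. gt x t} H" unfolding kills_def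
  proof (intro allI impI)
    fix a b assume ab: "valid r a" "valid r b" "endp y a \<in> {t. gt x t}"
    show "H (a @ b) = 0"
    proof (rule ccontr)
      assume "H (a @ b) \<noteq> 0"
      then have m: "mset (a @ b) = mset (geo r y x)" by (auto simp: H_def split: if_splits)
      have e: "endp y (a @ b) = x" using endp_mset[OF m] ge by simp
      have l: "length (a @ b) = d1 r y x" using mset_eq_length[OF m] by simp
      have bt: "(y j \<le> endp y a j \<and> endp y a j \<le> x j) \<or> (x j \<le> endp y a j \<and> endp y a j \<le> y j)" for j
        using geodesic_between[of r a b y j] ab e l by simp
      have "endp y a \<in> mu x"
      proof (rule muI[OF x endp_lattice[OF yL ab(1)]])
        show "endp y a j \<le> x j" if "1 \<le> j" "j < idx x" for j using bt[of j] mu_coord(1)[OF x y that] by linarith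
        show "x j \<le> endp y a j" if "idx x < j" "j \<le> r" for j using bt[of j] mu_coord(2)[OF x y that] by linarith
      qed
      then show False using ab(3) gt_not_mu by blast
    qed
  qed
  show "H (geo r y x) \<noteq> 0" by (simp add: H_def)
qed

end

section \<open>Linear algebra: presented spaces, their quotients and dimensions\<close>

abbreviation scl :: "'k::field \<Rightarrow> ('b \<Rightarrow>\<^sub>0 'k) \<Rightarrow> ('b \<Rightarrow>\<^sub>0 'k)" where
  "scl c \<equiv> Poly_Mapping.map ((*) c)"

lemma lookup_scl: "Poly_Mapping.lookup (scl c f) k = c * Poly_Mapping.lookup f k"
  by (simp add: Poly_Mapping.map.rep_eq when_def)

interpretation pv: vector_space "scl :: 'k::field \<Rightarrow> ('b \<Rightarrow>\<^sub>0 'k) \<Rightarrow> ('b \<Rightarrow>\<^sub>0 'k)"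
  by unfold_locales (auto intro!: poly_mapping_eqI simp: lookup_scl lookup_add algebra_simps)

interpretation pk: vector_space_pair "scl :: 'k::field \<Rightarrow> ('b \<Rightarrow>\<^sub>0 'k) \<Rightarrow> ('b \<Rightarrow>\<^sub>0 'k)" "(*) :: 'k \<Rightarrow> 'k \<Rightarrow> 'k"
  by unfold_locales (auto simp: algebra_simps)

text \<open>A vector space in the sense of the algebra library is described as the image \<open>\<pi> ` S\<close> of a
  space \<open>S\<close> of finitely supported functions, where \<open>\<pi>\<close> identifies functions that differ by
  elements of \<open>N\<close>.\<close>

definition presents :: "(('b \<Rightarrow>\<^sub>0 'k) \<Rightarrow> 'a) \<Rightarrow> ('b \<Rightarrow>\<^sub>0 'k) set \<Rightarrow> ('b \<Rightarrow>\<^sub>0 'k) set \<Rightarrow>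
    ('k::field, 'a, 'm) module_scheme \<Rightarrow> bool" where
  "presents \<pi> S N M \<longleftrightarrow> pv.subspace S \<and> pv.subspace N \<and> carrier M = \<pi> ` S \<and> \<zero>\<^bsub>M\<^esub> = \<pi> 0 \<and>
     (\<forall>f\<in>S. \<forall>g\<in>S. \<pi> f \<oplus>\<^bsub>M\<^esub> \<pi> g = \<pi> (f + g)) \<and> (\<forall>c. \<forall>f\<in>S. c \<odot>\<^bsub>M\<^esub> \<pi> f = \<pi> (scl c f)) \<and>
     (\<forall>f\<in>S. \<forall>g\<in>S. \<pi> f = \<pi> g \<longleftrightarrow> f - g \<in> N)"

lemma presentsD:
  assumes "presents \<pi> S N M"
  shows "pv.subspace S" "pv.subspace N" "carrier M = \<pi> ` S" "\<zero>\<^bsub>M\<^esub> = \<pi> 0"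
    "\<And>f g. f \<in> S \<Longrightarrow> g \<in> S \<Longrightarrow> \<pi> f \<oplus>\<^bsub>M\<^esub> \<pi> g = \<pi> (f + g)"
    "\<And>c f. f \<in> S \<Longrightarrow> c \<odot>\<^bsub>M\<^esub> \<pi> f = \<pi> (scl c f)"
    "\<And>f g. f \<in> S \<Longrightarrow> g \<in> S \<Longrightarrow> \<pi> f = \<pi> g \<longleftrightarrow> f - g \<in> N"
    "0 \<in> S" "\<And>f g. f \<in> S \<Longrightarrow> g \<in> S \<Longrightarrow> f + g \<in> S" "\<And>c f. f \<in> S \<Longrightarrow> scl c f \<in> S" "0 \<in> N"
  using assms unfolding presents_def pv.subspace_def by blast+

lemma presents_module:
  assumes "presents \<pi> S N M"
  shows "module class_ring M"
proof -
  note D = presentsD[OF assms]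
  show ?thesis
  proof (rule module_criteria)
    show "cring (class_ring :: 'b ring)" by (rule class_cring.is_cring)
    show "\<zero>\<^bsub>M\<^esub> \<in> carrier M" using D by auto
    show "\<forall>v w. v \<in> carrier M \<and> w \<in> carrier M \<longrightarrow> v \<oplus>\<^bsub>M\<^esub> w \<in> carrier M" using D by auto
    show "\<forall>v\<in>carrier M. \<exists>n\<in>carrier M. v \<oplus>\<^bsub>M\<^esub> n = \<zero>\<^bsub>M\<^esub>"
    proof
      fix v assume "v \<in> carrier M"
      then obtain f where f: "f \<in> S" "v = \<pi> f" using D(3) by auto
      have "- f \<in> S" using D(1) f(1) by (rule pv.subspace_neg)
      then show "\<exists>n\<in>carrier M. v \<oplus>\<^bsub>M\<^esub> n = \<zero>\<^bsub>M\<^esub>" using f D(3,4,5) by (intro bexI[of _ "\<pi> (- f)"]) auto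
    qed
    show "\<forall>c v. c \<in> carrier (class_ring :: 'b ring) \<and> v \<in> carrier M \<longrightarrow> c \<odot>\<^bsub>M\<^esub> v \<in> carrier M" using D by auto
    show "\<forall>v w. v \<in> carrier M \<and> w \<in> carrier M \<longrightarrow> v \<oplus>\<^bsub>M\<^esub> w = w \<oplus>\<^bsub>M\<^esub> v" using D by (auto simp: add.commute)
    show "\<forall>v w x. v \<in> carrier M \<and> w \<in> carrier M \<and> x \<in> carrier M \<longrightarrow> v \<oplus>\<^bsub>M\<^esub> w \<oplus>\<^bsub>M\<^esub> x = v \<oplus>\<^bsub>M\<^esub> (w \<oplus>\<^bsub>M\<^esub> x)"
      using D by (auto simp: add.assoc)
    show "\<forall>v\<in>carrier M. v \<oplus>\<^bsub>M\<^esub> \<zero>\<^bsub>M\<^esub> = v" using D by auto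
    show "\<forall>a b v. a \<in> carrier (class_ring :: 'b ring) \<and> b \<in> carrier (class_ring :: 'b ring) \<and> v \<in> carrier M \<longrightarrow>
        (a \<otimes>\<^bsub>class_ring\<^esub> b) \<odot>\<^bsub>M\<^esub> v = a \<odot>\<^bsub>M\<^esub> (b \<odot>\<^bsub>M\<^esub> v)" using D by auto
    show "\<forall>v\<in>carrier M. \<one>\<^bsub>class_ring\<^esub> \<odot>\<^bsub>M\<^esub> v = v" using D by auto
    show "\<forall>a b v. a \<in> carrier (class_ring :: 'b ring) \<and> b \<in> carrier (class_ring :: 'b ring) \<and> v \<in> carrier M \<longrightarrow>
        (a \<oplus>\<^bsub>class_ring\<^esub> b) \<odot>\<^bsub>M\<^esub> v = a \<odot>\<^bsub>M\<^esub> v \<oplus>\<^bsub>M\<^esub> b \<odot>\<^bsub>M\<^esub> v" using D by (auto simp: pv.scale_left_distrib)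
    show "\<forall>a v w. a \<in> carrier (class_ring :: 'b ring) \<and> v \<in> carrier M \<and> w \<in> carrier M \<longrightarrow>
        a \<odot>\<^bsub>M\<^esub> (v \<oplus>\<^bsub>M\<^esub> w) = a \<odot>\<^bsub>M\<^esub> v \<oplus>\<^bsub>M\<^esub> a \<odot>\<^bsub>M\<^esub> w" using D by (auto simp: pv.scale_right_distrib)
  qed
qed

lemma presents_restrict:
  assumes "presents \<pi> S N M" "pv.subspace S'" "S' \<subseteq> S"
  shows "presents \<pi> S' N (M\<lparr>carrier := \<pi> ` S'\<rparr>)"
  using assms(2,3) presentsD[OF assms(1)] unfolding presents_def by (auto simp: subset_iff)

lemma presents_submodule:
  assumes "presents \<pi> S N M" "pv.subspace T" "T \<subseteq> S"
  shows "submodule class_ring (\<pi> ` T) M"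
proof -
  note D = presentsD[OF assms(1)]
  note T = assms(2)[unfolded pv.subspace_def]
  show ?thesis
  proof (rule submodule.intro[OF presents_module[OF assms(1)]])
    show "\<pi> ` T \<subseteq> carrier M" using assms(3) D(3) by auto
    show "v \<oplus>\<^bsub>M\<^esub> w \<in> \<pi> ` T" if "v \<in> \<pi> ` T" "w \<in> \<pi> ` T" for v w
      using that assms(3) D(5) T by (auto simp: subset_iff)
    show "\<zero>\<^bsub>M\<^esub> \<in> \<pi> ` T" using D(4) T by auto
    show "c \<odot>\<^bsub>M\<^esub> v \<in> \<pi> ` T" if "v \<in> \<pi> ` T" for c v
      using that assms(3) D(6) T by (auto simp: subset_iff)
  qed
qed

lemma presents_span:
  assumes P: "presents \<pi> S N M" and "T \<subseteq> S"
  shows "lin_span M (\<pi> ` T) = \<pi> ` pv.span T"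
proof
  note D = presentsD[OF P]
  interpret m: module class_ring M by (rule presents_module[OF P])
  have TS: "pv.span T \<subseteq> S" using assms(2) D(1) by (rule pv.span_minimal)
  have TM: "\<pi> ` T \<subseteq> carrier M" using assms(2) D(3) by auto
  show "lin_span M (\<pi> ` T) \<subseteq> \<pi> ` pv.span T"
    using pv.span_superset[of T] by (intro m.span_is_subset presents_submodule[OF P _ TS]) auto
  interpret s: submodule class_ring "lin_span M (\<pi> ` T)" M by (rule m.span_is_submodule[OF TM])
  have "pv.span T \<subseteq> {f \<in> S. \<pi> f \<in> lin_span M (\<pi> ` T)}"
  proof (rule pv.span_minimal)
    show "T \<subseteq> {f \<in> S. \<pi> f \<in> lin_span M (\<pi> ` T)}"
      using assms(2) m.in_own_span[OF TM] by auto
    show "pv.subspace {f \<in> S. \<pi> f \<in> lin_span M (\<pi> ` T)}"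
      unfolding pv.subspace_def
    proof (intro conjI ballI allI)
      show "0 \<in> {f \<in> S. \<pi> f \<in> lin_span M (\<pi> ` T)}" using D(4,8) s.zero_closed by simp
      show "f + g \<in> {f \<in> S. \<pi> f \<in> lin_span M (\<pi> ` T)}"
        if "f \<in> {f \<in> S. \<pi> f \<in> lin_span M (\<pi> ` T)}" "g \<in> {f \<in> S. \<pi> f \<in> lin_span M (\<pi> ` T)}" for f g
        using that D(5,9) s.m_closed[of "\<pi> f" "\<pi> g"] by simp
      show "scl c f \<in> {f \<in> S. \<pi> f \<in> lin_span M (\<pi> ` T)}" if "f \<in> {f \<in> S. \<pi> f \<in> lin_span M (\<pi> ` T)}" for c f
        using that D(6,10) s.smult_closed[of c "\<pi> f"] by simp
    qed
  qed
  then show "\<pi> ` pv.span T \<subseteq> lin_span M (\<pi> ` T)" by auto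
qed

definition set_sum :: "'c::ab_group_add set \<Rightarrow> 'c set \<Rightarrow> 'c set" where
  "set_sum A B = {a + b | a b. a \<in> A \<and> b \<in> B}"

lemma subspace_set_sum: "pv.subspace A \<Longrightarrow> pv.subspace B \<Longrightarrow> pv.subspace (set_sum A B)"
  unfolding set_sum_def using pv.subspace_sums by blast

lemma set_sum_1: "pv.subspace B \<Longrightarrow> A \<subseteq> set_sum A B"
  unfolding set_sum_def using pv.subspace_0 by force

lemma set_sum_2: "pv.subspace A \<Longrightarrow> B \<subseteq> set_sum A B"
  unfolding set_sum_def using pv.subspace_0 by force

lemma presents_coset:
  assumes P: "presents \<pi> S N M" and J: "J \<subseteq> S" and f: "f \<in> S"
  shows "\<pi> ` J +>\<^bsub>M\<^esub> \<pi> f = (\<lambda>n. \<pi> (n + f)) ` J"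
  using presentsD(5)[OF P _ f] J unfolding a_r_coset_def r_coset_def by (auto simp: image_iff subset_iff)

lemma presents_coset_eq:
  assumes P: "presents \<pi> S N M" and J: "pv.subspace J" "J \<subseteq> S" and f: "f \<in> S" "g \<in> S"
  shows "\<pi> ` J +>\<^bsub>M\<^esub> \<pi> f = \<pi> ` J +>\<^bsub>M\<^esub> \<pi> g \<longleftrightarrow> f - g \<in> set_sum N J"
proof
  note D = presentsD[OF P]
  note c = presents_coset[OF P J(2) f(1)] presents_coset[OF P J(2) f(2)]
  assume e: "\<pi> ` J +>\<^bsub>M\<^esub> \<pi> f = \<pi> ` J +>\<^bsub>M\<^esub> \<pi> g"
  have "\<pi> (0 + f) \<in> (\<lambda>n. \<pi> (n + f)) ` J" using pv.subspace_0[OF J(1)] by blast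
  then obtain n where n: "n \<in> J" "\<pi> f = \<pi> (n + g)" using e unfolding c by auto
  then have "f - (n + g) \<in> N" using D(7)[OF f(1), of "n + g"] D(9) J(2) f(2) by blast
  moreover have "f - g = (f - (n + g)) + n" by simp
  ultimately show "f - g \<in> set_sum N J" using n(1) unfolding set_sum_def by blast
next
  note D = presentsD[OF P]
  note c = presents_coset[OF P J(2) f(1)] presents_coset[OF P J(2) f(2)]
  assume "f - g \<in> set_sum N J"
  then obtain a b where ab: "a \<in> N" "b \<in> J" "f - g = a + b" unfolding set_sum_def by blast
  have sub: "(\<lambda>n. \<pi> (n + f)) ` J \<subseteq> (\<lambda>n. \<pi> (n + g)) ` J"
    if ab: "a \<in> N" "b \<in> J" "f - g = a + b" "f \<in> S" "g \<in> S" for a b f g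
  proof
    fix y assume "y \<in> (\<lambda>n. \<pi> (n + f)) ` J"
    then obtain n where n: "n \<in> J" "y = \<pi> (n + f)" by blast
    have "n + f \<in> S" "n + b + g \<in> S" using n(1) ab(2,4,5) J(2) D(9) by (meson subsetD)+
    moreover have "(n + f) - (n + b + g) = a" using ab(3) by (simp add: algebra_simps)
    ultimately have "\<pi> (n + f) = \<pi> (n + b + g)" using D(7) ab(1) by simp
    moreover have "n + b \<in> J" using n(1) ab(2) J(1) by (simp add: pv.subspace_add)
    ultimately show "y \<in> (\<lambda>n. \<pi> (n + g)) ` J" using n(2) by blast
  qed
  have "g - f = - a + - b" using ab(3) by (metis minus_add_distrib minus_diff_eq)
  moreover have "- a \<in> N" "- b \<in> J" using ab(1,2) D(2) J(1) by (simp_all add: pv.subspace_neg)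
  ultimately have "(\<lambda>n. \<pi> (n + g)) ` J \<subseteq> (\<lambda>n. \<pi> (n + f)) ` J" using sub[of "- a" "- b" g f] f by simp
  then show "\<pi> ` J +>\<^bsub>M\<^esub> \<pi> f = \<pi> ` J +>\<^bsub>M\<^esub> \<pi> g" unfolding c using sub[OF ab f] by blast
qed

lemma quot_module_simps:
  "carrier (quot_module M J) = (\<lambda>a. J +>\<^bsub>M\<^esub> a) ` carrier M" "zero (quot_module M J) = J"
  "add (quot_module M J) = set_add M" "mult (quot_module M J) = rcoset_mult M J"
  "smult (quot_module M J) c T = (\<Union>s\<in>T. J +>\<^bsub>M\<^esub> (c \<odot>\<^bsub>M\<^esub> s))"
  by (auto simp: quot_module_def ring.defs module.defs FactRing_def A_RCOSETS_def RCOSETS_def a_r_coset_def)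

lemma quot_algebra_simps:
  "carrier (quot_algebra A J) = (\<lambda>a. J +>\<^bsub>A\<^esub> a) ` carrier A" "zero (quot_algebra A J) = J"
  "add (quot_algebra A J) = set_add A" "mult (quot_algebra A J) = rcoset_mult A J"
  "smult (quot_algebra A J) c T = (\<Union>s\<in>T. J +>\<^bsub>A\<^esub> (c \<odot>\<^bsub>A\<^esub> s))"
  "component (quot_algebra A J) n = (\<lambda>a. J +>\<^bsub>A\<^esub> a) ` component A n"
  "idem (quot_algebra A J) x = J +>\<^bsub>A\<^esub> idem A x"
  by (simp_all add: quot_algebra_def module.defs idem_algebra.defs quot_module_simps)

text \<open>A quotient keeps the space \<open>S\<close> and only enlarges the kernel, so repeated
  quotients are all described by the same finitely supported functions. The target \<open>M'\<close>
  is given through its operations in order to cover module and algebra quotients alike.\<close>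

lemma presents_quot_gen:
  assumes P: "presents \<pi> S N M" and J: "pv.subspace J" "J \<subseteq> S"
    and M': "carrier M' = (\<lambda>a. \<pi> ` J +>\<^bsub>M\<^esub> a) ` carrier M" "zero M' = \<pi> ` J" "add M' = set_add M"
    "\<And>c T. smult M' c T = (\<Union>s\<in>T. \<pi> ` J +>\<^bsub>M\<^esub> (c \<odot>\<^bsub>M\<^esub> s))"
  shows "presents (\<lambda>f. \<pi> ` J +>\<^bsub>M\<^esub> \<pi> f) S (set_sum N J) M'"
proof -
  note D = presentsD[OF P]
  note c = presents_coset[OF P J(2)]
  note ceq = presents_coset_eq[OF P J]
  have add: "(\<pi> ` J +>\<^bsub>M\<^esub> \<pi> f) \<oplus>\<^bsub>M'\<^esub> (\<pi> ` J +>\<^bsub>M\<^esub> \<pi> g) = \<pi> ` J +>\<^bsub>M\<^esub> \<pi> (f + g)" if fg: "f \<in> S" "g \<in> S" for f g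
  proof -
    have "(\<pi> ` J +>\<^bsub>M\<^esub> \<pi> f) \<oplus>\<^bsub>M'\<^esub> (\<pi> ` J +>\<^bsub>M\<^esub> \<pi> g) = (\<Union>n\<in>J. \<Union>n'\<in>J. {\<pi> (n + f) \<oplus>\<^bsub>M\<^esub> \<pi> (n' + g)})"
      unfolding c[OF fg(1)] c[OF fg(2)] M'(3) set_add_def set_mult_def by auto
    also have "\<dots> = (\<Union>n\<in>J. \<Union>n'\<in>J. {\<pi> ((n + n') + (f + g))})"
    proof (intro SUP_cong refl)
      fix n n' assume n: "n \<in> J" "n' \<in> J"
      have "\<pi> (n + f) \<oplus>\<^bsub>M\<^esub> \<pi> (n' + g) = \<pi> ((n + f) + (n' + g))" using n fg J(2) D(9) by (intro D(5)) auto
      then show "{\<pi> (n + f) \<oplus>\<^bsub>M\<^esub> \<pi> (n' + g)} = {\<pi> ((n + n') + (f + g))}" by (simp add: algebra_simps)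
    qed
    also have "\<dots> = (\<lambda>n. \<pi> (n + (f + g))) ` J"
    proof
      show "(\<Union>n\<in>J. \<Union>n'\<in>J. {\<pi> ((n + n') + (f + g))}) \<subseteq> (\<lambda>n. \<pi> (n + (f + g))) ` J"
        using pv.subspace_add[OF J(1)] by blast
      show "(\<lambda>n. \<pi> (n + (f + g))) ` J \<subseteq> (\<Union>n\<in>J. \<Union>n'\<in>J. {\<pi> ((n + n') + (f + g))})"
      proof
        fix y assume "y \<in> (\<lambda>n. \<pi> (n + (f + g))) ` J"
        then obtain n where "n \<in> J" "y = \<pi> ((n + 0) + (f + g))" by auto
        then show "y \<in> (\<Union>n\<in>J. \<Union>n'\<in>J. {\<pi> ((n + n') + (f + g))})" using pv.subspace_0[OF J(1)] by blast
      qed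
    qed
    finally show ?thesis using c[of "f + g"] D(9)[OF fg] by simp
  qed
  have smult: "k \<odot>\<^bsub>M'\<^esub> (\<pi> ` J +>\<^bsub>M\<^esub> \<pi> f) = \<pi> ` J +>\<^bsub>M\<^esub> \<pi> (scl k f)" if f: "f \<in> S" for k f
  proof -
    have "\<pi> ` J +>\<^bsub>M\<^esub> (k \<odot>\<^bsub>M\<^esub> \<pi> (n + f)) = \<pi> ` J +>\<^bsub>M\<^esub> \<pi> (scl k f)" if n: "n \<in> J" for n
    proof -
      have S: "n + f \<in> S" using n f J(2) D(9) by auto
      have "scl k (n + f) - scl k f = scl k n" by (simp add: pv.scale_right_distrib)
      also have "\<dots> \<in> J" using n J(1) by (simp add: pv.subspace_scale)
      finally have "scl k (n + f) - scl k f \<in> set_sum N J" using set_sum_2[OF D(2)] by blast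
      then show ?thesis using ceq[of "scl k (n + f)" "scl k f"] D(6)[OF S] D(10) S f by simp
    qed
    then show ?thesis unfolding M'(4) c[OF f] using pv.subspace_0[OF J(1)] by auto
  qed
  have zero: "\<pi> ` J = \<pi> ` J +>\<^bsub>M\<^esub> \<pi> 0" unfolding c[OF D(8)] by simp
  show ?thesis
    unfolding presents_def
    using D(1) subspace_set_sum[OF D(2) J(1)] M'(1,2) D(3) zero add smult ceq by (auto simp: image_image)
qed

lemma presents_quot_module:
  "presents \<pi> S N M \<Longrightarrow> pv.subspace J \<Longrightarrow> J \<subseteq> S \<Longrightarrow>
    presents (\<lambda>f. \<pi> ` J +>\<^bsub>M\<^esub> \<pi> f) S (set_sum N J) (quot_module M (\<pi> ` J))"
  by (rule presents_quot_gen) (simp_all add: quot_module_simps)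

lemma presents_quot_algebra:
  "presents \<pi> S N A \<Longrightarrow> pv.subspace J \<Longrightarrow> J \<subseteq> S \<Longrightarrow>
    presents (\<lambda>f. \<pi> ` J +>\<^bsub>A\<^esub> \<pi> f) S (set_sum N J) (quot_algebra A (\<pi> ` J))"
  by (rule presents_quot_gen) (simp_all add: quot_algebra_simps)

text \<open>Independence and spanning are tested on representatives modulo \<open>N\<close>. Bases
  are sets, so the family must first be seen to be injective, which is independence applied to the
  difference of two members.\<close>

lemma presents_dim:
  assumes P: "presents \<pi> S N M" and E: "pv.subspace E" "E \<subseteq> S" and B: "finite B" "\<And>b. b \<in> B \<Longrightarrow> p b \<in> E"
    and indep: "\<And>c. (\<Sum>b\<in>B. scl (c b) (p b)) \<in> N \<Longrightarrow> \<forall>b\<in>B. c b = 0"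
    and span: "\<And>f. f \<in> E \<Longrightarrow> \<exists>c. f - (\<Sum>b\<in>B. scl (c b) (p b)) \<in> N"
  shows "sub_dim M (\<pi> ` E) = card B"
proof -
  define M' where "M' = M\<lparr>carrier := \<pi> ` E\<rparr>"
  have P': "presents \<pi> E N M'" unfolding M'_def by (rule presents_restrict[OF P E])
  note D = presentsD[OF P']
  interpret v: vectorspace class_ring M'
    by (rule vectorspace.intro[OF presents_module[OF P'] class_field])
  have inj: "inj_on (\<lambda>b. \<pi> (p b)) B"
  proof
    fix a b assume ab: "a \<in> B" "b \<in> B" "\<pi> (p a) = \<pi> (p b)"
    show "a = b"
    proof (rule ccontr)
      assume "a \<noteq> b"
      define c where "c = (\<lambda>x. if x = a then 1 else if x = b then - 1 else (0 :: 'b))"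
      have "(\<Sum>x\<in>B. scl (c x) (p x)) = (\<Sum>x\<in>{a, b}. scl (c x) (p x))"
        using ab B(1) by (intro sum.mono_neutral_right) (auto simp: c_def)
      also have "\<dots> = p a - p b" using \<open>a \<noteq> b\<close> by (simp add: c_def)
      also have "\<dots> \<in> N" using ab D(7)[of "p a" "p b"] B(2) by simp
      finally show False using indep[of c] ab(1) by (auto simp: c_def)
    qed
  qed
  let ?A = "(\<lambda>b. \<pi> (p b)) ` B"
  have AM: "?A \<subseteq> carrier M'" using B(2) D(3) by auto
  have lc: "v.lincomb a ((\<lambda>b. \<pi> (p b)) ` C) = \<pi> (\<Sum>b\<in>C. scl (a (\<pi> (p b))) (p b)) \<and> (\<Sum>b\<in>C. scl (a (\<pi> (p b))) (p b)) \<in> E"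
    if "C \<subseteq> B" for a C
    using finite_subset[OF that B(1)] that
  proof (induction C)
    case empty
    then show ?case using D(4,8) by (simp add: v.lincomb_def)
  next
    case (insert b C)
    have b: "b \<in> B" "p b \<in> E" using insert B(2) by auto
    have nin: "\<pi> (p b) \<notin> (\<lambda>b. \<pi> (p b)) ` C" using inj insert by (auto simp: inj_on_def)
    have "v.lincomb a ((\<lambda>b. \<pi> (p b)) ` insert b C) = (a (\<pi> (p b)) \<odot>\<^bsub>M'\<^esub> \<pi> (p b)) \<oplus>\<^bsub>M'\<^esub> v.lincomb a ((\<lambda>b. \<pi> (p b)) ` C)"
      using v.lincomb_insert2[of "(\<lambda>b. \<pi> (p b)) ` C" a "\<pi> (p b)"] insert AM nin D(3) b by auto
    also have "\<dots> = \<pi> (scl (a (\<pi> (p b))) (p b) + (\<Sum>b\<in>C. scl (a (\<pi> (p b))) (p b)))"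
      using insert b D(5,6,10) by simp
    finally show ?case using insert b D(9,10) by simp
  qed
  have "v.lin_indpt ?A"
  proof
    assume "v.lin_dep ?A"
    then obtain a w where aw: "v.lincomb a ?A = \<zero>\<^bsub>M'\<^esub>" "w \<in> ?A" "a w \<noteq> 0"
      using v.finite_lin_dep[of ?A] B(1) AM by auto
    have "(\<Sum>b\<in>B. scl (a (\<pi> (p b))) (p b)) - 0 \<in> N"
      using aw(1) lc[OF order.refl, of a] D(4) D(7)[of "\<Sum>b\<in>B. scl (a (\<pi> (p b))) (p b)" 0] D(8) by simp
    then show False using indep[of "\<lambda>b. a (\<pi> (p b))"] aw(2,3) by auto
  qed
  moreover have "v.gen_set ?A"
  proof
    show "v.span ?A \<subseteq> carrier M'" by (rule v.span_is_subset2[OF AM])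
    show "carrier M' \<subseteq> v.span ?A"
    proof
      fix x assume "x \<in> carrier M'"
      then obtain f where f: "f \<in> E" "x = \<pi> f" using D(3) by auto
      obtain c where c: "f - (\<Sum>b\<in>B. scl (c b) (p b)) \<in> N" using span[OF f(1)] by blast
      define a where "a = (\<lambda>x. c (the_inv_into B (\<lambda>b. \<pi> (p b)) x))"
      have a: "a (\<pi> (p b)) = c b" if "b \<in> B" for b using the_inv_into_f_f[OF inj that] by (simp add: a_def)
      have s: "(\<Sum>b\<in>B. scl (a (\<pi> (p b))) (p b)) = (\<Sum>b\<in>B. scl (c b) (p b))" using a by (intro sum.cong) auto
      have "x = v.lincomb a ?A" using f c lc[OF order.refl, of a] D(7)[of f "\<Sum>b\<in>B. scl (c b) (p b)"] by (simp add: s)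
      moreover have "finite ?A" "a \<in> ?A \<rightarrow> carrier class_ring" using B(1) by auto
      ultimately show "x \<in> v.span ?A" unfolding v.span_def by blast
    qed
  qed
  ultimately have "v.basis ?A" using AM by (simp add: v.basis_def)
  then have "v.dim = card ?A" using B(1) by (intro v.dim_basis) auto
  also have "card ?A = card B" by (rule card_image[OF inj])
  finally show ?thesis by (simp add: M'_def)
qed

text \<open>A basis of the span of \<open>N\<close> stays independent when \<open>f\<close> is
  added, so values of a functional can be prescribed on it.\<close>

lemma separate:
  fixes N :: "('b \<Rightarrow>\<^sub>0 'k::field) set"
  assumes "f \<notin> pv.span N"
  obtains \<psi> where "Vector_Spaces.linear scl (*) \<psi>" "\<And>g. g \<in> N \<Longrightarrow> \<psi> g = 0" "\<psi> f = (1 :: 'k)"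
proof -
  obtain B where B: "B \<subseteq> N" "pv.independent B" "N \<subseteq> pv.span B"
    using pv.maximal_independent_subset[of N] by blast
  have "f \<notin> pv.span B" using assms pv.span_mono[OF B(1)] by blast
  then have "pv.independent (insert f B)" using B(2) by (rule pv.independent_insertI)
  then obtain \<psi> where \<psi>: "Vector_Spaces.linear scl (*) \<psi>" "\<forall>x\<in>insert f B. \<psi> x = (if x = f then 1 else 0)"
    using pk.linear_independent_extend[of "insert f B" "\<lambda>x. if x = f then 1 else 0"] by blast
  have fB: "f \<notin> B" using \<open>f \<notin> pv.span B\<close> pv.span_base by blast
  have "\<psi> b = 0" if "b \<in> B" for b using \<psi>(2) fB that by auto
  then have "\<psi> g = 0" if "g \<in> pv.span B" for g
    using pk.linear_eq_0_on_span[OF \<psi>(1) _ that] by blast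
  then have "\<psi> g = 0" if "g \<in> N" for g using that B(3) by blast
  moreover have "\<psi> f = 1" using \<psi>(2) by simp
  ultimately show ?thesis using that[OF \<psi>(1)] by blast
qed

subsection \<open>Paths of the lattice quiver\<close>

definition arrow_of :: "point \<Rightarrow> step \<Rightarrow> arrow" where
  "arrow_of u s = (if fst s then Up u (snd s) else Down u (snd s))"

text \<open>Arrows record their tails, so a path amounts to a start and a word;
  \<open>step_of\<close> forgets the tails again.\<close>

fun walk :: "point \<Rightarrow> step list \<Rightarrow> arrow list" where
  "walk u [] = []"
| "walk u (s # w) = arrow_of u s # walk (mv u s) w"

fun step_of :: "arrow \<Rightarrow> step" where
  "step_of (Up x i) = (True, i)"
| "step_of (Down x i) = (False, i)"

lemma step_of_walk [simp]: "map step_of (walk u w) = w"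
  by (induction w arbitrary: u) (auto simp: arrow_of_def)

lemma length_walk [simp]: "length (walk u w) = length w"
  by (induction w arbitrary: u) auto

lemma walk_append: "walk u (v @ w) = walk u v @ walk (endp u v) w"
  by (induction v arbitrary: u) auto

lemma quiver_arrow:
  "tail (lattice_quiver r) (arrow_of u s) = u" "head (lattice_quiver r) (arrow_of u s) = mv u s"
  "arrow_of u s \<in> arcs (lattice_quiver r) \<longleftrightarrow> u \<in> lattice_pts r \<and> snd s \<in> {1..r}"
  by (auto simp: lattice_quiver_def arrow_of_def mv_def up_def down_def sg_def)

lemma arc_arrow_of:
  assumes "e \<in> arcs (lattice_quiver r)"
  obtains s where "e = arrow_of (tail (lattice_quiver r) e) s" "snd s \<in> {1..r}"
proof -
  have "\<exists>u s. e = arrow_of u s \<and> snd s \<in> {1..r}"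
  proof -
    from assms consider x i where "e = Up x i" "i \<in> {1..r}" | x i where "e = Down x i" "i \<in> {1..r}"
      by (auto simp: lattice_quiver_def)
    then show ?thesis
    proof cases
      case 1
      then have "e = arrow_of x (True, i) \<and> snd (True, i) \<in> {1..r}" by (simp add: arrow_of_def)
      then show ?thesis by blast
    next
      case 2
      then have "e = arrow_of x (False, i) \<and> snd (False, i) \<in> {1..r}" by (simp add: arrow_of_def)
      then show ?thesis by blast
    qed
  qed
  then show ?thesis using that by (metis quiver_arrow(1))
qed

lemma awalk_iff:
  "pre_digraph.awalk (lattice_quiver r) u p v \<longleftrightarrow>
     u \<in> lattice_pts r \<and> (\<exists>w. valid r w \<and> p = walk u w \<and> v = endp u w)"
proof -
  have cas: "set p \<subseteq> arcs (lattice_quiver r) \<and> pre_digraph.cas (lattice_quiver r) u p v \<longleftrightarrow>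
      (\<exists>w. valid r w \<and> p = walk u w \<and> v = endp u w)" if "u \<in> lattice_pts r" for u
    using that
  proof (induction p arbitrary: u)
    case Nil
    have "walk u w = [] \<longleftrightarrow> w = []" for w by (cases w) simp_all
    then have "(\<exists>w. valid r w \<and> [] = walk u w \<and> v = endp u w) \<longleftrightarrow> u = v"
      by (metis endp_simps(1) valid_simps(1))
    then show ?case by (simp add: pre_digraph.cas.simps)
  next
    case (Cons e p)
    show ?case
    proof
      assume a: "set (e # p) \<subseteq> arcs (lattice_quiver r) \<and> pre_digraph.cas (lattice_quiver r) u (e # p) v"
      then have e: "e \<in> arcs (lattice_quiver r)" "tail (lattice_quiver r) e = u"
        by (auto simp: pre_digraph.cas.simps)
      obtain s where s: "e = arrow_of u s" "snd s \<in> {1..r}" using arc_arrow_of[OF e(1)] e(2) by metis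
      have "set p \<subseteq> arcs (lattice_quiver r) \<and> pre_digraph.cas (lattice_quiver r) (mv u s) p v"
        using a s by (simp add: pre_digraph.cas.simps quiver_arrow)
      then obtain w where "valid r w" "p = walk (mv u s) w" "v = endp (mv u s) w"
        using Cons.IH[OF mv_lattice[OF Cons.prems s(2)]] by blast
      then show "\<exists>w. valid r w \<and> e # p = walk u w \<and> v = endp u w"
        using s by (intro exI[of _ "s # w"]) simp
    next
      assume "\<exists>w. valid r w \<and> e # p = walk u w \<and> v = endp u w"
      then obtain w where w: "valid r w" "e # p = walk u w" "v = endp u w" by blast
      then obtain s w' where sw: "w = s # w'" by (cases w) auto
      have "set p \<subseteq> arcs (lattice_quiver r) \<and> pre_digraph.cas (lattice_quiver r) (mv u s) p v"
        using w sw Cons.IH[OF mv_lattice[OF Cons.prems, of s]] by auto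
      then show "set (e # p) \<subseteq> arcs (lattice_quiver r) \<and> pre_digraph.cas (lattice_quiver r) u (e # p) v"
        using w sw Cons.prems by (simp add: pre_digraph.cas.simps quiver_arrow)
    qed
  qed
  have "verts (lattice_quiver r) = lattice_pts r" by (simp add: lattice_quiver_def)
  then show ?thesis unfolding pre_digraph.awalk_def using cas by auto
qed

definition pel :: "point \<Rightarrow> step list \<Rightarrow> 'k::field lattice_path_elem" where
  "pel u w = Poly_Mapping.single (u, walk u w) 1"

abbreviation pm :: "nat \<Rightarrow> 'k::field lattice_path_elem \<Rightarrow> 'k lattice_path_elem \<Rightarrow> 'k lattice_path_elem" where
  "pm r \<equiv> path_mult (lattice_quiver r)"

lemma pm_eq:
  "pm r f g = (\<Sum>k\<in>Poly_Mapping.keys f. \<Sum>l\<in>Poly_Mapping.keys g.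
     if pre_digraph.awalk (lattice_quiver r) (fst k) (snd k) (fst l)
     then Poly_Mapping.single (fst k, snd k @ snd l) (Poly_Mapping.lookup f k * Poly_Mapping.lookup g l) else 0)"
  by (simp add: path_mult_def case_prod_unfold cong: if_cong)

lemma pm_add_left: "pm r (f + f') g = pm r f g + pm r f' g"
  unfolding pm_eq
proof (rule setsum_keys_plus_distrib)
  fix k
  show "(\<Sum>l\<in>Poly_Mapping.keys g. if pre_digraph.awalk (lattice_quiver r) (fst k) (snd k) (fst l)
     then Poly_Mapping.single (fst k, snd k @ snd l) (0 * Poly_Mapping.lookup g l) else 0) = 0"
    by (simp cong: if_cong)
  show "(\<Sum>l\<in>Poly_Mapping.keys g. if pre_digraph.awalk (lattice_quiver r) (fst k) (snd k) (fst l)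
     then Poly_Mapping.single (fst k, snd k @ snd l) ((Poly_Mapping.lookup f k + Poly_Mapping.lookup f' k) * Poly_Mapping.lookup g l) else 0) =
   (\<Sum>l\<in>Poly_Mapping.keys g. if pre_digraph.awalk (lattice_quiver r) (fst k) (snd k) (fst l)
     then Poly_Mapping.single (fst k, snd k @ snd l) (Poly_Mapping.lookup f k * Poly_Mapping.lookup g l) else 0) +
   (\<Sum>l\<in>Poly_Mapping.keys g. if pre_digraph.awalk (lattice_quiver r) (fst k) (snd k) (fst l)
     then Poly_Mapping.single (fst k, snd k @ snd l) (Poly_Mapping.lookup f' k * Poly_Mapping.lookup g l) else 0)"
    unfolding sum.distrib[symmetric] by (intro sum.cong) (simp_all add: single_add distrib_right)
qed

lemma pm_add_right: "pm r f (g + g') = pm r f g + pm r f g'"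
  unfolding pm_eq sum.distrib[symmetric]
  by (intro sum.cong refl setsum_keys_plus_distrib) (auto simp: single_add distrib_left)

lemma keys_scl: "c \<noteq> 0 \<Longrightarrow> Poly_Mapping.keys (scl c f) = Poly_Mapping.keys f"
  by (auto simp: in_keys_iff lookup_scl)

lemma scl_single: "scl c (Poly_Mapping.single k a) = Poly_Mapping.single k (c * a)"
  by (simp add: map_single)

lemma pm_zero [simp]: "pm r 0 g = 0" "pm r f 0 = 0"
  by (simp_all add: pm_eq)

text \<open>One summand of the product, isolated so that scalars can be pulled through the case
  distinction.\<close>

definition pterm :: "nat \<Rightarrow> point \<times> arrow list \<Rightarrow> point \<times> arrow list \<Rightarrow> 'k::field \<Rightarrow> 'k lattice_path_elem" where
  "pterm r k l c = (if pre_digraph.awalk (lattice_quiver r) (fst k) (snd k) (fst l)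
     then Poly_Mapping.single (fst k, snd k @ snd l) c else 0)"

lemma pm_pterm:
  "pm r f g = (\<Sum>k\<in>Poly_Mapping.keys f. \<Sum>l\<in>Poly_Mapping.keys g.
     pterm r k l (Poly_Mapping.lookup f k * Poly_Mapping.lookup g l))"
  by (simp add: pm_eq pterm_def)

lemma pterm_scl: "pterm r k l (c * a) = scl c (pterm r k l a)"
  by (simp add: pterm_def scl_single)

lemma pm_scl_left: "pm r (scl c f) g = scl c (pm r f g)"
proof (cases "c = 0")
  case True
  then show ?thesis using pv.scale_zero_left[of f] pv.scale_zero_left[of "pm r f g"] by (metis pm_zero(1))
next
  case False
  have "pm r (scl c f) g = (\<Sum>k\<in>Poly_Mapping.keys f. \<Sum>l\<in>Poly_Mapping.keys g.
     scl c (pterm r k l (Poly_Mapping.lookup f k * Poly_Mapping.lookup g l)))"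
    unfolding pm_pterm[of r "scl c f"] keys_scl[OF False] lookup_scl mult.assoc pterm_scl by (rule refl)
  also have "\<dots> = scl c (pm r f g)" by (simp only: pm_pterm[of r f g] pv.scale_sum_right)
  finally show ?thesis .
qed

lemma pm_scl_right: "pm r f (scl c g) = scl c (pm r f g)"
proof (cases "c = 0")
  case True
  then show ?thesis using pv.scale_zero_left[of g] pv.scale_zero_left[of "pm r f g"] by (metis pm_zero(2))
next
  case False
  have "pm r f (scl c g) = (\<Sum>k\<in>Poly_Mapping.keys f. \<Sum>l\<in>Poly_Mapping.keys g.
     scl c (pterm r k l (Poly_Mapping.lookup f k * Poly_Mapping.lookup g l)))"
    unfolding pm_pterm[of r f "scl c g"] keys_scl[OF False] lookup_scl mult.left_commute[of _ c] pterm_scl by (rule refl)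
  also have "\<dots> = scl c (pm r f g)" by (simp only: pm_pterm[of r f g] pv.scale_sum_right)
  finally show ?thesis .
qed

lemma pm_pel:
  assumes "u \<in> lattice_pts r" "valid r a"
  shows "pm r (pel u a) (pel v b) = (if v = endp u a then pel u (a @ b) else 0 :: 'k::field lattice_path_elem)"
proof -
  have "pre_digraph.awalk (lattice_quiver r) u (walk u a) v \<longleftrightarrow> v = endp u a"
    using assms step_of_walk unfolding awalk_iff by metis
  moreover have "Poly_Mapping.keys (pel u w :: 'k lattice_path_elem) = {(u, walk u w)}" for u w by (simp add: pel_def)
  moreover have "Poly_Mapping.lookup (pel u w) (u, walk u w) = (1 :: 'k)" for u w by (simp add: pel_def)
  ultimately show ?thesis by (simp add: pm_pterm pterm_def) (simp add: pel_def walk_append)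
qed

definition Pth :: "nat \<Rightarrow> 'k::field lattice_path_elem set" where
  "Pth r = path_carrier (lattice_quiver r)"

lemma span_keys:
  assumes "\<And>k. k \<in> Poly_Mapping.keys f \<Longrightarrow> Poly_Mapping.single k (1 :: 'k::field) \<in> T"
  shows "f \<in> pv.span T"
proof -
  have "f = (\<Sum>k\<in>Poly_Mapping.keys f. scl (Poly_Mapping.lookup f k) (Poly_Mapping.single k 1))"
    by (rule poly_mapping_eqI) (simp add: lookup_sum scl_single lookup_single when_def in_keys_iff)
  also have "\<dots> \<in> pv.span T" using assms by (intro pv.span_sum pv.span_scale pv.span_base)
  finally show ?thesis .
qed

lemma keys_subspace: "pv.subspace {f. \<forall>k\<in>Poly_Mapping.keys f. R k}"
  unfolding pv.subspace_def
proof (intro conjI ballI allI)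
  show "f + g \<in> {f. \<forall>k\<in>Poly_Mapping.keys f. R k}"
    if "f \<in> {f. \<forall>k\<in>Poly_Mapping.keys f. R k}" "g \<in> {f. \<forall>k\<in>Poly_Mapping.keys f. R k}" for f g
    using that keys_add[of f g] by blast
  show "scl c f \<in> {f. \<forall>k\<in>Poly_Mapping.keys f. R k}" if "f \<in> {f. \<forall>k\<in>Poly_Mapping.keys f. R k}" for c f
    using that by (auto simp: in_keys_iff lookup_scl)
qed simp

lemma Pth_span: "(Pth r :: 'k::field lattice_path_elem set) = pv.span {pel u w | u w. u \<in> lattice_pts r \<and> valid r w}"
proof
  show "(Pth r :: 'k lattice_path_elem set) \<subseteq> pv.span {pel u w | u w. u \<in> lattice_pts r \<and> valid r w}"
  proof (rule subsetI, rule span_keys)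
    fix f :: "'k lattice_path_elem" and k assume "f \<in> Pth r" "k \<in> Poly_Mapping.keys f"
    then obtain v where "pre_digraph.awalk (lattice_quiver r) (fst k) (snd k) v"
      by (auto simp: Pth_def path_carrier_def)
    then obtain w where w: "fst k \<in> lattice_pts r" "valid r w" "snd k = walk (fst k) w"
      unfolding awalk_iff by auto
    then have "Poly_Mapping.single k 1 = pel (fst k) w" by (metis pel_def prod.collapse)
    then show "Poly_Mapping.single k (1 :: 'k) \<in> {pel u w | u w. u \<in> lattice_pts r \<and> valid r w}"
      using w by blast
  qed
  have *: "(Pth r :: 'k lattice_path_elem set) = {f. \<forall>k\<in>Poly_Mapping.keys f. \<exists>v. pre_digraph.awalk (lattice_quiver r) (fst k) (snd k) v}"
    by (simp add: Pth_def path_carrier_def case_prod_unfold)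
  have "pv.subspace (Pth r :: 'k lattice_path_elem set)" unfolding * by (rule keys_subspace)
  then show "pv.span {pel u w | u w. u \<in> lattice_pts r \<and> valid r w} \<subseteq> (Pth r :: 'k lattice_path_elem set)"
    by (intro pv.span_minimal) (auto simp: Pth_def path_carrier_def awalk_iff pel_def)
qed

lemma pel_Pth [simp]: "u \<in> lattice_pts r \<Longrightarrow> valid r w \<Longrightarrow> pel u w \<in> Pth r"
  unfolding Pth_span by (rule pv.span_base) blast

lemma Pth_subspace: "pv.subspace (Pth r)"
  unfolding Pth_span by (rule pv.subspace_span)

text \<open>Bilinearity as an induction principle: closure of products is checked on generators
  only.\<close>

lemma pm_span:
  assumes "f \<in> pv.span A" "g \<in> pv.span B" "pv.subspace T" "\<And>a b. a \<in> A \<Longrightarrow> b \<in> B \<Longrightarrow> pm r a b \<in> T"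
  shows "pm r f g \<in> T"
proof -
  note T = assms(3)[unfolded pv.subspace_def]
  have 1: "pm r a g \<in> T" if "a \<in> A" for a
    using assms(2)
  proof (rule pv.span_induct)
    show "pv.subspace {g. pm r a g \<in> T}" using T by (auto simp: pv.subspace_def pm_add_right pm_scl_right)
  qed (use assms(4) that in auto)
  show ?thesis using assms(1)
  proof (rule pv.span_induct)
    show "pv.subspace {f. pm r f g \<in> T}" using T by (auto simp: pv.subspace_def pm_add_left pm_scl_left)
  qed (use 1 in auto)
qed

lemma pm_Pth: "f \<in> Pth r \<Longrightarrow> g \<in> Pth r \<Longrightarrow> pm r f g \<in> Pth r"
proof -
  assume f: "f \<in> Pth r" and g: "g \<in> Pth r"
  show ?thesis
    by (rule pm_span[OF f[unfolded Pth_span] g[unfolded Pth_span] Pth_subspace])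
      (auto simp: pm_pel pv.subspace_0[OF Pth_subspace])
qed

lemma Pth_induct [consumes 1, case_names sub base]:
  assumes "f \<in> Pth r" "pv.subspace {f. R f}" "\<And>u w. u \<in> lattice_pts r \<Longrightarrow> valid r w \<Longrightarrow> R (pel u w)"
  shows "R f"
  using assms(1) unfolding Pth_span
  by (rule pv.span_induct) (use assms(2,3) in auto)

lemma pm_assoc:
  assumes "f \<in> Pth r" "g \<in> Pth r" "h \<in> Pth r"
  shows "pm r (pm r f g) h = pm r f (pm r g h)"
  using assms(1)
proof (induction f rule: Pth_induct)
  case sub
  show ?case by (auto simp: pv.subspace_def pm_add_left pm_scl_left)
next
  case f: (base u a)
  show ?case using assms(2)
  proof (induction g rule: Pth_induct)
    case sub
    show ?case by (auto simp: pv.subspace_def pm_add_left pm_scl_left pm_add_right pm_scl_right)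
  next
    case g: (base v b)
    show ?case using assms(3)
    proof (induction h rule: Pth_induct)
      case sub
      show ?case by (auto simp: pv.subspace_def pm_add_right pm_scl_right)
    next
      case h: (base w c)
      show ?case using f g h by (auto simp: pm_pel)
    qed
  qed
qed

subsection \<open>Ideals and homogeneous parts\<close>

definition two_sided :: "nat \<Rightarrow> 'k::field lattice_path_elem set \<Rightarrow> 'k lattice_path_elem set" where
  "two_sided r T = pv.span {pm r (pm r a t) b | a t b. a \<in> Pth r \<and> t \<in> T \<and> b \<in> Pth r}"

definition homog :: "nat \<Rightarrow> nat \<Rightarrow> 'k::field lattice_path_elem set" where
  "homog r n = {f \<in> Pth r. \<forall>(u, p)\<in>Poly_Mapping.keys f. length p = n}"

text \<open>The part of degree \<open>n\<close> between the idempotents at \<open>x\<close> and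
  \<open>y\<close>; all four matrices measure images of such spaces.\<close>

definition Ewd :: "nat \<Rightarrow> point \<Rightarrow> point \<Rightarrow> nat \<Rightarrow> 'k::field lattice_path_elem set" where
  "Ewd r x y n = pv.span {pel x w | w. valid r w \<and> endp x w = y \<and> length w = n}"

lemma two_sided_subspace: "pv.subspace (two_sided r T)"
  unfolding two_sided_def by (rule pv.subspace_span)

lemma two_sided_Pth: "T \<subseteq> Pth r \<Longrightarrow> two_sided r T \<subseteq> Pth r"
  unfolding two_sided_def by (rule pv.span_minimal[OF _ Pth_subspace]) (auto intro!: pm_Pth)

lemma two_sided_mult:
  assumes T: "T \<subseteq> Pth r" and f: "f \<in> Pth r" and n: "n \<in> two_sided r T"
  shows "pm r f n \<in> two_sided r T" "pm r n f \<in> two_sided r T"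
proof -
  have f': "f \<in> pv.span {f}" by (simp add: pv.span_base)
  show "pm r f n \<in> two_sided r T"
  proof (rule pm_span[OF f' n[unfolded two_sided_def] two_sided_subspace])
    fix g h assume g: "g \<in> {f}" and "h \<in> {pm r (pm r a t) b | a t b. a \<in> Pth r \<and> t \<in> T \<and> b \<in> Pth r}"
    then obtain a t b where h: "h = pm r (pm r a t) b" "a \<in> Pth r" "t \<in> T" "b \<in> Pth r" by blast
    have "pm r g h = pm r (pm r (pm r f a) t) b" using h f T g by (auto simp: pm_assoc pm_Pth subset_iff)
    moreover have "pm r f a \<in> Pth r" using f h by (simp add: pm_Pth)
    ultimately show "pm r g h \<in> two_sided r T" unfolding two_sided_def using h by (intro pv.span_base) blast
  qed
  show "pm r n f \<in> two_sided r T"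
  proof (rule pm_span[OF n[unfolded two_sided_def] f' two_sided_subspace])
    fix g h assume g: "g \<in> {f}" and "h \<in> {pm r (pm r a t) b | a t b. a \<in> Pth r \<and> t \<in> T \<and> b \<in> Pth r}"
    then obtain a t b where h: "h = pm r (pm r a t) b" "a \<in> Pth r" "t \<in> T" "b \<in> Pth r" by blast
    have "pm r h g = pm r (pm r a t) (pm r b f)" using h f T g by (auto simp: pm_assoc pm_Pth subset_iff)
    moreover have "pm r b f \<in> Pth r" using f h by (simp add: pm_Pth)
    ultimately show "pm r h g \<in> two_sided r T" unfolding two_sided_def using h by (intro pv.span_base) blast
  qed
qed

lemma homog_Pth: "f \<in> homog r n \<Longrightarrow> f \<in> Pth r"
  by (simp add: homog_def)

lemma homog_span: "(homog r n :: 'k::field lattice_path_elem set) \<subseteq> pv.span {pel u w | u w. u \<in> lattice_pts r \<and> valid r w \<and> length w = n}"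
proof (rule subsetI, rule span_keys)
  fix f :: "'k lattice_path_elem" and k assume f: "f \<in> homog r n" and k: "k \<in> Poly_Mapping.keys f"
  then obtain v where "pre_digraph.awalk (lattice_quiver r) (fst k) (snd k) v" "length (snd k) = n"
    unfolding homog_def Pth_def path_carrier_def case_prod_unfold by blast
  then obtain w where w: "fst k \<in> lattice_pts r" "valid r w" "snd k = walk (fst k) w" "length w = n"
    unfolding awalk_iff by auto
  then have "Poly_Mapping.single k 1 = pel (fst k) w" by (metis pel_def prod.collapse)
  then show "Poly_Mapping.single k (1 :: 'k) \<in> {pel u w | u w. u \<in> lattice_pts r \<and> valid r w \<and> length w = n}"
    using w by blast
qed

lemma Ewd_subspace: "pv.subspace (Ewd r x y n)"
  unfolding Ewd_def by (rule pv.subspace_span)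

lemma Ewd_hom: assumes "x \<in> lattice_pts r" shows "(Ewd r x y n :: 'k::field lattice_path_elem set) \<subseteq> homog r n"
  unfolding Ewd_def
proof (rule pv.span_minimal)
  have "pel x w \<in> (homog r (length w) :: 'k lattice_path_elem set)" if w: "valid r w" for w
  proof -
    have "Poly_Mapping.keys (pel x w :: 'k lattice_path_elem) = {(x, walk x w)}" by (simp add: pel_def)
    moreover have "(pel x w :: 'k lattice_path_elem) \<in> Pth r" using assms w by (rule pel_Pth)
    ultimately show ?thesis by (simp add: homog_def)
  qed
  then show "{pel x w | w. valid r w \<and> endp x w = y \<and> length w = n} \<subseteq> (homog r n :: 'k lattice_path_elem set)"
    by blast
  have "(homog r n :: 'k lattice_path_elem set) = Pth r \<inter> {f. \<forall>k\<in>Poly_Mapping.keys f. length (snd k) = n}"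
    unfolding homog_def case_prod_unfold by blast
  then show "pv.subspace (homog r n :: 'k lattice_path_elem set)"
    using pv.subspace_inter[OF Pth_subspace keys_subspace] by simp
qed

lemma idem_hom:
  assumes "x \<in> lattice_pts r" "f \<in> homog r n"
  shows "pm r (pm r (pel x []) f) (pel y []) \<in> Ewd r x y n"
proof -
  have "f \<in> pv.span {pel u w | u w. u \<in> lattice_pts r \<and> valid r w \<and> length w = n}" using homog_span assms(2) by blast
  then show ?thesis
  proof (rule pv.span_induct)
    show "pv.subspace {f. pm r (pm r (pel x []) f) (pel y []) \<in> Ewd r x y n}"
      using Ewd_subspace[of r x y n] by (auto simp: pv.subspace_def pm_add_left pm_scl_left pm_add_right pm_scl_right)
    fix g assume "g \<in> {pel u w | u w. u \<in> lattice_pts r \<and> valid r w \<and> length w = n}"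
    then obtain u w where g: "g = pel u w" "u \<in> lattice_pts r" "valid r w" "length w = n" by blast
    show "pm r (pm r (pel x []) g) (pel y []) \<in> Ewd r x y n"
      using assms(1) g by (auto simp: pm_pel Ewd_def intro!: pv.span_zero pv.span_base)
  qed
qed

lemma Ewd_idem:
  assumes "x \<in> lattice_pts r" "f \<in> Ewd r x y n"
  shows "pm r (pm r (pel x []) f) (pel y []) = f" "pm r (pel x []) f = f" "pm r f (pel y []) = f"
proof -
  have *: "pm r (pel x []) f = f \<and> pm r f (pel y []) = f"
    using assms(2) unfolding Ewd_def
  proof (rule pv.span_induct)
    show "pv.subspace {f. pm r (pel x []) f = f \<and> pm r f (pel y []) = f}"
      by (auto simp: pv.subspace_def pm_add_left pm_scl_left pm_add_right pm_scl_right)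
    show "pm r (pel x []) g = g \<and> pm r g (pel y []) = g"
      if "g \<in> {pel x w | w. valid r w \<and> endp x w = y \<and> length w = n}" for g
      using that assms(1) by (auto simp: pm_pel)
  qed
  then show "pm r (pm r (pel x []) f) (pel y []) = f" "pm r (pel x []) f = f" "pm r f (pel y []) = f" by simp_all
qed

subsection \<open>Linear functionals on paths\<close>

text \<open>The linear extension of a function on words, read on the paths from \<open>x\<close>. It
  translates \<open>U_rel\<close>, \<open>V_rel\<close> and \<open>kills\<close> into vanishing on
  ideals.\<close>

definition phi :: "point \<Rightarrow> (step list \<Rightarrow> 'k::field) \<Rightarrow> 'k lattice_path_elem \<Rightarrow> 'k" where
  "phi x F f = (\<Sum>k\<in>Poly_Mapping.keys f. Poly_Mapping.lookup f k * (if fst k = x then F (map step_of (snd k)) else 0))"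

lemma phi_add: "phi x F (f + g) = phi x F f + phi x F g"
  unfolding phi_def by (rule setsum_keys_plus_distrib) (simp_all only: mult_zero_left distrib_right)

lemma phi_scl: "phi x F (scl c f) = c * phi x F f"
proof (cases "c = 0")
  case False
  show ?thesis unfolding phi_def keys_scl[OF False] lookup_scl sum_distrib_left mult.assoc by (rule refl)
next
  case True
  then show ?thesis using pv.scale_zero_left[of f] by (simp add: phi_def)
qed

lemma phi_zero [simp]: "phi x F 0 = 0"
  by (simp add: phi_def)

lemma phi_pel: "phi x F (pel u w) = (if u = x then F w else (0 :: 'k::field))"
proof -
  have k: "Poly_Mapping.keys (pel u w :: 'k lattice_path_elem) = {(u, walk u w)}" by (simp add: pel_def)
  have l: "Poly_Mapping.lookup (pel u w) (u, walk u w) = (1 :: 'k)" by (simp add: pel_def)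
  show ?thesis unfolding phi_def k by (simp add: l)
qed

lemma phi_uminus: "phi x F (- f) = - phi x F f"
  using phi_add[of x F f "- f"] by (simp add: eq_neg_iff_add_eq_0 add.commute)

lemma phi_diff: "phi x F (f - g) = phi x F f - phi x F g"
  using phi_add[of x F f "- g"] by (simp add: phi_uminus)

lemma phi_sum: "phi x F (\<Sum>i\<in>A. f i) = (\<Sum>i\<in>A. phi x F (f i))"
  by (induction A rule: infinite_finite_induct) (auto simp: phi_add)

lemma phi_subspace: "pv.subspace {f. phi x F f = 0}"
  by (auto simp: pv.subspace_def phi_add phi_scl)

text \<open>The duality behind all four dimension formulas. \<open>adm\<close> describes the
  functions on words that come from functionals vanishing on \<open>N\<close>: triangular values of
  admissible functions give independence, and that an admissible function vanishing on all
  \<open>wd b\<close> vanishes throughout gives spanning.\<close>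

lemma dim_by_functionals:
  fixes N :: "'k::field lattice_path_elem set" and key :: "'b \<Rightarrow> nat" and G :: "'b \<Rightarrow> step list \<Rightarrow> 'k"
  assumes P: "presents \<pi> S N M" and ES: "Ewd r x y n \<subseteq> S"
    and B: "finite B" "\<And>b. b \<in> B \<Longrightarrow> valid r (wd b) \<and> endp x (wd b) = y \<and> length (wd b) = n"
    and inN: "\<And>\<psi>. Vector_Spaces.linear scl (*) \<psi> \<Longrightarrow> (\<And>g. g \<in> N \<Longrightarrow> \<psi> g = 0) \<Longrightarrow>
      adm (\<lambda>w. if length w = n \<and> endp x w = y then \<psi> (pel x w) else 0)"
    and outN: "\<And>F f. adm F \<Longrightarrow> f \<in> N \<Longrightarrow> phi x F f = 0"
    and span: "\<And>F w. adm F \<Longrightarrow> (\<And>b. b \<in> B \<Longrightarrow> F (wd b) = 0) \<Longrightarrow> valid r w \<Longrightarrow> endp x w = y \<Longrightarrow> length w = n \<Longrightarrow> F w = 0"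
    and G: "\<And>b. b \<in> B \<Longrightarrow> adm (G b)" "\<And>b. b \<in> B \<Longrightarrow> G b (wd b) \<noteq> 0"
      "\<And>b b'. b \<in> B \<Longrightarrow> b' \<in> B \<Longrightarrow> b \<noteq> b' \<Longrightarrow> G b' (wd b) \<noteq> 0 \<Longrightarrow> key b < key b'"
  shows "sub_dim M (\<pi> ` Ewd r x y n) = card B"
proof (rule presents_dim[OF P Ewd_subspace ES B(1), of "\<lambda>b. pel x (wd b)"])
  show "pel x (wd b) \<in> Ewd r x y n" if "b \<in> B" for b
    unfolding Ewd_def using B(2)[OF that] by (intro pv.span_base) blast
  show "\<forall>b\<in>B. c b = 0" if c: "(\<Sum>b\<in>B. scl (c b) (pel x (wd b))) \<in> N" for c
  proof (rule ccontr)
    assume "\<not> (\<forall>b\<in>B. c b = 0)"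
    then have "\<exists>b. b \<in> B \<and> c b \<noteq> 0" by blast
    \<comment> \<open>In a nontrivial relation the coefficient with the least key is isolated by its
      own function, which annihilates all other words whose key is not smaller.\<close>
    then obtain b0 where b0: "b0 \<in> B" "c b0 \<noteq> 0" and least: "\<And>b. b \<in> B \<Longrightarrow> c b \<noteq> 0 \<Longrightarrow> key b0 \<le> key b"
      using ex_has_least_nat[of "\<lambda>b. b \<in> B \<and> c b \<noteq> 0" _ key] by blast
    have "0 = phi x (G b0) (\<Sum>b\<in>B. scl (c b) (pel x (wd b)))" using outN[OF G(1)[OF b0(1)] c] by simp
    also have "\<dots> = (\<Sum>b\<in>B. c b * G b0 (wd b))" by (simp add: phi_sum phi_scl phi_pel)
    also have "\<dots> = (\<Sum>b\<in>{b0}. c b * G b0 (wd b))"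
    proof (rule sum.mono_neutral_right)
      show "\<forall>b\<in>B - {b0}. c b * G b0 (wd b) = 0"
      proof
        fix b assume b: "b \<in> B - {b0}"
        show "c b * G b0 (wd b) = 0"
        proof (rule ccontr)
          assume "c b * G b0 (wd b) \<noteq> 0"
          then have "key b0 \<le> key b" "key b < key b0" using least[of b] G(3)[of b b0] b b0(1) by auto
          then show False by simp
        qed
      qed
    qed (use B(1) b0 in auto)
    also have "\<dots> \<noteq> 0" using b0 G(2) by simp
    finally show False by simp
  qed
  show "\<exists>c. f - (\<Sum>b\<in>B. scl (c b) (pel x (wd b))) \<in> N" if f: "f \<in> Ewd r x y n" for f
  proof -
    let ?p = "\<lambda>b. pel x (wd b) :: 'k lattice_path_elem"
    let ?R = "{f. \<exists>c. f - (\<Sum>b\<in>B. scl (c b) (?p b)) \<in> N}"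
    note N = presentsD(2)[OF P]
    have subR: "pv.subspace ?R"
      unfolding pv.subspace_def
    proof (intro conjI ballI allI)
      show "0 \<in> ?R" using pv.subspace_0[OF N] by (intro CollectI exI[of _ "\<lambda>_. 0"]) simp
      fix g assume "g \<in> ?R"
      then obtain c where c: "g - (\<Sum>b\<in>B. scl (c b) (?p b)) \<in> N" by blast
      show "scl a g \<in> ?R" for a
      proof (intro CollectI exI[of _ "\<lambda>b. a * c b"])
        have "scl a g - (\<Sum>b\<in>B. scl (a * c b) (?p b)) = scl a (g - (\<Sum>b\<in>B. scl (c b) (?p b)))"
          by (simp add: pv.scale_right_diff_distrib pv.scale_sum_right)
        then show "scl a g - (\<Sum>b\<in>B. scl (a * c b) (?p b)) \<in> N" using pv.subspace_scale[OF N c] by (simp only:)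
      qed
      fix h assume "h \<in> ?R"
      then obtain d where d: "h - (\<Sum>b\<in>B. scl (d b) (?p b)) \<in> N" by blast
      show "g + h \<in> ?R"
      proof (intro CollectI exI[of _ "\<lambda>b. c b + d b"])
        have "g + h - (\<Sum>b\<in>B. scl (c b + d b) (?p b)) =
          (g - (\<Sum>b\<in>B. scl (c b) (?p b))) + (h - (\<Sum>b\<in>B. scl (d b) (?p b)))"
          by (simp add: pv.scale_left_distrib sum.distrib algebra_simps)
        then show "g + h - (\<Sum>b\<in>B. scl (c b + d b) (?p b)) \<in> N" using pv.subspace_add[OF N c d] by (simp only:)
      qed
    qed
    have "N \<union> ?p ` B \<subseteq> ?R"
    proof
      fix g assume "g \<in> N \<union> ?p ` B"
      then show "g \<in> ?R"
      proof
        assume "g \<in> N"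
        then show ?thesis by (intro CollectI exI[of _ "\<lambda>_. 0"]) simp
      next
        assume "g \<in> ?p ` B"
        then obtain b where b: "b \<in> B" "g = ?p b" by blast
        have "(\<Sum>b'\<in>B. scl (if b' = b then 1 else 0) (?p b')) = (\<Sum>b'\<in>{b}. scl (if b' = b then 1 else 0) (?p b'))"
          using b B(1) by (intro sum.mono_neutral_right) auto
        then show ?thesis using b pv.subspace_0[OF N]
          by (intro CollectI exI[of _ "\<lambda>b'. if b' = b then 1 else 0"]) simp
      qed
    qed
    \<comment> \<open>Otherwise a functional separates \<open>f\<close> from \<open>N\<close> and
      the chosen words; read on words it is admissible and zero on the chosen ones, hence zero on
      all of \<open>Ewd r x y n\<close>.\<close>
    moreover have "f \<in> pv.span (N \<union> ?p ` B)"
    proof (rule ccontr)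
      assume "f \<notin> pv.span (N \<union> ?p ` B)"
      then obtain \<psi> where \<psi>: "Vector_Spaces.linear scl (*) \<psi>" "\<And>g. g \<in> N \<union> ?p ` B \<Longrightarrow> \<psi> g = 0" "\<psi> f = 1"
        using separate by blast
      define F where "F = (\<lambda>w. if length w = n \<and> endp x w = y then \<psi> (pel x w) else 0)"
      have adm: "adm F" unfolding F_def using \<psi>(1,2) by (intro inN) auto
      have "F (wd b) = 0" if "b \<in> B" for b using \<psi>(2)[of "?p b"] that by (simp add: F_def)
      then have "F w = 0" if "valid r w" "endp x w = y" "length w = n" for w using span[OF adm] that by blast
      then have "\<psi> g = 0" if "g \<in> {pel x w | w. valid r w \<and> endp x w = y \<and> length w = n}" for g
        using that by (auto simp: F_def)
      then have "\<psi> f = 0" using pk.linear_eq_0_on_span[OF \<psi>(1)] f unfolding Ewd_def by blast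
      then show False using \<psi>(3) by simp
    qed
    ultimately show ?thesis using pv.span_minimal[OF _ subR] by blast
  qed
qed

subsection \<open>Presentations of the algebras\<close>

text \<open>A graded algebra of paths modulo \<open>N\<close>, with representatives in
  \<open>S\<close> and idempotents for the vertices in \<open>Y\<close>. Products are described for
  all paths, and components are only enclosed between word spaces and homogeneous paths, so that the
  format survives quotients as well as passage to a corner algebra.\<close>

definition gpres :: "nat \<Rightarrow> point set \<Rightarrow> ('k::field lattice_path_elem \<Rightarrow> 'a) \<Rightarrow> 'k lattice_path_elem set \<Rightarrow>
    'k lattice_path_elem set \<Rightarrow> ('k, 'a, point) idem_algebra \<Rightarrow> bool" where
  "gpres r Y \<pi> S N A \<longleftrightarrow> presents \<pi> S N A \<and> S \<subseteq> Pth r \<and> Y \<subseteq> lattice_pts r \<and>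
     (\<forall>f\<in>Pth r. \<forall>g\<in>Pth r. \<pi> f \<otimes>\<^bsub>A\<^esub> \<pi> g = \<pi> (pm r f g)) \<and>
     (\<forall>f\<in>S. \<forall>g\<in>S. pm r f g \<in> S) \<and> (\<forall>x\<in>Y. idem A x = \<pi> (pel x [])) \<and>
     (\<forall>n. component A n \<subseteq> \<pi> ` homog r n \<inter> carrier A) \<and>
     (\<forall>x\<in>Y. \<forall>y\<in>Y. \<forall>n. Ewd r x y n \<subseteq> S \<and> \<pi> ` Ewd r x y n \<subseteq> component A n)"

lemma gpresD:
  assumes "gpres r Y \<pi> S N A"
  shows "presents \<pi> S N A" "S \<subseteq> Pth r" "Y \<subseteq> lattice_pts r"
    "\<And>f g. f \<in> Pth r \<Longrightarrow> g \<in> Pth r \<Longrightarrow> \<pi> f \<otimes>\<^bsub>A\<^esub> \<pi> g = \<pi> (pm r f g)"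
    "\<And>f g. f \<in> S \<Longrightarrow> g \<in> S \<Longrightarrow> pm r f g \<in> S"
    "\<And>x. x \<in> Y \<Longrightarrow> idem A x = \<pi> (pel x [])"
    "\<And>n. component A n \<subseteq> \<pi> ` homog r n"
    "\<And>x y n. x \<in> Y \<Longrightarrow> y \<in> Y \<Longrightarrow> Ewd r x y n \<subseteq> S"
    "\<And>x y n. x \<in> Y \<Longrightarrow> y \<in> Y \<Longrightarrow> \<pi> ` Ewd r x y n \<subseteq> component A n"
    "\<And>n. component A n \<subseteq> carrier A"
proof -
  note g = assms[unfolded gpres_def]
  have c: "\<forall>f\<in>Pth r. \<forall>g\<in>Pth r. \<pi> f \<otimes>\<^bsub>A\<^esub> \<pi> g = \<pi> (pm r f g)" using g by (elim conjE)
  have d: "\<forall>f\<in>S. \<forall>g\<in>S. pm r f g \<in> S" using g by (elim conjE)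
  have e: "\<forall>x\<in>Y. idem A x = \<pi> (pel x [])" using g by (elim conjE)
  have f: "\<forall>n. component A n \<subseteq> \<pi> ` homog r n \<inter> carrier A" using g by (elim conjE)
  have h: "\<forall>x\<in>Y. \<forall>y\<in>Y. \<forall>n. Ewd r x y n \<subseteq> S \<and> \<pi> ` Ewd r x y n \<subseteq> component A n" using g by (elim conjE)
  show "presents \<pi> S N A" using g by (elim conjE)
  show "S \<subseteq> Pth r" using g by (elim conjE)
  show "Y \<subseteq> lattice_pts r" using g by (elim conjE)
  show "\<And>f g. f \<in> Pth r \<Longrightarrow> g \<in> Pth r \<Longrightarrow> \<pi> f \<otimes>\<^bsub>A\<^esub> \<pi> g = \<pi> (pm r f g)" using c by simp
  show "\<And>f g. f \<in> S \<Longrightarrow> g \<in> S \<Longrightarrow> pm r f g \<in> S" using d by simp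
  show "\<And>x. x \<in> Y \<Longrightarrow> idem A x = \<pi> (pel x [])" using e by simp
  show "\<And>n. component A n \<subseteq> \<pi> ` homog r n" using f by simp
  show "\<And>x y n. x \<in> Y \<Longrightarrow> y \<in> Y \<Longrightarrow> Ewd r x y n \<subseteq> S" using h by simp
  show "\<And>x y n. x \<in> Y \<Longrightarrow> y \<in> Y \<Longrightarrow> \<pi> ` Ewd r x y n \<subseteq> component A n" using h by simp
  show "\<And>n. component A n \<subseteq> carrier A" using f by simp
qed

lemma gpres_pel:
  assumes "gpres r Y \<pi> S N A" "x \<in> Y" "y \<in> Y" "valid r w" "endp x w = y"
  shows "pel x w \<in> S"
proof -
  have "pel x w \<in> Ewd r x y (length w)" unfolding Ewd_def using assms(4,5) by (intro pv.span_base) blast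
  then show ?thesis using gpresD(8)[OF assms(1-3)] by blast
qed

lemma gpresI:
  assumes "presents \<pi> S N A" "S \<subseteq> Pth r" "Y \<subseteq> lattice_pts r"
    "\<And>f g. f \<in> Pth r \<Longrightarrow> g \<in> Pth r \<Longrightarrow> \<pi> f \<otimes>\<^bsub>A\<^esub> \<pi> g = \<pi> (pm r f g)"
    "\<And>f g. f \<in> S \<Longrightarrow> g \<in> S \<Longrightarrow> pm r f g \<in> S"
    "\<And>x. x \<in> Y \<Longrightarrow> idem A x = \<pi> (pel x [])"
    "\<And>n. component A n \<subseteq> \<pi> ` homog r n" "\<And>n. component A n \<subseteq> carrier A"
    "\<And>x y n. x \<in> Y \<Longrightarrow> y \<in> Y \<Longrightarrow> Ewd r x y n \<subseteq> S"
    "\<And>x y n. x \<in> Y \<Longrightarrow> y \<in> Y \<Longrightarrow> \<pi> ` Ewd r x y n \<subseteq> component A n"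
  shows "gpres r Y \<pi> S N A"
  unfolding gpres_def using assms by simp

text \<open>Composition runs from left to right, so the left idempotent selects the start of a path
  and the right one its end.\<close>

lemma cartan_space:
  assumes G: "gpres r Y \<pi> S N A" and xy: "x \<in> Y" "y \<in> Y"
  shows "{idem A x \<otimes>\<^bsub>A\<^esub> a \<otimes>\<^bsub>A\<^esub> idem A y | a. a \<in> component A n} = \<pi> ` Ewd r x y n"
proof -
  note D = gpresD[OF G]
  have L: "x \<in> lattice_pts r" "y \<in> lattice_pts r" using D(3) xy by auto
  have e: "idem A x \<otimes>\<^bsub>A\<^esub> \<pi> f \<otimes>\<^bsub>A\<^esub> idem A y = \<pi> (pm r (pm r (pel x []) f) (pel y []))" if "f \<in> Pth r" for f
    using L that xy by (simp add: D(4,6) pm_Pth)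
  show ?thesis
  proof (intro equalityI subsetI)
    fix b assume "b \<in> {idem A x \<otimes>\<^bsub>A\<^esub> a \<otimes>\<^bsub>A\<^esub> idem A y | a. a \<in> component A n}"
    then obtain f where f: "f \<in> homog r n" "b = idem A x \<otimes>\<^bsub>A\<^esub> \<pi> f \<otimes>\<^bsub>A\<^esub> idem A y" using D(7)[of n] by auto
    then show "b \<in> \<pi> ` Ewd r x y n" using e[OF homog_Pth[OF f(1)]] idem_hom[OF L(1) f(1), of y] by auto
  next
    fix b assume "b \<in> \<pi> ` Ewd r x y n"
    then obtain f where f: "f \<in> Ewd r x y n" "b = \<pi> f" by blast
    have "f \<in> Pth r" using Ewd_hom[OF L(1)] f(1) homog_Pth by blast
    then have "b = idem A x \<otimes>\<^bsub>A\<^esub> \<pi> f \<otimes>\<^bsub>A\<^esub> idem A y" using e f Ewd_idem(1)[OF L(1) f(1)] by simp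
    moreover have "\<pi> f \<in> component A n" using D(9)[OF xy] f(1) by blast
    ultimately show "b \<in> {idem A x \<otimes>\<^bsub>A\<^esub> a \<otimes>\<^bsub>A\<^esub> idem A y | a. a \<in> component A n}" by blast
  qed
qed

lemma subspace_zero: "pv.subspace {0}"
  by (simp add: pv.subspace_def)

lemma gpres_path: "gpres r (lattice_pts r) (\<lambda>f. f) (Pth r) {0} (path_algebra (lattice_quiver r) :: ('k::field, _, _) idem_algebra)"
proof -
  have "presents (\<lambda>f. f) (Pth r) {0} (path_algebra (lattice_quiver r) :: ('k, _, _) idem_algebra)"
    unfolding presents_def using Pth_subspace subspace_zero
    by (simp add: path_algebra_def Pth_def)
  moreover have "component (path_algebra (lattice_quiver r)) n = (homog r n :: 'k lattice_path_elem set)" for n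
    by (simp add: path_algebra_def homog_def Pth_def)
  moreover have "Ewd r x y n \<subseteq> (Pth r :: 'k lattice_path_elem set)" if "x \<in> lattice_pts r" for x y n
    using Ewd_hom[OF that] homog_Pth by blast
  moreover have "carrier (path_algebra (lattice_quiver r)) = (Pth r :: 'k lattice_path_elem set)"
    "mult (path_algebra (lattice_quiver r)) = (pm r :: 'k lattice_path_elem \<Rightarrow> _)"
    "idem (path_algebra (lattice_quiver r)) x = (pel x [] :: 'k lattice_path_elem)" for x
    by (simp_all add: path_algebra_def Pth_def pel_def)
  moreover have "homog r n \<subseteq> (Pth r :: 'k lattice_path_elem set)" for n using homog_Pth by blast
  ultimately show ?thesis
    using Ewd_hom pm_Pth by (intro gpresI) simp_all
qed

lemma ideal_gen_pres:
  assumes G: "gpres r Y \<pi> (Pth r) N A" and T: "T \<subseteq> Pth r"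
  shows "ideal_gen A (\<pi> ` T) = \<pi> ` two_sided r T"
proof -
  note D = gpresD[OF G]
  let ?G = "{pm r (pm r a t) b | a t b. a \<in> Pth r \<and> t \<in> T \<and> b \<in> Pth r}"
  have mul: "\<pi> a \<otimes>\<^bsub>A\<^esub> \<pi> t \<otimes>\<^bsub>A\<^esub> \<pi> b = \<pi> (pm r (pm r a t) b)" if "a \<in> Pth r" "t \<in> T" "b \<in> Pth r" for a t b
    using that T by (simp add: D(4) pm_Pth subset_iff)
  have "{a \<otimes>\<^bsub>A\<^esub> s \<otimes>\<^bsub>A\<^esub> b | a s b. a \<in> carrier A \<and> s \<in> \<pi> ` T \<and> b \<in> carrier A} = \<pi> ` ?G"
  proof (intro equalityI subsetI)
    fix z assume "z \<in> {a \<otimes>\<^bsub>A\<^esub> s \<otimes>\<^bsub>A\<^esub> b | a s b. a \<in> carrier A \<and> s \<in> \<pi> ` T \<and> b \<in> carrier A}"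
    then obtain a' s b' where z': "a' \<in> carrier A" "s \<in> \<pi> ` T" "b' \<in> carrier A" "z = a' \<otimes>\<^bsub>A\<^esub> s \<otimes>\<^bsub>A\<^esub> b'"
      by blast
    then obtain a t b where "a \<in> Pth r" "a' = \<pi> a" "t \<in> T" "s = \<pi> t" "b \<in> Pth r" "b' = \<pi> b"
      unfolding presentsD(3)[OF D(1)] by (elim imageE)
    then have z: "a \<in> Pth r" "t \<in> T" "b \<in> Pth r" "z = \<pi> a \<otimes>\<^bsub>A\<^esub> \<pi> t \<otimes>\<^bsub>A\<^esub> \<pi> b" using z'(4) by simp_all
    then show "z \<in> \<pi> ` ?G" using mul[OF z(1-3)] by blast
  next
    fix z assume "z \<in> \<pi> ` ?G"
    then obtain a t b where z: "a \<in> Pth r" "t \<in> T" "b \<in> Pth r" "z = \<pi> (pm r (pm r a t) b)" by blast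
    then show "z \<in> {a \<otimes>\<^bsub>A\<^esub> s \<otimes>\<^bsub>A\<^esub> b | a s b. a \<in> carrier A \<and> s \<in> \<pi> ` T \<and> b \<in> carrier A}"
      using mul[OF z(1-3), symmetric] presentsD(3)[OF D(1)] by blast
  qed
  moreover have "?G \<subseteq> Pth r" using T pm_Pth by blast
  ultimately show ?thesis unfolding ideal_gen_def two_sided_def using presents_span[OF D(1)] by simp
qed

lemma gpres_quot:
  assumes G: "gpres r Y \<pi> (Pth r) N A" and T: "T \<subseteq> Pth r"
  defines "J \<equiv> two_sided r T"
  shows "gpres r Y (\<lambda>f. \<pi> ` J +>\<^bsub>A\<^esub> \<pi> f) (Pth r) (set_sum N J) (quot_algebra A (\<pi> ` J))"
proof -
  note D = gpresD[OF G]
  have J: "pv.subspace J" "J \<subseteq> Pth r" unfolding J_def by (rule two_sided_subspace, rule two_sided_Pth[OF T])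
  note ceq = presents_coset_eq[OF D(1) J] and c = presents_coset[OF D(1) J(2)]
  note P = pv.subspace_add[OF Pth_subspace]
  have mul: "rcoset_mult A (\<pi> ` J) (\<pi> ` J +>\<^bsub>A\<^esub> \<pi> f) (\<pi> ` J +>\<^bsub>A\<^esub> \<pi> g) = \<pi> ` J +>\<^bsub>A\<^esub> \<pi> (pm r f g)"
    if fg: "f \<in> Pth r" "g \<in> Pth r" for f g
  proof -
    have "\<pi> ` J +>\<^bsub>A\<^esub> (\<pi> (n + f) \<otimes>\<^bsub>A\<^esub> \<pi> (n' + g)) = \<pi> ` J +>\<^bsub>A\<^esub> \<pi> (pm r f g)" if n: "n \<in> J" "n' \<in> J" for n n'
    proof -
      have S: "n + f \<in> Pth r" "n' + g \<in> Pth r" using n fg J(2) P by blast+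
      have "pm r (n + f) (n' + g) - pm r f g = pm r n (n' + g) + pm r f n'"
        by (simp add: pm_add_left pm_add_right)
      also have "\<dots> \<in> J" unfolding J_def
        using two_sided_mult[OF T] n S fg unfolding J_def by (intro pv.subspace_add[OF two_sided_subspace]) blast+
      finally have "pm r (n + f) (n' + g) - pm r f g \<in> set_sum N J"
        using set_sum_2[OF presentsD(2)[OF D(1)]] by blast
      then show ?thesis using ceq[OF pm_Pth[OF S] pm_Pth[OF fg]] D(4)[OF S] by simp
    qed
    then show ?thesis unfolding rcoset_mult_def c[OF fg(1)] c[OF fg(2)]
      using pv.subspace_0[OF J(1)] by auto
  qed
  show ?thesis
  proof (rule gpresI)
    show "presents (\<lambda>f. \<pi> ` J +>\<^bsub>A\<^esub> \<pi> f) (Pth r) (set_sum N J) (quot_algebra A (\<pi> ` J))"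
      by (rule presents_quot_algebra[OF D(1) J])
    show "Y \<subseteq> lattice_pts r" by (rule D(3))
    show "component (quot_algebra A (\<pi> ` J)) n \<subseteq> (\<lambda>f. \<pi> ` J +>\<^bsub>A\<^esub> \<pi> f) ` homog r n" for n
      using D(7)[of n] by (auto simp: quot_algebra_simps)
    show "(\<lambda>f. \<pi> ` J +>\<^bsub>A\<^esub> \<pi> f) ` Ewd r x y n \<subseteq> component (quot_algebra A (\<pi> ` J)) n"
      if "x \<in> Y" "y \<in> Y" for x y n using D(9)[OF that, of n] by (auto simp: quot_algebra_simps)
    show "component (quot_algebra A (\<pi> ` J)) n \<subseteq> carrier (quot_algebra A (\<pi> ` J))" for n
      using D(10)[of n] by (auto simp: quot_algebra_simps)
  qed (use D(5,6,8) mul in \<open>simp_all add: quot_algebra_simps\<close>)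
qed

definition Sub :: "nat \<Rightarrow> point set \<Rightarrow> 'k::field lattice_path_elem set" where
  "Sub r Y = pv.span {pm r (pm r (pel x []) f) (pel y []) | x f y. x \<in> Y \<and> f \<in> Pth r \<and> y \<in> Y}"

text \<open>A product of two corner generators is reassociated into one generator whose middle
  factor absorbs the two inner idempotents, so the corner is closed under multiplication.\<close>

lemma gpres_sub:
  fixes \<pi> :: "'k::field lattice_path_elem \<Rightarrow> 'a"
  assumes G: "gpres r (lattice_pts r) \<pi> (Pth r) N V" and Y: "Y \<subseteq> lattice_pts r"
    and W: "W = lin_span V {idem V x \<otimes>\<^bsub>V\<^esub> v \<otimes>\<^bsub>V\<^esub> idem V y | x v y. x \<in> Y \<and> v \<in> carrier V \<and> y \<in> Y}"
  shows "gpres r Y \<pi> (Sub r Y) N (V\<lparr>carrier := W, component := (\<lambda>n. component V n \<inter> W)\<rparr>)"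
proof -
  note D = gpresD[OF G]
  let ?G = "{pm r (pm r (pel x []) f) (pel y []) | x f y. x \<in> Y \<and> f \<in> Pth r \<and> y \<in> Y} :: 'k lattice_path_elem set"
  have pP: "pel x [] \<in> (Pth r :: 'k lattice_path_elem set)" if "x \<in> Y" for x using that Y by (intro pel_Pth) auto
  have GP: "?G \<subseteq> Pth r" using pP pm_Pth by blast
  have SP: "Sub r Y \<subseteq> (Pth r :: 'k lattice_path_elem set)" unfolding Sub_def by (rule pv.span_minimal[OF GP Pth_subspace])
  have sub: "pv.subspace (Sub r Y :: 'k lattice_path_elem set)" unfolding Sub_def by (rule pv.subspace_span)
  have mul: "idem V x \<otimes>\<^bsub>V\<^esub> \<pi> f \<otimes>\<^bsub>V\<^esub> idem V y = \<pi> (pm r (pm r (pel x []) f) (pel y []))"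
    if "x \<in> Y" "f \<in> Pth r" "y \<in> Y" for x f y
    using that Y pP by (simp add: D(4,6) pm_Pth subset_iff)
  have "{idem V x \<otimes>\<^bsub>V\<^esub> v \<otimes>\<^bsub>V\<^esub> idem V y | x v y. x \<in> Y \<and> v \<in> carrier V \<and> y \<in> Y} = \<pi> ` ?G"
  proof (intro equalityI subsetI)
    fix z assume "z \<in> {idem V x \<otimes>\<^bsub>V\<^esub> v \<otimes>\<^bsub>V\<^esub> idem V y | x v y. x \<in> Y \<and> v \<in> carrier V \<and> y \<in> Y}"
    then obtain x v y where z': "x \<in> Y" "v \<in> carrier V" "y \<in> Y" "z = idem V x \<otimes>\<^bsub>V\<^esub> v \<otimes>\<^bsub>V\<^esub> idem V y" by blast
    then obtain f where "f \<in> Pth r" "v = \<pi> f" unfolding presentsD(3)[OF D(1)] by (elim imageE)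
    then have z: "x \<in> Y" "f \<in> Pth r" "y \<in> Y" "z = idem V x \<otimes>\<^bsub>V\<^esub> \<pi> f \<otimes>\<^bsub>V\<^esub> idem V y" using z' by simp_all
    then show "z \<in> \<pi> ` ?G" using mul[OF z(1-3)] by blast
  next
    fix z assume "z \<in> \<pi> ` ?G"
    then obtain x f y where z: "x \<in> Y" "f \<in> Pth r" "y \<in> Y" "z = \<pi> (pm r (pm r (pel x []) f) (pel y []))" by blast
    then show "z \<in> {idem V x \<otimes>\<^bsub>V\<^esub> v \<otimes>\<^bsub>V\<^esub> idem V y | x v y. x \<in> Y \<and> v \<in> carrier V \<and> y \<in> Y}"
      using mul[OF z(1-3), symmetric] presentsD(3)[OF D(1)] by blast
  qed
  then have Wpi: "W = \<pi> ` Sub r Y" unfolding W Sub_def using presents_span[OF D(1) GP] by simp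
  have "presents \<pi> (Sub r Y) N (V\<lparr>carrier := W\<rparr>)" unfolding Wpi by (rule presents_restrict[OF D(1) sub SP])
  then have pres: "presents \<pi> (Sub r Y) N (V\<lparr>carrier := W, component := (\<lambda>n. component V n \<inter> W)\<rparr>)"
    by (simp add: presents_def)
  have closed: "pm r f g \<in> Sub r Y" if "f \<in> Sub r Y" "g \<in> Sub r Y" for f g :: "'k lattice_path_elem"
  proof (rule pm_span[OF that[unfolded Sub_def] sub])
    fix a b assume "a \<in> ?G" "b \<in> ?G"
    then obtain x f y x' g y' where ab: "a = pm r (pm r (pel x []) f) (pel y [])" "x \<in> Y" "f \<in> Pth r" "y \<in> Y"
      "b = pm r (pm r (pel x' []) g) (pel y' [])" "x' \<in> Y" "g \<in> Pth r" "y' \<in> Y" by blast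
    have "pm r a b = pm r (pm r (pel x []) (pm r f (pm r (pel y []) (pm r (pel x' []) g)))) (pel y' [])"
      unfolding ab(1,5) using ab pP by (simp add: pm_assoc pm_Pth)
    moreover have "pm r f (pm r (pel y []) (pm r (pel x' []) g)) \<in> Pth r" using ab pP by (simp add: pm_Pth)
    ultimately show "pm r a b \<in> Sub r Y" unfolding Sub_def using ab by (intro pv.span_base) blast
  qed
  have E: "Ewd r x y n \<subseteq> (Sub r Y :: 'k lattice_path_elem set)" if "x \<in> Y" "y \<in> Y" for x y n
  proof
    fix f :: "'k lattice_path_elem" assume f: "f \<in> Ewd r x y n"
    have xL: "x \<in> lattice_pts r" using that Y by auto
    have "f \<in> Pth r" using Ewd_hom[OF xL] f homog_Pth by blast
    then have "f \<in> ?G" using Ewd_idem(1)[OF xL f, symmetric] that by blast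
    then show "f \<in> Sub r Y" unfolding Sub_def by (rule pv.span_base)
  qed
  show ?thesis
  proof (rule gpresI[OF pres SP Y])
    show "\<pi> ` Ewd r x y n \<subseteq> component (V\<lparr>carrier := W, component := (\<lambda>n. component V n \<inter> W)\<rparr>) n"
      if "x \<in> Y" "y \<in> Y" for x y n using D(9)[of x y n] E[OF that] that Y Wpi by auto
    show "component (V\<lparr>carrier := W, component := (\<lambda>n. component V n \<inter> W)\<rparr>) n \<subseteq> \<pi> ` homog r n" for n
      using D(7)[of n] by auto
    show "component (V\<lparr>carrier := W, component := (\<lambda>n. component V n \<inter> W)\<rparr>) n \<subseteq>
        carrier (V\<lparr>carrier := W, component := (\<lambda>n. component V n \<inter> W)\<rparr>)" for n by simp
    show "idem (V\<lparr>carrier := W, component := (\<lambda>n. component V n \<inter> W)\<rparr>) x = \<pi> (pel x [])" if "x \<in> Y" for x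
      using D(6)[of x] that Y by auto
    show "\<pi> f \<otimes>\<^bsub>V\<lparr>carrier := W, component := (\<lambda>n. component V n \<inter> W)\<rparr>\<^esub> \<pi> g = \<pi> (pm r f g)"
      if "f \<in> Pth r" "g \<in> Pth r" for f g using D(4)[OF that] by simp
  qed (use closed E in blast)+
qed

definition Kst :: "nat \<Rightarrow> 'k::field lattice_path_elem set \<Rightarrow> point set \<Rightarrow> point \<Rightarrow> 'k lattice_path_elem set" where
  "Kst r S T x = pv.span {pm r (pm r (pm r a (pel t [])) b) (pel x []) | a t b. a \<in> S \<and> t \<in> T \<and> b \<in> S}"

lemma coset_carrier [simp]: "J +>\<^bsub>A\<lparr>carrier := W\<rparr>\<^esub> a = J +>\<^bsub>A\<^esub> a"
  by (simp add: a_r_coset_def r_coset_def)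

text \<open>The standard module is again a presented space, with the kernel enlarged by the words
  through \<open>T\<close>. Its piece at \<open>y\<close> consists of paths from \<open>y\<close> to
  \<open>x\<close>, since the action is on the left and the generator sits at \<open>x\<close> on
  the right.\<close>

lemma standard_space:
  fixes \<pi> :: "'k::field lattice_path_elem \<Rightarrow> 'a"
  assumes G: "gpres r Y \<pi> S N A" and x: "x \<in> Y" and T: "T \<subseteq> Y"
  defines "K \<equiv> Kst r S T x" and "Sx \<equiv> (\<lambda>f. pm r f (pel x [])) ` S"
  defines "\<pi>' \<equiv> \<lambda>f. \<pi> ` K +>\<^bsub>A\<^esub> \<pi> f"
  shows "presents \<pi>' Sx (set_sum N K) (std_module A T x)"
    and "\<And>y n. y \<in> Y \<Longrightarrow> Ewd r y x n \<subseteq> Sx"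
    and "\<And>y n. y \<in> Y \<Longrightarrow> std_action A T x (idem A y) ` std_component A T x n = \<pi>' ` Ewd r y x n"
proof -
  note D = gpresD[OF G]
  let ?e = "\<lambda>x. pel x [] :: 'k lattice_path_elem"
  have eS: "?e t \<in> S" if "t \<in> Y" for t using gpres_pel[OF G that that, of "[]"] by simp
  have eP: "?e t \<in> Pth r" if "t \<in> Y" for t using eS[OF that] D(2) by blast
  have SP: "f \<in> Pth r" if "f \<in> S" for f using that D(2) by blast
  have carr: "carrier A = \<pi> ` S" by (rule presentsD(3)[OF D(1)])
  let ?G = "{pm r (pm r (pm r a (?e t)) b) (?e x) | a t b. a \<in> S \<and> t \<in> T \<and> b \<in> S}"
  have mul: "\<pi> a \<otimes>\<^bsub>A\<^esub> idem A t \<otimes>\<^bsub>A\<^esub> \<pi> b \<otimes>\<^bsub>A\<^esub> idem A x = \<pi> (pm r (pm r (pm r a (?e t)) b) (?e x))"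
    if "a \<in> S" "t \<in> T" "b \<in> S" for a t b
    using that T x eP SP by (simp add: D(4,6) pm_Pth subset_iff)
  have gens: "{a \<otimes>\<^bsub>A\<^esub> idem A t \<otimes>\<^bsub>A\<^esub> b \<otimes>\<^bsub>A\<^esub> idem A x | a t b. a \<in> carrier A \<and> t \<in> T \<and> b \<in> carrier A} = \<pi> ` ?G"
  proof (intro equalityI subsetI)
    fix z assume "z \<in> {a \<otimes>\<^bsub>A\<^esub> idem A t \<otimes>\<^bsub>A\<^esub> b \<otimes>\<^bsub>A\<^esub> idem A x | a t b. a \<in> carrier A \<and> t \<in> T \<and> b \<in> carrier A}"
    then obtain a' t b' where z': "a' \<in> carrier A" "t \<in> T" "b' \<in> carrier A" "z = a' \<otimes>\<^bsub>A\<^esub> idem A t \<otimes>\<^bsub>A\<^esub> b' \<otimes>\<^bsub>A\<^esub> idem A x"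
      by blast
    then obtain a b where "a \<in> S" "a' = \<pi> a" "b \<in> S" "b' = \<pi> b" unfolding carr by (elim imageE)
    then have z: "a \<in> S" "t \<in> T" "b \<in> S" "z = \<pi> a \<otimes>\<^bsub>A\<^esub> idem A t \<otimes>\<^bsub>A\<^esub> \<pi> b \<otimes>\<^bsub>A\<^esub> idem A x" using z' by simp_all
    then show "z \<in> \<pi> ` ?G" using mul[OF z(1-3)] by blast
  next
    fix z assume "z \<in> \<pi> ` ?G"
    then obtain a t b where z: "a \<in> S" "t \<in> T" "b \<in> S" "z = \<pi> (pm r (pm r (pm r a (?e t)) b) (?e x))" by blast
    then show "z \<in> {a \<otimes>\<^bsub>A\<^esub> idem A t \<otimes>\<^bsub>A\<^esub> b \<otimes>\<^bsub>A\<^esub> idem A x | a t b. a \<in> carrier A \<and> t \<in> T \<and> b \<in> carrier A}"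
      unfolding carr using mul[OF z(1-3), symmetric] by blast
  qed
  have GS: "?G \<subseteq> Sx" unfolding Sx_def using D(5) eS T by blast
  have SxS: "Sx \<subseteq> S" unfolding Sx_def using D(5) eS x by blast
  have subx: "pv.subspace Sx"
  proof -
    note s = presentsD(1)[OF D(1), unfolded pv.subspace_def]
    show ?thesis unfolding pv.subspace_def Sx_def
    proof (intro conjI ballI allI)
      show "0 \<in> (\<lambda>f. pm r f (?e x)) ` S" using s pm_zero(1)[of r "?e x"] by (metis imageI)
      show "f + g \<in> (\<lambda>f. pm r f (?e x)) ` S" if "f \<in> (\<lambda>f. pm r f (?e x)) ` S" "g \<in> (\<lambda>f. pm r f (?e x)) ` S" for f g
        using that s by (auto simp flip: pm_add_left)
      show "scl c f \<in> (\<lambda>f. pm r f (?e x)) ` S" if "f \<in> (\<lambda>f. pm r f (?e x)) ` S" for c f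
        using that s by (auto simp flip: pm_scl_left)
    qed
  qed
  have K: "pv.subspace K" unfolding K_def Kst_def by (rule pv.subspace_span)
  have KS: "K \<subseteq> Sx" unfolding K_def Kst_def by (rule pv.span_minimal[OF GS subx])
  have ker: "std_kernel A T x = \<pi> ` K"
    unfolding std_kernel_def gens K_def Kst_def using presents_span[OF D(1)] GS SxS by blast
  have cx: "(\<lambda>a. a \<otimes>\<^bsub>A\<^esub> idem A x) ` carrier A = \<pi> ` Sx"
  proof -
    have "\<pi> f \<otimes>\<^bsub>A\<^esub> idem A x = \<pi> (pm r f (?e x))" if "f \<in> S" for f
      using D(4)[OF SP[OF that] eP[OF x]] D(6)[OF x] by simp
    then show ?thesis unfolding carr Sx_def image_image by (rule image_cong[OF refl])
  qed
  have presx: "presents \<pi> Sx N (A\<lparr>carrier := \<pi> ` Sx\<rparr>)" by (rule presents_restrict[OF D(1) subx SxS])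
  show pres: "presents \<pi>' Sx (set_sum N K) (std_module A T x)"
    using presents_quot_module[OF presx K KS] unfolding std_module_def cx ker \<pi>'_def by simp
  show ES: "Ewd r y x n \<subseteq> Sx" if y: "y \<in> Y" for y n
  proof
    fix f :: "'k lattice_path_elem" assume f: "f \<in> Ewd r y x n"
    have "f \<in> S" using D(8)[OF y x] f by blast
    moreover have "f = pm r f (?e x)" using Ewd_idem(3)[of y r f x n] f D(3) y by auto
    ultimately show "f \<in> Sx" unfolding Sx_def by blast
  qed
  show "std_action A T x (idem A y) ` std_component A T x n = \<pi>' ` Ewd r y x n" if y: "y \<in> Y" for y n
  proof -
    have yL: "y \<in> lattice_pts r" using y D(3) by blast
    note c = presents_coset[OF presx KS, unfolded coset_carrier]
    have ceq: "\<pi>' f = \<pi>' g \<longleftrightarrow> f - g \<in> set_sum N K" if "f \<in> Sx" "g \<in> Sx" for f g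
      using presentsD(7)[OF pres that] .
    have eyS: "pm r (?e y) g \<in> Sx" if g: "g \<in> Sx" for g
    proof -
      obtain f where f: "f \<in> S" "g = pm r f (?e x)" using g unfolding Sx_def by blast
      have "pm r (?e y) g = pm r (pm r (?e y) f) (?e x)" unfolding f(2)
        using pm_assoc[OF eP[OF y] SP[OF f(1)] eP[OF x]] by simp
      moreover have "pm r (?e y) f \<in> S" using D(5) eS[OF y] f(1) by blast
      ultimately show ?thesis unfolding Sx_def by blast
    qed
    have eyK: "pm r (?e y) k \<in> K" if k: "k \<in> K" for k
    proof (rule pm_span[OF _ k[unfolded K_def Kst_def] K])
      show "?e y \<in> pv.span {?e y}" by (simp add: pv.span_base)
      fix g h assume g: "g \<in> {?e y}" and "h \<in> ?G"
      then obtain a t b where h: "a \<in> S" "t \<in> T" "b \<in> S" "h = pm r (pm r (pm r a (?e t)) b) (?e x)" by blast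
      have "pm r g h = pm r (pm r (pm r (pm r (?e y) a) (?e t)) b) (?e x)"
        unfolding h(4) using g h T eP x y SP by (auto simp: pm_assoc pm_Pth subset_iff)
      moreover have "pm r (?e y) a \<in> S" using D(5) eS[OF y] h(1) by blast
      ultimately show "pm r g h \<in> K" unfolding K_def Kst_def using h by (intro pv.span_base) blast
    qed
    have act: "std_action A T x (idem A y) (\<pi>' g) = \<pi>' (pm r (?e y) g)" if g: "g \<in> Sx" for g
    proof -
      have "\<pi> ` K +>\<^bsub>A\<^esub> (idem A y \<otimes>\<^bsub>A\<^esub> \<pi> (k + g)) = \<pi>' (pm r (?e y) g)" if k: "k \<in> K" for k
      proof -
        have kg: "k + g \<in> Sx" using k g KS pv.subspace_add[OF subx] by blast
        have "idem A y \<otimes>\<^bsub>A\<^esub> \<pi> (k + g) = \<pi> (pm r (?e y) (k + g))"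
          using D(4)[OF eP[OF y], of "k + g"] D(6)[OF y] SP SxS kg by auto
        moreover have "pm r (?e y) (k + g) - pm r (?e y) g = pm r (?e y) k" by (simp add: pm_add_right)
        then have "pm r (?e y) (k + g) - pm r (?e y) g \<in> set_sum N K"
          using eyK[OF k] set_sum_2[OF presentsD(2)[OF D(1)]] by auto
        then have "\<pi>' (pm r (?e y) (k + g)) = \<pi>' (pm r (?e y) g)" using ceq eyS[OF kg] eyS[OF g] by blast
        ultimately show ?thesis by (simp add: \<pi>'_def)
      qed
      then show ?thesis unfolding std_action_def ker using pv.subspace_0[OF K] c[OF g] by (auto simp: \<pi>'_def)
    qed
    show ?thesis
    proof (intro equalityI subsetI)
      fix z assume "z \<in> std_action A T x (idem A y) ` std_component A T x n"
      then obtain a where a: "a \<in> component A n"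
        "z = std_action A T x (idem A y) (\<pi> ` K +>\<^bsub>A\<^esub> (a \<otimes>\<^bsub>A\<^esub> idem A x))"
        unfolding std_component_def ker by blast
      obtain f where f: "f \<in> homog r n" "a = \<pi> f" using a(1) D(7) by blast
      have fP: "f \<in> Pth r" by (rule homog_Pth[OF f(1)])
      let ?h = "pm r (pm r (?e y) f) (?e x)"
      have hE: "?h \<in> Ewd r y x n" by (rule idem_hom[OF yL f(1)])
      \<comment> \<open>The homogeneous representative \<open>f\<close> need not lie in
        \<open>S\<close>, while the action is computed on representatives from \<open>S\<close>.
        Both are kept and compared through the product in \<open>A\<close>.\<close>
      obtain g where g: "g \<in> S" "a = \<pi> g" using a(1) D(10) unfolding carr by blast
      have gSx: "pm r g (?e x) \<in> Sx" unfolding Sx_def using g(1) by blast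
      have ax: "a \<otimes>\<^bsub>A\<^esub> idem A x = \<pi> (pm r g (?e x))" unfolding g(2)
        using D(4)[OF SP[OF g(1)] eP[OF x]] D(6)[OF x] by simp
      then have "z = std_action A T x (idem A y) (\<pi>' (pm r g (?e x)))" using a(2) by (simp add: \<pi>'_def)
      then have z: "z = \<pi>' (pm r (?e y) (pm r g (?e x)))" using act[OF gSx] by simp
      have "\<pi> (pm r (?e y) (pm r g (?e x))) = \<pi> (?e y) \<otimes>\<^bsub>A\<^esub> \<pi> (pm r g (?e x))"
        using D(4)[OF eP[OF y], of "pm r g (?e x)"] SP SxS gSx by auto
      also have "\<pi> (pm r g (?e x)) = \<pi> (pm r f (?e x))"
        using ax D(4)[OF fP eP[OF x]] D(6)[OF x] f(2) by simp
      also have "\<pi> (?e y) \<otimes>\<^bsub>A\<^esub> \<pi> (pm r f (?e x)) = \<pi> ?h"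
        using D(4)[OF eP[OF y] pm_Pth[OF fP eP[OF x]]] pm_assoc[OF eP[OF y] fP eP[OF x]] by simp
      finally have "z = \<pi>' ?h" unfolding z by (simp add: \<pi>'_def)
      then show "z \<in> \<pi>' ` Ewd r y x n" using hE by blast
    next
      fix z assume "z \<in> \<pi>' ` Ewd r y x n"
      then obtain f where f: "f \<in> Ewd r y x n" "z = \<pi>' f" by blast
      have fS: "f \<in> Sx" using ES[OF y] f(1) by blast
      have fP: "f \<in> Pth r" using SP SxS fS by blast
      have "\<pi> f \<in> component A n" using D(9)[OF y x] f(1) by blast
      moreover have "\<pi> f \<otimes>\<^bsub>A\<^esub> idem A x = \<pi> f"
        using D(4)[OF fP eP[OF x]] D(6)[OF x] Ewd_idem(3)[OF yL f(1)] by simp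
      ultimately have "\<pi>' f \<in> std_component A T x n" unfolding std_component_def ker \<pi>'_def by force
      moreover have "std_action A T x (idem A y) (\<pi>' f) = z"
        using act[OF fS] Ewd_idem(2)[OF yL f(1)] f(2) by simp
      ultimately show "z \<in> std_action A T x (idem A y) ` std_component A T x n" by blast
    qed
  qed
qed

subsection \<open>The relations in terms of words\<close>

lemma path_pel:
  "path_aa x i j = pel x [(True, i), (True, j)]" "path_bb x i j = pel x [(False, i), (False, j)]"
  "path_ab x i j = pel x [(True, i), (False, j)]" "path_ba x i j = pel x [(False, i), (True, j)]"
  by (simp_all add: path_aa_def path_bb_def path_ab_def path_ba_def pel_def arrow_of_def mv_def sg_def up_def down_def)

definition crel :: "point \<Rightarrow> nat \<Rightarrow> 'k::field lattice_path_elem" where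
  "crel z i = pel z [(False, i), (True, i)] + pel z [(True, i), (False, i)]"

lemma U_relations_cases:
  assumes "\<rho> \<in> (U_relations r :: 'k::field lattice_path_elem set)"
  obtains z s where "z \<in> lattice_pts r" "snd s \<in> {1..r}" "\<rho> = pel z [s, s]"
  | z s t where "z \<in> lattice_pts r" "snd s \<in> {1..r}" "snd t \<in> {1..r}" "snd s \<noteq> snd t" "\<rho> = pel z [s, t] + pel z [t, s]"
  | z i where "z \<in> lattice_pts r" "i \<in> {1..<r}" "\<rho> = crel z i - crel z (i + 1)"
  using assms unfolding U_relations_def path_pel crel_def
  by (elim UnE CollectE exE conjE) (metis fst_conv snd_conv)+

lemma U_relations_mem:
  assumes "z \<in> lattice_pts r"
  shows "snd s \<in> {1..r} \<Longrightarrow> pel z [s, s] \<in> (U_relations r :: 'k::field lattice_path_elem set)"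
    and "snd s \<in> {1..r} \<Longrightarrow> snd t \<in> {1..r} \<Longrightarrow> snd s \<noteq> snd t \<Longrightarrow> pel z [s, t] + pel z [t, s] \<in> (U_relations r :: 'k lattice_path_elem set)"
    and "i \<in> {1..<r} \<Longrightarrow> crel z i - crel z (i + 1) \<in> (U_relations r :: 'k lattice_path_elem set)"
proof -
  show "pel z [s, s] \<in> (U_relations r :: 'k lattice_path_elem set)" if "snd s \<in> {1..r}"
    using assms that unfolding U_relations_def path_pel by (cases s; cases "fst s") (simp_all, blast+)
  show "pel z [s, t] + pel z [t, s] \<in> (U_relations r :: 'k lattice_path_elem set)"
    if "snd s \<in> {1..r}" "snd t \<in> {1..r}" "snd s \<noteq> snd t"
  proof -
    obtain b i c j where s: "s = (b, i)" "t = (c, j)" by (metis surj_pair)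
    have ij: "i \<in> {1..r}" "j \<in> {1..r}" "i \<noteq> j" using that s by auto
    have 1: "pel z [(True, i), (False, j)] + pel z [(False, j), (True, i)] \<in> (U_relations r :: 'k lattice_path_elem set)"
      if "i \<in> {1..r}" "j \<in> {1..r}" "i \<noteq> j" for i j
      using assms that unfolding U_relations_def path_pel by blast
    have 2: "pel z [(True, i), (True, j)] + pel z [(True, j), (True, i)] \<in> (U_relations r :: 'k lattice_path_elem set)"
      "pel z [(False, i), (False, j)] + pel z [(False, j), (False, i)] \<in> (U_relations r :: 'k lattice_path_elem set)"
      using assms ij unfolding U_relations_def path_pel by blast+
    show ?thesis using 1[of i j] 1[of j i] 2 ij by (cases b; cases c) (simp_all add: s add.commute)
  qed
  show "crel z i - crel z (i + 1) \<in> (U_relations r :: 'k lattice_path_elem set)" if "i \<in> {1..<r}"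
    using assms that unfolding U_relations_def path_pel crel_def by blast
qed

lemma V_relations_cases:
  assumes "\<rho> \<in> (V_relations r :: 'k::field lattice_path_elem set)"
  obtains z s t where "z \<in> lattice_pts r" "snd s \<in> {1..r}" "snd t \<in> {1..r}" "\<rho> = pel z [s, t] - pel z [t, s]"
  | z where "z \<in> lattice_pts r" "\<rho> = (\<Sum>i=1..r. pel z [(False, i), (True, i)])"
  using assms unfolding V_relations_def path_pel
proof (elim UnE CollectE exE conjE)
  fix z i j assume "\<rho> = pel z [(True, i), (True, j)] - pel z [(True, j), (True, i)]" "z \<in> lattice_pts r" "i \<in> {1..r}" "j \<in> {1..r}"
  then show thesis using that(1)[of z "(True, i)" "(True, j)"] by simp
next
  fix z i j assume "\<rho> = pel z [(False, i), (False, j)] - pel z [(False, j), (False, i)]" "z \<in> lattice_pts r" "i \<in> {1..r}" "j \<in> {1..r}"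
  then show thesis using that(1)[of z "(False, i)" "(False, j)"] by simp
next
  fix z i j assume "\<rho> = pel z [(True, i), (False, j)] - pel z [(False, j), (True, i)]" "z \<in> lattice_pts r" "i \<in> {1..r}" "j \<in> {1..r}"
  then show thesis using that(1)[of z "(True, i)" "(False, j)"] by simp
next
  fix z assume "\<rho> = (\<Sum>i=1..r. pel z [(False, i), (True, i)])" "z \<in> lattice_pts r"
  then show thesis using that(2) by simp
qed

lemma pel_Pth2: "z \<in> lattice_pts r \<Longrightarrow> snd s \<in> {1..r} \<Longrightarrow> snd t \<in> {1..r} \<Longrightarrow> pel z [s, t] \<in> Pth r"
  by (rule pel_Pth) simp_all

lemma crel_Pth: "z \<in> lattice_pts r \<Longrightarrow> i \<in> {1..r} \<Longrightarrow> crel z i \<in> Pth r"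
  unfolding crel_def by (intro pv.subspace_add[OF Pth_subspace] pel_Pth2) simp_all

lemma U_relations_Pth: "(U_relations r :: 'k::field lattice_path_elem set) \<subseteq> Pth r"
proof
  fix \<rho> :: "'k lattice_path_elem" assume "\<rho> \<in> U_relations r"
  then show "\<rho> \<in> Pth r"
  proof (cases rule: U_relations_cases)
    case (1 z s)
    then show ?thesis by (simp add: pel_Pth2)
  next
    case (2 z s t)
    then show ?thesis by (simp add: pel_Pth2 pv.subspace_add[OF Pth_subspace])
  next
    case (3 z i)
    then show ?thesis by (simp add: crel_Pth pv.subspace_diff[OF Pth_subspace])
  qed
qed

lemma V_relations_Pth: "(V_relations r :: 'k::field lattice_path_elem set) \<subseteq> Pth r"
proof
  fix \<rho> :: "'k lattice_path_elem" assume "\<rho> \<in> V_relations r"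
  then show "\<rho> \<in> Pth r"
  proof (cases rule: V_relations_cases)
    case (1 z s t)
    then show ?thesis by (simp add: pel_Pth2 pv.subspace_diff[OF Pth_subspace])
  next
    case (2 z)
    have "pel z [(False, i), (True, i)] \<in> (Pth r :: 'k lattice_path_elem set)" if "i \<in> {1..r}" for i
      using 2(1) that by (intro pel_Pth2) simp_all
    then show ?thesis unfolding 2(2) by (rule pv.subspace_sum[OF Pth_subspace])
  qed
qed

lemma pm_sandwich:
  assumes "u \<in> lattice_pts r" "valid r a" "valid r c"
  shows "pm r (pm r (pel u a) (pel z c)) (pel v b) =
    (if z = endp u a \<and> v = endp z c then pel u (a @ c @ b) else 0 :: 'k::field lattice_path_elem)"
  using assms by (simp add: pm_pel)

lemma pm_diff_left: "pm r (f - g) h = pm r f h - pm r g h"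
  using pm_add_left[of r "f - g" g h] by simp

lemma pm_diff_right: "pm r f (g - h) = pm r f g - pm r f h"
  using pm_add_right[of r f "g - h" h] by simp

lemma pm_sum_left: "pm r (\<Sum>i\<in>A. f i) h = (\<Sum>i\<in>A. pm r (f i) h)"
  by (induction A rule: infinite_finite_induct) (auto simp: pm_add_left)

lemma pm_sum_right: "pm r h (\<Sum>i\<in>A. f i) = (\<Sum>i\<in>A. pm r h (f i))"
  by (induction A rule: infinite_finite_induct) (auto simp: pm_add_right)

lemma endp_pair: "endp z [s, t] = endp z [t, s]" "endp z [(False, i), (True, i)] = z" "endp z [(True, i), (False, i)] = z"
  using mv_commute[of z s t] mv_opp[of z "(True, i)"] by (simp_all add: opp_def)

text \<open>Bilinearity reduces the outer factors to single paths, where the conditions on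
  \<open>F\<close> can be read off letter by letter.\<close>

lemma phi_two_sided:
  assumes "\<And>u a t v b. u \<in> lattice_pts r \<Longrightarrow> valid r a \<Longrightarrow> t \<in> T \<Longrightarrow> v \<in> lattice_pts r \<Longrightarrow> valid r b \<Longrightarrow>
      phi x F (pm r (pm r (pel u a) t) (pel v b)) = (0 :: 'k::field)"
    and "f \<in> two_sided r T"
  shows "phi x F f = 0"
proof -
  let ?Z = "{f. phi x F f = 0}"
  let ?P = "{pel u w | u w. u \<in> lattice_pts r \<and> valid r w} :: 'k lattice_path_elem set"
  have "two_sided r T \<subseteq> ?Z"
    unfolding two_sided_def
  proof (rule pv.span_minimal[OF _ phi_subspace], rule subsetI)
    fix g assume "g \<in> {pm r (pm r a t) b | a t b. a \<in> Pth r \<and> t \<in> T \<and> b \<in> Pth r}"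
    then obtain a t b where g: "g = pm r (pm r a t) b" "a \<in> Pth r" "t \<in> T" "b \<in> Pth r" by blast
    let ?Q = "{pm r p t | p. p \<in> ?P}"
    have "pm r a t \<in> pv.span ?Q"
    proof (rule pm_span[OF g(2)[unfolded Pth_span], of t "{t}"])
      show "t \<in> pv.span {t}" by (simp add: pv.span_base)
      show "pv.subspace (pv.span ?Q)" by (rule pv.subspace_span)
      show "pm r p q \<in> pv.span ?Q" if "p \<in> ?P" "q \<in> {t}" for p q using that by (intro pv.span_base) blast
    qed
    then show "g \<in> ?Z" unfolding g(1)
    proof (rule pm_span[OF _ g(4)[unfolded Pth_span] phi_subspace])
      fix p q assume "p \<in> ?Q" "q \<in> ?P"
      then obtain u a v b where "p = pm r (pel u a) t" "u \<in> lattice_pts r" "valid r a"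
        "q = pel v b" "v \<in> lattice_pts r" "valid r b" by blast
      then show "pm r p q \<in> ?Z" using assms(1)[OF _ _ g(3)] by simp
    qed
  qed
  then show ?thesis using assms(2) by blast
qed

lemma phi_U_relations:
  assumes F: "U_rel r F" and f: "f \<in> two_sided r (U_relations r)"
  shows "phi x F f = (0 :: 'k::field)"
  using _ f
proof (rule phi_two_sided)
  fix u a t v b assume u: "u \<in> lattice_pts r" "valid r a" and t: "t \<in> (U_relations r :: 'k lattice_path_elem set)"
    and v: "v \<in> lattice_pts r" "valid r b"
  note D = U_relD[OF F u(2) v(2)]
  note S = pm_sandwich[OF u]
  have c: "phi x F (pm r (pm r (pel u a) (crel z i)) (pel v b)) =
      (if u = x \<and> z = endp u a \<and> v = z then F (a @ (False, i) # (True, i) # b) + F (a @ (True, i) # (False, i) # b) else 0)"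
    if "i \<in> {1..r}" for z i
  proof -
    have "valid r [(False, i), (True, i)]" "valid r [(True, i), (False, i)]" using that by simp_all
    then show ?thesis unfolding crel_def pm_add_left pm_add_right phi_add
      by (simp add: S endp_pair phi_pel del: endp_simps)
  qed
  from t show "phi x F (pm r (pm r (pel u a) t) (pel v b)) = 0"
  proof (cases rule: U_relations_cases)
    case (1 z s)
    then have "valid r [s, s]" by simp
    then show ?thesis unfolding 1(3) using D(1)[OF 1(2)] by (simp add: S phi_pel del: endp_simps)
  next
    case (2 z s t')
    then have "valid r [s, t']" "valid r [t', s]" by simp_all
    then show ?thesis unfolding 2(5) pm_add_left pm_add_right phi_add
      using D(2)[OF 2(2-4)] endp_pair(1)[of z s t'] by (simp add: S phi_pel del: endp_simps)
  next
    case (3 z i)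
    then have i: "i \<in> {1..r}" "i + 1 \<in> {1..r}" by auto
    show ?thesis unfolding 3(3) pm_diff_left pm_diff_right phi_diff c[OF i(1)] c[OF i(2)]
      using D(3)[OF i] by simp
  qed
qed

lemma phi_V_relations:
  assumes F: "V_rel r F" and f: "f \<in> two_sided r (V_relations r)"
  shows "phi x F f = (0 :: 'k::field)"
  using _ f
proof (rule phi_two_sided)
  fix u a t v b assume u: "u \<in> lattice_pts r" "valid r a" and t: "t \<in> (V_relations r :: 'k lattice_path_elem set)"
    and v: "v \<in> lattice_pts r" "valid r b"
  note D = V_relD[OF F u(2) v(2)]
  note S = pm_sandwich[OF u]
  from t show "phi x F (pm r (pm r (pel u a) t) (pel v b)) = 0"
  proof (cases rule: V_relations_cases)
    case (1 z s t')
    then have "valid r [s, t']" "valid r [t', s]" by simp_all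
    then show ?thesis unfolding 1(4) pm_diff_left pm_diff_right phi_diff
      using D(1)[OF 1(2,3)] endp_pair(1)[of z s t'] by (simp add: S phi_pel del: endp_simps)
  next
    case (2 z)
    have "phi x F (pm r (pm r (pel u a) (pel z [(False, i), (True, i)])) (pel v b)) =
      (if u = x \<and> z = endp u a \<and> v = z then F (a @ (False, i) # (True, i) # b) else 0)" if "i \<in> {1..r}" for i
    proof -
      have "valid r [(False, i), (True, i)]" using that by simp
      then show ?thesis by (simp add: S endp_pair phi_pel del: endp_simps)
    qed
    then have "phi x F (pm r (pm r (pel u a) t) (pel v b)) =
      (\<Sum>i=1..r. if u = x \<and> z = endp u a \<and> v = z then F (a @ (False, i) # (True, i) # b) else 0)"
      unfolding 2(2) pm_sum_left pm_sum_right phi_sum by (intro sum.cong) auto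
    then show ?thesis using D(2) by (cases "u = x \<and> z = endp u a \<and> v = z") simp_all
  qed
qed

lemma two_sided_pel:
  assumes "u \<in> lattice_pts r" "valid r a" "t \<in> T" "v \<in> lattice_pts r" "valid r b"
  shows "pm r (pm r (pel u a) t) (pel v b) \<in> two_sided r T"
  unfolding two_sided_def using assms pel_Pth by (intro pv.span_base) blast

text \<open>Converse of \<open>phi_U_relations\<close>: together they identify the dual of a graded
  piece with a space of functions on words.\<close>

lemma U_rel_linear:
  fixes \<psi> :: "'k::field lattice_path_elem \<Rightarrow> 'k"
  assumes \<psi>: "Vector_Spaces.linear scl (*) \<psi>" and N: "\<And>g. g \<in> two_sided r (U_relations r) \<Longrightarrow> \<psi> g = 0"
    and x: "x \<in> lattice_pts r"
  shows "U_rel r (\<lambda>w. \<psi> (pel x w))"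
proof (rule U_relI)
  interpret \<psi>: Vector_Spaces.linear scl "(*)" \<psi> by (rule \<psi>)
  fix a b assume ab: "valid r a" "valid r b"
  let ?z = "endp x a"
  have z: "?z \<in> lattice_pts r" by (rule endp_lattice[OF x ab(1)])
  note S = pm_sandwich[OF x ab(1)]
  have zz: "\<psi> (pm r (pm r (pel x a) t) (pel v b)) = 0" if "t \<in> U_relations r" "v \<in> lattice_pts r" for t v
    by (rule N[OF two_sided_pel[OF x ab(1) that ab(2)]])
  show "\<psi> (pel x (a @ s # s # b)) = 0" if s: "snd s \<in> {1..r}" for s
  proof -
    have v: "valid r [s, s]" using s by simp
    show ?thesis using zz[OF U_relations_mem(1)[OF z s] endp_lattice[OF z v]] unfolding S[OF v]
      by (simp del: endp_simps)
  qed
  show "\<psi> (pel x (a @ s # t # b)) + \<psi> (pel x (a @ t # s # b)) = 0"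
    if s: "snd s \<in> {1..r}" "snd t \<in> {1..r}" "snd s \<noteq> snd t" for s t
  proof -
    have v: "valid r [s, t]" "valid r [t, s]" using s by simp_all
    have "\<psi> (pm r (pm r (pel x a) (pel ?z [s, t] + pel ?z [t, s])) (pel (endp ?z [s, t]) b)) = 0"
      by (rule zz[OF U_relations_mem(2)[OF z s] endp_lattice[OF z v(1)]])
    then show ?thesis unfolding pm_add_left pm_add_right \<psi>.add S[OF v(1)] S[OF v(2)]
      using endp_pair(1)[of ?z s t] by (simp del: endp_simps)
  qed
  let ?g = "\<lambda>i. \<psi> (pel x (a @ (False, i) # (True, i) # b)) + \<psi> (pel x (a @ (True, i) # (False, i) # b))"
  \<comment> \<open>The quiver relations compare neighbouring directions; chaining them down to
    direction 1 compares any two.\<close>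
  have step: "?g i = ?g (i + 1)" if i: "i \<in> {1..<r}" for i
  proof -
    have v: "valid r [(False, i), (True, i)]" "valid r [(True, i), (False, i)]"
      "valid r [(False, i + 1), (True, i + 1)]" "valid r [(True, i + 1), (False, i + 1)]" using i by simp_all
    have "\<psi> (pm r (pm r (pel x a) (crel ?z i - crel ?z (i + 1))) (pel ?z b)) = 0"
      by (rule zz[OF U_relations_mem(3)[OF z i] z])
    then show ?thesis unfolding crel_def pm_diff_left pm_diff_right pm_add_left pm_add_right \<psi>.add \<psi>.diff
        S[OF v(1)] S[OF v(2)] S[OF v(3)] S[OF v(4)] endp_pair(2,3) by simp
  qed
  have one: "?g i = ?g 1" if "i \<in> {1..r}" for i
    using that
  proof (induction i)
    case (Suc i)
    then show ?case using step[of i] by (cases "i = 0") auto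
  qed simp
  show "?g i = ?g j" if "i \<in> {1..r}" "j \<in> {1..r}" for i j using one[OF that(1)] one[OF that(2)] by simp
qed

text \<open>Mixed commutations are listed with the up letter first in the positive term, so the
  difference is available only up to sign.\<close>

lemma V_relations_mem:
  assumes "z \<in> lattice_pts r"
  shows "snd s \<in> {1..r} \<Longrightarrow> snd t \<in> {1..r} \<Longrightarrow> s \<noteq> t \<Longrightarrow>
      pel z [s, t] - pel z [t, s] \<in> (V_relations r :: 'k::field lattice_path_elem set) \<or>
      pel z [t, s] - pel z [s, t] \<in> (V_relations r :: 'k lattice_path_elem set)"
    and "(\<Sum>i=1..r. pel z [(False, i), (True, i)]) \<in> (V_relations r :: 'k lattice_path_elem set)"
proof -
  show "pel z [s, t] - pel z [t, s] \<in> (V_relations r :: 'k lattice_path_elem set) \<or>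
      pel z [t, s] - pel z [s, t] \<in> (V_relations r :: 'k lattice_path_elem set)"
    if st: "snd s \<in> {1..r}" "snd t \<in> {1..r}" "s \<noteq> t"
  proof -
    obtain b i c j where s: "s = (b, i)" "t = (c, j)" by (metis surj_pair)
    have ij: "i \<in> {1..r}" "j \<in> {1..r}" using st s by auto
    have 1: "pel z [(True, i), (False, j)] - pel z [(False, j), (True, i)] \<in> (V_relations r :: 'k lattice_path_elem set)"
      if "i \<in> {1..r}" "j \<in> {1..r}" for i j
      using assms that unfolding V_relations_def path_pel by blast
    have 2: "pel z [(True, i), (True, j)] - pel z [(True, j), (True, i)] \<in> (V_relations r :: 'k lattice_path_elem set)"
      "pel z [(False, i), (False, j)] - pel z [(False, j), (False, i)] \<in> (V_relations r :: 'k lattice_path_elem set)"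
      if "i \<noteq> j"
      using assms ij that unfolding V_relations_def path_pel by blast+
    show ?thesis using 1[of i j] 1[of j i] 2 ij st(3) by (cases b; cases c) (simp_all add: s)
  qed
  show "(\<Sum>i=1..r. pel z [(False, i), (True, i)]) \<in> (V_relations r :: 'k lattice_path_elem set)"
    using assms unfolding V_relations_def path_pel by blast
qed

lemma V_rel_linear:
  fixes \<psi> :: "'k::field lattice_path_elem \<Rightarrow> 'k"
  assumes \<psi>: "Vector_Spaces.linear scl (*) \<psi>" and N: "\<And>g. g \<in> two_sided r (V_relations r) \<Longrightarrow> \<psi> g = 0"
    and x: "x \<in> lattice_pts r"
  shows "V_rel r (\<lambda>w. if length w = n \<and> endp x w = y then \<psi> (pel x w) else 0)"
  unfolding V_rel_def
proof (intro allI impI conjI)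
  interpret \<psi>: Vector_Spaces.linear scl "(*)" \<psi> by (rule \<psi>)
  fix a b assume ab: "valid r a" "valid r b"
  let ?F = "\<lambda>w. if length w = n \<and> endp x w = y then \<psi> (pel x w) else 0"
  let ?z = "endp x a"
  have z: "?z \<in> lattice_pts r" by (rule endp_lattice[OF x ab(1)])
  note S = pm_sandwich[OF x ab(1)]
  have zz: "\<psi> (pm r (pm r (pel x a) t) (pel v b)) = 0" if "t \<in> V_relations r" "v \<in> lattice_pts r" for t v
    by (rule N[OF two_sided_pel[OF x ab(1) that ab(2)]])
  show "?F (a @ [s, t] @ b) = ?F (a @ [t, s] @ b)" if s: "snd s \<in> {1..r}" "snd t \<in> {1..r}" for s t
  proof -
    have eq: "\<psi> (pel x (a @ [s, t] @ b)) = \<psi> (pel x (a @ [t, s] @ b))"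
      if d: "pel ?z [s, t] - pel ?z [t, s] \<in> (V_relations r :: 'k lattice_path_elem set)"
        and s: "snd s \<in> {1..r}" "snd t \<in> {1..r}" for s t
    proof -
      have v: "valid r [s, t]" "valid r [t, s]" using s by simp_all
      have "\<psi> (pm r (pm r (pel x a) (pel ?z [s, t] - pel ?z [t, s])) (pel (endp ?z [s, t]) b)) = 0"
        by (rule zz[OF d endp_lattice[OF z v(1)]])
      then show ?thesis unfolding pm_diff_left pm_diff_right \<psi>.diff S[OF v(1)] S[OF v(2)]
        using endp_pair(1)[of ?z s t] by (simp del: endp_simps)
    qed
    have "\<psi> (pel x (a @ [s, t] @ b)) = \<psi> (pel x (a @ [t, s] @ b))"
    proof (cases "s = t")
      case False
      then show ?thesis using V_relations_mem(1)[OF z s, where 'k='k] eq[of s t] eq[of t s] s by auto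
    qed simp
    moreover have "endp x (a @ [s, t] @ b) = endp x (a @ [t, s] @ b)" using mv_commute[of ?z s t] by simp
    ultimately show ?thesis by simp
  qed
  show "(\<Sum>i=1..r. ?F (a @ [(False, i), (True, i)] @ b)) = 0"
  proof -
    have "0 = \<psi> (pm r (pm r (pel x a) (\<Sum>i=1..r. pel ?z [(False, i), (True, i)])) (pel ?z b))"
      using zz[OF V_relations_mem(2)[OF z] z] by simp
    also have "\<dots> = (\<Sum>i=1..r. \<psi> (pel x (a @ [(False, i), (True, i)] @ b)))"
      unfolding pm_sum_left pm_sum_right \<psi>.sum
    proof (rule sum.cong[OF refl])
      fix i assume "i \<in> {1..r}"
      then have v: "valid r [(False, i), (True, i)]" by simp
      show "\<psi> (pm r (pm r (pel x a) (pel ?z [(False, i), (True, i)])) (pel ?z b)) = \<psi> (pel x (a @ [(False, i), (True, i)] @ b))"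
        unfolding S[OF v] endp_pair(2) by simp
    qed
    finally have *: "(\<Sum>i=1..r. \<psi> (pel x (a @ [(False, i), (True, i)] @ b))) = 0" by simp
    have e: "?F (a @ [(False, i), (True, i)] @ b) =
      (if length a + 2 + length b = n \<and> endp ?z b = y then \<psi> (pel x (a @ [(False, i), (True, i)] @ b)) else 0)" for i
      using endp_pair(2)[of ?z i] by simp
    show ?thesis unfolding e
    proof (cases "length a + 2 + length b = n \<and> endp ?z b = y")
      case True
      show "(\<Sum>i=1..r. if length a + 2 + length b = n \<and> endp ?z b = y
          then \<psi> (pel x (a @ [(False, i), (True, i)] @ b)) else 0) = 0" unfolding if_P[OF True] by (rule *)
    next
      case False
      show "(\<Sum>i=1..r. if length a + 2 + length b = n \<and> endp ?z b = y
          then \<psi> (pel x (a @ [(False, i), (True, i)] @ b)) else 0) = 0" unfolding if_not_P[OF False] by simp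
    qed
  qed
qed

lemma kills_linear:
  fixes \<psi> :: "'k::field lattice_path_elem \<Rightarrow> 'k"
  assumes "\<And>a b. valid r a \<Longrightarrow> valid r b \<Longrightarrow> endp x a \<in> K \<Longrightarrow> endp x (a @ b) = y \<Longrightarrow> \<psi> (pel x (a @ b)) = 0"
  shows "kills r x K (\<lambda>w. if length w = n \<and> endp x w = y then \<psi> (pel x w) else 0)"
  using assms unfolding kills_def by simp

lemma phi_idem:
  assumes F: "kills r x K F" and K: "K \<subseteq> lattice_pts r" and f: "f \<in> two_sided r ((\<lambda>t. pel t []) ` K)"
  shows "phi x F f = (0 :: 'k::field)"
  using _ f
proof (rule phi_two_sided)
  fix u a v b and t :: "'k lattice_path_elem" assume u: "u \<in> lattice_pts r" "valid r a" and t: "t \<in> (\<lambda>t. pel t []) ` K"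
    and v: "v \<in> lattice_pts r" "valid r b"
  from t obtain z where z: "z \<in> K" "t = pel z []" by blast
  have n: "valid r []" by simp
  show "phi x F (pm r (pm r (pel u a) t) (pel v b)) = 0"
    using killsD[OF F u(2) v(2)] z(1) unfolding z(2) pm_sandwich[OF u n] by (auto simp: phi_pel)
qed

text \<open>The kernel of a standard module lies in the two-sided ideal of the idempotents at
  \<open>T\<close>, so \<open>phi_idem\<close> applies.\<close>

lemma phi_Kst:
  assumes F: "kills r x K F" and S: "S \<subseteq> Pth r" and T: "T \<subseteq> K" "T \<subseteq> lattice_pts r" and y: "y \<in> lattice_pts r" and f: "f \<in> Kst r S T y"
  shows "phi x F f = (0 :: 'k::field)"
proof -
  let ?I = "two_sided r ((\<lambda>t. pel t []) ` T) :: 'k lattice_path_elem set"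
  have TP: "(\<lambda>t. pel t []) ` T \<subseteq> (Pth r :: 'k lattice_path_elem set)" using T(2) pel_Pth by fastforce
  have "Kst r S T y \<subseteq> ?I"
    unfolding Kst_def
  proof (rule pv.span_minimal[OF _ two_sided_subspace], rule subsetI)
    fix g assume "g \<in> {pm r (pm r (pm r a (pel t [])) b) (pel y []) | a t b. a \<in> S \<and> t \<in> T \<and> b \<in> S}"
    then obtain a t b where g: "g = pm r (pm r (pm r a (pel t [])) b) (pel y [])" "a \<in> S" "t \<in> T" "b \<in> S" by blast
    have "pm r (pm r a (pel t [])) b \<in> ?I" unfolding two_sided_def using g S by (intro pv.span_base) blast
    moreover have "pel y [] \<in> (Pth r :: 'k lattice_path_elem set)" using y by simp
    ultimately show "g \<in> ?I" unfolding g(1) using two_sided_mult(2)[OF TP] by blast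
  qed
  moreover have "kills r x T F" using F T(1) unfolding kills_def by blast
  ultimately show ?thesis using phi_idem[OF _ T(2)] f by blast
qed

lemma phi_set_sum:
  assumes "\<And>g. g \<in> A \<Longrightarrow> phi x F g = 0" "\<And>g. g \<in> B \<Longrightarrow> phi x F g = 0" "f \<in> set_sum A B"
  shows "phi x F f = 0"
  using assms unfolding set_sum_def by (auto simp: phi_add)

lemma pel_idem_mem:
  assumes "x \<in> lattice_pts r" "valid r a" "valid r b" "endp x a \<in> K" "K \<subseteq> lattice_pts r"
  shows "pel x (a @ b) \<in> (two_sided r ((\<lambda>t. pel t []) ` K) :: 'k::field lattice_path_elem set)"
proof -
  have n: "valid r []" by simp
  have "pm r (pm r (pel x a) (pel (endp x a) [])) (pel (endp x a) b) \<in> (two_sided r ((\<lambda>t. pel t []) ` K) :: 'k lattice_path_elem set)"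
    using assms by (intro two_sided_pel) auto
  then show ?thesis unfolding pm_sandwich[OF assms(1,2) n] by simp
qed

subsection \<open>Dimensions\<close>

lemma set_sum_0 [simp]: "set_sum {0} B = B"
  by (auto simp: set_sum_def)

lemma gpres_quot_ideal:
  assumes G: "gpres r Y \<pi> (Pth r) N A" and T: "T \<subseteq> Pth r"
  obtains \<pi>' where "gpres r Y \<pi>' (Pth r) (set_sum N (two_sided r T)) (quot_algebra A (ideal_gen A (\<pi> ` T)))"
  using gpres_quot[OF G T] ideal_gen_pres[OF G T] by metis

lemma path_quot_gpres:
  assumes "T \<subseteq> (Pth r :: 'k::field lattice_path_elem set)"
  obtains \<pi> where "gpres r (lattice_pts r) \<pi> (Pth r) (two_sided r T)
    (quot_algebra (path_algebra (lattice_quiver r)) (ideal_gen (path_algebra (lattice_quiver r)) T))"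
  using gpres_quot_ideal[OF gpres_path assms] by (metis image_ident set_sum_0)

lemma pel_Kst:
  assumes "y \<in> lattice_pts r" "x \<in> lattice_pts r" "valid r a" "valid r b" "endp y a \<in> T" "endp y (a @ b) = x"
    and "pel y a \<in> S" "pel (endp y a) b \<in> S"
  shows "pel y (a @ b) \<in> (Kst r S T x :: 'k::field lattice_path_elem set)"
proof -
  have n: "valid r []" by simp
  have v: "valid r (a @ b)" using assms by simp
  have "pm r (pm r (pm r (pel y a) (pel (endp y a) [])) (pel (endp y a) b)) (pel x []) = (pel y (a @ b) :: 'k lattice_path_elem)"
    using assms(6) unfolding pm_sandwich[OF assms(1,3) n] by (simp add: pm_pel[OF assms(1) v])
  then show ?thesis unfolding Kst_def using assms by (intro pv.span_base CollectI) metis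
qed

lemma linear_kills_idem:
  fixes \<psi> :: "'k::field lattice_path_elem \<Rightarrow> 'k"
  assumes "\<And>g. g \<in> two_sided r ((\<lambda>t. pel t []) ` K) \<Longrightarrow> \<psi> g = 0" "x \<in> lattice_pts r" "K \<subseteq> lattice_pts r"
  shows "kills r x K (\<lambda>w. if length w = n \<and> endp x w = y then \<psi> (pel x w) else 0)"
  using assms by (intro kills_linear) (metis pel_idem_mem)

text \<open>A word through \<open>T\<close> is cut at a point of \<open>T\<close>, and both halves
  must be representatives in \<open>S\<close>; this is where \<open>T \<subseteq> Y\<close>
  enters.\<close>

lemma linear_kills_Kst:
  fixes \<psi> :: "'k::field lattice_path_elem \<Rightarrow> 'k"
  assumes G: "gpres r Y \<pi> S N A" and "x \<in> Y" "y \<in> Y" "T \<subseteq> Y" and \<psi>: "\<And>g. g \<in> Kst r S T x \<Longrightarrow> \<psi> g = 0"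
  shows "kills r y T (\<lambda>w. if length w = n \<and> endp y w = x then \<psi> (pel y w) else 0)"
proof (rule kills_linear)
  fix a b assume ab: "valid r a" "valid r b" "endp y a \<in> T" "endp y (a @ b) = x"
  have "pel y a \<in> S" by (rule gpres_pel[OF G \<open>y \<in> Y\<close> _ ab(1)]) (use ab(3) assms in auto)
  moreover have "pel (endp y a) b \<in> S" by (rule gpres_pel[OF G _ \<open>x \<in> Y\<close> ab(2)]) (use ab assms in auto)
  moreover have "x \<in> lattice_pts r" "y \<in> lattice_pts r" using assms gpresD(3)[OF G] by auto
  ultimately show "\<psi> (pel y (a @ b)) = 0" by (intro \<psi> pel_Kst ab)
qed

lemma kills_Un: "kills r x (K \<union> K') F \<longleftrightarrow> kills r x K F \<and> kills r x K' F"
  unfolding kills_def by blast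

context cubist_ideal
begin

definition null_paths :: "'k::field lattice_path_elem set" where
  "null_paths = set_sum (two_sided r (U_relations r)) (two_sided r ((\<lambda>t. pel t []) ` (L - X)))"

text \<open>All lattice points are kept as vertices of the presentation; outside the Cubist set
  their idempotents have class zero.\<close>

lemma U_gpres:
  obtains \<pi> where "gpres r L \<pi> (Pth r) null_paths (U_cubist TYPE('k::field) r X)"
proof -
  let ?E = "(\<lambda>t. pel t []) ` (L - X) :: 'k lattice_path_elem set"
  obtain \<pi> where \<pi>: "gpres r L \<pi> (Pth r) (two_sided r (U_relations r)) (U_algebra TYPE('k) r)"
    using path_quot_gpres[OF U_relations_Pth[where 'k='k, of r]] unfolding U_algebra_def by blast
  have E: "?E \<subseteq> Pth r" using pel_Pth[of _ r "[]"] by auto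
  have "idem (U_algebra TYPE('k) r) ` (L - X) = \<pi> ` ?E"
    unfolding image_image using gpresD(6)[OF \<pi>] by (intro image_cong refl) blast
  then show thesis
    using gpres_quot_ideal[OF \<pi> E] that unfolding null_paths_def U_cubist_def by metis
qed

lemma null_paths_subset:
  "two_sided r (U_relations r) \<subseteq> (null_paths :: 'k::field lattice_path_elem set)"
  "two_sided r ((\<lambda>t. pel t []) ` (L - X)) \<subseteq> (null_paths :: 'k lattice_path_elem set)"
proof -
  have E: "(\<lambda>t. pel t []) ` (L - X) \<subseteq> (Pth r :: 'k lattice_path_elem set)" using pel_Pth[of _ r "[]"] by auto
  show "two_sided r (U_relations r) \<subseteq> (null_paths :: 'k lattice_path_elem set)"
    "two_sided r ((\<lambda>t. pel t []) ` (L - X)) \<subseteq> (null_paths :: 'k lattice_path_elem set)"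
    unfolding null_paths_def by (simp_all add: set_sum_1 set_sum_2 two_sided_subspace)
qed

lemma phi_null_paths:
  assumes "U_rel r F" "kills r x (L - X) F" "f \<in> null_paths"
  shows "phi x F f = (0 :: 'k::field)"
proof (rule phi_set_sum[OF _ _ assms(3)[unfolded null_paths_def]])
  show "phi x F g = 0" if "g \<in> two_sided r (U_relations r)" for g by (rule phi_U_relations[OF assms(1) that])
  show "phi x F g = 0" if "g \<in> two_sided r ((\<lambda>t. pel t []) ` (L - X))" for g
    by (rule phi_idem[OF assms(2) _ that]) blast
qed

lemma linear_null_paths:
  fixes \<psi> :: "'k::field lattice_path_elem \<Rightarrow> 'k"
  assumes "Vector_Spaces.linear scl (*) \<psi>" and Z: "\<And>g. g \<in> null_paths \<Longrightarrow> \<psi> g = 0" and x: "x \<in> L"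
  shows "U_rel r (\<lambda>w. if length w = n \<and> endp x w = y then \<psi> (pel x w) else 0)"
    and "kills r x (L - X) (\<lambda>w. if length w = n \<and> endp x w = y then \<psi> (pel x w) else 0)"
proof -
  show "U_rel r (\<lambda>w. if length w = n \<and> endp x w = y then \<psi> (pel x w) else 0)"
    by (rule U_rel_restrict, rule U_rel_linear[OF assms(1) _ x]) (use Z null_paths_subset(1) in blast)
  show "kills r x (L - X) (\<lambda>w. if length w = n \<and> endp x w = y then \<psi> (pel x w) else 0)"
    by (rule linear_kills_idem[OF _ x]) (use Z null_paths_subset(2) in blast)+
qed

text \<open>Makes every product with the transpose of \<open>D_U\<close> on the left a finite
  sum.\<close>

lemma lam_parents_finite: "finite {v \<in> X. x \<in> lam v}"
proof -
  have "{v \<in> X. x \<in> lam v} \<subseteq> {v \<in> L. \<forall>j\<in>{1..r}. x j - 1 \<le> v j \<and> v j \<le> x j + 1}"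
  proof
    fix v assume v: "v \<in> {v \<in> X. x \<in> lam v}"
    have "x j - 1 \<le> v j \<and> v j \<le> x j + 1" for j using lam_d[of v x j] v by auto
    then show "v \<in> {v \<in> L. \<forall>j\<in>{1..r}. x j - 1 \<le> v j \<and> v j \<le> x j + 1}" using v X_L by blast
  qed
  then show ?thesis by (rule finite_subset) (rule finite_box)
qed

text \<open>Words through a common cube span, and truncated traces separate them. The count runs
  over the cubes that contain both points, graded by the two distances to the base vertex.\<close>

lemma C_U_dim:
  assumes x: "x \<in> X" and y: "y \<in> X"
  shows "C_U TYPE('k::field) r X x y =
    graded_dim (\<lambda>n. card {v \<in> X. x \<in> lam v \<and> y \<in> lam v \<and> d1 r x v + d1 r y v = n})"
proof -
  obtain \<pi> where G: "gpres r L \<pi> (Pth r) null_paths (U_cubist TYPE('k) r X)" by (rule U_gpres)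
  have xL: "x \<in> L" "y \<in> L" using x y X_L by auto
  have "sub_dim (U_cubist TYPE('k) r X) (\<pi> ` Ewd r x y n) = card {v \<in> X. x \<in> lam v \<and> y \<in> lam v \<and> d1 r x v + d1 r y v = n}"
    (is "_ = card ?B") for n
  proof (rule dim_by_functionals[OF gpresD(1)[OF G] gpresD(8)[OF G xL],
        where wd = "pword x y" and adm = "\<lambda>F. U_rel r F \<and> kills r x (L - X) F" and G = "tfun x y n" and key = "key x"])
    show "finite ?B" by (rule finite_subset[OF _ lam_parents_finite[of x]]) blast
    show "valid r (pword x y v) \<and> endp x (pword x y v) = y \<and> length (pword x y v) = n" if "v \<in> ?B" for v
      using that pword_props[of v x y] by simp
    show "U_rel r (\<lambda>w. if length w = n \<and> endp x w = y then \<psi> (pel x w) else 0) \<and>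
        kills r x (L - X) (\<lambda>w. if length w = n \<and> endp x w = y then \<psi> (pel x w) else 0)"
      if "Vector_Spaces.linear scl (*) \<psi>" "\<And>g. g \<in> null_paths \<Longrightarrow> \<psi> g = 0" for \<psi> :: "'k lattice_path_elem \<Rightarrow> 'k"
      using linear_null_paths[OF that xL(1)] by blast
    show "phi x F f = 0" if "U_rel r F \<and> kills r x (L - X) F" "f \<in> null_paths" for F and f :: "'k lattice_path_elem"
      using phi_null_paths that by blast
    show "F w = 0" if F: "U_rel r F \<and> kills r x (L - X) F" and Z: "\<And>v. v \<in> ?B \<Longrightarrow> F (pword x y v) = 0"
      and w: "valid r w" "endp x w = y" "length w = n" for F :: "step list \<Rightarrow> 'k" and w
    proof (rule cartan_words_span[OF x y _ _ _ w])
      show "F (geo r x v @ rv (geo r y v)) = 0" if "v \<in> X" "x \<in> lam v" "y \<in> lam v" "d1 r x v + d1 r y v = n" for v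
        using Z[of v] that by (simp add: pword_def)
    qed (use F in blast)+
    show "U_rel r (tfun x y n v :: step list \<Rightarrow> 'k) \<and> kills r x (L - X) (tfun x y n v :: step list \<Rightarrow> 'k)" if "v \<in> ?B" for v
      using that tfun_U_rel[of v x y n] tfun_kills[of v x y n] by simp
    show "tfun x y n v (pword x y v) \<noteq> (0 :: 'k)" if "v \<in> ?B" for v using that tfun_diag[of v x y n] by simp
    show "key x v < key x v'" if "v \<in> ?B" "v' \<in> ?B" "v \<noteq> v'" "tfun x y n v' (pword x y v) \<noteq> (0 :: 'k)" for v v'
      using that tfun_triangular[of v x y n v'] by simp
  qed
  then show ?thesis unfolding C_U_def cartan_def cartan_space[OF G xL] by simp
qed

text \<open>At most one class of words survives in each piece, so the basis is indexed by a
  singleton or the empty set and the order of keys is trivial.\<close>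

lemma D_U_dim:
  assumes x: "x \<in> X" and y: "y \<in> X"
  shows "D_U TYPE('k::field) r X x y = graded_dim (\<lambda>n. of_bool (y \<in> lam x \<and> n = d1 r y x))"
proof -
  obtain \<pi> where G: "gpres r L \<pi> (Pth r) null_paths (U_cubist TYPE('k) r X)" by (rule U_gpres)
  have xL: "x \<in> L" "y \<in> L" using x y X_L by auto
  let ?T = "{t \<in> X. (t, x) \<in> cubist_order r X \<and> t \<noteq> x}"
  have T: "?T = {t. gt t x}" using x by (auto simp: gt_def)
  have TL: "?T \<subseteq> L" using X_L by auto
  note St = standard_space[OF G xL(1) TL]
  let ?S = "(\<lambda>f. pm r f (pel x [])) ` Pth r :: 'k lattice_path_elem set"
  let ?N = "set_sum null_paths (Kst r (Pth r) ?T x) :: 'k lattice_path_elem set"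
  have sub: "null_paths \<subseteq> ?N" "Kst r (Pth r) ?T x \<subseteq> ?N"
  proof -
    show "null_paths \<subseteq> ?N" by (rule set_sum_1) (simp add: Kst_def pv.subspace_span)
    show "Kst r (Pth r) ?T x \<subseteq> ?N" by (rule set_sum_2) (rule presentsD(2)[OF gpresD(1)[OF G]])
  qed
  let ?adm = "\<lambda>F :: step list \<Rightarrow> 'k. U_rel r F \<and> kills r y ((L - X) \<union> ?T) F"
  let ?H = "\<lambda>w. if length w = d1 r y x \<and> endp y w = x then chi r (top x) y w else (0 :: 'k)"
  have dim: "sub_dim (std_module (U_cubist TYPE('k) r X) ?T x)
      ((\<lambda>f. \<pi> ` Kst r (Pth r) ?T x +>\<^bsub>U_cubist TYPE('k) r X\<^esub> \<pi> f) ` Ewd r y x n) =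
    card (if y \<in> lam x \<and> n = d1 r y x then {()} else {})" (is "_ = card ?B") for n
  proof (rule dim_by_functionals[OF St(1) St(2)[OF xL(2)],
        where wd = "\<lambda>_. geo r y x" and adm = ?adm and G = "\<lambda>_. ?H" and key = "\<lambda>_. 0"])
    show "finite ?B" by simp
    show "valid r (geo r y x) \<and> endp y (geo r y x) = x \<and> length (geo r y x) = n" if "b \<in> ?B" for b
      using that xL by (auto split: if_splits)
    show "?adm (\<lambda>w. if length w = n \<and> endp y w = x then \<psi> (pel y w) else 0)"
      if \<psi>: "Vector_Spaces.linear scl (*) \<psi>" "\<And>g. g \<in> ?N \<Longrightarrow> \<psi> g = 0" for \<psi> :: "'k lattice_path_elem \<Rightarrow> 'k"
    proof -
      have "kills r y ?T (\<lambda>w. if length w = n \<and> endp y w = x then \<psi> (pel y w) else 0)"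
        by (rule linear_kills_Kst[OF G xL TL]) (use \<psi>(2) sub(2) in blast)
      moreover have "g \<in> null_paths \<Longrightarrow> \<psi> g = 0" for g using \<psi>(2) sub(1) by blast
      ultimately show ?thesis unfolding kills_Un using linear_null_paths[OF \<psi>(1) _ xL(2)] by blast
    qed
    show "phi y F f = 0" if F: "?adm F" and f: "f \<in> ?N" for F and f :: "'k lattice_path_elem"
    proof (rule phi_set_sum[OF _ _ f])
      show "phi y F g = 0" if "g \<in> null_paths" for g
        using F that unfolding kills_Un by (intro phi_null_paths) blast+
      show "phi y F g = 0" if "g \<in> Kst r (Pth r) ?T x" for g
        using F by (intro phi_Kst[OF _ _ _ TL xL(1) that]) blast+
    qed
    show "F w = 0" if F: "?adm F" and Z: "\<And>b. b \<in> ?B \<Longrightarrow> F (geo r y x) = 0"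
      and w: "valid r w" "endp y w = x" "length w = n" for F :: "step list \<Rightarrow> 'k" and w
    proof -
      have F': "U_rel r F" "kills r y ((L - X) \<union> {t. gt t x}) F" using F unfolding T by blast+
      show ?thesis using standard_words[OF x F' xL(2) w(1,2)] Z w(3) by (auto split: if_splits)
    qed
    show "?adm ?H" if "b \<in> ?B" for b
    proof -
      have "y \<in> lam x" using that by (auto split: if_splits)
      from standard_functional[OF x this, where 'k='k] show ?thesis unfolding T by blast
    qed
    show "?H (geo r y x) \<noteq> (0 :: 'k)" if "b \<in> ?B" for b
    proof -
      have "y \<in> lam x" using that by (auto split: if_splits)
      from standard_functional(3)[OF x this, where 'k='k] show ?thesis by blast
    qed
  qed simp
  show ?thesis unfolding D_U_def decomp_def St(3)[OF xL(2)] dim by (intro arg_cong[of _ _ graded_dim] ext) simp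
qed

lemma V_gpres:
  obtains \<pi> where "gpres r X \<pi> (Sub r X) (two_sided r (V_relations r)) (V_cubist TYPE('k::field) r X)"
proof -
  obtain \<pi> where \<pi>: "gpres r L \<pi> (Pth r) (two_sided r (V_relations r)) (V_algebra TYPE('k) r)"
    using path_quot_gpres[OF V_relations_Pth[where 'k='k, of r]] unfolding V_algebra_def by blast
  have "X \<subseteq> L" using X_L by blast
  from that[OF gpres_sub[OF \<pi> this refl, folded V_cubist_def[unfolded Let_def]]] show thesis .
qed

text \<open>Passing to the corner algebra does not change the paths between two of its vertices, so
  this is a count of normal words in \<open>V\<close> itself.\<close>

lemma C_V_dim:
  assumes x: "x \<in> X" and y: "y \<in> X"
  shows "C_V TYPE('k::field) r X x y =
    graded_dim (\<lambda>n. card (if d1 r x y \<le> n then even_lists (n - d1 r x y) (r - 1) else {}))"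
proof -
  obtain \<pi> where G: "gpres r X \<pi> (Sub r X) (two_sided r (V_relations r)) (V_cubist TYPE('k) r X)" by (rule V_gpres)
  have xL: "x \<in> L" "y \<in> L" using x y X_L by auto
  let ?G = "\<lambda>l w. Poly_Mapping.lookup (word_poly r x y w :: 'k mpoly) (expo r (half_exp l))"
  have "sub_dim (V_cubist TYPE('k) r X) (\<pi> ` Ewd r x y n) =
    card (if d1 r x y \<le> n then even_lists (n - d1 r x y) (r - 1) else {})" (is "_ = card ?B") for n
  proof (rule dim_by_functionals[OF gpresD(1)[OF G] gpresD(8)[OF G x y],
        where wd = "\<lambda>l. cword r x y (half_exp l)" and adm = "V_rel r" and G = ?G and key = "\<lambda>_. 0"])
    show "finite ?B" by (simp add: finite_even_lists)
    show "valid r (cword r x y (half_exp l)) \<and> endp x (cword r x y (half_exp l)) = y \<and> length (cword r x y (half_exp l)) = n"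
      if "l \<in> ?B" for l
      using that cword_props[OF xL, of "half_exp l"] half_exp_sum[OF _ r_pos, of l "n - d1 r x y"] by (auto split: if_splits)
    show "V_rel r (\<lambda>w. if length w = n \<and> endp x w = y then \<psi> (pel x w) else 0)"
      if "Vector_Spaces.linear scl (*) \<psi>" "\<And>g. g \<in> two_sided r (V_relations r) \<Longrightarrow> \<psi> g = 0"
      for \<psi> :: "'k lattice_path_elem \<Rightarrow> 'k" by (rule V_rel_linear[OF that xL(1)])
    show "phi x F f = 0" if "V_rel r F" "f \<in> two_sided r (V_relations r)" for F and f :: "'k lattice_path_elem"
      by (rule phi_V_relations[OF that])
    show "F w = 0" if F: "V_rel r F" and Z: "\<And>l. l \<in> ?B \<Longrightarrow> F (cword r x y (half_exp l)) = 0"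
      and w: "valid r w" "endp x w = y" "length w = n" for F :: "step list \<Rightarrow> 'k" and w
      by (rule V_cartan_words_span[OF xL F r_pos _ w]) (use Z in simp)
    show "V_rel r (?G l)" for l by (rule V_rel_word_poly[OF r_pos])
    show "?G l (cword r x y (half_exp l)) \<noteq> 0" if "l \<in> ?B" for l
      using that V_cartan_diag[OF xL r_pos, of l "n - d1 r x y" l, where 'k='k] by (auto split: if_splits)
    show "(0::nat) < 0" if "l \<in> ?B" "l' \<in> ?B" "l \<noteq> l'" "?G l' (cword r x y (half_exp l)) \<noteq> 0" for l l'
      using that V_cartan_diag[OF xL r_pos, of l "n - d1 r x y" l', where 'k='k] by (auto split: if_splits)
  qed
  then show ?thesis unfolding C_V_def cartan_def cartan_space[OF G x y] by simp
qed

text \<open>The order is reversed, so words through smaller vertices are factored out. Paths may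
  leave the Cubist set in between, which is why only \<open>?T\<close> has to be killed.\<close>

lemma D_V_dim:
  assumes x: "x \<in> X" and y: "y \<in> X"
  shows "D_V TYPE('k::field) r X x y = graded_dim (\<lambda>n. of_bool (y \<in> mu x \<and> n = d1 r y x))"
proof -
  obtain \<pi> where G: "gpres r X \<pi> (Sub r X) (two_sided r (V_relations r)) (V_cubist TYPE('k) r X)" by (rule V_gpres)
  have xL: "x \<in> L" "y \<in> L" using x y X_L by auto
  let ?T = "{t \<in> X. (x, t) \<in> cubist_order r X \<and> t \<noteq> x}"
  have T: "?T = {t. gt x t}" using x by (auto simp: gt_def)
  have TX: "?T \<subseteq> X" by blast
  have TL: "?T \<subseteq> L" using X_L by auto
  note St = standard_space[OF G x TX]
  let ?R = "two_sided r (V_relations r) :: 'k lattice_path_elem set"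
  let ?N = "set_sum ?R (Kst r (Sub r X) ?T x) :: 'k lattice_path_elem set"
  have sub: "?R \<subseteq> ?N" "Kst r (Sub r X) ?T x \<subseteq> ?N"
  proof -
    show "?R \<subseteq> ?N" by (rule set_sum_1) (simp add: Kst_def pv.subspace_span)
    show "Kst r (Sub r X) ?T x \<subseteq> ?N" by (rule set_sum_2) (rule presentsD(2)[OF gpresD(1)[OF G]])
  qed
  let ?adm = "\<lambda>F :: step list \<Rightarrow> 'k. V_rel r F \<and> kills r y ?T F"
  let ?H = "\<lambda>w. if mset w = mset (geo r y x) then 1 else (0 :: 'k)"
  have dim: "sub_dim (std_module (V_cubist TYPE('k) r X) ?T x)
      ((\<lambda>f. \<pi> ` Kst r (Sub r X) ?T x +>\<^bsub>V_cubist TYPE('k) r X\<^esub> \<pi> f) ` Ewd r y x n) =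
    card (if y \<in> mu x \<and> n = d1 r y x then {()} else {})" (is "_ = card ?B") for n
  proof (rule dim_by_functionals[OF St(1) St(2)[OF y],
        where wd = "\<lambda>_. geo r y x" and adm = ?adm and G = "\<lambda>_. ?H" and key = "\<lambda>_. 0"])
    show "finite ?B" by simp
    show "valid r (geo r y x) \<and> endp y (geo r y x) = x \<and> length (geo r y x) = n" if "b \<in> ?B" for b
      using that xL by (auto split: if_splits)
    show "?adm (\<lambda>w. if length w = n \<and> endp y w = x then \<psi> (pel y w) else 0)"
      if \<psi>: "Vector_Spaces.linear scl (*) \<psi>" "\<And>g. g \<in> ?N \<Longrightarrow> \<psi> g = 0" for \<psi> :: "'k lattice_path_elem \<Rightarrow> 'k"
    proof
      show "V_rel r (\<lambda>w. if length w = n \<and> endp y w = x then \<psi> (pel y w) else 0)"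
        by (rule V_rel_linear[OF \<psi>(1) _ xL(2)]) (use \<psi>(2) sub(1) in blast)
      show "kills r y ?T (\<lambda>w. if length w = n \<and> endp y w = x then \<psi> (pel y w) else 0)"
        by (rule linear_kills_Kst[OF G x y TX]) (use \<psi>(2) sub(2) in blast)
    qed
    show "phi y F f = 0" if F: "?adm F" and f: "f \<in> ?N" for F and f :: "'k lattice_path_elem"
    proof (rule phi_set_sum[OF _ _ f])
      show "phi y F g = 0" if "g \<in> ?R" for g using F that by (intro phi_V_relations) blast+
      show "phi y F g = 0" if "g \<in> Kst r (Sub r X) ?T x" for g
        using F gpresD(2)[OF G] by (intro phi_Kst[OF _ _ _ TL xL(1) that]) blast+
    qed
    show "F w = 0" if F: "?adm F" and Z: "\<And>b. b \<in> ?B \<Longrightarrow> F (geo r y x) = 0"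
      and w: "valid r w" "endp y w = x" "length w = n" for F :: "step list \<Rightarrow> 'k" and w
    proof -
      have F': "V_rel r F" "kills r y {t. gt x t} F" using F unfolding T by blast+
      show ?thesis using V_standard_words[OF x F' xL(2) w(1,2)] Z w(3) by (auto split: if_splits)
    qed
    show "?adm ?H" if "b \<in> ?B" for b
    proof -
      have "y \<in> mu x" using that by (auto split: if_splits)
      from V_standard_functional[OF x this, where 'k='k] show ?thesis unfolding T by blast
    qed
    show "?H (geo r y x) \<noteq> (0 :: 'k)" if "b \<in> ?B" for b by simp
  qed simp
  show ?thesis unfolding D_V_def decomp_def St(3)[OF y] dim by (intro arg_cong[of _ _ graded_dim] ext) simp
qed

end

subsection \<open>Orthogonality of faces and cones\<close>

lemma power_d1: "(a :: 'a::comm_monoid_mult) ^ d1 r x y = (\<Prod>j=1..r. a ^ nat \<bar>x j - y j\<bar>)"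
  by (simp add: d1_def power_sum)

lemma d1_eq_0:
  assumes "x \<in> lattice_pts r" "y \<in> lattice_pts r" "d1 r x y = 0" shows "x = y"
proof
  fix j
  show "x j = y j" using assms by (cases "j \<in> {1..r}") (auto simp: d1_def lattice_pts_def)
qed

text \<open>The sum over the two values of one spanned coordinate: on the side of the cone a factor
  \<open>1 - q^2\<close> remains, on the other side the two terms cancel.\<close>

lemma unit_step_sum:
  fixes q :: "'a::comm_ring_1" and x z :: int
  shows "(- q) ^ nat \<bar>x - z\<bar> + q * (- q) ^ nat \<bar>x + 1 - z\<bar> = (if z \<le> x then (1 - q\<^sup>2) * (- q) ^ nat \<bar>z - x\<bar> else 0)"
    and "(- q) ^ nat \<bar>x - z\<bar> + q * (- q) ^ nat \<bar>x - 1 - z\<bar> = (if x \<le> z then (1 - q\<^sup>2) * (- q) ^ nat \<bar>z - x\<bar> else 0)"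
proof -
  show "(- q) ^ nat \<bar>x - z\<bar> + q * (- q) ^ nat \<bar>x + 1 - z\<bar> = (if z \<le> x then (1 - q\<^sup>2) * (- q) ^ nat \<bar>z - x\<bar> else 0)"
  proof (cases "z \<le> x")
    case True
    then have "nat \<bar>x + 1 - z\<bar> = Suc (nat \<bar>z - x\<bar>)" "\<bar>x - z\<bar> = \<bar>z - x\<bar>" by auto
    then show ?thesis using True by (simp add: algebra_simps power2_eq_square)
  next
    case False
    then have "nat \<bar>x - z\<bar> = Suc (nat \<bar>x + 1 - z\<bar>)" by auto
    then show ?thesis using False by simp
  qed
  show "(- q) ^ nat \<bar>x - z\<bar> + q * (- q) ^ nat \<bar>x - 1 - z\<bar> = (if x \<le> z then (1 - q\<^sup>2) * (- q) ^ nat \<bar>z - x\<bar> else 0)"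
  proof (cases "x \<le> z")
    case True
    then have "nat \<bar>x - 1 - z\<bar> = Suc (nat \<bar>z - x\<bar>)" "\<bar>x - z\<bar> = \<bar>z - x\<bar>" by auto
    then show ?thesis using True by (simp add: algebra_simps power2_eq_square)
  next
    case False
    then have "nat \<bar>x - z\<bar> = Suc (nat \<bar>x - 1 - z\<bar>)" by auto
    then show ?thesis using False by simp
  qed
qed

lemma sum_of_bool_delta:
  assumes "finite A"
  shows "(\<Sum>z\<in>A. f z * of_bool (w = z)) = (if w \<in> A then f w else (0 :: 'a::semiring_1))"
proof -
  have "(\<Sum>z\<in>A. f z * of_bool (w = z)) = (\<Sum>z\<in>A. if w = z then f z else 0)" by (intro sum.cong) auto
  then show ?thesis using assms by (simp add: sum.delta')
qed

context cubist_ideal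
begin

text \<open>The cube as a product of coordinate sets, so that sums over \<open>lam x\<close> factor;
  \<open>cone\<close> does the same for \<open>mu x\<close>.\<close>

definition face :: "point \<Rightarrow> nat \<Rightarrow> int set" where
  "face x j = (if j = idx x then {x j} else if j < idx x then {x j, x j + 1} else {x j, x j - 1})"

definition cone :: "point \<Rightarrow> nat \<Rightarrow> int \<Rightarrow> bool" where
  "cone x j a \<longleftrightarrow> (if j < idx x then a \<le> x j else if idx x < j then x j \<le> a else True)"

lemma lam_face:
  assumes x: "x \<in> X" shows "y \<in> lam x \<longleftrightarrow> y \<in> L \<and> (\<forall>j\<in>{1..r}. y j \<in> face x j)"
proof
  assume y: "y \<in> lam x"
  have "y j \<in> face x j" if "j \<in> {1..r}" for j
  proof -
    consider "j < idx x" | "j = idx x" | "idx x < j" by linarith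
    then show ?thesis using lam_coord[OF x y, of j] that by cases (auto simp: face_def)
  qed
  then show "y \<in> L \<and> (\<forall>j\<in>{1..r}. y j \<in> face x j)" using y lam_X[OF x] X_L by blast
next
  assume y: "y \<in> L \<and> (\<forall>j\<in>{1..r}. y j \<in> face x j)"
  show "y \<in> lam x"
  proof (rule lamI[OF x])
    show "y \<in> L" using y by blast
    have "y (idx x) \<in> face x (idx x)" using y idx_props(1)[OF x] by blast
    then show "y (idx x) = x (idx x)" by (simp add: face_def)
    show "y j = x j \<or> y j = x j + 1" if "1 \<le> j" "j < idx x" for j
    proof -
      have "j \<in> {1..r}" using that idx_props(1)[OF x] by auto
      then have "y j \<in> face x j" using y by blast
      then show ?thesis using that by (simp add: face_def)
    qed
    show "y j = x j \<or> y j = x j - 1" if "idx x < j" "j \<le> r" for j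
    proof -
      have "j \<in> {1..r}" using that by auto
      then have "y j \<in> face x j" using y by blast
      then show ?thesis using that by (simp add: face_def)
    qed
  qed
qed

lemma mu_cone: "x \<in> X \<Longrightarrow> z \<in> mu x \<longleftrightarrow> z \<in> L \<and> (\<forall>j\<in>{1..r}. cone x j (z j))"
  using idx_props(1)[of x] unfolding mu_iff cone_def by (auto split: if_splits)

lemma lam_L2: "x \<in> X \<Longrightarrow> y \<in> lam x \<Longrightarrow> y \<in> L"
  using lam_X X_L by blast

lemma lam_sum:
  fixes g :: "nat \<Rightarrow> int \<Rightarrow> 'a::comm_semiring_1"
  assumes x: "x \<in> X"
  shows "(\<Sum>y\<in>lam x. \<Prod>j=1..r. g j (y j)) = (\<Prod>j=1..r. \<Sum>a\<in>face x j. g j a)"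
proof -
  have "(\<Prod>j=1..r. \<Sum>a\<in>face x j. g j a) = (\<Sum>f\<in>PiE {1..r} (face x). \<Prod>j=1..r. g j (f j))"
    by (rule prod_sum_PiE) (simp_all add: face_def)
  also have "\<dots> = (\<Sum>y\<in>lam x. \<Prod>j=1..r. g j (y j))"
  proof (rule sum.reindex_bij_witness[where j = "\<lambda>f j. if j \<in> {1..r} then f j else 0" and i = "\<lambda>y. restrict y {1..r}"])
    fix f assume f: "f \<in> PiE {1..r} (face x)"
    show "restrict (\<lambda>j. if j \<in> {1..r} then f j else 0) {1..r} = f"
      using f by (auto simp: PiE_def extensional_def restrict_def fun_eq_iff)
    show "(\<lambda>j. if j \<in> {1..r} then f j else 0) \<in> lam x"
      unfolding lam_face[OF x] using f by (auto simp: PiE_def lattice_pts_def)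
    show "(\<Prod>j=1..r. g j (if j \<in> {1..r} then f j else 0)) = (\<Prod>j=1..r. g j (f j))" by (intro prod.cong) auto
  next
    fix y assume y: "y \<in> lam x"
    show "(\<lambda>j. if j \<in> {1..r} then restrict y {1..r} j else 0) = y"
      using lam_L2[OF x y] by (auto simp: lattice_pts_def fun_eq_iff)
    show "restrict y {1..r} \<in> PiE {1..r} (face x)" using y unfolding lam_face[OF x] by auto
  qed
  finally show ?thesis ..
qed

text \<open>Each spanned coordinate contributes as in \<open>unit_step_sum\<close> and the missing
  one a single term, whence the exponent \<open>r - 1\<close>.\<close>

lemma face_sum_cone:
  fixes q :: "'a::comm_ring_1"
  assumes x: "x \<in> X" and z: "z \<in> L"
  shows "(\<Sum>y\<in>lam x. q ^ d1 r y x * (- q) ^ d1 r y z) = (if z \<in> mu x then (1 - q\<^sup>2) ^ (r - 1) * (- q) ^ d1 r z x else 0)"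
proof -
  let ?c = "\<lambda>j. if j = idx x then 1 else 1 - q\<^sup>2"
  have "(\<Sum>y\<in>lam x. q ^ d1 r y x * (- q) ^ d1 r y z) =
      (\<Sum>y\<in>lam x. \<Prod>j=1..r. q ^ nat \<bar>y j - x j\<bar> * (- q) ^ nat \<bar>y j - z j\<bar>)"
    by (simp add: power_d1 prod.distrib)
  also have "\<dots> = (\<Prod>j=1..r. \<Sum>a\<in>face x j. q ^ nat \<bar>a - x j\<bar> * (- q) ^ nat \<bar>a - z j\<bar>)" by (rule lam_sum[OF x])
  also have "\<dots> = (\<Prod>j=1..r. if cone x j (z j) then ?c j * (- q) ^ nat \<bar>z j - x j\<bar> else 0)"
  proof (rule prod.cong[OF refl])
    fix j
    consider "j < idx x" | "j = idx x" | "idx x < j" by linarith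
    then show "(\<Sum>a\<in>face x j. q ^ nat \<bar>a - x j\<bar> * (- q) ^ nat \<bar>a - z j\<bar>) = (if cone x j (z j) then ?c j * (- q) ^ nat \<bar>z j - x j\<bar> else 0)"
      using unit_step_sum[of q "x j" "z j"] by cases (simp_all add: face_def cone_def abs_minus_commute)
  qed
  also have "\<dots> = (if z \<in> mu x then (1 - q\<^sup>2) ^ (r - 1) * (- q) ^ d1 r z x else 0)"
  proof (cases "z \<in> mu x")
    case True
    then have "(\<Prod>j=1..r. if cone x j (z j) then ?c j * (- q) ^ nat \<bar>z j - x j\<bar> else 0) = (\<Prod>j=1..r. ?c j * (- q) ^ nat \<bar>z j - x j\<bar>)"
      unfolding mu_cone[OF x] by (intro prod.cong) auto
    also have "\<dots> = (\<Prod>j=1..r. ?c j) * (- q) ^ d1 r z x" by (simp add: prod.distrib power_d1)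
    also have "(\<Prod>j=1..r. ?c j) = (\<Prod>j\<in>{1..r} - {idx x}. ?c j)"
      by (subst prod.remove[of "{1..r}" "idx x"]) (use idx_props(1)[OF x] in simp_all)
    also have "\<dots> = (\<Prod>j\<in>{1..r} - {idx x}. 1 - q\<^sup>2)" by (intro prod.cong) auto
    also have "\<dots> = (1 - q\<^sup>2) ^ (r - 1)" using idx_props(1)[OF x] by (simp add: card_Diff_singleton)
    finally show ?thesis using True by simp
  next
    case False
    then obtain j where "j \<in> {1..r}" "\<not> cone x j (z j)" using z unfolding mu_cone[OF x] by blast
    then have "(\<Prod>j=1..r. if cone x j (z j) then ?c j * (- q) ^ nat \<bar>z j - x j\<bar> else 0) = 0"
      by (intro prod_zero bexI[of _ j]) simp_all
    then show ?thesis using False by simp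
  qed
  finally show ?thesis .
qed

text \<open>In terms of points the inequality reads
  \<open>pshift (idx u) u \<le> pshift (idx w - 1) w\<close>: a point outside the ideal below one
  inside it.\<close>

lemma shifted_not_le:
  assumes u: "u \<in> X" and w: "w \<in> X"
    and le: "\<And>j. j \<in> {1..r} \<Longrightarrow> u j + of_bool (j \<le> idx u) \<le> w j + of_bool (j \<le> idx w - 1)"
  shows False
proof -
  have "pshift (idx u) u \<le> pshift (idx w - 1) w"
  proof (rule le_funI)
    fix j
    show "pshift (idx u) u j \<le> pshift (idx w - 1) w j"
    proof (cases "j \<in> {1..r}")
      case True
      then show ?thesis using le[OF True] by (auto simp: pshift_def)
    next
      case False
      then show ?thesis using X_L[OF u] X_L[OF w] idx_props(1)[OF u] idx_props(1)[OF w]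
        by (auto simp: pshift_def lattice_pts_def)
    qed
  qed
  then show False
    using I_down[of "pshift (idx w - 1) w" "pshift (idx u) u"] idx_props[OF u] idx_props[OF w]
      pshift_lattice[OF X_L[OF u], of "idx u"] by auto
qed

text \<open>The sum factors over the coordinates. If no factor vanished for distinct vertices, every
  coordinate would contribute an inequality, and together these would contradict
  \<open>shifted_not_le\<close>.\<close>

lemma face_cone_orthogonal:
  fixes q :: "'a::comm_ring_1"
  assumes x: "x \<in> X" and x': "x' \<in> X"
  shows "(\<Sum>y\<in>lam x. if y \<in> mu x' then q ^ d1 r y x * (- q) ^ d1 r y x' else 0) = of_bool (x = x')"
proof -
  define g where "g j a = q ^ nat \<bar>a - x j\<bar> * (if cone x' j a then (- q) ^ nat \<bar>a - x' j\<bar> else 0)" for j a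
  define k where "k j = (\<Sum>a\<in>face x j. g j a)" for j
  have "(\<Sum>y\<in>lam x. if y \<in> mu x' then q ^ d1 r y x * (- q) ^ d1 r y x' else 0) = (\<Sum>y\<in>lam x. \<Prod>j=1..r. g j (y j))"
  proof (rule sum.cong[OF refl])
    fix y assume y: "y \<in> lam x"
    show "(if y \<in> mu x' then q ^ d1 r y x * (- q) ^ d1 r y x' else 0) = (\<Prod>j=1..r. g j (y j))"
    proof (cases "y \<in> mu x'")
      case True
      then have "(\<Prod>j=1..r. g j (y j)) = (\<Prod>j=1..r. q ^ nat \<bar>y j - x j\<bar> * (- q) ^ nat \<bar>y j - x' j\<bar>)"
        unfolding mu_cone[OF x'] g_def by (intro prod.cong) auto
      then show ?thesis using True by (simp add: prod.distrib power_d1)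
    next
      case False
      then obtain j where "j \<in> {1..r}" "\<not> cone x' j (y j)" using lam_L2[OF x y] unfolding mu_cone[OF x'] by blast
      then have "(\<Prod>j=1..r. g j (y j)) = 0" by (intro prod_zero bexI[of _ j]) (simp_all add: g_def)
      then show ?thesis using False by simp
    qed
  qed
  also have "\<dots> = (\<Prod>j=1..r. k j)" unfolding k_def by (rule lam_sum[OF x])
  also have "\<dots> = of_bool (x = x')"
  proof -
    \<comment> \<open>Where both cubes extend on the same side, the factor is a Kronecker delta in
      that coordinate.\<close>
    have below: "k j = of_bool (x j = x' j)" if "j < idx x" "j < idx x'" for j
    proof -
      consider "x j = x' j" | "x j < x' j" | "x' j < x j" by linarith
      then show ?thesis using that unit_step_sum(1)[of q "x j" "x' j"]
        by cases (simp_all add: k_def g_def face_def cone_def)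
    qed
    have above: "k j = of_bool (x j = x' j)" if "idx x < j" "idx x' < j" for j
    proof -
      consider "x j = x' j" | "x j < x' j" | "x' j < x j" by linarith
      then show ?thesis using that unit_step_sum(2)[of q "x j" "x' j"]
        by cases (simp_all add: k_def g_def face_def cone_def)
    qed
    have lt: "j \<le> idx x' - 1 \<longleftrightarrow> j < idx x'" "j \<le> idx x - 1 \<longleftrightarrow> j < idx x" for j
      using idx_props(1)[OF x] idx_props(1)[OF x'] by auto
    have vanish: "\<exists>j\<in>{1..r}. k j = 0" if "x \<noteq> x'"
    proof (rule ccontr)
      assume "\<not> (\<exists>j\<in>{1..r}. k j = 0)"
      then have nz: "k j \<noteq> 0" if "j \<in> {1..r}" for j using that by blast
      consider "idx x < idx x'" | "idx x' < idx x" | "idx x = idx x'" by linarith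
      then show False
      proof cases
        case 1
        show False
        proof (rule shifted_not_le[OF x x'])
          fix j assume j: "j \<in> {1..r}"
          consider "j < idx x" | "j = idx x" | "idx x < j" "j < idx x'" | "j = idx x'" | "idx x' < j" by linarith
          then have "x j + of_bool (j \<le> idx x) \<le> x' j + of_bool (j < idx x')"
          proof cases
            case 1
            then show ?thesis using nz[OF j] below[of j] \<open>idx x < idx x'\<close> by (cases "x j = x' j") auto
          next
            case 2
            then have "x j \<le> x' j" using nz[OF j] \<open>idx x < idx x'\<close> by (rule_tac ccontr) (simp add: k_def g_def face_def cone_def)
            then show ?thesis using 2 \<open>idx x < idx x'\<close> by simp
          next
            case 3
            then have "x j \<le> x' j + 1" using nz[OF j] by (rule_tac ccontr) (simp add: k_def g_def face_def cone_def)
            then show ?thesis using 3 by simp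
          next
            case 4
            then have "x j \<le> x' j" using nz[OF j] \<open>idx x < idx x'\<close> unit_step_sum(2)[of q "x j" "x' j"]
              by (rule_tac ccontr) (simp add: k_def g_def face_def cone_def)
            then show ?thesis using 4 \<open>idx x < idx x'\<close> by simp
          next
            case 5
            then show ?thesis using nz[OF j] above[of j] \<open>idx x < idx x'\<close> by (cases "x j = x' j") auto
          qed
          then show "x j + of_bool (j \<le> idx x) \<le> x' j + of_bool (j \<le> idx x' - 1)" unfolding lt .
        qed
      next
        case 2
        show False
        proof (rule shifted_not_le[OF x' x])
          fix j assume j: "j \<in> {1..r}"
          consider "j < idx x'" | "j = idx x'" | "idx x' < j" "j < idx x" | "j = idx x" | "idx x < j" by linarith
          then have "x' j + of_bool (j \<le> idx x') \<le> x j + of_bool (j < idx x)"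
          proof cases
            case 1
            then show ?thesis using nz[OF j] below[of j] \<open>idx x' < idx x\<close> by (cases "x j = x' j") auto
          next
            case 2
            then have "x' j \<le> x j" using nz[OF j] \<open>idx x' < idx x\<close> unit_step_sum(1)[of q "x j" "x' j"]
              by (rule_tac ccontr) (simp add: k_def g_def face_def cone_def)
            then show ?thesis using 2 \<open>idx x' < idx x\<close> by simp
          next
            case 3
            then have "x' j \<le> x j + 1" using nz[OF j] by (rule_tac ccontr) (simp add: k_def g_def face_def cone_def)
            then show ?thesis using 3 by simp
          next
            case 4
            then have "x' j \<le> x j" using nz[OF j] \<open>idx x' < idx x\<close> by (rule_tac ccontr) (simp add: k_def g_def face_def cone_def)
            then show ?thesis using 4 \<open>idx x' < idx x\<close> by simp
          next
            case 5
            then show ?thesis using nz[OF j] above[of j] \<open>idx x' < idx x\<close> by (cases "x j = x' j") auto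
          qed
          then show "x' j + of_bool (j \<le> idx x') \<le> x j + of_bool (j \<le> idx x - 1)" unfolding lt .
        qed
      next
        case 3
        \<comment> \<open>With equal indices all other coordinates agree, so the two points lie on
          one line in direction \<open>idx x\<close>, and the ideal admits only one of them.\<close>
        have eq: "x j = x' j" if "j \<noteq> idx x" for j
        proof (cases "j \<in> {1..r}")
          case True
          then show ?thesis using nz[OF True] below[of j] above[of j] that 3 by (cases "x j = x' j"; cases "j < idx x") auto
        next
          case False
          then show ?thesis using X_L[OF x] X_L[OF x'] by (auto simp: lattice_pts_def)
        qed
        have "x (idx x) \<noteq> x' (idx x)"
        proof
          assume "x (idx x) = x' (idx x)"
          then have "x j = x' j" for j using eq[of j] by (cases "j = idx x") simp_all
          then show False using \<open>x \<noteq> x'\<close> by (auto simp: fun_eq_iff)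
        qed
        then consider "x (idx x) < x' (idx x)" | "x' (idx x) < x (idx x)" by linarith
        then show False
        proof cases
          case 1
          then have "x j + of_bool (j \<le> idx x) \<le> x' j + of_bool (j \<le> idx x' - 1)" for j
            using eq[of j] 3 unfolding lt by (cases "j = idx x") auto
          then show False by (rule shifted_not_le[OF x x'])
        next
          case 2
          then have "x' j + of_bool (j \<le> idx x') \<le> x j + of_bool (j \<le> idx x - 1)" for j
            using eq[of j] 3 unfolding lt by (cases "j = idx x") auto
          then show False by (rule shifted_not_le[OF x' x])
        qed
      qed
    qed
    show ?thesis
    proof (cases "x = x'")
      case True
      have "k j = 1" for j
      proof -
        consider "j < idx x" | "j = idx x" | "idx x < j" by linarith
        then show ?thesis using below[of j] above[of j] True
          by cases (simp_all add: k_def g_def face_def cone_def)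
      qed
      then show ?thesis using True by simp
    next
      case False
      then have "(\<Prod>j=1..r. k j) = 0" using vanish by (intro prod_zero) auto
      then show ?thesis using False by simp
    qed
  qed
  finally show ?thesis .
qed

lemma finite_lam: assumes x: "x \<in> X" shows "finite (lam x)"
proof (rule finite_subset)
  show "lam x \<subseteq> {z \<in> L. \<forall>j\<in>{1..r}. x j - 1 \<le> z j \<and> z j \<le> x j + 1}"
  proof
    fix y assume y: "y \<in> lam x"
    have "x j - 1 \<le> y j \<and> y j \<le> x j + 1" for j using lam_d[OF x y, of j] by auto
    then show "y \<in> {z \<in> L. \<forall>j\<in>{1..r}. x j - 1 \<le> z j \<and> z j \<le> x j + 1}" using lam_L2[OF x y] by blast
  qed
qed (rule finite_box)

text \<open>Off the diagonal the entries of \<open>D_U\<close> are divisible by \<open>q\<close>, so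
  the coefficients of \<open>M\<close> vanish degree by degree. The sign \<open>s = fls_X\<close>
  serves the inverse formula, \<open>s = - fls_X\<close> the Brauer formula of
  \<open>V\<close>.\<close>

lemma triangular_zero:
  fixes M :: "point \<Rightarrow> rat fls"
  assumes M: "\<And>x n. x \<in> X \<Longrightarrow> n < 0 \<Longrightarrow> fls_nth (M x) n = 0" and s: "s = fls_X \<or> s = - fls_X"
    and Z: "\<And>w. w \<in> X \<Longrightarrow> (\<Sum>x\<in>lam w. s ^ d1 r x w * M x) = 0" and x: "x \<in> X"
  shows "M x = 0"
proof -
  have nth: "fls_nth (s ^ d * f) n = 0" if "fls_nth f (n - int d) = 0" for d f n
    using s that by (auto simp: uminus_power_if fls_X_power_times_conv_shift)
  have *: "\<forall>x\<in>X. \<forall>k<int n. fls_nth (M x) k = 0" for n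
  proof (induction n)
    case 0
    then show ?case using M by simp
  next
    case (Suc n)
    have "fls_nth (M x) (int n) = 0" if x: "x \<in> X" for x
    proof -
      have "0 = fls_nth (\<Sum>y\<in>lam x. s ^ d1 r y x * M y) (int n)" using Z[OF x] by simp
      also have "\<dots> = fls_nth (M x) (int n) + (\<Sum>y\<in>lam x - {x}. fls_nth (s ^ d1 r y x * M y) (int n))"
        using finite_lam[OF x] lam_self[OF x] by (simp add: sum.remove fls_nth_sum d1_def)
      also have "(\<Sum>y\<in>lam x - {x}. fls_nth (s ^ d1 r y x * M y) (int n)) = 0"
      proof (intro sum.neutral ballI nth)
        fix y assume y: "y \<in> lam x - {x}"
        then have "y \<in> X" using lam_X[OF x] by blast
        moreover have "d1 r y x > 0" using d1_eq_0[of y r x] y lam_L2[OF x, of y] X_L[OF x] by auto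
        ultimately show "fls_nth (M y) (int n - int (d1 r y x)) = 0" using Suc by simp
      qed
      finally show ?thesis by simp
    qed
    moreover have "k < int n \<or> k = int n" if "k < int (Suc n)" for k using that by linarith
    ultimately show ?case using Suc by blast
  qed
  have "fls_nth (M x) k = 0" for k using *[of "nat (k + 1)"] M[OF x, of k] x by (cases "k < 0") auto
  then show ?thesis by (intro fls_eqI) simp
qed

text \<open>\<open>face_cone_orthogonal\<close> is the product in the other order. Applying
  \<open>D_U\<close> from the left turns the claim into that product, and
  \<open>triangular_zero\<close> cancels \<open>D_U\<close> again.\<close>

lemma decomposition_inverse:
  assumes x: "x \<in> X" and y: "y \<in> X"
  shows "(\<Sum>z\<in>{z \<in> X. x \<in> lam z}. fls_X ^ d1 r x z * (if y \<in> mu z then (- fls_X) ^ d1 r y z else 0)) =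
    (of_bool (x = y) :: rat fls)"
proof -
  let ?P = "{z \<in> X. x \<in> lam z}"
  let ?M = "\<lambda>y. (\<Sum>z\<in>?P. fls_X ^ d1 r x z * (if y \<in> mu z then (- fls_X) ^ d1 r y z else 0)) - (of_bool (x = y) :: rat fls)"
  note fin = lam_parents_finite[of x]
  have "?M y = 0"
  proof (rule triangular_zero[where s = fls_X, OF _ _ _ y])
    show "fls_nth (?M y) n = 0" if "n < 0" for y n
      using that by (auto simp: fls_nth_sum fls_X_power_times_conv_shift uminus_power_if intro!: sum.neutral)
    fix w assume w: "w \<in> X"
    have "(\<Sum>y\<in>lam w. fls_X ^ d1 r y w * ?M y) =
      (\<Sum>y\<in>lam w. \<Sum>z\<in>?P. fls_X ^ d1 r x z * (if y \<in> mu z then fls_X ^ d1 r y w * (- fls_X) ^ d1 r y z else 0)) -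
      (\<Sum>y\<in>lam w. fls_X ^ d1 r y w * of_bool (x = y))"
    proof -
      have "fls_X ^ d1 r y w * (\<Sum>z\<in>?P. fls_X ^ d1 r x z * (if y \<in> mu z then (- fls_X) ^ d1 r y z else 0)) =
        (\<Sum>z\<in>?P. fls_X ^ d1 r x z * (if y \<in> mu z then fls_X ^ d1 r y w * (- fls_X) ^ d1 r y z else (0 :: rat fls)))" for y
        unfolding sum_distrib_left
      proof (rule sum.cong[OF refl])
        fix z
        show "fls_X ^ d1 r y w * (fls_X ^ d1 r x z * (if y \<in> mu z then (- fls_X) ^ d1 r y z else 0)) =
          fls_X ^ d1 r x z * (if y \<in> mu z then fls_X ^ d1 r y w * (- fls_X) ^ d1 r y z else (0 :: rat fls))"
          by (cases "y \<in> mu z") (simp_all add: mult.left_commute)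
      qed
      then show ?thesis unfolding right_diff_distrib sum_subtractf by simp
    qed
    also have "(\<Sum>y\<in>lam w. \<Sum>z\<in>?P. fls_X ^ d1 r x z * (if y \<in> mu z then fls_X ^ d1 r y w * (- fls_X) ^ d1 r y z else (0 :: rat fls))) =
      (\<Sum>z\<in>?P. fls_X ^ d1 r x z * (\<Sum>y\<in>lam w. if y \<in> mu z then fls_X ^ d1 r y w * (- fls_X) ^ d1 r y z else 0))"
      unfolding sum_distrib_left by (rule sum.swap)
    also have "\<dots> = (\<Sum>z\<in>?P. fls_X ^ d1 r x z * of_bool (w = z))"
    proof (rule sum.cong[OF refl])
      fix z assume "z \<in> ?P"
      then have "z \<in> X" by blast
      from face_cone_orthogonal[OF w this, of "fls_X :: rat fls"]
      show "fls_X ^ d1 r x z * (\<Sum>y\<in>lam w. if y \<in> mu z then fls_X ^ d1 r y w * (- fls_X) ^ d1 r y z else 0) =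
        fls_X ^ d1 r x z * (of_bool (w = z) :: rat fls)" by simp
    qed
    also have "\<dots> = (if w \<in> ?P then fls_X ^ d1 r x w else 0)" by (rule sum_of_bool_delta[OF fin])
    also have "(\<Sum>y\<in>lam w. fls_X ^ d1 r y w * of_bool (x = y)) = (if x \<in> lam w then fls_X ^ d1 r x w else (0 :: rat fls))"
      by (rule sum_of_bool_delta[OF finite_lam[OF w]])
    finally show "(\<Sum>y\<in>lam w. fls_X ^ d1 r y w * ?M y) = 0" using w by simp
  qed simp
  then show ?thesis by simp
qed

end

subsection \<open>Hilbert series\<close>

lemma graded_dim_monomial: "graded_dim (\<lambda>n. of_bool (P \<and> n = m)) = (if P then fls_X ^ m else 0)"
  by (intro fls_eqI) (auto simp: graded_dim_def)

lemma graded_dim_card: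
  assumes "finite P" shows "graded_dim (\<lambda>n. card {v \<in> P. m v = n}) = (\<Sum>v\<in>P. fls_X ^ m v)"
proof (rule fls_eqI)
  fix n
  show "fls_nth (graded_dim (\<lambda>n. card {v \<in> P. m v = n})) n = fls_nth (\<Sum>v\<in>P. fls_X ^ m v) n"
  proof (cases "n < 0")
    case True
    then show ?thesis by (auto simp: graded_dim_def fls_nth_sum intro!: sum.neutral)
  next
    case False
    then have "{v \<in> P. m v = nat n} = P \<inter> {v. n = int (m v)}" by auto
    then show ?thesis using False assms by (simp add: graded_dim_def fls_nth_sum sum.If_cases)
  qed
qed

text \<open>A coefficient of a power of a series is a sum over \<open>natpermute\<close>, and a list
  contributes exactly when all its entries are even.\<close>

lemma even_power_nth: "fps_nth (Abs_fps (\<lambda>n. of_bool (even n)) ^ k) n = (of_nat (card (even_lists n k)) :: rat)"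
proof (cases "k = 0")
  case True
  have "even_lists n 0 = (if n = 0 then {[]} else {})" by (auto simp: even_lists_def natpermute_def)
  then show ?thesis using True by simp
next
  case False
  have "(\<Prod>j=0..k - 1. of_bool (even (v ! j))) = (if \<forall>e\<in>set v. even e then 1 else 0 :: rat)" if "v \<in> natpermute n k" for v
  proof -
    have l: "length v = k" using that by (simp add: natpermute_def)
    show ?thesis
    proof (cases "\<forall>e\<in>set v. even e")
      case True
      then have "even (v ! j)" if "j \<in> {0..k - 1}" for j using that False l by (intro bspec[OF True] nth_mem) auto
      then show ?thesis using True by simp
    next
      case F: False
      then obtain j where "j < k" "odd (v ! j)" using l by (metis in_set_conv_nth)
      then have z: "(\<Prod>j=0..k - 1. of_bool (even (v ! j))) = (0 :: rat)" by (intro prod_zero) auto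
      show ?thesis unfolding z using F by simp
    qed
  qed
  then have "fps_nth (Abs_fps (\<lambda>n. of_bool (even n)) ^ k) n = (\<Sum>v\<in>natpermute n k. if \<forall>e\<in>set v. even e then 1 else (0 :: rat))"
    using False by (simp add: fps_power_nth)
  also have "\<dots> = of_nat (card (even_lists n k))"
    unfolding even_lists_def by (subst sum.inter_filter[symmetric]) (simp_all add: natpermute_finite)
  finally show ?thesis .
qed

text \<open>The series of even degrees is inverse to \<open>1 - q^2\<close>; multiplied out, the
  identity can be checked on power series.\<close>

lemma graded_dim_even_lists:
  "graded_dim (\<lambda>n. card (if d \<le> n then even_lists (n - d) k else {})) * (1 - fls_X\<^sup>2) ^ k = fls_X ^ d"
proof -
  let ?a = "Abs_fps (\<lambda>n. of_bool (even n)) :: rat fps"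
  have "?a * (1 - fps_X\<^sup>2) = 1"
  proof (rule fps_ext)
    fix n
    consider "n = 0" | "n = 1" | m where "n = Suc (Suc m)" by (metis One_nat_def old.nat.exhaust)
    then show "fps_nth (?a * (1 - fps_X\<^sup>2)) n = fps_nth 1 n"
      unfolding right_diff_distrib fps_sub_nth fps_X_power_mult_right_nth by cases simp_all
  qed
  then have a: "?a ^ k * (1 - fps_X\<^sup>2) ^ k = 1" by (simp flip: power_mult_distrib)
  have "Abs_fps (\<lambda>n. of_nat (card (if d \<le> n then even_lists (n - d) k else {}))) = fps_X ^ d * ?a ^ k"
    by (rule fps_ext) (auto simp: fps_X_power_mult_nth even_power_nth)
  then have G: "graded_dim (\<lambda>n. card (if d \<le> n then even_lists (n - d) k else {})) = fps_to_fls (fps_X ^ d * ?a ^ k)"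
    unfolding graded_dim_def by (rule arg_cong)
  have O: "1 - fls_X\<^sup>2 = fps_to_fls (1 - fps_X\<^sup>2 :: rat fps)"
    unfolding fps_to_fls_minus fps_to_fls_power fps_X_to_fls by simp
  show ?thesis unfolding G O fps_to_fls_power[symmetric] fls_times_fps_to_fls[symmetric] mult.assoc a
    unfolding mult_1_right fps_to_fls_power fps_X_to_fls ..
qed

text \<open>Series that agree up to degree \<open>n\<close> have distance at most
  \<open>2^-n\<close>, so convergence is eventual agreement of coefficients.\<close>

lemma has_sum_fls:
  fixes f :: "'b \<Rightarrow> rat fls"
  assumes "\<And>n::nat. \<exists>K. finite K \<and> K \<subseteq> A \<and>
    (\<forall>F. finite F \<longrightarrow> K \<subseteq> F \<longrightarrow> F \<subseteq> A \<longrightarrow> (\<forall>k\<le>int n. fls_nth (sum f F) k = fls_nth S k))"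
  shows "(f has_sum S) A"
  unfolding has_sum_def tendsto_iff
proof (intro allI impI)
  fix e :: real assume e: "e > 0"
  obtain n where n: "(1 / 2) ^ n < e" using real_arch_pow_inv[OF e, of "1 / 2"] by auto
  from assms[of n] obtain K where K: "finite K \<and> K \<subseteq> A \<and>
    (\<forall>F. finite F \<longrightarrow> K \<subseteq> F \<longrightarrow> F \<subseteq> A \<longrightarrow> (\<forall>k\<le>int n. fls_nth (sum f F) k = fls_nth S k))"
    by (rule exE)
  have "dist (sum f F) S < e" if F: "finite F" "K \<subseteq> F" "F \<subseteq> A" for F
  proof (cases "sum f F = S")
    case False
    then have d: "int n < fls_subdegree (sum f F - S)"
      using K F by (intro fls_subdegree_greaterI) simp_all
    then have "n \<le> nat (fls_subdegree (sum f F - S))" by linarith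
    then have "(2::real) ^ n \<le> 2 ^ nat (fls_subdegree (sum f F - S))" by (intro power_increasing) auto
    then have "inverse (2 ^ nat (fls_subdegree (sum f F - S))) \<le> inverse ((2::real) ^ n)" by (intro le_imp_inverse_le) auto
    then have "dist (sum f F) S \<le> (1 / 2) ^ n" using False d by (simp add: dist_fls_def power_one_over inverse_eq_divide)
    then show ?thesis using n by linarith
  qed (use e in simp)
  then show "\<forall>\<^sub>F F in finite_subsets_at_top A. dist (sum f F) S < e"
    unfolding eventually_finite_subsets_at_top using K by (intro exI[of _ K]) simp
qed

lemma neg_fps_X: "- fps_X \<noteq> (0 :: rat fps)" "fps_nth (- fps_X :: rat fps) 0 = 0"
  by simp_all

lemma at_minus_q_simps:
  "at_minus_q (f * g) = at_minus_q f * at_minus_q g" "at_minus_q (fls_X ^ n) = (- fls_X) ^ n" "at_minus_q 0 = 0"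
  "at_minus_q (inverse (1 - fls_X\<^sup>2) ^ n) = inverse (1 - fls_X\<^sup>2) ^ n"
  unfolding at_minus_q_def
  by (simp_all add: fls_compose_fps_mult[OF neg_fps_X] fls_compose_fps_power[OF neg_fps_X]
      fls_compose_fps_inverse[OF neg_fps_X] fls_compose_fps_diff[OF neg_fps_X])

lemma one_minus_sq_nonzero: "(1 - fls_X\<^sup>2 :: rat fls) \<noteq> 0"
proof
  assume "(1 - fls_X\<^sup>2 :: rat fls) = 0"
  then have "fls_nth (1 - fls_X\<^sup>2 :: rat fls) 0 = 0" by simp
  then show False by simp
qed

lemma l1_d1: "l1_dist r x y = int (d1 r x y)"
  by (simp add: l1_dist_def d1_def)

text \<open>A power of the variable only shifts upwards, so degree \<open>n\<close> of the product
  sees degrees up to \<open>n\<close> of the factor. This allows an infinite sum to be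
  truncated.\<close>

lemma signed_power_nth:
  assumes s: "s = fls_X \<or> s = - fls_X" and "\<And>k. k \<le> n \<Longrightarrow> fls_nth f k = fls_nth g k"
  shows "fls_nth (s ^ d * f) n = fls_nth (s ^ d * g :: rat fls) n"
proof -
  have "fls_nth f (n - int d) = fls_nth g (n - int d)" by (rule assms(2)) simp
  then show ?thesis using s by (auto simp: uminus_power_if fls_X_power_times_conv_shift)
qed

subsection \<open>Telescoping\<close>

text \<open>In the application \<open>p j\<close> counts how many of two points lie below a corner
  \<open>z\<close> in direction \<open>j\<close>, and \<open>mid r p v\<close> is the sum of their
  distances to the vertex whose cube has largest corner \<open>z\<close> and missing direction
  \<open>v\<close>.\<close>

definition mid :: "nat \<Rightarrow> (nat \<Rightarrow> nat) \<Rightarrow> nat \<Rightarrow> nat" where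
  "mid r p v = (\<Sum>j\<in>{1..<v}. 2 - p j) + (\<Sum>j\<in>{v<..r}. p j)"

definition tele :: "nat \<Rightarrow> (nat \<Rightarrow> nat) \<Rightarrow> rat fls" where
  "tele r p = (\<Sum>v=1..r. (of_bool (p v = 0) - of_bool (p v = 2)) * fls_X ^ mid r p v)"

text \<open>Let \<open>M v\<close> be the sum of \<open>2 - p j\<close> over
  \<open>j \<le> v\<close> plus the sum of \<open>p j\<close> over \<open>j > v\<close>. Multiplied
  by \<open>q^2 - 1\<close>, the summand at \<open>v\<close> becomes
  \<open>q^(M v) - q^(M (v - 1))\<close>, and the sum telescopes.\<close>

lemma tele_closed:
  assumes "\<And>j. j \<in> {1..r} \<Longrightarrow> p j \<le> 2"
  shows "(fls_X\<^sup>2 - 1) * tele r p = fls_X ^ (\<Sum>j=1..r. 2 - p j) - fls_X ^ (\<Sum>j=1..r. p j)"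
  using assms
proof (induction r)
  case 0
  then show ?case by (simp add: tele_def)
next
  case (Suc r)
  let ?k = "p (Suc r)" and ?A = "\<Sum>j=1..r. 2 - p j" and ?P = "\<Sum>j=1..r. p j"
  let ?c = "of_bool (?k = 0) - of_bool (?k = 2) :: rat fls"
  have "mid (Suc r) p v = ?k + mid r p v" if "v \<in> {1..r}" for v
  proof -
    have "{v<..Suc r} = insert (Suc r) {v<..r}" using that by auto
    then show ?thesis by (simp add: mid_def)
  qed
  moreover have "mid (Suc r) p (Suc r) = ?A" by (simp add: mid_def atLeastLessThanSuc_atLeastAtMost)
  ultimately have "tele (Suc r) p =
      (\<Sum>v=1..r. (of_bool (p v = 0) - of_bool (p v = 2)) * fls_X ^ (?k + mid r p v)) + ?c * fls_X ^ ?A"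
    by (simp add: tele_def)
  also have "(\<Sum>v=1..r. (of_bool (p v = 0) - of_bool (p v = 2)) * fls_X ^ (?k + mid r p v)) = fls_X ^ ?k * tele r p"
    unfolding tele_def sum_distrib_left power_add by (intro sum.cong refl mult.left_commute)
  finally have "tele (Suc r) p = fls_X ^ ?k * tele r p + ?c * fls_X ^ ?A" .
  then have "(fls_X\<^sup>2 - 1) * tele (Suc r) p = fls_X ^ ?k * ((fls_X\<^sup>2 - 1) * tele r p) + (fls_X\<^sup>2 - 1) * (?c * fls_X ^ ?A)"
    by (simp only: distrib_left mult.left_commute)
  also have "(fls_X\<^sup>2 - 1) * tele r p = fls_X ^ ?A - fls_X ^ ?P" using Suc by simp
  also have "fls_X ^ ?k * (fls_X ^ ?A - fls_X ^ ?P) + (fls_X\<^sup>2 - 1) * (?c * fls_X ^ ?A) =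
    fls_X ^ (2 - ?k) * fls_X ^ ?A - fls_X ^ ?k * (fls_X ^ ?P :: rat fls)"
  proof -
    consider "?k = 0" | "?k = 1" | "?k = 2" using Suc.prems[of "Suc r"] by fastforce
    then show ?thesis by cases (simp_all add: algebra_simps)
  qed
  finally show ?case by (simp add: power_add mult.commute)
qed

lemma sq_minus_one_nonzero: "(fls_X\<^sup>2 - 1 :: rat fls) \<noteq> 0"
  using one_minus_sq_nonzero by (metis right_minus_eq)

text \<open>Replacing \<open>p\<close> by \<open>2 - p\<close> exchanges the ends of the telescope,
  so \<open>tele\<close> changes sign. Term by term it changes the sign of each coefficient and
  replaces the exponent \<open>mid\<close> by \<open>2 r - 2 - mid\<close>; comparing the two gives
  the symmetry.\<close>

lemma tele_sym:
  assumes p: "\<And>j. j \<in> {1..r} \<Longrightarrow> p j \<le> 2"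
  shows "fls_nth (tele r p) (2 * int r - 2 - n) = fls_nth (tele r p) n"
proof -
  let ?p = "\<lambda>j. 2 - p j"
  have pp: "(\<Sum>j=1..r. 2 - ?p j) = (\<Sum>j=1..r. p j)" using p by (intro sum.cong) auto
  have "(fls_X\<^sup>2 - 1) * tele r ?p = (fls_X\<^sup>2 - 1) * (- tele r p)"
    using tele_closed[of r ?p] tele_closed[OF p] unfolding pp by simp
  then have neg: "tele r ?p = - tele r p" using sq_minus_one_nonzero unfolding mult_cancel_left by blast
  have "(of_bool (?p v = 0) - of_bool (?p v = 2)) * (fls_X :: rat fls) ^ mid r ?p v =
      - ((of_bool (p v = 0) - of_bool (p v = 2)) * fls_X ^ (2 * r - 2 - mid r p v)) \<and> mid r p v \<le> 2 * r - 2"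
    if v: "v \<in> {1..r}" for v
  proof -
    have "mid r p v + mid r ?p v = (\<Sum>j\<in>{1..<v}. (2 - p j) + (2 - (2 - p j))) + (\<Sum>j\<in>{v<..r}. p j + (2 - p j))"
      unfolding mid_def sum.distrib by simp
    also have "\<dots> = (\<Sum>j\<in>{1..<v}. 2) + (\<Sum>j\<in>{v<..r}. 2)"
      using p v by (intro arg_cong2[where f = "(+)"] sum.cong) (auto intro!: le_add_diff_inverse le_add_diff_inverse2)
    also have "\<dots> = 2 * r - 2" using v by auto
    finally have m: "mid r p v + mid r ?p v = 2 * r - 2" .
    then have "mid r ?p v = 2 * r - 2 - mid r p v" by linarith
    moreover have "p v \<le> 2" by (rule p[OF v])
    ultimately show ?thesis using m by (auto simp: of_bool_def)
  qed
  note t = this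
  have "fls_nth (tele r p) n = - fls_nth (tele r ?p) n" using neg by simp
  also have "\<dots> = (\<Sum>v=1..r. fls_nth ((of_bool (p v = 0) - of_bool (p v = 2)) * fls_X ^ (2 * r - 2 - mid r p v)) n)"
    unfolding tele_def[of r ?p] fls_nth_sum sum_negf[symmetric] using t by (intro sum.cong) simp_all
  also have "\<dots> = (\<Sum>v=1..r. fls_nth ((of_bool (p v = 0) - of_bool (p v = 2)) * fls_X ^ mid r p v) (2 * int r - 2 - n))"
  proof (rule sum.cong[OF refl])
    fix v assume v: "v \<in> {1..r}"
    then have "n = int (2 * r - 2 - mid r p v) \<longleftrightarrow> 2 * int r - 2 - n = int (mid r p v)" using t[OF v] by auto
    then show "fls_nth ((of_bool (p v = 0) - of_bool (p v = 2)) * fls_X ^ (2 * r - 2 - mid r p v) :: rat fls) n =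
      fls_nth ((of_bool (p v = 0) - of_bool (p v = 2)) * fls_X ^ mid r p v) (2 * int r - 2 - n)"
      by (cases "p v = 0"; cases "p v = 2") (simp_all add: of_bool_def)
  qed
  finally show ?thesis by (simp add: tele_def fls_nth_sum)
qed

text \<open>Since \<open>q^2 - 1 = q (q - q^-1)\<close>, clearing the denominator of the
  \<open>q\<close>-integer leaves the two ends of the telescope, with exponents
  \<open>2 r - D\<close> and \<open>D\<close>.\<close>

lemma q_int_tele:
  assumes p: "\<And>j. j \<in> {1..r} \<Longrightarrow> p j \<le> 2" and D: "D = (\<Sum>j=1..r. p j)"
  shows "fls_X powi (int r - 1) * q_int (int r - int D) = tele r p"
proof -
  let ?X = "fls_X :: rat fls"
  have X: "?X \<noteq> 0" by simp
  define Q where "Q = (\<Sum>j=1..r. 2 - p j)"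
  have "Q + D = (\<Sum>j=1..r. 2)" unfolding D Q_def sum.distrib[symmetric] using p by (intro sum.cong) auto
  then have s: "int Q = 2 * int r - int D" by simp
  have f: "?X\<^sup>2 - 1 = ?X * (?X - ?X powi (- 1))" using X by (simp add: power_int_minus algebra_simps power2_eq_square)
  then have B: "?X - ?X powi (- 1) \<noteq> 0" using sq_minus_one_nonzero by auto
  have "(?X\<^sup>2 - 1) * (?X powi (int r - 1) * q_int (int r - int D)) =
      ?X powi 1 * ?X powi (int r - 1) * (?X powi (int r - int D) - ?X powi (- (int r - int D)))"
    unfolding q_int_def f using B by simp
  also have "\<dots> = ?X powi (2 * int r - int D) - ?X powi (int D)"
    unfolding right_diff_distrib power_int_add[OF disjI1[OF X], symmetric]
    by (intro arg_cong2[where f = "(-)"] arg_cong[where f = "power_int ?X"]) linarith+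
  also have "\<dots> = (?X\<^sup>2 - 1) * tele r p"
  proof -
    have "(?X\<^sup>2 - 1) * tele r p = ?X ^ Q - ?X ^ D" unfolding Q_def D by (rule tele_closed[OF p])
    then show ?thesis unfolding s[symmetric] power_int_of_nat by simp
  qed
  finally show ?thesis using sq_minus_one_nonzero by simp
qed

context cubist_ideal
begin

subsection \<open>The matrices as Laurent series\<close>

text \<open>With the variable \<open>s\<close> as an argument, the matrices at \<open>q\<close> and
  at \<open>- q\<close> are available without substitution.\<close>

definition du :: "rat fls \<Rightarrow> point \<Rightarrow> point \<Rightarrow> rat fls" where
  "du s x y = (if y \<in> lam x then s ^ d1 r y x else 0)"

definition dv :: "rat fls \<Rightarrow> point \<Rightarrow> point \<Rightarrow> rat fls" where
  "dv s x y = (if y \<in> mu x then s ^ d1 r y x else 0)"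

definition cv :: "rat fls \<Rightarrow> point \<Rightarrow> point \<Rightarrow> rat fls" where
  "cv s x y = inverse (1 - fls_X\<^sup>2) ^ (r - 1) * s ^ d1 r x y"

lemma D_U_eq: "x \<in> X \<Longrightarrow> y \<in> X \<Longrightarrow> D_U TYPE('k::field) r X x y = du fls_X x y"
  by (simp add: D_U_dim graded_dim_monomial du_def)

lemma D_V_eq: "x \<in> X \<Longrightarrow> y \<in> X \<Longrightarrow> D_V TYPE('k::field) r X x y = dv fls_X x y"
  by (simp add: D_V_dim graded_dim_monomial dv_def)

lemma cv_graded: "graded_dim (\<lambda>n. card (if d1 r x y \<le> n then even_lists (n - d1 r x y) (r - 1) else {})) = cv fls_X x y"
  (is "?g = _")
proof -
  have "cv fls_X x y = inverse (1 - fls_X\<^sup>2) ^ (r - 1) * (?g * (1 - fls_X\<^sup>2) ^ (r - 1))"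
    unfolding graded_dim_even_lists cv_def ..
  then show ?thesis using one_minus_sq_nonzero by (simp add: power_inverse)
qed

lemma C_V_eq: "x \<in> X \<Longrightarrow> y \<in> X \<Longrightarrow> C_V TYPE('k::field) r X x y = cv fls_X x y"
  unfolding C_V_dim cv_graded ..

lemma C_U_eq:
  assumes "x \<in> X" "y \<in> X"
  shows "C_U TYPE('k::field) r X x y = (\<Sum>v\<in>{v \<in> {v \<in> X. x \<in> lam v}. y \<in> lam v}. fls_X ^ (d1 r x v + d1 r y v))"
proof -
  have "{v \<in> X. x \<in> lam v \<and> y \<in> lam v \<and> d1 r x v + d1 r y v = n} =
    {v \<in> {v \<in> {v \<in> X. x \<in> lam v}. y \<in> lam v}. d1 r x v + d1 r y v = n}" for n by blast
  moreover have "finite {v \<in> {v \<in> X. x \<in> lam v}. y \<in> lam v}"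
    by (rule finite_subset[OF _ lam_parents_finite[of x]]) blast
  ultimately show ?thesis unfolding C_U_dim[OF assms] by (simp only: graded_dim_card)
qed

lemma C_U_du:
  assumes "x \<in> X" "y \<in> X"
  shows "C_U TYPE('k::field) r X x y = (\<Sum>v\<in>{v \<in> X. x \<in> lam v}. fls_X ^ d1 r x v * du fls_X v y)"
  unfolding C_U_eq[OF assms] sum.inter_filter[OF lam_parents_finite]
  by (intro sum.cong) (simp_all add: du_def power_add)

lemma at_minus_cv: "at_minus_q (cv fls_X x y) = cv (- fls_X) x y"
  by (simp add: cv_def at_minus_q_simps)

text \<open>\<open>face_sum_cone\<close> with its factor cancelled by that of \<open>C_V\<close>.
  Only the square of \<open>s\<close> enters this factor, so both signs are covered.\<close>

lemma du_cv:
  assumes x: "x \<in> X" and z: "z \<in> L" and s: "s\<^sup>2 = fls_X\<^sup>2"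
  shows "(\<Sum>y\<in>lam x. s ^ d1 r y x * cv (- s) y z) = dv (- s) x z"
proof -
  let ?W = "inverse (1 - fls_X\<^sup>2) ^ (r - 1) :: rat fls"
  have "(\<Sum>y\<in>lam x. s ^ d1 r y x * cv (- s) y z) = ?W * (\<Sum>y\<in>lam x. s ^ d1 r y x * (- s) ^ d1 r y z)"
    unfolding cv_def sum_distrib_left by (intro sum.cong refl mult.left_commute)
  also have "\<dots> = ?W * (if z \<in> mu x then (1 - fls_X\<^sup>2) ^ (r - 1) * (- s) ^ d1 r z x else 0)"
    unfolding face_sum_cone[OF x z, of s] s ..
  also have "\<dots> = dv (- s) x z" using one_minus_sq_nonzero by (simp add: dv_def power_inverse)
  finally show ?thesis .
qed

subsection \<open>Matrix identities\<close>

lemma brauer_U: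
  assumes x: "x \<in> X" and y: "y \<in> X"
  shows "((\<lambda>z. D_U TYPE('k::field) r X z x * D_U TYPE('k) r X z y) has_sum C_U TYPE('k) r X x y) X"
proof (rule has_sum_finite_neutralI[OF lam_parents_finite[of x]])
  show "D_U TYPE('k) r X z x * D_U TYPE('k) r X z y = 0" if "z \<in> X - {v \<in> X. x \<in> lam v}" for z
    using that x by (simp add: D_U_eq du_def)
  show "C_U TYPE('k) r X x y = (\<Sum>z\<in>{v \<in> X. x \<in> lam v}. D_U TYPE('k) r X z x * D_U TYPE('k) r X z y)"
    unfolding C_U_du[OF x y] using x y by (intro sum.cong refl) (simp add: D_U_eq du_def)
qed blast

lemma inverse_D:
  assumes x: "x \<in> X" and y: "y \<in> X"
  shows "((\<lambda>z. D_U TYPE('k::field) r X z x * at_minus_q (D_V TYPE('k) r X z y)) has_sum of_bool (x = y)) X"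
proof (rule has_sum_finite_neutralI[OF lam_parents_finite[of x]])
  show "D_U TYPE('k) r X z x * at_minus_q (D_V TYPE('k) r X z y) = 0" if "z \<in> X - {v \<in> X. x \<in> lam v}" for z
    using that x by (simp add: D_U_eq du_def)
  show "of_bool (x = y) = (\<Sum>z\<in>{v \<in> X. x \<in> lam v}. D_U TYPE('k) r X z x * at_minus_q (D_V TYPE('k) r X z y))"
    unfolding decomposition_inverse[OF x y, symmetric] using x y
    by (intro sum.cong refl) (simp add: D_U_eq D_V_eq at_minus_q_simps du_def dv_def)
qed blast

text \<open>Inserting \<open>D_U^T D_U\<close> for \<open>C_U\<close>, the right part collapses by
  \<open>du_cv\<close> to \<open>D_V(-q)\<close>, and \<open>decomposition_inverse\<close> finishes.
  The sum lives on the finitely many cubes through \<open>x\<close>.\<close>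

lemma inverse_C:
  assumes x: "x \<in> X" and y: "y \<in> X"
  shows "((\<lambda>z. C_U TYPE('k::field) r X x z * at_minus_q (C_V TYPE('k) r X z y)) has_sum of_bool (x = y)) X"
proof -
  let ?P = "{v \<in> X. x \<in> lam v}"
  let ?B = "\<Union>v\<in>?P. lam v"
  have fin: "finite ?B" using lam_parents_finite[of x] finite_lam by auto
  have BX: "?B \<subseteq> X" using lam_X by blast
  have yL: "y \<in> L" using X_L y by blast
  show ?thesis
  proof (rule has_sum_finite_neutralI[OF fin BX])
    show "C_U TYPE('k) r X x z * at_minus_q (C_V TYPE('k) r X z y) = 0" if z: "z \<in> X - ?B" for z
    proof -
      have "C_U TYPE('k) r X x z = 0"
        using z x by (subst C_U_du) (auto simp: du_def intro!: sum.neutral)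
      then show ?thesis by simp
    qed
    have "(\<Sum>z\<in>?B. C_U TYPE('k) r X x z * at_minus_q (C_V TYPE('k) r X z y)) =
      (\<Sum>z\<in>?B. \<Sum>v\<in>?P. fls_X ^ d1 r x v * (du fls_X v z * cv (- fls_X) z y))"
    proof (rule sum.cong[OF refl])
      fix z assume "z \<in> ?B"
      then have z: "z \<in> X" using BX by blast
      show "C_U TYPE('k) r X x z * at_minus_q (C_V TYPE('k) r X z y) =
        (\<Sum>v\<in>?P. fls_X ^ d1 r x v * (du fls_X v z * cv (- fls_X) z y))"
        unfolding C_U_du[OF x z] C_V_eq[OF z y] at_minus_cv sum_distrib_right mult.assoc ..
    qed
    also have "\<dots> = (\<Sum>v\<in>?P. fls_X ^ d1 r x v * (\<Sum>z\<in>?B. du fls_X v z * cv (- fls_X) z y))"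
      unfolding sum_distrib_left by (rule sum.swap)
    also have "\<dots> = (\<Sum>v\<in>?P. fls_X ^ d1 r x v * dv (- fls_X) v y)"
    proof (rule sum.cong[OF refl])
      fix v assume v: "v \<in> ?P"
      then have vX: "v \<in> X" by blast
      have "(\<Sum>z\<in>?B. du fls_X v z * cv (- fls_X) z y) = (\<Sum>z\<in>lam v. du fls_X v z * cv (- fls_X) z y)"
        by (rule sum.mono_neutral_right[OF fin]) (use v in \<open>auto simp: du_def\<close>)
      also have "\<dots> = (\<Sum>z\<in>lam v. fls_X ^ d1 r z v * cv (- fls_X) z y)"
        by (intro sum.cong) (simp_all add: du_def)
      finally show "fls_X ^ d1 r x v * (\<Sum>z\<in>?B. du fls_X v z * cv (- fls_X) z y) = fls_X ^ d1 r x v * dv (- fls_X) v y"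
        unfolding du_cv[OF vX yL refl] by simp
    qed
    also have "\<dots> = of_bool (x = y)" unfolding dv_def by (rule decomposition_inverse[OF x y])
    finally show "of_bool (x = y) = (\<Sum>z\<in>?B. C_U TYPE('k) r X x z * at_minus_q (C_V TYPE('k) r X z y))" ..
  qed
qed

lemma finite_sphere: "finite {z \<in> X. d1 r y z \<le> n}"
proof (rule finite_subset[OF _ finite_box[of r "\<lambda>j. y j - int n" "\<lambda>j. y j + int n"]], rule subsetI)
  fix z assume z: "z \<in> {z \<in> X. d1 r y z \<le> n}"
  have "y j - int n \<le> z j \<and> z j \<le> y j + int n" if "j \<in> {1..r}" for j
  proof -
    have "nat \<bar>y j - z j\<bar> \<le> d1 r y z" unfolding d1_def using that by (intro member_le_sum) auto
    then have "nat \<bar>y j - z j\<bar> \<le> n" using z by simp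
    then show ?thesis by linarith
  qed
  then show "z \<in> {z \<in> L. \<forall>j\<in>{1..r}. y j - int n \<le> z j \<and> z j \<le> y j + int n}" using z X_L by blast
qed

text \<open>The sum is infinite, so it is first identified with the series \<open>S\<close> that
  counts vertices by total distance. Then \<open>D_U(-q)\<close> sends both \<open>S\<close> and
  \<open>C_V(q)\<close> to \<open>D_V(q)\<close>, and \<open>triangular_zero\<close> cancels
  it.\<close>

lemma brauer_V:
  assumes x: "x \<in> X" and y: "y \<in> X"
  shows "((\<lambda>z. D_V TYPE('k::field) r X z x * D_V TYPE('k) r X z y) has_sum C_V TYPE('k) r X x y) X"
proof -
  let ?X = "fls_X :: rat fls"
  let ?P = "\<lambda>x z. x \<in> mu z \<and> y \<in> mu z"
  define S where "S x = graded_dim (\<lambda>n. card {z \<in> X. ?P x z \<and> d1 r x z + d1 r y z = n})" for x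
  define Z where "Z n = {z \<in> X. d1 r y z \<le> n}" for n
  have f: "dv ?X z x * dv ?X z y = (if ?P x z then ?X ^ (d1 r x z + d1 r y z) else 0)" for x z
    by (simp add: dv_def power_add)
  \<comment> \<open>Up to degree \<open>n\<close> only vertices within distance \<open>n\<close> of
    \<open>y\<close> contribute.\<close>
  have part: "fls_nth (\<Sum>z\<in>F. dv ?X z x * dv ?X z y) k = fls_nth (S x) k"
    if F: "finite F" "Z n \<subseteq> F" "F \<subseteq> X" and k: "k \<le> int n" for F n k x
  proof (cases "k < 0")
    case True
    then show ?thesis unfolding f by (auto simp: S_def graded_dim_def fls_nth_sum intro!: sum.neutral)
  next
    case False
    then obtain m where m: "k = int m" by (metis nonneg_int_cases not_less)
    have "{z \<in> X. ?P x z \<and> d1 r x z + d1 r y z = m} = F \<inter> {z. ?P x z \<and> m = d1 r x z + d1 r y z}"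
      using F k m by (auto simp: Z_def)
    then have "fls_nth (S x) k = of_nat (card (F \<inter> {z. ?P x z \<and> m = d1 r x z + d1 r y z}))"
      by (simp add: S_def graded_dim_def m)
    also have "\<dots> = (\<Sum>z\<in>F. if ?P x z \<and> m = d1 r x z + d1 r y z then 1 else 0)" using F(1) by (simp add: sum.If_cases)
    also have "\<dots> = (\<Sum>z\<in>F. fls_nth (dv ?X z x * dv ?X z y) k)"
    proof (rule sum.cong[OF refl])
      fix z
      show "(if ?P x z \<and> m = d1 r x z + d1 r y z then 1 else 0) = fls_nth (dv ?X z x * dv ?X z y) k"
        unfolding f m by (cases "?P x z") (simp_all flip: of_nat_add)
    qed
    finally show ?thesis by (simp add: fls_nth_sum)
  qed
  have fin: "finite (Z n)" for n unfolding Z_def by (rule finite_sphere)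
  have ZX: "Z n \<subseteq> X" for n unfolding Z_def by blast
  have sums: "((\<lambda>z. dv ?X z x * dv ?X z y) has_sum S x) X"
  proof (rule has_sum_fls)
    fix n :: nat
    show "\<exists>K. finite K \<and> K \<subseteq> X \<and> (\<forall>F. finite F \<longrightarrow> K \<subseteq> F \<longrightarrow> F \<subseteq> X \<longrightarrow>
        (\<forall>k\<le>int n. fls_nth (\<Sum>z\<in>F. dv ?X z x * dv ?X z y) k = fls_nth (S x) k))"
      using fin[of n] ZX[of n] part[of _ n] by (intro exI[of _ "Z n"]) simp
  qed
  have "S x - cv ?X x y = 0"
  proof (rule triangular_zero[where s = "- ?X" and M = "\<lambda>x. S x - cv ?X x y", OF _ _ _ x])
    show "fls_nth (S x - cv ?X x y) n = 0" if "n < 0" for x n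
      using that unfolding cv_graded[symmetric] S_def by (simp add: graded_dim_def)
    fix w assume w: "w \<in> X"
    have "(\<Sum>x\<in>lam w. (- ?X) ^ d1 r x w * S x) = dv ?X w y"
    proof (rule fls_eqI)
      fix k
      \<comment> \<open>Coefficient \<open>k\<close> involves \<open>S\<close> only up to degree
        \<open>k\<close>, so a finite part of the sum suffices and the order of summation can be
        exchanged.\<close>
      define F where "F = Z (nat k)"
      have "fls_nth (\<Sum>x\<in>lam w. (- ?X) ^ d1 r x w * S x) k =
        fls_nth (\<Sum>x\<in>lam w. (- ?X) ^ d1 r x w * (\<Sum>z\<in>F. dv ?X z x * dv ?X z y)) k"
        unfolding fls_nth_sum
      proof (rule sum.cong[OF refl], rule signed_power_nth)
        show "fls_nth (S x) k' = fls_nth (\<Sum>z\<in>F. dv ?X z x * dv ?X z y) k'" if "k' \<le> k" for x k'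
          unfolding F_def using that by (intro part[symmetric, OF fin order.refl ZX]) linarith
      qed simp
      also have "(\<Sum>x\<in>lam w. (- ?X) ^ d1 r x w * (\<Sum>z\<in>F. dv ?X z x * dv ?X z y)) =
        (\<Sum>x\<in>lam w. \<Sum>z\<in>F. dv ?X z y * ((- ?X) ^ d1 r x w * dv ?X z x))"
        unfolding sum_distrib_left by (intro sum.cong refl) (simp only: mult_ac)
      also have "\<dots> = (\<Sum>z\<in>F. dv ?X z y * (\<Sum>x\<in>lam w. (- ?X) ^ d1 r x w * dv ?X z x))"
        unfolding sum_distrib_left by (rule sum.swap)
      also have "\<dots> = (\<Sum>z\<in>F. dv ?X z y * of_bool (w = z))"
      proof (rule sum.cong[OF refl])
        fix z assume "z \<in> F"
        then have z: "z \<in> X" using ZX unfolding F_def by blast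
        have "(\<Sum>x\<in>lam w. (- ?X) ^ d1 r x w * dv ?X z x) =
          (\<Sum>x\<in>lam w. if x \<in> mu z then (- ?X) ^ d1 r x w * (- (- ?X)) ^ d1 r x z else 0)"
          by (intro sum.cong) (simp_all add: dv_def)
        then show "dv ?X z y * (\<Sum>x\<in>lam w. (- ?X) ^ d1 r x w * dv ?X z x) = dv ?X z y * of_bool (w = z)"
          unfolding face_cone_orthogonal[OF w z, of "- ?X"] by simp
      qed
      also have "\<dots> = (if w \<in> F then dv ?X w y else 0)" unfolding F_def by (rule sum_of_bool_delta[OF fin])
      also have "fls_nth (if w \<in> F then dv ?X w y else 0) k = fls_nth (dv ?X w y) k"
        using w by (auto simp: F_def Z_def dv_def)
      finally show "fls_nth (\<Sum>x\<in>lam w. (- ?X) ^ d1 r x w * S x) k = fls_nth (dv ?X w y) k" .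
    qed
    moreover have "(\<Sum>x\<in>lam w. (- ?X) ^ d1 r x w * cv ?X x y) = dv ?X w y"
      using du_cv[OF w X_L[OF y], of "- ?X"] by simp
    ultimately show "(\<Sum>x\<in>lam w. (- ?X) ^ d1 r x w * (S x - cv ?X x y)) = 0"
      unfolding right_diff_distrib sum_subtractf by simp
  qed simp
  then have "S x = C_V TYPE('k) r X x y" unfolding C_V_eq[OF x y] by simp
  moreover have "((\<lambda>z. D_V TYPE('k) r X z x * D_V TYPE('k) r X z y) has_sum S x) X"
    using sums by (rule has_sum_cong[THEN iffD2, rotated]) (simp add: D_V_eq x y)
  ultimately show ?thesis by simp
qed

end

lemma mid_cong:
  assumes "\<And>j. j \<in> {1..r} \<Longrightarrow> j \<noteq> v \<Longrightarrow> p j = p' j" "v \<in> {1..r}"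
  shows "mid r p v = mid r p' v"
  unfolding mid_def using assms by (intro arg_cong2[where f = "(+)"] sum.cong) auto

context cubist_ideal
begin

subsection \<open>The Cartan matrix of \<open>U\<close>\<close>

definition box :: "point \<Rightarrow> point \<Rightarrow> point set" where
  "box x y = {z \<in> L. \<forall>j\<in>{1..r}. x j \<le> z j \<and> z j \<le> x j + 1 \<and> y j \<le> z j \<and> z j \<le> y j + 1}"

definition gap :: "point \<Rightarrow> point \<Rightarrow> point \<Rightarrow> nat \<Rightarrow> nat" where
  "gap x y z j = nat (z j - x j) + nat (z j - y j)"

lemma finite_pbox: "finite (box x y)"
  by (rule finite_subset[OF _ finite_box[of r x "\<lambda>j. x j + 1"]]) (auto simp: box_def)

lemma boxD: "z \<in> box x y \<Longrightarrow> j \<in> {1..r} \<Longrightarrow> x j \<le> z j \<and> z j \<le> x j + 1 \<and> y j \<le> z j \<and> z j \<le> y j + 1"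
  by (simp add: box_def)

lemma gap_le: "z \<in> box x y \<Longrightarrow> j \<in> {1..r} \<Longrightarrow> gap x y z j \<le> 2"
  using boxD[of z x y j] unfolding gap_def by linarith

text \<open>A point above \<open>x\<close> automatically has its diagonal shift outside the ideal,
  so membership in the Cubist set reduces to membership in the ideal.\<close>

lemma unit_interval_box:
  assumes x: "x \<in> X" and y: "y \<in> X"
  shows "unit_interval r X x \<inter> unit_interval r X y = box x y \<inter> I"
proof (intro equalityI subsetI)
  fix z assume "z \<in> unit_interval r X x \<inter> unit_interval r X y"
  then have z: "z \<in> X" "x \<le> z" "z \<le> pshift r x" "y \<le> z" "z \<le> pshift r y"
    by (simp_all add: unit_interval_def diag_shift_1)
  have "x j \<le> z j \<and> z j \<le> x j + 1 \<and> y j \<le> z j \<and> z j \<le> y j + 1" if "j \<in> {1..r}" for j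
    using that z(2-5)[THEN le_funD, of j] by (simp add: pshift_def)
  then show "z \<in> box x y \<inter> I" using X_L[OF z(1)] X_I[OF z(1)] by (simp add: box_def)
next
  fix z assume "z \<in> box x y \<inter> I"
  then have z: "z \<in> box x y" "z \<in> I" "z \<in> L" by (simp_all add: box_def)
  have le: "u \<le> z \<and> z \<le> pshift r u" if u: "u \<in> L" "\<And>j. j \<in> {1..r} \<Longrightarrow> u j \<le> z j \<and> z j \<le> u j + 1" for u
  proof
    show "u \<le> z"
    proof (rule le_funI)
      fix j show "u j \<le> z j" using u z(3) by (cases "j \<in> {1..r}") (auto simp: lattice_pts_def)
    qed
    show "z \<le> pshift r u"
    proof (rule le_funI)
      fix j show "z j \<le> pshift r u j" using u z(3) by (cases "j \<in> {1..r}") (auto simp: lattice_pts_def pshift_def)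
    qed
  qed
  have lx: "x \<le> z \<and> z \<le> pshift r x" by (rule le[OF X_L[OF x]]) (use boxD[OF z(1)] in blast)
  have ly: "y \<le> z \<and> z \<le> pshift r y" by (rule le[OF X_L[OF y]]) (use boxD[OF z(1)] in blast)
  have "pshift r x \<le> pshift r z" using lx by (intro pshift_mono) auto
  then have "pshift r z \<notin> I" using I_down[of "pshift r z" "pshift r x"] pshift_lattice[OF X_L[OF x]] x unfolding X_iff by blast
  then have "z \<in> X" unfolding X_iff using z(2) by blast
  then show "z \<in> unit_interval r X x \<inter> unit_interval r X y" using lx ly by (simp add: unit_interval_def diag_shift_1)
qed

text \<open>Measured from the largest corner, \<open>w\<close> is at the low end in the directions
  before the missing one, where distances are complementary, and at the high end after it.\<close>

lemma pshift_face_coord: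
  assumes w: "w \<in> X" and x: "x \<in> lam w" and j: "j \<in> {1..r}"
  defines "z \<equiv> pshift (idx w - 1) w"
  shows "x j \<le> z j \<and> z j \<le> x j + 1"
    and "nat \<bar>x j - w j\<bar> = (if j < idx w then 1 - nat (z j - x j) else nat (z j - x j))"
proof -
  consider "j < idx w" | "j = idx w" | "idx w < j" by linarith
  then have "(x j \<le> z j \<and> z j \<le> x j + 1) \<and> nat \<bar>x j - w j\<bar> = (if j < idx w then 1 - nat (z j - x j) else nat (z j - x j))"
  proof cases
    case 1
    then have "z j = w j + 1" using j by (simp add: z_def pshift_def)
    then show ?thesis using lam_coord(1)[OF w x, of j] j 1 by auto
  next
    case 2
    then have "z j = w j" using j by (auto simp: z_def pshift_def)
    then show ?thesis using lam_coord(3)[OF w x, of j] 2 by auto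
  next
    case 3
    then have "z j = w j" using j by (auto simp: z_def pshift_def)
    then show ?thesis using lam_coord(2)[OF w x, of j] j 3 by auto
  qed
  then show "x j \<le> z j \<and> z j \<le> x j + 1"
    "nat \<bar>x j - w j\<bar> = (if j < idx w then 1 - nat (z j - x j) else nat (z j - x j))" by blast+
qed

lemma split_at: "v \<in> {1..r} \<Longrightarrow> (\<Sum>j=1..r. f j) = (\<Sum>j\<in>{1..<v}. f j) + f v + (\<Sum>j\<in>{v<..r}. f j :: nat)"
proof -
  assume v: "v \<in> {1..r}"
  have "{1..r} = ({1..<v} \<union> {v}) \<union> {v<..r}" using v by auto
  then show ?thesis by (simp only:) (subst sum.union_disjoint, auto)+
qed

lemma face_pair_exponent:
  assumes w: "w \<in> X" and x: "x \<in> lam w" and y: "y \<in> lam w"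
  shows "d1 r x w + d1 r y w = mid r (gap x y (pshift (idx w - 1) w)) (idx w)"
proof -
  let ?z = "pshift (idx w - 1) w"
  have v: "idx w \<in> {1..r}" by (rule idx_props(1)[OF w])
  have "d1 r x w + d1 r y w = (\<Sum>j=1..r. nat \<bar>x j - w j\<bar> + nat \<bar>y j - w j\<bar>)" by (simp add: d1_def sum.distrib)
  also have "\<dots> = (\<Sum>j=1..r. if j < idx w then 2 - gap x y ?z j else gap x y ?z j)"
  proof (rule sum.cong[OF refl])
    fix j assume j: "j \<in> {1..r}"
    have le: "nat (?z j - x j) \<le> 1" "nat (?z j - y j) \<le> 1"
      using pshift_face_coord(1)[OF w x j] pshift_face_coord(1)[OF w y j] by auto
    show "nat \<bar>x j - w j\<bar> + nat \<bar>y j - w j\<bar> = (if j < idx w then 2 - gap x y ?z j else gap x y ?z j)"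
      unfolding pshift_face_coord(2)[OF w x j] pshift_face_coord(2)[OF w y j] gap_def using le by (auto simp: numeral_2_eq_2)
  qed
  also have "\<dots> = mid r (gap x y ?z) (idx w)"
  proof -
    have "gap x y ?z (idx w) = 0"
      using lam_coord(3)[OF w x, of "idx w"] lam_coord(3)[OF w y, of "idx w"] v by (auto simp: gap_def pshift_def)
    then show ?thesis unfolding split_at[OF v] mid_def by simp
  qed
  finally show ?thesis .
qed

text \<open>Inverts the map that sends \<open>w\<close> to
  \<open>(pshift (idx w - 1) w, idx w)\<close>: a corner of the ideal that leaves it when raised in
  direction \<open>v\<close> is the largest corner of a cube with missing direction
  \<open>v\<close>.\<close>

lemma face_of_unshift:
  assumes z: "z \<in> I" "z(v := z v + 1) \<notin> I" and v: "v \<in> {1..r}"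
  defines "w \<equiv> (\<lambda>j. if j \<in> {1..v - 1} then z j - 1 else z j)"
  shows "w \<in> X" "idx w = v" "pshift (v - 1) w = z"
    and "\<And>x. x \<in> L \<Longrightarrow> x v = z v \<Longrightarrow> (\<And>j. j \<in> {1..r} \<Longrightarrow> x j \<le> z j \<and> z j \<le> x j + 1) \<Longrightarrow> x \<in> lam w"
proof -
  have zL: "z \<in> L" by (rule I_L[OF z(1)])
  show p: "pshift (v - 1) w = z" by (auto simp: w_def pshift_def)
  have e: "j \<le> v - Suc 0 \<longleftrightarrow> j < v" for j using v by auto
  have p': "pshift v w = z(v := z v + 1)" using v by (auto simp: fun_eq_iff w_def pshift_def e)
  have wL: "w \<in> L" using zL v by (auto simp: w_def lattice_pts_def)
  have "w \<le> z" by (auto simp: w_def le_fun_def)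
  then have wI: "w \<in> I" using I_down z(1) wL by blast
  have "pshift v w \<le> pshift r w" using v by (intro pshift_mono) auto
  then have "pshift r w \<notin> I" using I_down[of "pshift r w" "pshift v w"] pshift_lattice[OF wL, of v] z(2) v unfolding p' by auto
  then show wX: "w \<in> X" unfolding X_iff using wI by blast
  show i: "idx w = v" by (rule idx_eqI[OF wX v]) (unfold p p', rule z(1), rule z(2))
  fix x assume x: "x \<in> L" "x v = z v" "\<And>j. j \<in> {1..r} \<Longrightarrow> x j \<le> z j \<and> z j \<le> x j + 1"
  show "x \<in> lam w"
  proof (rule lamI[OF wX x(1)], unfold i)
    show "x v = w v" using x(2) v by (auto simp: w_def)
    show "x j = w j \<or> x j = w j + 1" if "1 \<le> j" "j < v" for j
    proof -
      have "w j = z j - 1" "j \<in> {1..r}" using that v by (auto simp: w_def)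
      then show ?thesis using x(3)[of j] by auto
    qed
    show "x j = w j \<or> x j = w j - 1" if "v < j" "j \<le> r" for j
    proof -
      have "w j = z j" "j \<in> {1..r}" using that v by (auto simp: w_def)
      then show ?thesis using x(3)[of j] by auto
    qed
  qed
qed

text \<open>A cube \<open>lam w\<close> containing \<open>x\<close> and \<open>y\<close> is recorded by the corner \<open>z = pshift (v - 1) w\<close> and
  the missing direction \<open>v = idx w\<close>. The pairs so obtained are those with \<open>x v = y v = z v\<close> for which
  raising \<open>z\<close> in direction \<open>v\<close> leaves the ideal; pairs for which it does not are in bijection with
  those where \<open>x v = y v = z v - 1\<close>.\<close>

lemma face_pair_sum:
  assumes x: "x \<in> X" and y: "y \<in> X"
  shows "(\<Sum>w\<in>{w \<in> {w \<in> X. x \<in> lam w}. y \<in> lam w}. fls_X ^ (d1 r x w + d1 r y w)) =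
    (\<Sum>z\<in>box x y \<inter> I. tele r (gap x y z))" (is "sum ?f ?W = _")
proof -
  let ?g = "gap x y"
  let ?P = "(box x y \<inter> I) \<times> {1..r}"
  let ?e = "\<lambda>(z, v). fls_X ^ mid r (?g z) v :: rat fls"
  let ?T = "{zv \<in> ?P. ?g (fst zv) (snd zv) = 0}"
  let ?B = "{zv \<in> ?P. ?g (fst zv) (snd zv) = 2}"
  let ?T' = "{zv \<in> ?T. (fst zv)(snd zv := fst zv (snd zv) + 1) \<in> I}"
  have fP: "finite ?P" using finite_pbox by simp
  have fT: "finite ?T" by (rule finite_subset[OF _ fP]) blast
  have xyL: "x \<in> L" "y \<in> L" using x y X_L by auto
  have "(\<Sum>z\<in>box x y \<inter> I. tele r (?g z)) =
    (\<Sum>zv\<in>?P. of_bool (?g (fst zv) (snd zv) = 0) * ?e zv) - (\<Sum>zv\<in>?P. of_bool (?g (fst zv) (snd zv) = 2) * ?e zv)"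
    unfolding tele_def sum.cartesian_product left_diff_distrib sum_subtractf by (simp add: split_beta)
  also have "(\<Sum>zv\<in>?P. of_bool (?g (fst zv) (snd zv) = 0) * ?e zv) = sum ?e ?T"
    unfolding sum.inter_filter[OF fP] by (intro sum.cong) auto
  also have "(\<Sum>zv\<in>?P. of_bool (?g (fst zv) (snd zv) = 2) * ?e zv) = sum ?e ?B"
    unfolding sum.inter_filter[OF fP] by (intro sum.cong) auto
  \<comment> \<open>Lowering \<open>z\<close> by one in direction \<open>v\<close> keeps the
    exponent, because \<open>mid\<close> omits that direction.\<close>
  also have "sum ?e ?B = sum ?e ?T'"
  proof (rule sum.reindex_bij_witness[where i = "\<lambda>(z, v). (z(v := z v + 1), v)" and j = "\<lambda>(z, v). (z(v := z v - 1), v)"])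
    fix zv assume "zv \<in> ?B"
    then obtain z v where zv: "zv = (z, v)" and z: "z \<in> box x y" "z \<in> I" and v: "v \<in> {1..r}" and g: "?g z v = 2" by auto
    have c: "z v = x v + 1" "z v = y v + 1" using g boxD[OF z(1) v] by (auto simp: gap_def)
    let ?z = "z(v := z v - 1)"
    have zL: "?z \<in> L" using I_L[OF z(2)] v by (auto simp: lattice_pts_def)
    have "?z \<le> z" by (simp add: le_fun_def)
    then have zI: "?z \<in> I" using I_down[OF z(2) zL] by blast
    have zb: "?z \<in> box x y" using z(1) zL c by (auto simp: box_def)
    have gz: "?g ?z v = 0" using c by (simp add: gap_def)
    show "(case case zv of (z, v) \<Rightarrow> (z(v := z v - 1), v) of (z, v) \<Rightarrow> (z(v := z v + 1), v)) = zv" by (simp add: zv)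
    show "(case zv of (z, v) \<Rightarrow> (z(v := z v - 1), v)) \<in> ?T'" using zI zb gz v z(2) by (simp add: zv)
    have "mid r (?g ?z) v = mid r (?g z) v" by (rule mid_cong) (use v in \<open>auto simp: gap_def\<close>)
    then show "?e (case zv of (z, v) \<Rightarrow> (z(v := z v - 1), v)) = ?e zv" by (simp add: zv)
  next
    fix zv assume "zv \<in> ?T'"
    then obtain z v where zv: "zv = (z, v)" and z: "z \<in> box x y" "z \<in> I" and v: "v \<in> {1..r}" and g: "?g z v = 0"
      and up: "z(v := z v + 1) \<in> I" by auto
    have c: "z v = x v" "z v = y v" using g boxD[OF z(1) v] by (auto simp: gap_def)
    have "z(v := z v + 1) \<in> box x y" using z(1) I_L[OF up] c by (auto simp: box_def)
    moreover have "?g (z(v := z v + 1)) v = 2" using c by (simp add: gap_def)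
    ultimately show "(case zv of (z, v) \<Rightarrow> (z(v := z v + 1), v)) \<in> ?B" using up v by (simp add: zv)
    show "(case case zv of (z, v) \<Rightarrow> (z(v := z v + 1), v) of (z, v) \<Rightarrow> (z(v := z v - 1), v)) = zv" by (simp add: zv)
  qed
  also have "sum ?e ?T - sum ?e ?T' = sum ?e (?T - ?T')" by (rule sum_diff[symmetric, OF fT]) blast
  also have "\<dots> = sum ?f ?W"
  proof (rule sum.reindex_bij_witness[where i = "\<lambda>w. (pshift (idx w - 1) w, idx w)"
        and j = "\<lambda>(z, v) j. if j \<in> {1..v - 1} then z j - 1 else z j"])
    fix zv assume "zv \<in> ?T - ?T'"
    then obtain z v where zv: "zv = (z, v)" and z: "z \<in> box x y" "z \<in> I" and v: "v \<in> {1..r}" and g: "?g z v = 0"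
      and up: "z(v := z v + 1) \<notin> I" by auto
    have c: "x v = z v" "y v = z v" using g boxD[OF z(1) v] by (auto simp: gap_def)
    let ?w = "\<lambda>j. if j \<in> {1..v - 1} then z j - 1 else z j"
    note w = face_of_unshift[OF z(2) up v]
    have xw: "x \<in> lam ?w" by (rule w(4)[OF xyL(1) c(1)]) (use boxD[OF z(1)] in blast)
    have yw: "y \<in> lam ?w" by (rule w(4)[OF xyL(2) c(2)]) (use boxD[OF z(1)] in blast)
    have j: "(case zv of (z, v) \<Rightarrow> (\<lambda>j. if j \<in> {1..v - 1} then z j - 1 else z j)) = ?w" by (simp add: zv)
    show "(\<lambda>w. (pshift (idx w - 1) w, idx w)) (case zv of (z, v) \<Rightarrow> (\<lambda>j. if j \<in> {1..v - 1} then z j - 1 else z j)) = zv"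
      unfolding j unfolding w(2) w(3) zv ..
    show "(case zv of (z, v) \<Rightarrow> (\<lambda>j. if j \<in> {1..v - 1} then z j - 1 else z j)) \<in> ?W"
      unfolding j using w(1) xw yw by blast
    show "?f (case zv of (z, v) \<Rightarrow> (\<lambda>j. if j \<in> {1..v - 1} then z j - 1 else z j)) = ?e zv"
      unfolding j face_pair_exponent[OF w(1) xw yw] w(2) w(3) by (simp add: zv)
  next
    fix w assume "w \<in> ?W"
    then have w: "w \<in> X" "x \<in> lam w" "y \<in> lam w" by auto
    let ?v = "idx w" and ?z = "pshift (idx w - 1) w"
    note p = idx_props[OF w(1)]
    have zL: "?z \<in> L" using p(1) by (intro pshift_lattice[OF X_L[OF w(1)]]) auto
    have zb: "?z \<in> box x y" unfolding box_def
      using zL pshift_face_coord(1)[OF w(1,2)] pshift_face_coord(1)[OF w(1,3)] by blast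
    have zI: "?z \<in> I" using p by simp
    have gz: "?g ?z ?v = 0"
      using lam_coord(3)[OF w(1,2), of ?v] lam_coord(3)[OF w(1,3), of ?v] p(1) by (auto simp: gap_def pshift_def)
    have e: "j \<le> ?v - Suc 0 \<longleftrightarrow> j < ?v" for j using p(1) by auto
    have "?z(?v := ?z ?v + 1) = pshift ?v w" using p(1) by (auto simp: fun_eq_iff pshift_def e)
    then have "?z(?v := ?z ?v + 1) \<notin> I" using p by simp
    then show "(?z, ?v) \<in> ?T - ?T'" using zb zI gz p(1) by simp
    show "(case (?z, ?v) of (z, v) \<Rightarrow> (\<lambda>j. if j \<in> {1..v - 1} then z j - 1 else z j)) = w"
      by (auto simp: pshift_def)
  qed
  finally show ?thesis ..
qed

lemma C_U_tele:
  assumes "x \<in> X" "y \<in> X"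
  shows "C_U TYPE('k::field) r X x y = (\<Sum>z\<in>box x y \<inter> I. tele r (gap x y z))"
  unfolding C_U_eq[OF assms] by (rule face_pair_sum[OF assms])

lemma C_U_formula:
  assumes x: "x \<in> X" and y: "y \<in> X"
  shows "C_U TYPE('k::field) r X x y = (\<Sum>z\<in>unit_interval r X x \<inter> unit_interval r X y.
    fls_X powi (int r - 1) * q_int (int r - l1_dist r z x - l1_dist r z y))"
  unfolding C_U_tele[OF x y] unit_interval_box[OF x y]
proof (rule sum.cong[OF refl])
  fix z assume "z \<in> box x y \<inter> I"
  then have z: "z \<in> box x y" by blast
  have "d1 r z x + d1 r z y = (\<Sum>j=1..r. gap x y z j)"
    unfolding d1_def sum.distrib[symmetric] gap_def using boxD[OF z] by (intro sum.cong) auto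
  from q_int_tele[OF gap_le[OF z] this]
  show "tele r (gap x y z) = fls_X powi (int r - 1) * q_int (int r - l1_dist r z x - l1_dist r z y)"
    by (simp only: l1_d1 of_nat_add diff_diff_eq)
qed

text \<open>The entry is a finite sum of monomials, and its coefficients inherit from
  \<open>tele_sym\<close> the reflection of degrees about \<open>r - 1\<close>.\<close>

lemma C_U_laurent:
  assumes x: "x \<in> X" and y: "y \<in> X"
  shows "laurent_poly (C_U TYPE('k::field) r X x y)"
    and "at_inverse_q (C_U TYPE('k) r X x y) = fls_X powi (2 - 2 * int r) * C_U TYPE('k) r X x y"
proof -
  let ?C = "C_U TYPE('k) r X x y"
  let ?W = "{v \<in> {v \<in> X. x \<in> lam v}. y \<in> lam v}"
  have fin: "finite ?W" by (rule finite_subset[OF _ lam_parents_finite[of x]]) blast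
  have "{n. fls_nth ?C n \<noteq> 0} \<subseteq> (\<lambda>v. int (d1 r x v + d1 r y v)) ` ?W"
  proof
    fix n assume "n \<in> {n. fls_nth ?C n \<noteq> 0}"
    then have "(\<Sum>v\<in>?W. fls_nth (fls_X ^ (d1 r x v + d1 r y v) :: rat fls) n) \<noteq> 0"
      unfolding C_U_eq[OF x y] fls_nth_sum by simp
    then obtain v where "v \<in> ?W" "fls_nth (fls_X ^ (d1 r x v + d1 r y v) :: rat fls) n \<noteq> 0"
      by (meson sum.neutral)
    then show "n \<in> (\<lambda>v. int (d1 r x v + d1 r y v)) ` ?W" by (intro image_eqI[of _ _ v]) (simp_all split: if_splits)
  qed
  then show "laurent_poly ?C" unfolding laurent_poly_def using fin by (rule finite_subset[OF _ finite_imageI])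
  have sym: "fls_nth ?C (2 * int r - 2 - n) = fls_nth ?C n" for n
    unfolding C_U_tele[OF x y] fls_nth_sum
    by (intro sum.cong refl tele_sym gap_le[of _ x y]) simp_all
  have "(\<lambda>n. fls_nth ?C (- n)) = fls_nth (fls_X powi (2 - 2 * int r) * ?C)"
  proof
    fix n
    have "fls_X powi (2 - 2 * int r) * ?C = fls_shift (- (2 - 2 * int r)) ?C"
      by (simp add: fls_X_intpow_times_conv_shift(1)[of "2 - 2 * int r", simplified])
    then show "fls_nth ?C (- n) = fls_nth (fls_X powi (2 - 2 * int r) * ?C) n" using sym[of "- n"] by (simp add: algebra_simps)
  qed
  then show "at_inverse_q ?C = fls_X powi (2 - 2 * int r) * ?C"
    unfolding at_inverse_q_def by (simp only: fls_nth_inverse)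
qed

lemma D_U_formula:
  assumes x: "x \<in> X" and y: "y \<in> X"
  shows "D_U TYPE('k::field) r X x y = (\<Sum>z\<in>lam x. of_bool (z = y) * fls_X powi l1_dist r z x)"
proof -
  have "(\<Sum>z\<in>lam x. of_bool (z = y) * fls_X powi l1_dist r z x) =
    (\<Sum>z\<in>lam x. fls_X ^ d1 r z x * (of_bool (y = z) :: rat fls))"
    by (intro sum.cong) (auto simp: l1_d1)
  then show ?thesis unfolding D_U_eq[OF x y] sum_of_bool_delta[OF finite_lam[OF x]] du_def ..
qed

text \<open>The cone may be infinite, but the Kronecker delta leaves at most one term.\<close>

lemma D_V_formula:
  assumes x: "x \<in> X" and y: "y \<in> X"
  shows "((\<lambda>z. of_bool (z = y) * fls_X powi l1_dist r z x) has_sum D_V TYPE('k::field) r X x y) (mu x)"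
  by (rule has_sum_finite_neutralI[of "{y} \<inter> mu x"]) (auto simp: D_V_eq[OF x y] dv_def l1_d1)

lemma C_V_formula:
  assumes x: "x \<in> X" and y: "y \<in> X"
  shows "C_V TYPE('k::field) r X x y = (1 - fls_X\<^sup>2) powi (1 - int r) * fls_X powi l1_dist r x y"
proof -
  have "1 - int r = - int (r - 1)" using r_pos by simp
  then have "(1 - fls_X\<^sup>2 :: rat fls) powi (1 - int r) = inverse (1 - fls_X\<^sup>2) ^ (r - 1)"
    by (simp only: power_int_minus power_int_of_nat power_inverse)
  then show ?thesis unfolding C_V_eq[OF x y] cv_def l1_d1 power_int_of_nat by simp
qed

lemma C_sym:
  assumes x: "x \<in> X" and y: "y \<in> X"
  shows "C_U TYPE('k::field) r X x y = C_U TYPE('k) r X y x" "C_V TYPE('k) r X x y = C_V TYPE('k) r X y x"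
proof -
  have "{v \<in> {v \<in> X. x \<in> lam v}. y \<in> lam v} = {v \<in> {v \<in> X. y \<in> lam v}. x \<in> lam v}" by blast
  then show "C_U TYPE('k) r X x y = C_U TYPE('k) r X y x"
    unfolding C_U_eq[OF x y] C_U_eq[OF y x] by (simp add: add.commute)
  show "C_V TYPE('k) r X x y = C_V TYPE('k) r X y x"
    unfolding C_V_eq[OF x y] C_V_eq[OF y x] by (simp add: cv_def d1_def abs_minus_commute)
qed

end

theorem theorem90:
  fixes r :: nat and X :: "point set"
  assumes "r \<ge> 1" and "cubist r X"
  shows
    "(\<forall>x\<in>X. \<forall>y\<in>X. D_U TYPE('k::field) r X x y =
        (\<Sum>z\<in>cubist_lam r X x. of_bool (z = y) * fls_X powi l1_dist r z x)) \<and>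
     (\<forall>x\<in>X. \<forall>y\<in>X. ((\<lambda>z. of_bool (z = y) * fls_X powi l1_dist r z x) has_sum
        D_V TYPE('k) r X x y) (cubist_mu r X x)) \<and>
     (\<forall>x\<in>X. \<forall>y\<in>X. C_U TYPE('k) r X x y =
        (\<Sum>z\<in>unit_interval r X x \<inter> unit_interval r X y.
           fls_X powi (int r - 1) * q_int (int r - l1_dist r z x - l1_dist r z y))) \<and>
     (\<forall>x\<in>X. \<forall>y\<in>X. C_V TYPE('k) r X x y =
        (1 - fls_X\<^sup>2) powi (1 - int r) * fls_X powi l1_dist r x y) \<and>
     mat_prod_eq X (mat_transpose (D_U TYPE('k) r X)) (D_U TYPE('k) r X) (C_U TYPE('k) r X) \<and>
     mat_prod_eq X (mat_transpose (D_V TYPE('k) r X)) (D_V TYPE('k) r X) (C_V TYPE('k) r X) \<and>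
     (\<forall>x\<in>X. \<forall>y\<in>X. C_U TYPE('k) r X x y = mat_transpose (C_U TYPE('k) r X) x y) \<and>
     (\<forall>x\<in>X. \<forall>y\<in>X. C_V TYPE('k) r X x y = mat_transpose (C_V TYPE('k) r X) x y) \<and>
     mat_prod_eq X (mat_transpose (D_U TYPE('k) r X)) (\<lambda>x y. at_minus_q (D_V TYPE('k) r X x y))
       mat_one \<and>
     mat_prod_eq X (C_U TYPE('k) r X) (\<lambda>x y. at_minus_q (C_V TYPE('k) r X x y)) mat_one \<and>
     (\<forall>x\<in>X. \<forall>y\<in>X. laurent_poly (C_U TYPE('k) r X x y) \<and>
        at_inverse_q (C_U TYPE('k) r X x y) = fls_X powi (2 - 2 * int r) * C_U TYPE('k) r X x y)"
proof -
  obtain I where I: "proper_ideal r I" and X: "X = I - diag_shift r (- 1) ` I"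
    using assms(2) unfolding cubist_def by blast
  interpret I: cubist_ideal r I using assms(1) I by unfold_locales
  have XI: "X = I.X" unfolding X I.X_def ..
  show ?thesis
    unfolding XI mat_prod_eq_def mat_transpose_def mat_one_def
    by (intro conjI ballI I.D_U_formula I.D_V_formula I.C_U_formula I.C_V_formula I.brauer_U I.brauer_V
        I.C_sym I.inverse_D I.inverse_C I.C_U_laurent)
qed

end
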